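(* Let $S$ be a countable left cancellative monoid. Assume that for any nontrivial units $u_1,\dots,u_k\in S^*\setminus\{e\}$ and every $X\in\bar{\mathcal{J}}(S)$ containing $e$, there is $Z\in\bar{\mathcal{J}}(S)$ such that $\emptyset\ne Z\subset X$ and $u_is\ne s$ for all $s\in Z$ and $i=1,\dots,k$. Then the maps $\rho_{\chi_e}\colon C^*_r(\mathcal{G}_P(S))\to C^*_r(S)$ and $\rho_{\chi_e}\colon C^*_r(\mathcal{G}(S))\to C^*_r(S)$ define isomorphisms $$C^*_{\mathrm{ess}}(\mathcal{G}_P(S))\cong C^*_r(S)\cong C^*_{\mathrm{ess}}(\mathcal{G}(S)).$$
   Context: Monoid. Let $S$ be a left cancellative monoid with identity $e$; $S^*$ is its group of units (invertible elements). $C^*_r(S)\subset B(\ell^2(S))$ is the C$^*$-algebra generated by the operators $\lambda_s$, $\lambda_s\delta_t=\delta_{st}$. The left inverse hull $I_\ell(S)$ is the inverse semigroup of partial bijections of $S$ generated by the left translations $t\mapsto st$ ($s\in S$); $S$ is viewed as a subset of $I_\ell(S)$, and $s^{-1}\in I_\ell(S)$ is the bijection $sS\to S$ inverse to $t\mapsto st$. $E(S)$ is the semigroup of idempotents of $I_\ell(S)$; each of them is the identity map $p_X$ on a constructible right ideal $X=s_1^{-1}t_1\dots s_n^{-1}t_nS$, and $\mathcal{J}(S)$ is the set of constructible right ideals. $\bar{\mathcal{J}}(S)$ is the collection of subsets of $S$ consisting of $\mathcal{J}(S)$ and all sets $X\setminus\bigcup_{i=1}^mX_i$ with $X,X_1,\dots,X_m\in\mathcal{J}(S)$.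 Groupoids. $\widehat{E(S)}$ is the compact space (topology of pointwise convergence) of not identically zero semigroup homomorphisms $E(S)\to\{0,1\}$. For $s\in S$, $\chi_s(p_X)=1$ if $s\in X$ and $0$ otherwise. The Paterson groupoid $\mathcal{G}(I_\ell(S))$ is the set of classes $[g,\chi]$ of pairs $(g,\chi)\in I_\ell(S)\times\widehat{E(S)}$ with $\chi(g^{-1}g)=1$, where $(g_1,\chi_1)$, $(g_2,\chi_2)$ are equivalent iff $\chi_1=\chi_2$ and $g_1p=g_2p$ for some $p\in E(S)$ with $\chi_1(p)=1$. Product: $[g,\chi][h,\psi]=[gh,\psi]$ if $\chi=\psi(h^{-1}\cdot h)$; the unit space is identified with $\widehat{E(S)}$ via $\chi\mapsto[p_S,\chi]$; $s([g,\chi])=\chi$, $r([g,\chi])=\chi(g^{-1}\cdot g)$. A basis of the topology is given by the sets $D(g,U)=\{[g,\chi]:\chi\in U\}$, $U$ an open subset of $\{\chi:\chi(g^{-1}g)=1\}$. Let $\Omega(S)$ be the closure of $\{\chi_s:s\in S\}$ in $\widehat{E(S)}$ (an invariant set), and $\mathcal{G}_P(S)=\mathcal{G}(I_\ell(S))_{\Omega(S)}=r^{-1}(\Omega(S))=s^{-1}(\Omega(S))$. Each $\chi\in\Omega(S)$ extends to $\bar{\mathcal{J}}(S)$: for $X,X_i\in\mathcal{J}(S)$, $\chi(p_{X\setminus\bigcup_iX_i})=1$ if $\chi(p_X)=1$ and $\chi(p_{X_i})=0$ for all $i$, and it is $0$ otherwise. Then $\mathcal{G}(S)=\mathcal{G}_P(S)/{\sim}$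 is the quotient (étale, possibly non-Hausdorff) groupoid, where $[g,\chi]\sim[h,\chi]$ iff there is $X\in\bar{\mathcal{J}}(S)$ with $\chi(p_X)=1$ and $g|_X=h|_X$. C$^*$-algebras. For a locally compact étale groupoid $\mathcal{G}$, $C_c(\mathcal{G})$ is the linear span, inside functions on $\mathcal{G}$, of $C_c(V)$ (extended by zero) over open Hausdorff $V\subset\mathcal{G}$, with convolution $(f_1*f_2)(g)=\sum_{h\in\mathcal{G}^{r(g)}}f_1(h)f_2(h^{-1}g)$ and $f^*(g)=\overline{f(g^{-1})}$; for $x\in\mathcal{G}^{(0)}$, $\rho_x$ is the representation on $\ell^2(\mathcal{G}_x)$, $\mathcal{G}_x=s^{-1}(x)$, given by $(\rho_x(f)\xi)(g)=\sum_{h\in\mathcal{G}^{r(g)}}f(h)\xi(h^{-1}g)$, and $C^*_r(\mathcal{G})$ is the completion in $\|f\|_r=\sup_x\|\rho_x(f)\|$. The essential C$^*$-algebra is $C^*_{\mathrm{ess}}(\mathcal{G})=C^*_r(\mathcal{G})/J_{\mathrm{sing}}$, where $J_{\mathrm{sing}}$ is the closed ideal of all $a\in C^*_r(\mathcal{G})$ such that the set of $x\in\mathcal{G}^{(0)}$ with $\rho_x(a)\delta_x\ne0$ is meager in $\mathcal{G}^{(0)}$. For $\mathcal{G}=\mathcal{G}_P(S)$ or $\mathcal{G}(S)$, the map $s\mapsto[s,\chi_e]$ is a bijection $S\to\mathcal{G}_{\chi_e}$, so $\rho_{\chi_e}$ is viewed as a representation on $\ell^2(S)$; it gives a surjective $*$-homomorphism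 $C^*_r(\mathcal{G})\to C^*_r(S)$. The statement that $\rho_{\chi_e}$ defines an isomorphism $C^*_{\mathrm{ess}}(\mathcal{G})\cong C^*_r(S)$ means that its kernel is exactly $J_{\mathrm{sing}}$. *)

theory Defs
  imports "HOL-Analysis.Analysis"
begin

section \<open>Bounded operators on $\ell^2$-spaces\<close>

text \<open>
  The Hilbert space $\ell^2(A)$ consists of the square summable functions on the ambient type that
  vanish outside \<open>A\<close>.  An operator on it is a function that is set to zero outside of
  $\ell^2(A)$, so that equality of operators is equality of functions.
\<close>

definition l2 :: "'i set \<Rightarrow> ('i \<Rightarrow> complex) set" where
  "l2 A = {\<xi>. (\<forall>i. i \<notin> A \<longrightarrow> \<xi> i = 0) \<and> (\<lambda>i. (cmod (\<xi> i))\<^sup>2) summable_on A}"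

definition l2_norm :: "('i \<Rightarrow> complex) \<Rightarrow> real" where
  "l2_norm \<xi> = sqrt (\<Sum>\<^sub>\<infinity>i. (cmod (\<xi> i))\<^sup>2)"

definition l2_inner :: "('i \<Rightarrow> complex) \<Rightarrow> ('i \<Rightarrow> complex) \<Rightarrow> complex" where
  "l2_inner \<xi> \<eta> = (\<Sum>\<^sub>\<infinity>i. \<xi> i * cnj (\<eta> i))"

definition l2_delta :: "'i \<Rightarrow> 'i \<Rightarrow> complex" where
  "l2_delta i = (\<lambda>j. if j = i then 1 else 0)"

type_synonym 'i l2_op = "('i \<Rightarrow> complex) \<Rightarrow> ('i \<Rightarrow> complex)"

definition zero_op :: "'i l2_op" where
  "zero_op = (\<lambda>_ _. 0)"

definition add_op :: "'i l2_op \<Rightarrow> 'i l2_op \<Rightarrow> 'i l2_op" where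
  "add_op S T = (\<lambda>\<xi> i. S \<xi> i + T \<xi> i)"

definition diff_op :: "'i l2_op \<Rightarrow> 'i l2_op \<Rightarrow> 'i l2_op" where
  "diff_op S T = (\<lambda>\<xi> i. S \<xi> i - T \<xi> i)"

definition scale_op :: "complex \<Rightarrow> 'i l2_op \<Rightarrow> 'i l2_op" where
  "scale_op c T = (\<lambda>\<xi> i. c * T \<xi> i)"

definition op_norm :: "'i set \<Rightarrow> 'i l2_op \<Rightarrow> ennreal" where
  "op_norm A T = (SUP \<xi>\<in>{\<xi> \<in> l2 A. l2_norm \<xi> \<le> 1}. ennreal (l2_norm (T \<xi>)))"

definition bounded_ops :: "'i set \<Rightarrow> 'i l2_op set" where
  "bounded_ops A = {T.
     (\<forall>\<xi>. \<xi> \<notin> l2 A \<longrightarrow> T \<xi> = (\<lambda>_. 0)) \<and>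
     (\<forall>\<xi>\<in>l2 A. T \<xi> \<in> l2 A) \<and>
     (\<forall>\<xi>\<in>l2 A. \<forall>\<eta>\<in>l2 A. T (\<lambda>i. \<xi> i + \<eta> i) = (\<lambda>i. T \<xi> i + T \<eta> i)) \<and>
     (\<forall>c. \<forall>\<xi>\<in>l2 A. T (\<lambda>i. c * \<xi> i) = (\<lambda>i. c * T \<xi> i)) \<and>
     op_norm A T < \<infinity>}"

definition is_adjoint :: "'i set \<Rightarrow> 'i l2_op \<Rightarrow> 'i l2_op \<Rightarrow> bool" where
  "is_adjoint A T T' \<longleftrightarrow> (\<forall>\<xi>\<in>l2 A. \<forall>\<eta>\<in>l2 A. l2_inner (T \<xi>) \<eta> = l2_inner \<xi> (T' \<eta>))"

definition cstar_subalgebra :: "'i set \<Rightarrow> 'i l2_op set \<Rightarrow> bool" where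
  "cstar_subalgebra A B \<longleftrightarrow>
     B \<subseteq> bounded_ops A \<and> zero_op \<in> B \<and>
     (\<forall>S\<in>B. \<forall>T\<in>B. add_op S T \<in> B) \<and>
     (\<forall>c. \<forall>T\<in>B. scale_op c T \<in> B) \<and>
     (\<forall>S\<in>B. \<forall>T\<in>B. S \<circ> T \<in> B) \<and>
     (\<forall>T\<in>B. \<forall>T'\<in>bounded_ops A. is_adjoint A T T' \<longrightarrow> T' \<in> B) \<and>
     (\<forall>T\<in>bounded_ops A. (\<forall>\<epsilon>>0. \<exists>S\<in>B. op_norm A (diff_op T S) < \<epsilon>) \<longrightarrow> T \<in> B)"

definition cstar_generated :: "'i set \<Rightarrow> 'i l2_op set \<Rightarrow> 'i l2_op set" where
  "cstar_generated A X = \<Inter>{B. cstar_subalgebra A B \<and> X \<subseteq> B}"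

text \<open>
  Transport of an operator on $\ell^2(\varphi(S))$ to $\ell^2(S)$ along an injective map
  $\varphi$; the inner sum has at most one term, and is the vector $\xi \circ \varphi^{-1}$.
\<close>

definition transport_op :: "('s \<Rightarrow> 'g) \<Rightarrow> 'g l2_op \<Rightarrow> 's l2_op" where
  "transport_op \<phi> T =
     (\<lambda>\<xi>. if \<xi> \<in> l2 UNIV then (\<lambda>s. T (\<lambda>g. \<Sum>t | \<phi> t = g. \<xi> t) (\<phi> s)) else (\<lambda>_. 0))"


section \<open>The left regular C*-algebra of a monoid\<close>

text \<open>
  $\lambda_s\delta_t = \delta_{st}$, that is, $(\lambda_s\xi)(r) = \sum_{t\,:\,st = r}\xi(t)$.  By left
  cancellation the sum has at most one term.
\<close>

definition left_reg :: "'s::monoid_mult \<Rightarrow> 's l2_op" where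
  "left_reg s = (\<lambda>\<xi>. if \<xi> \<in> l2 UNIV then (\<lambda>r. \<Sum>t | s * t = r. \<xi> t) else (\<lambda>_. 0))"

definition cstar_r_monoid :: "'s::monoid_mult l2_op set" where
  "cstar_r_monoid = cstar_generated UNIV (range left_reg)"


section \<open>The left inverse hull and constructible ideals\<close>

definition monoid_units :: "'s::monoid_mult set" where
  "monoid_units = {u. \<exists>v. u * v = 1 \<and> v * u = 1}"

definition ltrans :: "'s::monoid_mult \<Rightarrow> 's \<rightharpoonup> 's" where
  "ltrans s = (\<lambda>t. Some (s * t))"

definition pinv :: "('s \<rightharpoonup> 's) \<Rightarrow> 's \<rightharpoonup> 's" where
  "pinv g = (\<lambda>y. if y \<in> ran g then Some (THE x. g x = Some y) else None)"

inductive_set inv_hull :: "('s::monoid_mult \<rightharpoonup> 's) set" where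
  "ltrans s \<in> inv_hull"
| "g \<in> inv_hull \<Longrightarrow> pinv g \<in> inv_hull"
| "g \<in> inv_hull \<Longrightarrow> h \<in> inv_hull \<Longrightarrow> g \<circ>\<^sub>m h \<in> inv_hull"

definition idems :: "('s::monoid_mult \<rightharpoonup> 's) set" where
  "idems = {p \<in> inv_hull. p \<circ>\<^sub>m p = p}"

definition pid :: "'s set \<Rightarrow> 's \<rightharpoonup> 's" where
  "pid X = Some |` X"

text \<open>The sets $s_1^{-1}t_1\cdots s_n^{-1}t_nS$; here $s^{-1}Y = \{x : sx \in Y\}$.\<close>

inductive_set constructible :: "'s::monoid_mult set set" where
  "UNIV \<in> constructible"
| "X \<in> constructible \<Longrightarrow> {x. s * x \<in> (*) t ` X} \<in> constructible"

text \<open>The sets $X \setminus \bigcup_i X_i$; the empty family gives $X$ itself.\<close>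

definition constructible_bar :: "'s::monoid_mult set set" where
  "constructible_bar = {X - \<Union>F | X F. X \<in> constructible \<and> finite F \<and> F \<subseteq> constructible}"


section \<open>Characters of the semilattice of idempotents\<close>

type_synonym 's chr = "('s \<rightharpoonup> 's) \<Rightarrow> nat"

text \<open>
  Characters $\chi$ are written \<open>\<omega>\<close> in formulas, as \<open>vec_lambda\<close> occupies the symbol $\chi$.
  They are extensional functions on \<open>idems\<close>, so that pointwise convergence is the product
  topology.
\<close>

definition chars :: "'s::monoid_mult chr set" where
  "chars = {\<omega>. \<omega> \<in> idems \<rightarrow>\<^sub>E {0, 1} \<and>
     (\<forall>p\<in>idems. \<forall>q\<in>idems. \<omega> (p \<circ>\<^sub>m q) = \<omega> p * \<omega> q) \<and> (\<exists>p\<in>idems. \<omega> p \<noteq> 0)}"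

definition chars_top :: "'s::monoid_mult chr topology" where
  "chars_top = subtopology (product_topology (\<lambda>_. discrete_topology {0, 1}) idems) chars"

definition point_char :: "'s::monoid_mult \<Rightarrow> 's chr" where
  "point_char s = (\<lambda>p\<in>idems. if s \<in> dom p then 1 else 0)"

definition Omega :: "'s::monoid_mult chr set" where
  "Omega = chars_top closure_of (range point_char)"

text \<open>The character $\chi(g^{-1}\,\cdot\,g)$.\<close>

definition act :: "('s::monoid_mult \<rightharpoonup> 's) \<Rightarrow> 's chr \<Rightarrow> 's chr" where
  "act g \<omega> = (\<lambda>p\<in>idems. \<omega> (pinv g \<circ>\<^sub>m p \<circ>\<^sub>m g))"

text \<open>
  The condition $\chi(p_W) = 1$ for the extension of $\chi \in \Omega(S)$ to
  $W \in \bar{\mathcal J}(S)$; for such $\chi$ it does not depend on the presentation of \<open>W\<close>.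
\<close>

definition char_ext :: "'s::monoid_mult chr \<Rightarrow> 's set \<Rightarrow> bool" where
  "char_ext \<omega> W \<longleftrightarrow> (\<exists>X\<in>constructible. \<exists>F. finite F \<and> F \<subseteq> constructible \<and> W = X - \<Union>F \<and>
     \<omega> (pid X) = 1 \<and> (\<forall>Y\<in>F. \<omega> (pid Y) = 0))"


section \<open>Topological groupoids\<close>

text \<open>
  The set of arrows is the underlying set of the topology, and units are arrows.  The product is
  only meaningful for composable arrows.
\<close>

record 'g groupoid =
  gtop :: "'g topology"
  gsrc :: "'g \<Rightarrow> 'g"
  grng :: "'g \<Rightarrow> 'g"
  gmul :: "'g \<Rightarrow> 'g \<Rightarrow> 'g"
  ginv :: "'g \<Rightarrow> 'g"

definition arrows :: "'g groupoid \<Rightarrow> 'g set" where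
  "arrows G = topspace (gtop G)"

definition gunits :: "'g groupoid \<Rightarrow> 'g set" where
  "gunits G = gsrc G ` arrows G"

definition sfibre :: "'g groupoid \<Rightarrow> 'g \<Rightarrow> 'g set" where
  "sfibre G x = {g \<in> arrows G. gsrc G g = x}"

definition rfibre :: "'g groupoid \<Rightarrow> 'g \<Rightarrow> 'g set" where
  "rfibre G x = {g \<in> arrows G. grng G g = x}"

text \<open>Restriction to an invariant set of units.\<close>

definition groupoid_restrict :: "'g groupoid \<Rightarrow> 'g set \<Rightarrow> 'g groupoid" where
  "groupoid_restrict G A = G\<lparr>gtop := subtopology (gtop G) {g \<in> arrows G. gsrc G g \<in> A}\<rparr>"

definition quotient_top :: "'a topology \<Rightarrow> ('a \<times> 'a) set \<Rightarrow> 'a set topology" where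
  "quotient_top T R =
     topology (\<lambda>U. U \<subseteq> topspace T // R \<and> openin T {x \<in> topspace T. R `` {x} \<in> U})"

lemma openin_quotient_top:
  "openin (quotient_top T R) U \<longleftrightarrow>
     U \<subseteq> topspace T // R \<and> openin T {x \<in> topspace T. R `` {x} \<in> U}"
proof -
  define P where "P = (\<lambda>U. {x \<in> topspace T. R `` {x} \<in> U})"
  have "istopology (\<lambda>U. U \<subseteq> topspace T // R \<and> openin T (P U))"
    unfolding istopology_def
  proof (intro conjI allI impI)
    fix U V
    assume U: "U \<subseteq> topspace T // R \<and> openin T (P U)"
      and V: "V \<subseteq> topspace T // R \<and> openin T (P V)"
    show "U \<inter> V \<subseteq> topspace T // R" using U by (rule le_infI1[OF conjunct1])
    have "P (U \<inter> V) = P U \<inter> P V" by (auto simp: P_def)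
    then show "openin T (P (U \<inter> V))"
      using U V by (simp add: openin_Int)
  next
    fix K
    assume K: "\<forall>U\<in>K. U \<subseteq> topspace T // R \<and> openin T (P U)"
    show "\<Union>K \<subseteq> topspace T // R" by (rule Union_least) (rule conjunct1[OF bspec[OF K]])
    have "P (\<Union>K) = \<Union>(P ` K)" by (auto simp: P_def)
    moreover have "openin T (\<Union>(P ` K))" by (rule openin_Union) (use K in \<open>auto simp del: subset_iff\<close>)
    ultimately show "openin T (P (\<Union>K))" by simp
  qed
  then show ?thesis unfolding quotient_top_def P_def[symmetric]
    by (simp only: topology_inverse' P_def)
qed

text \<open>
  Quotient by an equivalence relation that is compatible with the groupoid structure: the sets to
  which \<open>the_elem\<close> is applied are then singletons.
\<close>

definition groupoid_quotient :: "'g groupoid \<Rightarrow> ('g \<times> 'g) set \<Rightarrow> 'g set groupoid" where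
  "groupoid_quotient G R = \<lparr>
     gtop = quotient_top (gtop G) R,
     gsrc = (\<lambda>C. the_elem ((\<lambda>g. R `` {gsrc G g}) ` C)),
     grng = (\<lambda>C. the_elem ((\<lambda>g. R `` {grng G g}) ` C)),
     gmul = (\<lambda>C D. the_elem {R `` {gmul G g h} | g h. g \<in> C \<and> h \<in> D \<and> gsrc G g = grng G h}),
     ginv = (\<lambda>C. the_elem ((\<lambda>g. R `` {ginv G g}) ` C))\<rparr>"


section \<open>Reduced and essential groupoid C*-algebras\<close>

definition cc_on :: "'g topology \<Rightarrow> 'g set \<Rightarrow> ('g \<Rightarrow> complex) set" where
  "cc_on T V = {f. (\<forall>g. g \<notin> V \<longrightarrow> f g = 0) \<and> continuous_map (subtopology T V) euclidean f \<and>
     compactin (subtopology T V) (subtopology T V closure_of {g \<in> V. f g \<noteq> 0})}"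

definition cc :: "'g groupoid \<Rightarrow> ('g \<Rightarrow> complex) set" where
  "cc G = {\<lambda>g. \<Sum>f\<in>F. c f * f g | c F. finite F \<and>
     F \<subseteq> (\<Union>V\<in>{V. openin (gtop G) V \<and> Hausdorff_space (subtopology (gtop G) V)}. cc_on (gtop G) V)}"

text \<open>
  The representation $\rho_x$ on $\ell^2(\mathcal G_x)$.  For an etale groupoid and
  $f \in C_c(\mathcal G)$ the sum has only finitely many nonzero terms.
\<close>

definition rho :: "'g groupoid \<Rightarrow> 'g \<Rightarrow> ('g \<Rightarrow> complex) \<Rightarrow> 'g l2_op" where
  "rho G x f = (\<lambda>\<xi>. if \<xi> \<in> l2 (sfibre G x)
     then (\<lambda>g. if g \<in> sfibre G x
             then \<Sum>\<^sub>\<infinity>h\<in>rfibre G (grng G g). f h * \<xi> (gmul G (ginv G h) g) else 0)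
     else (\<lambda>_. 0))"

text \<open>
  The completion of $C_c(\mathcal G)$ in the norm $\|f\|_r = \sup_x\|\rho_x(f)\|$ is realised as the
  closure of the image of the isometric map $f \mapsto (\rho_x(f))_x$ in the C*-algebra of bounded
  families $(a_x)_x$ of operators $a_x \in B(\ell^2(\mathcal G_x))$, $x \in \mathcal G^{(0)}$, with
  supremum norm and coordinatewise operations.  Under this identification $\rho_x$ is the coordinate
  projection $a \mapsto a_x$, and convolution and involution of $C_c(\mathcal G)$ become composition
  and adjoint in each coordinate.  Families are zero outside of $\mathcal G^{(0)}$.
\<close>

type_synonym 'g op_family = "'g \<Rightarrow> 'g l2_op"

definition family_norm :: "'g groupoid \<Rightarrow> 'g op_family \<Rightarrow> ennreal" where
  "family_norm G a = (SUP x\<in>gunits G. op_norm (sfibre G x) (a x))"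

definition cstar_r :: "'g groupoid \<Rightarrow> 'g op_family set" where
  "cstar_r G = {a. (\<forall>x\<in>gunits G. a x \<in> bounded_ops (sfibre G x)) \<and>
     (\<forall>x. x \<notin> gunits G \<longrightarrow> a x = zero_op) \<and>
     (\<forall>\<epsilon>>0. \<exists>f\<in>cc G. family_norm G (\<lambda>x. diff_op (a x) (rho G x f)) < \<epsilon>)}"

definition meager_in :: "'a topology \<Rightarrow> 'a set \<Rightarrow> bool" where
  "meager_in T A \<longleftrightarrow> (\<exists>N :: nat \<Rightarrow> 'a set.
     (\<forall>n. N n \<subseteq> topspace T \<and> T interior_of (T closure_of N n) = {}) \<and> A = (\<Union>n. N n))"

definition J_sing :: "'g groupoid \<Rightarrow> 'g op_family set" where
  "J_sing G = {a \<in> cstar_r G.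
     meager_in (subtopology (gtop G) (gunits G)) {x \<in> gunits G. a x (l2_delta x) \<noteq> (\<lambda>_. 0)}}"

text \<open>
  For a unit \<open>x\<close> and a bijection $\varphi\colon S \to \mathcal G_x$, used to identify
  $\ell^2(\mathcal G_x)$ with $\ell^2(S)$: the map $\rho_x$ is a surjective *-homomorphism
  $C^*_r(\mathcal G) \to C^*_r(S)$ with kernel $J_{\mathrm{sing}}$, so it defines an isomorphism of
  $C^*_{\mathrm{ess}}(\mathcal G) = C^*_r(\mathcal G)/J_{\mathrm{sing}}$ onto $C^*_r(S)$.
\<close>

definition rho_monoid :: "'g \<Rightarrow> ('s \<Rightarrow> 'g) \<Rightarrow> 'g op_family \<Rightarrow> 's l2_op" where
  "rho_monoid x \<phi> a = transport_op \<phi> (a x)"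

definition defines_ess_iso :: "'g groupoid \<Rightarrow> 'g \<Rightarrow> ('s::monoid_mult \<Rightarrow> 'g) \<Rightarrow> bool" where
  "defines_ess_iso G x \<phi> \<longleftrightarrow>
     (\<forall>a\<in>cstar_r G. \<forall>b\<in>cstar_r G.
        rho_monoid x \<phi> (\<lambda>y. add_op (a y) (b y)) = add_op (rho_monoid x \<phi> a) (rho_monoid x \<phi> b)) \<and>
     (\<forall>c. \<forall>a\<in>cstar_r G. rho_monoid x \<phi> (\<lambda>y. scale_op c (a y)) = scale_op c (rho_monoid x \<phi> a)) \<and>
     (\<forall>a\<in>cstar_r G. \<forall>b\<in>cstar_r G.
        rho_monoid x \<phi> (\<lambda>y. a y \<circ> b y) = rho_monoid x \<phi> a \<circ> rho_monoid x \<phi> b) \<and>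
     (\<forall>a\<in>cstar_r G. \<forall>b\<in>cstar_r G. (\<forall>y\<in>gunits G. is_adjoint (sfibre G y) (a y) (b y)) \<longrightarrow>
        is_adjoint UNIV (rho_monoid x \<phi> a) (rho_monoid x \<phi> b)) \<and>
     rho_monoid x \<phi> ` cstar_r G = cstar_r_monoid \<and>
     {a \<in> cstar_r G. rho_monoid x \<phi> a = zero_op} = J_sing G"


section \<open>The groupoids of a left cancellative monoid\<close>

type_synonym 's germ = "(('s \<rightharpoonup> 's) \<times> 's chr) set"

text \<open>The class $[g,\chi]$.\<close>

definition germ :: "('s::monoid_mult \<rightharpoonup> 's) \<Rightarrow> 's chr \<Rightarrow> 's germ" where
  "germ g \<omega> = {(h, \<psi>). h \<in> inv_hull \<and> \<psi> = \<omega> \<and> \<omega> (pinv h \<circ>\<^sub>m h) = 1 \<and>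
     (\<exists>p\<in>idems. \<omega> p = 1 \<and> g \<circ>\<^sub>m p = h \<circ>\<^sub>m p)}"

definition basic_open :: "('s::monoid_mult \<rightharpoonup> 's) \<Rightarrow> 's chr set \<Rightarrow> 's germ set" where
  "basic_open g U = germ g ` U"

text \<open>
  The groupoid $\mathcal G(I_\ell(S))$.  The structure maps are defined on representatives; the sets
  to which \<open>the_elem\<close> is applied are singletons.  The unit given by \<open>\<omega>\<close> is
  \<open>germ Some \<omega>\<close>, where \<open>Some\<close> is the identity map of \<open>S\<close>.
\<close>

definition paterson :: "'s::monoid_mult germ groupoid" where
  "paterson = \<lparr>
     gtop = topology_generated_by {basic_open g U | g U. g \<in> inv_hull \<and> openin chars_top U \<and>
              U \<subseteq> {\<omega> \<in> chars. \<omega> (pinv g \<circ>\<^sub>m g) = 1}},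
     gsrc = (\<lambda>\<gamma>. the_elem ((\<lambda>(g, \<omega>). germ Some \<omega>) ` \<gamma>)),
     grng = (\<lambda>\<gamma>. the_elem ((\<lambda>(g, \<omega>). germ Some (act g \<omega>)) ` \<gamma>)),
     gmul = (\<lambda>\<gamma> \<delta>. the_elem {germ (g \<circ>\<^sub>m h) \<psi> | g \<omega> h \<psi>. (g, \<omega>) \<in> \<gamma> \<and> (h, \<psi>) \<in> \<delta> \<and> \<omega> = act h \<psi>}),
     ginv = (\<lambda>\<gamma>. the_elem ((\<lambda>(g, \<omega>). germ (pinv g) (act g \<omega>)) ` \<gamma>))\<rparr>"

definition G_P :: "'s::monoid_mult germ groupoid" where
  "G_P = groupoid_restrict paterson (germ Some ` Omega)"

definition germ_rel :: "('s::monoid_mult germ \<times> 's germ) set" where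
  "germ_rel = {(\<gamma>, \<delta>). \<gamma> \<in> arrows G_P \<and> \<delta> \<in> arrows G_P \<and>
     (\<exists>g h \<omega>. (g, \<omega>) \<in> \<gamma> \<and> (h, \<omega>) \<in> \<delta> \<and>
        (\<exists>X\<in>constructible_bar. char_ext \<omega> X \<and> g |` X = h |` X))}"

definition G_S :: "'s::monoid_mult germ set groupoid" where
  "G_S = groupoid_quotient G_P germ_rel"

text \<open>
  The units of the two groupoids given by $\chi_e$, and the bijections $s \mapsto [s,\chi_e]$ of
  \<open>S\<close> onto the corresponding source fibres.
\<close>

definition unit_P :: "'s::monoid_mult germ" where
  "unit_P = germ Some (point_char 1)"

definition fibre_P :: "'s::monoid_mult \<Rightarrow> 's germ" where
  "fibre_P s = germ (ltrans s) (point_char 1)"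

definition unit_S :: "'s::monoid_mult germ set" where
  "unit_S = germ_rel `` {unit_P}"

definition fibre_S :: "'s::monoid_mult \<Rightarrow> 's germ set" where
  "fibre_S s = germ_rel `` {fibre_P s}"

end

theory Submission
  imports Defs
begin

text \<open>
  In both groupoids the indicator functions of the bisections given by the elements $g$ of the left
  inverse hull multiply like the elements themselves and span a dense *-subalgebra of the reduced
  C*-algebra; $\rho_{\chi_e}$ sends them to the partial isometries $\delta_t \mapsto \delta_{g(t)}$.  The
  image is closed since $a$ can be replaced by $a(1 - a^*a/R)^n$, which has norm comparable to
  $\|\rho_{\chi_e}(a)\|$ and still approximates $a$ under $\rho_{\chi_e}$.

  Each $a$ has coefficients $\omega \mapsto (\rho_\omega(a)\delta_\omega)([g,\omega])$, which are uniform limits of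
  combinations of indicators of open sets, hence continuous off the countable union of the
  boundaries of these sets.  If $\rho_{\chi_e}(a) = 0$, they vanish at the dense set of point
  characters, hence off a meager set.  Conversely, let the coefficient of $a$ at $[ts^{-1},\chi_s]$
  be nonzero and approximate $a$ by a finite combination of elements $h$.  Each $t^{-1}hs$ either
  fixes $e$, or $e$ is not in its domain, or not in its range, or it is a nontrivial unit; so the
  hypothesis gives a set $Z$ in $\bar{\mathcal J}(S)$ no point of which is fixed by one that does
  not fix $e$.  The coefficient of the approximation is then constant on the nonempty open set of
  characters supported on $sZ$, which is not meager by Baire's theorem.
\<close>

section \<open>Square summable families\<close>

text \<open>The groupoids need not be Hausdorff: two bisections may agree on a set that is open but
  not closed, and at its boundary the coefficients of an element of the reduced algebra can jump.
  \<open>J_sing\<close> collects what lives on meager sets, such as the boundaries of countably many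
  pairs of bisections. A finite combination of bisections sees a character only through the
  coincidence sets that contain it, so both inclusions reduce to finding points where finitely many
  coincidences are decided. The arrow [ts^{-1}, chi_s] occurs because right multiplication by
  [s, chi_e] identifies the fibre over chi_s with the one over chi_e: the coefficient at that arrow
  is the matrix entry of rho_{chi_e}(a) from delta_s to delta_t. The two groupoids differ only in
  how many representatives of an arrow are identified, so one argument over an abstract germ map
  \<open>a\<close> serves both. In the damped element, R and n are chosen from norms alone; the same
  polynomial then acts in all fibres at once, and a bound known only at chi_e yields one in the
  supremum norm.\<close>

lemma l2_zero: "\<xi> \<in> l2 A \<Longrightarrow> i \<notin> A \<Longrightarrow> \<xi> i = 0"
  by (simp add: l2_def)

lemma l2_summable:
  assumes "\<xi> \<in> l2 A" shows "(\<lambda>i. (cmod (\<xi> i))\<^sup>2) summable_on UNIV"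
proof -
  have "(\<lambda>i. (cmod (\<xi> i))\<^sup>2) summable_on A" using assms by (simp add: l2_def)
  then show ?thesis
    by (rule summable_on_cong_neutral[THEN iffD1, rotated -1]) (use assms in \<open>auto simp: l2_def\<close>)
qed

lemma L2_set_le_l2_norm:
  assumes "\<xi> \<in> l2 A" shows "L2_set (\<lambda>i. cmod (\<xi> i)) F \<le> l2_norm \<xi>"
proof (cases "finite F")
  case True
  then show ?thesis unfolding L2_set_def l2_norm_def
    by (intro real_sqrt_le_mono finite_sum_le_infsum l2_summable[OF assms]) auto
\<comment> \<open>For infinite \<open>F\<close> the sum in \<open>L2_set\<close> is 0 by convention,
  so the bound holds for every \<open>F\<close>.\<close>
qed (auto simp: l2_norm_def infsum_nonneg)

text \<open>Finite partial sums are what later estimates control: a common bound on them gives both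
  summability and the bound on the norm. Taking \<open>F\<close> empty shows that \<open>C\<close>
  is nonnegative.\<close>

lemma l2_bound:
  assumes "\<And>i. i \<notin> A \<Longrightarrow> \<xi> i = 0"
    and "\<And>F. finite F \<Longrightarrow> L2_set (\<lambda>i. cmod (\<xi> i)) F \<le> C"
  shows "\<xi> \<in> l2 A" and "l2_norm \<xi> \<le> C"
proof -
  have C: "0 \<le> C" using assms(2)[of "{}"] by simp
  have le: "(\<Sum>i\<in>F. (cmod (\<xi> i))\<^sup>2) \<le> C\<^sup>2" if "finite F" for F
    using assms(2)[OF that] C unfolding L2_set_def by (simp add: real_sqrt_le_iff' sum_nonneg)
  have s: "(\<lambda>i. (cmod (\<xi> i))\<^sup>2) summable_on B" for B
    by (rule nonneg_bdd_above_summable_on) (auto intro!: bdd_aboveI2[where M = "C\<^sup>2"] le)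
  show "\<xi> \<in> l2 A" using assms(1) s by (simp add: l2_def)
  have "(\<Sum>\<^sub>\<infinity>i. (cmod (\<xi> i))\<^sup>2) \<le> C\<^sup>2" by (rule infsum_le_finite_sums[OF s]) (rule le)
  then show "l2_norm \<xi> \<le> C" unfolding l2_norm_def using C by (simp add: real_le_lsqrt)
qed

lemma l2_norm_nonneg [simp]: "0 \<le> l2_norm \<xi>"
  by (simp add: l2_norm_def infsum_nonneg)

lemma cmod_le_l2_norm: "\<xi> \<in> l2 A \<Longrightarrow> cmod (\<xi> i) \<le> l2_norm \<xi>"
  using L2_set_le_l2_norm[of \<xi> A "{i}"] by simp

lemma l2_norm_zero [simp]: "l2_norm (\<lambda>_. 0) = 0"
  by (simp add: l2_norm_def)

lemma l2_norm_eq_0: "\<xi> \<in> l2 A \<Longrightarrow> l2_norm \<xi> = 0 \<Longrightarrow> \<xi> = (\<lambda>_. 0)"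
  using cmod_le_l2_norm[of \<xi> A] by (intro ext) simp

lemma zero_in_l2 [simp]: "(\<lambda>_. 0) \<in> l2 A"
  by (simp add: l2_def)

lemma l2_add:
  assumes "\<xi> \<in> l2 A" "\<eta> \<in> l2 A"
  shows "(\<lambda>i. \<xi> i + \<eta> i) \<in> l2 A" and "l2_norm (\<lambda>i. \<xi> i + \<eta> i) \<le> l2_norm \<xi> + l2_norm \<eta>"
proof -
  have b: "L2_set (\<lambda>i. cmod (\<xi> i + \<eta> i)) F \<le> l2_norm \<xi> + l2_norm \<eta>" for F
  proof -
    have "L2_set (\<lambda>i. cmod (\<xi> i + \<eta> i)) F \<le> L2_set (\<lambda>i. cmod (\<xi> i) + cmod (\<eta> i)) F"
      by (rule L2_set_mono) (auto intro: norm_triangle_ineq)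
    also have "\<dots> \<le> L2_set (\<lambda>i. cmod (\<xi> i)) F + L2_set (\<lambda>i. cmod (\<eta> i)) F"
      by (rule L2_set_triangle_ineq)
    also have "\<dots> \<le> l2_norm \<xi> + l2_norm \<eta>"
      by (rule add_mono[OF L2_set_le_l2_norm[OF assms(1)] L2_set_le_l2_norm[OF assms(2)]])
    finally show ?thesis .
  qed
  have z: "\<xi> i + \<eta> i = 0" if "i \<notin> A" for i
    using that assms by (simp add: l2_zero)
  show "(\<lambda>i. \<xi> i + \<eta> i) \<in> l2 A" using z b by (rule l2_bound(1))
  show "l2_norm (\<lambda>i. \<xi> i + \<eta> i) \<le> l2_norm \<xi> + l2_norm \<eta>" using z b by (rule l2_bound(2))
qed

lemma l2_norm_scale: "l2_norm (\<lambda>i. c * \<xi> i) = cmod c * l2_norm \<xi>"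
  by (simp add: l2_norm_def norm_mult power_mult_distrib infsum_cmult_right' real_sqrt_mult)

lemma l2_scale: "\<xi> \<in> l2 A \<Longrightarrow> (\<lambda>i. c * \<xi> i) \<in> l2 A"
  by (rule l2_bound(1)[of _ _ "cmod c * l2_norm \<xi>"])
    (auto simp: l2_zero norm_mult intro!: mult_left_mono L2_set_le_l2_norm simp flip: L2_set_right_distrib)

lemma l2_diff:
  assumes "\<xi> \<in> l2 A" "\<eta> \<in> l2 A"
  shows "(\<lambda>i. \<xi> i - \<eta> i) \<in> l2 A" and "l2_norm (\<lambda>i. \<xi> i - \<eta> i) \<le> l2_norm \<xi> + l2_norm \<eta>"
  using l2_add[OF assms(1) l2_scale[OF assms(2), of "-1"]] l2_norm_scale[of "-1" \<eta>] by simp_all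

lemma l2_delta_in: "i \<in> A \<Longrightarrow> l2_delta i \<in> l2 A"
proof (rule l2_bound(1)[of _ _ 1])
  fix F :: "'a set" assume "finite F"
  then have "(\<Sum>j\<in>F. (cmod (l2_delta i j))\<^sup>2) \<le> (\<Sum>j\<in>F. if j = i then 1 else 0)"
    by (intro sum_mono) (simp add: l2_delta_def)
  also have "\<dots> \<le> 1" using \<open>finite F\<close> by simp
  finally show "L2_set (\<lambda>j. cmod (l2_delta i j)) F \<le> 1" by (simp add: L2_set_def)
qed (auto simp: l2_delta_def)

lemma l2_norm_delta: "l2_norm (l2_delta i) = 1"
proof -
  have "(\<Sum>\<^sub>\<infinity>j. (cmod (l2_delta i j))\<^sup>2) = (\<Sum>\<^sub>\<infinity>j\<in>{i}. (cmod (l2_delta i j))\<^sup>2)"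
    by (rule infsum_cong_neutral) (auto simp: l2_delta_def)
  then show ?thesis by (simp add: l2_norm_def l2_delta_def)
qed

lemma l2_finite_support:
  assumes "finite F" "F \<subseteq> A"
  shows "(\<lambda>i. if i \<in> F then c i else 0) \<in> l2 A"
    and "l2_norm (\<lambda>i. if i \<in> F then c i else 0) = L2_set (\<lambda>i. cmod (c i)) F"
proof -
  have "(\<lambda>i. (cmod (if i \<in> F then c i else 0))\<^sup>2) summable_on F" using assms by simp
  then have "(\<lambda>i. (cmod (if i \<in> F then c i else 0))\<^sup>2) summable_on A"
    by (rule summable_on_cong_neutral[THEN iffD1, rotated -1]) (use assms in auto)
  then show "(\<lambda>i. if i \<in> F then c i else 0) \<in> l2 A" using assms by (auto simp: l2_def)
  have "(\<Sum>\<^sub>\<infinity>i. (cmod (if i \<in> F then c i else 0))\<^sup>2) = (\<Sum>\<^sub>\<infinity>i\<in>F. (cmod (c i))\<^sup>2)"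
    by (rule infsum_cong_neutral) auto
  then show "l2_norm (\<lambda>i. if i \<in> F then c i else 0) = L2_set (\<lambda>i. cmod (c i)) F"
    using assms by (simp add: l2_norm_def L2_set_def)
qed

text \<open>Density of the finitely supported vectors, by which identities known on basis vectors
  are extended.\<close>

lemma l2_truncate:
  assumes \<xi>: "\<xi> \<in> l2 A" and e: "0 < e"
  obtains F where "finite F" "F \<subseteq> A" "l2_norm (\<lambda>i. \<xi> i - (if i \<in> F then \<xi> i else 0)) \<le> e"
proof -
  let ?f = "\<lambda>i. (cmod (\<xi> i))\<^sup>2"
  have s: "?f summable_on A" using \<xi> by (simp add: l2_def)
  \<comment> \<open>The tolerance is squared because the sum consists of squares.\<close>
  obtain F where F: "finite F" "F \<subseteq> A" "dist (sum ?f F) (infsum ?f A) \<le> e\<^sup>2"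
    using infsum_finite_approximation[OF s, of "e\<^sup>2"] e by auto
  let ?\<eta> = "\<lambda>i. \<xi> i - (if i \<in> F then \<xi> i else 0)"
  have "L2_set (\<lambda>i. cmod (?\<eta> i)) H \<le> e" if H: "finite H" for H
  proof -
    have "(\<Sum>i\<in>H. (cmod (?\<eta> i))\<^sup>2) = (\<Sum>i\<in>H \<inter> A - F. ?f i)"
      by (rule sum.mono_neutral_cong_right) (use H l2_zero[OF \<xi>] in auto)
    also have "\<dots> = sum ?f (H \<inter> A \<union> F) - sum ?f F"
    proof -
      have "sum ?f (H \<inter> A - F \<union> F) = sum ?f (H \<inter> A - F) + sum ?f F"
        by (rule sum.union_disjoint) (use H F in auto)
      then show ?thesis by simp
    qed
    also have "\<dots> \<le> infsum ?f A - sum ?f F"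
      by (intro diff_right_mono finite_sum_le_infsum s) (use H F in auto)
    also have "\<dots> \<le> e\<^sup>2" using F(3) by (simp add: dist_real_def)
    finally show ?thesis unfolding L2_set_def using e by (simp add: real_le_lsqrt)
  qed
  then have "l2_norm ?\<eta> \<le> e" by (intro l2_bound(2)[of UNIV]) auto
  then show thesis using that F by blast
qed

text \<open>Cauchy-Schwarz on finite sets gives absolute summability and, in the limit, the
  inequality itself.\<close>

lemma inner_summable:
  assumes "\<xi> \<in> l2 A" "\<eta> \<in> l2 B" shows "(\<lambda>i. \<xi> i * cnj (\<eta> i)) summable_on UNIV"
    and "cmod (l2_inner \<xi> \<eta>) \<le> l2_norm \<xi> * l2_norm \<eta>"
proof -
  have le: "(\<Sum>i\<in>F. cmod (\<xi> i * cnj (\<eta> i))) \<le> l2_norm \<xi> * l2_norm \<eta>" for F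
  proof -
    have "(\<Sum>i\<in>F. cmod (\<xi> i * cnj (\<eta> i))) = (\<Sum>i\<in>F. \<bar>cmod (\<xi> i)\<bar> * \<bar>cmod (\<eta> i)\<bar>)"
      by (simp add: norm_mult)
    also have "\<dots> \<le> L2_set (\<lambda>i. cmod (\<xi> i)) F * L2_set (\<lambda>i. cmod (\<eta> i)) F"
      by (rule L2_set_mult_ineq)
    also have "\<dots> \<le> l2_norm \<xi> * l2_norm \<eta>"
      by (intro mult_mono L2_set_le_l2_norm[OF assms(1)] L2_set_le_l2_norm[OF assms(2)]) auto
    finally show ?thesis .
  qed
  have s: "(\<lambda>i. cmod (\<xi> i * cnj (\<eta> i))) summable_on UNIV"
    by (rule nonneg_bdd_above_summable_on) (auto intro!: bdd_aboveI2 le)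
  then show "(\<lambda>i. \<xi> i * cnj (\<eta> i)) summable_on UNIV" by (rule abs_summable_summable)
  have "cmod (l2_inner \<xi> \<eta>) \<le> (\<Sum>\<^sub>\<infinity>i. cmod (\<xi> i * cnj (\<eta> i)))"
    unfolding l2_inner_def by (rule norm_infsum_bound[OF s])
  also have "\<dots> \<le> l2_norm \<xi> * l2_norm \<eta>" by (rule infsum_le_finite_sums[OF s]) (rule le)
  finally show "cmod (l2_inner \<xi> \<eta>) \<le> l2_norm \<xi> * l2_norm \<eta>" .
qed

lemma inner_add_left:
  assumes "\<xi> \<in> l2 A" "\<eta> \<in> l2 A" "\<zeta> \<in> l2 A"
  shows "l2_inner (\<lambda>i. \<xi> i + \<eta> i) \<zeta> = l2_inner \<xi> \<zeta> + l2_inner \<eta> \<zeta>"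
  unfolding l2_inner_def distrib_right
  by (rule infsum_add; rule inner_summable(1); fact)

lemma inner_scale_left: "l2_inner (\<lambda>i. c * \<xi> i) \<eta> = c * l2_inner \<xi> \<eta>"
  by (simp add: l2_inner_def mult.assoc infsum_cmult_right')

lemma inner_cnj: "l2_inner \<eta> \<xi> = cnj (l2_inner \<xi> \<eta>)"
  by (simp add: l2_inner_def mult.commute flip: infsum_cnj)

lemma inner_diff_left:
  assumes "\<xi> \<in> l2 A" "\<eta> \<in> l2 A" "\<zeta> \<in> l2 A"
  shows "l2_inner (\<lambda>i. \<xi> i - \<eta> i) \<zeta> = l2_inner \<xi> \<zeta> - l2_inner \<eta> \<zeta>"
  using inner_add_left[OF assms(1) l2_scale[OF assms(2), of "-1"] assms(3)]
  by (simp add: inner_scale_left[of "-1", simplified])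

lemma inner_add_right:
  assumes "\<xi> \<in> l2 A" "\<eta> \<in> l2 A" "\<zeta> \<in> l2 A"
  shows "l2_inner \<zeta> (\<lambda>i. \<xi> i + \<eta> i) = l2_inner \<zeta> \<xi> + l2_inner \<zeta> \<eta>"
  using inner_add_left[OF assms] by (simp add: inner_cnj[of \<zeta>])

lemma inner_diff_right:
  assumes "\<xi> \<in> l2 A" "\<eta> \<in> l2 A" "\<zeta> \<in> l2 A"
  shows "l2_inner \<zeta> (\<lambda>i. \<xi> i - \<eta> i) = l2_inner \<zeta> \<xi> - l2_inner \<zeta> \<eta>"
  using inner_diff_left[OF assms] by (simp add: inner_cnj[of \<zeta>])

lemma inner_scale_right: "l2_inner \<xi> (\<lambda>i. c * \<eta> i) = cnj c * l2_inner \<xi> \<eta>"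
  by (simp add: inner_cnj[of \<xi>] inner_scale_left)

lemma inner_self: "\<xi> \<in> l2 A \<Longrightarrow> l2_inner \<xi> \<xi> = of_real ((l2_norm \<xi>)\<^sup>2)"
proof -
  assume "\<xi> \<in> l2 A"
  then have s: "(\<lambda>i. \<xi> i * cnj (\<xi> i)) summable_on UNIV" by (simp add: inner_summable(1))
  have "\<xi> i * cnj (\<xi> i) = of_real ((cmod (\<xi> i))\<^sup>2)" for i
    by (simp only: complex_norm_square)
  then have "Re (\<xi> i * cnj (\<xi> i)) = (cmod (\<xi> i))\<^sup>2" "Im (\<xi> i * cnj (\<xi> i)) = 0" for i
    by simp_all
  moreover have "(l2_norm \<xi>)\<^sup>2 = (\<Sum>\<^sub>\<infinity>i. (cmod (\<xi> i))\<^sup>2)"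
    by (simp add: l2_norm_def infsum_nonneg)
  ultimately show ?thesis
    using infsum_Re[OF s] infsum_Im[OF s] by (intro complex_eqI) (simp_all add: l2_inner_def)
qed

lemma inner_delta_right: "l2_inner \<xi> (l2_delta i) = \<xi> i"
proof -
  have "l2_inner \<xi> (l2_delta i) = (\<Sum>\<^sub>\<infinity>j\<in>{i}. \<xi> j * cnj (l2_delta i j))"
    unfolding l2_inner_def by (rule infsum_cong_neutral) (auto simp: l2_delta_def)
  then show ?thesis by (simp add: l2_delta_def)
qed

section \<open>Bounded operators and adjoints\<close>

text \<open>The algebraic half of \<open>bounded_ops\<close>. Keeping it apart from the norm
  condition lets linearity be used before a bound is at hand, and lets explicit real constants in
  \<open>bnd\<close> replace the extended real \<open>op_norm\<close>.\<close>

definition lin_op :: "'i set \<Rightarrow> 'i l2_op \<Rightarrow> bool" where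
  "lin_op A T \<longleftrightarrow>
     (\<forall>\<xi>. \<xi> \<notin> l2 A \<longrightarrow> T \<xi> = (\<lambda>_. 0)) \<and>
     (\<forall>\<xi>\<in>l2 A. T \<xi> \<in> l2 A) \<and>
     (\<forall>\<xi>\<in>l2 A. \<forall>\<eta>\<in>l2 A. T (\<lambda>i. \<xi> i + \<eta> i) = (\<lambda>i. T \<xi> i + T \<eta> i)) \<and>
     (\<forall>c. \<forall>\<xi>\<in>l2 A. T (\<lambda>i. c * \<xi> i) = (\<lambda>i. c * T \<xi> i))"

definition bnd :: "'i set \<Rightarrow> 'i l2_op \<Rightarrow> real \<Rightarrow> bool" where
  "bnd A T c \<longleftrightarrow> 0 \<le> c \<and> (\<forall>\<xi>\<in>l2 A. l2_norm (T \<xi>) \<le> c * l2_norm \<xi>)"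

lemma bndD: "bnd A T c \<Longrightarrow> \<xi> \<in> l2 A \<Longrightarrow> l2_norm (T \<xi>) \<le> c * l2_norm \<xi>"
  by (simp add: bnd_def)

lemma bnd_mono: "bnd A T c \<Longrightarrow> c \<le> d \<Longrightarrow> bnd A T d"
  unfolding bnd_def by (meson l2_norm_nonneg mult_right_mono order_trans)

text \<open>Normalising a nonzero vector turns the supremum over the unit ball into an inequality
  for all vectors. Homogeneity also handles the zero vector, through the factor 0.\<close>

lemma op_norm_le_iff:
  assumes T: "\<And>c \<xi>. \<xi> \<in> l2 A \<Longrightarrow> T (\<lambda>i. c * \<xi> i) = (\<lambda>i. c * T \<xi> i)" and c: "0 \<le> c"
  shows "op_norm A T \<le> ennreal c \<longleftrightarrow> bnd A T c"
proof
  assume L: "op_norm A T \<le> ennreal c"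
  have unit: "l2_norm (T \<xi>) \<le> c" if "\<xi> \<in> l2 A" "l2_norm \<xi> \<le> 1" for \<xi>
  proof -
    have "ennreal (l2_norm (T \<xi>)) \<le> op_norm A T"
      unfolding op_norm_def by (rule SUP_upper) (use that in auto)
    then have "ennreal (l2_norm (T \<xi>)) \<le> ennreal c" using L by (rule order_trans)
    then show ?thesis using c by simp
  qed
  show "bnd A T c" unfolding bnd_def
  proof (intro conjI ballI c)
    fix \<xi> assume x: "\<xi> \<in> l2 A"
    show "l2_norm (T \<xi>) \<le> c * l2_norm \<xi>"
    proof (cases "l2_norm \<xi> = 0")
      case True
      then have "\<xi> = (\<lambda>_. 0)" using l2_norm_eq_0 x by blast
      then show ?thesis using T[OF x, of 0] by simp
    next
      case False
      then have n: "l2_norm \<xi> > 0" using l2_norm_nonneg[of \<xi>] by linarith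
      let ?c = "of_real (1 / l2_norm \<xi>) :: complex"
      have "l2_norm (T (\<lambda>i. ?c * \<xi> i)) \<le> c"
        by (rule unit) (use x n in \<open>simp_all only: l2_scale l2_norm_scale norm_of_real, simp\<close>)
      then have "l2_norm (T \<xi>) / l2_norm \<xi> \<le> c"
        unfolding T[OF x] l2_norm_scale norm_of_real using n by simp
      then show ?thesis using n by (simp add: divide_le_eq)
    qed
  qed
next
  assume B: "bnd A T c"
  show "op_norm A T \<le> ennreal c"
    unfolding op_norm_def
  proof (rule SUP_least)
    fix \<xi> assume "\<xi> \<in> {\<xi> \<in> l2 A. l2_norm \<xi> \<le> 1}"
    then have "l2_norm (T \<xi>) \<le> c * 1"
      using B c by (auto simp: bnd_def intro!: order_trans[OF _ mult_left_mono[of _ 1 c, simplified]])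
    then show "ennreal (l2_norm (T \<xi>)) \<le> ennreal c" by (simp add: ennreal_leI)
  qed
qed

text \<open>Holds for every vector: outside \<open>l2 A\<close> the value is the zero vector, which
  lies in \<open>l2 A\<close>.\<close>

lemma lin_op_in: "lin_op A T \<Longrightarrow> T \<xi> \<in> l2 A"
  by (cases "\<xi> \<in> l2 A") (auto simp: lin_op_def)

lemma lin_op_out: "lin_op A T \<Longrightarrow> \<xi> \<notin> l2 A \<Longrightarrow> T \<xi> = (\<lambda>_. 0)"
  by (simp add: lin_op_def)

lemma lin_op_add:
  "lin_op A T \<Longrightarrow> \<xi> \<in> l2 A \<Longrightarrow> \<eta> \<in> l2 A \<Longrightarrow> T (\<lambda>i. \<xi> i + \<eta> i) = (\<lambda>i. T \<xi> i + T \<eta> i)"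
  by (simp add: lin_op_def)

lemma lin_op_scale: "lin_op A T \<Longrightarrow> \<xi> \<in> l2 A \<Longrightarrow> T (\<lambda>i. c * \<xi> i) = (\<lambda>i. c * T \<xi> i)"
  by (simp add: lin_op_def)

lemma lin_op_zero: "lin_op A T \<Longrightarrow> T (\<lambda>_. 0) = (\<lambda>_. 0)"
  using lin_op_scale[of A T "\<lambda>_. 0" 0] by simp

lemma lin_op_diff:
  "lin_op A T \<Longrightarrow> \<xi> \<in> l2 A \<Longrightarrow> \<eta> \<in> l2 A \<Longrightarrow> T (\<lambda>i. \<xi> i - \<eta> i) = (\<lambda>i. T \<xi> i - T \<eta> i)"
  using lin_op_add[of A T \<xi> "\<lambda>i. -1 * \<eta> i"] lin_op_scale[of A T \<eta> "-1"] l2_scale[of \<eta> A "-1"]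
  by simp

lemma lin_op_zero_op: "lin_op A zero_op"
  by (simp add: lin_op_def zero_op_def)

lemma lin_op_add_op: "lin_op A S \<Longrightarrow> lin_op A T \<Longrightarrow> lin_op A (add_op S T)"
  by (auto simp: lin_op_def add_op_def l2_add algebra_simps)

lemma lin_op_scale_op: "lin_op A T \<Longrightarrow> lin_op A (scale_op c T)"
  by (auto simp: lin_op_def scale_op_def l2_scale algebra_simps)

lemma lin_op_diff_op: "lin_op A S \<Longrightarrow> lin_op A T \<Longrightarrow> lin_op A (diff_op S T)"
  by (auto simp: lin_op_def diff_op_def l2_diff algebra_simps)

lemma lin_op_comp: "lin_op A S \<Longrightarrow> lin_op A T \<Longrightarrow> lin_op A (S \<circ> T)"
  using lin_op_zero[of A S] by (auto simp: lin_op_def)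

lemma bounded_ops_iff: "T \<in> bounded_ops A \<longleftrightarrow> lin_op A T \<and> (\<exists>c. bnd A T c)"
proof -
  have "op_norm A T < \<infinity> \<longleftrightarrow> (\<exists>c. bnd A T c)" if T: "lin_op A T"
  proof
    assume "op_norm A T < \<infinity>"
    then obtain c where "0 \<le> c" "op_norm A T = ennreal c"
      by (cases "op_norm A T") auto
    then show "\<exists>c. bnd A T c" using op_norm_le_iff[of A T c] lin_op_scale[OF T] by auto
  next
    assume "\<exists>c. bnd A T c"
    then obtain c where c: "bnd A T c" by blast
    then have "op_norm A T \<le> ennreal c"
      using op_norm_le_iff[of A T c] lin_op_scale[OF T] by (auto simp: bnd_def)
    then show "op_norm A T < \<infinity>" by (simp add: order_le_less_trans)
  qed
  then show ?thesis by (auto simp: bounded_ops_def lin_op_def)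
qed

lemma bounded_opsI: "lin_op A T \<Longrightarrow> bnd A T c \<Longrightarrow> T \<in> bounded_ops A"
  by (auto simp: bounded_ops_iff)

lemma bounded_lin: "T \<in> bounded_ops A \<Longrightarrow> lin_op A T"
  by (simp add: bounded_ops_iff)

lemma bounded_bnd: "T \<in> bounded_ops A \<Longrightarrow> \<exists>c. bnd A T c"
  by (simp add: bounded_ops_iff)

lemma bnd_zero_op: "0 \<le> c \<Longrightarrow> bnd A zero_op c"
  by (simp add: bnd_def zero_op_def)

lemma bnd_add_op: "lin_op A S \<Longrightarrow> lin_op A T \<Longrightarrow> bnd A S c \<Longrightarrow> bnd A T d \<Longrightarrow> bnd A (add_op S T) (c + d)"
  unfolding bnd_def add_op_def distrib_right
  by (intro conjI ballI order_trans[OF l2_add(2)[OF lin_op_in lin_op_in]]) (auto intro: add_mono)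

lemma bnd_diff_op: "lin_op A S \<Longrightarrow> lin_op A T \<Longrightarrow> bnd A S c \<Longrightarrow> bnd A T d \<Longrightarrow> bnd A (diff_op S T) (c + d)"
  unfolding bnd_def diff_op_def distrib_right
  by (intro conjI ballI order_trans[OF l2_diff(2)[OF lin_op_in lin_op_in]]) (auto intro: add_mono)

lemma bnd_scale_op: "bnd A T d \<Longrightarrow> bnd A (scale_op c T) (cmod c * d)"
  unfolding bnd_def scale_op_def l2_norm_scale mult.assoc
  by (auto intro: mult_left_mono)

lemma bnd_comp: "lin_op A T \<Longrightarrow> bnd A S c \<Longrightarrow> bnd A T d \<Longrightarrow> bnd A (S \<circ> T) (c * d)"
  unfolding bnd_def
proof (intro conjI ballI)
  fix \<xi> assume *: "0 \<le> c \<and> (\<forall>\<xi>\<in>l2 A. l2_norm (S \<xi>) \<le> c * l2_norm \<xi>)"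
    "0 \<le> d \<and> (\<forall>\<xi>\<in>l2 A. l2_norm (T \<xi>) \<le> d * l2_norm \<xi>)" "lin_op A T" "\<xi> \<in> l2 A"
  then have "l2_norm (S (T \<xi>)) \<le> c * l2_norm (T \<xi>)" by (simp add: lin_op_in)
  also have "\<dots> \<le> c * (d * l2_norm \<xi>)" using * by (intro mult_left_mono) auto
  finally show "l2_norm ((S \<circ> T) \<xi>) \<le> c * d * l2_norm \<xi>" by simp
qed auto

lemma bounded_ops_zero: "zero_op \<in> bounded_ops A"
  by (rule bounded_opsI[OF lin_op_zero_op bnd_zero_op[of 0]]) simp

lemma bounded_ops_add: "S \<in> bounded_ops A \<Longrightarrow> T \<in> bounded_ops A \<Longrightarrow> add_op S T \<in> bounded_ops A"
  unfolding bounded_ops_iff by (metis lin_op_add_op bnd_add_op)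

lemma bounded_ops_diff: "S \<in> bounded_ops A \<Longrightarrow> T \<in> bounded_ops A \<Longrightarrow> diff_op S T \<in> bounded_ops A"
  unfolding bounded_ops_iff by (metis lin_op_diff_op bnd_diff_op)

lemma bounded_ops_scale: "T \<in> bounded_ops A \<Longrightarrow> scale_op c T \<in> bounded_ops A"
  unfolding bounded_ops_iff by (metis lin_op_scale_op bnd_scale_op)

lemma bounded_ops_comp: "S \<in> bounded_ops A \<Longrightarrow> T \<in> bounded_ops A \<Longrightarrow> S \<circ> T \<in> bounded_ops A"
  unfolding bounded_ops_iff by (metis lin_op_comp bnd_comp)

text \<open>The definitions quantify over extended reals with a strict inequality, the estimates
  over reals with \<le>. Halving, or taking 1 when the bound is infinite, passes between the
  two.\<close>

lemma ennreal_eps_iff: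
  fixes N :: "'a \<Rightarrow> ennreal"
  shows "(\<forall>\<epsilon>>0. \<exists>x\<in>B. N x < \<epsilon>) \<longleftrightarrow> (\<forall>e>0. \<exists>x\<in>B. N x \<le> ennreal e)"
proof safe
  fix e :: real assume "\<forall>\<epsilon>>0. \<exists>x\<in>B. N x < \<epsilon>" "0 < e"
  then show "\<exists>x\<in>B. N x \<le> ennreal e" by (meson ennreal_less_zero_iff less_imp_le)
next
  fix \<epsilon> :: ennreal assume *: "\<forall>e>0. \<exists>x\<in>B. N x \<le> ennreal e" "0 < \<epsilon>"
  obtain e where "0 < e" "ennreal e < \<epsilon>"
  proof (cases \<epsilon>)
    case (real r)
    then show ?thesis using \<open>0 < \<epsilon>\<close> by (intro that[of "r/2"]) (auto simp: ennreal_less_iff)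
  next
    case top then show ?thesis by (intro that[of 1]) auto
  qed
  then show "\<exists>x\<in>B. N x < \<epsilon>" using * by (meson order_le_less_trans)
qed

section \<open>Finite combinations of basis vectors and the adjoint\<close>

lemma inner_fun_sum:
  assumes "finite F" "\<And>i. i \<in> F \<Longrightarrow> f i \<in> l2 A" "\<eta> \<in> l2 A"
  shows "(\<lambda>j. \<Sum>i\<in>F. c i * f i j) \<in> l2 A"
    and "l2_inner (\<lambda>j. \<Sum>i\<in>F. c i * f i j) \<eta> = (\<Sum>i\<in>F. c i * l2_inner (f i) \<eta>)"
proof -
  have "(\<lambda>j. \<Sum>i\<in>F. c i * f i j) \<in> l2 A \<and>
    l2_inner (\<lambda>j. \<Sum>i\<in>F. c i * f i j) \<eta> = (\<Sum>i\<in>F. c i * l2_inner (f i) \<eta>)"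
    using assms(1,2)
  proof (induction F)
    case empty
    then show ?case by (simp add: l2_inner_def)
  next
    case (insert i F)
    then have IH: "(\<lambda>j. \<Sum>i\<in>F. c i * f i j) \<in> l2 A"
      "l2_inner (\<lambda>j. \<Sum>i\<in>F. c i * f i j) \<eta> = (\<Sum>i\<in>F. c i * l2_inner (f i) \<eta>)"
      and i: "(\<lambda>j. c i * f i j) \<in> l2 A" by (auto intro: l2_scale)
    show ?case
      using insert.hyps l2_add[OF i IH(1)] inner_add_left[OF i IH(1) assms(3)]
      by (simp add: IH(2) inner_scale_left)
  qed
  then show "(\<lambda>j. \<Sum>i\<in>F. c i * f i j) \<in> l2 A"
    "l2_inner (\<lambda>j. \<Sum>i\<in>F. c i * f i j) \<eta> = (\<Sum>i\<in>F. c i * l2_inner (f i) \<eta>)" by auto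
qed

lemma finite_support_eq_sum:
  "finite F \<Longrightarrow> (\<lambda>i. if i \<in> F then c i else 0) = (\<lambda>j. \<Sum>i\<in>F. c i * l2_delta i j)"
  by (auto simp: l2_delta_def if_distrib[of "(*) _"] cong: if_cong)

lemma lin_op_finite_sum:
  assumes T: "lin_op A T" and F: "finite F" "F \<subseteq> A"
  shows "T (\<lambda>j. \<Sum>i\<in>F. c i * l2_delta i j) = (\<lambda>j. \<Sum>i\<in>F. c i * T (l2_delta i) j)"
  using F
proof (induction F)
  case empty
  then show ?case by (simp add: lin_op_zero[OF T])
next
  case (insert i F)
  have i: "(\<lambda>j. c i * l2_delta i j) \<in> l2 A" using insert by (auto intro: l2_scale l2_delta_in)
  have F: "(\<lambda>j. \<Sum>i\<in>F. c i * l2_delta i j) \<in> l2 A"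
    using insert by (intro inner_fun_sum(1)[of _ _ _ "\<lambda>_. 0"]) (auto intro: l2_delta_in)
  show ?case using insert lin_op_add[OF T i F]
    by (simp add: lin_op_scale[OF T] l2_delta_in)
qed

text \<open>The adjoint through its matrix entries. The zeros off \<open>A\<close> and off
  \<open>l2 A\<close> follow the convention for operators and make the adjoint unique as a
  function.\<close>

definition adj :: "'i set \<Rightarrow> 'i l2_op \<Rightarrow> 'i l2_op" where
  "adj A T = (\<lambda>\<eta>. if \<eta> \<in> l2 A then (\<lambda>i. if i \<in> A then l2_inner \<eta> (T (l2_delta i)) else 0) else (\<lambda>_. 0))"

text \<open>Duality with a test vector made from the candidate itself: if \<xi> has the entries of
  \<open>adj A T \<eta>\<close> on a finite set and norm L, then L^2 = <T\<xi>, \<eta>> \<le> c L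
  |\<eta>|, and L can be cancelled.\<close>

lemma adj_bound:
  assumes T: "lin_op A T" and c: "bnd A T c" and \<eta>: "\<eta> \<in> l2 A"
  shows "adj A T \<eta> \<in> l2 A" "l2_norm (adj A T \<eta>) \<le> c * l2_norm \<eta>"
proof -
  let ?g = "adj A T \<eta>"
  have "L2_set (\<lambda>i. cmod (?g i)) F \<le> c * l2_norm \<eta>" if F: "finite F" for F
  proof -
    let ?H = "F \<inter> A" let ?L = "L2_set (\<lambda>i. cmod (?g i)) ?H"
    have L: "L2_set (\<lambda>i. cmod (?g i)) F = ?L"
      unfolding L2_set_def by (rule arg_cong[where f=sqrt], rule sum.mono_neutral_right)
        (use F in \<open>auto simp: adj_def \<eta>\<close>)
    have H: "finite ?H" "?H \<subseteq> A" using F by auto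
    define \<xi> where "\<xi> = (\<lambda>j. \<Sum>i\<in>?H. ?g i * l2_delta i j)"
    have \<xi>: "\<xi> \<in> l2 A" "l2_norm \<xi> = ?L"
      unfolding \<xi>_def finite_support_eq_sum[OF H(1), symmetric]
      using l2_finite_support[OF H] by auto
    have "complex_of_real (?L\<^sup>2) = (\<Sum>i\<in>?H. ?g i * cnj (?g i))"
    proof -
      have "?L\<^sup>2 = (\<Sum>i\<in>?H. (cmod (?g i))\<^sup>2)" by (simp add: L2_set_def sum_nonneg)
      then show ?thesis by (simp only: of_real_sum complex_norm_square)
    qed
    also have "\<dots> = (\<Sum>i\<in>?H. ?g i * l2_inner (T (l2_delta i)) \<eta>)"
      by (rule sum.cong) (auto simp: adj_def \<eta> simp flip: inner_cnj)
    also have "\<dots> = l2_inner (T \<xi>) \<eta>"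
      unfolding \<xi>_def lin_op_finite_sum[OF T H]
      by (rule inner_fun_sum(2)[symmetric]) (use H \<eta> T lin_op_in in auto)
    finally have "complex_of_real (?L\<^sup>2) = l2_inner (T \<xi>) \<eta>" .
    then have "?L\<^sup>2 = cmod (l2_inner (T \<xi>) \<eta>)" by (metis norm_of_real abs_power2)
    also have "\<dots> \<le> l2_norm (T \<xi>) * l2_norm \<eta>"
      by (rule inner_summable(2)) (use T \<xi> \<eta> lin_op_in in auto)
    also have "\<dots> \<le> (c * ?L) * l2_norm \<eta>"
      using bndD[OF c \<xi>(1)] \<xi>(2) by (intro mult_right_mono) auto
    finally have "?L * ?L \<le> ?L * (c * l2_norm \<eta>)" by (simp add: power2_eq_square mult_ac)
    then show ?thesis unfolding L
      using c by (cases "0 < ?L") (auto simp: bnd_def not_less intro: order_trans[of _ 0])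
  qed
  then show "?g \<in> l2 A" "l2_norm ?g \<le> c * l2_norm \<eta>"
    by (rule l2_bound[of A ?g, rotated 1]; simp add: adj_def)+
qed

lemma adj_lin:
  assumes T: "T \<in> bounded_ops A" shows "lin_op A (adj A T)"
proof -
  obtain c where c: "bnd A T c" using bounded_bnd[OF T] by blast
  note T = bounded_lin[OF T]
  show ?thesis unfolding lin_op_def
  proof (intro conjI ballI allI impI)
    fix \<xi> \<eta> assume *: "\<xi> \<in> l2 A" "\<eta> \<in> l2 A"
    show "adj A T (\<lambda>i. \<xi> i + \<eta> i) = (\<lambda>i. adj A T \<xi> i + adj A T \<eta> i)"
      using * by (auto simp: adj_def l2_add inner_add_left[OF * lin_op_in[OF T]])
  next
    fix \<xi> assume "\<xi> \<in> l2 A" then show "adj A T \<xi> \<in> l2 A" by (rule adj_bound[OF T c])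
  qed (auto simp: adj_def l2_scale inner_scale_left)
qed

lemma adj_bnd:
  assumes T: "lin_op A T" and c: "bnd A T c" shows "bnd A (adj A T) c"
  using c adj_bound[OF assms] by (auto simp: bnd_def)

lemma adj_bounded: "T \<in> bounded_ops A \<Longrightarrow> adj A T \<in> bounded_ops A"
  by (metis adj_lin adj_bnd bounded_ops_iff)

text \<open>The definition gives the identity on basis vectors, hence on finitely supported ones;
  both sides are bounded in the first argument, so truncation extends it to all of
  \<open>l2 A\<close>.\<close>

lemma adj_is_adjoint:
  assumes T: "T \<in> bounded_ops A" shows "is_adjoint A T (adj A T)"
  unfolding is_adjoint_def
proof (intro ballI)
  fix \<xi> \<eta> assume \<xi>: "\<xi> \<in> l2 A" and \<eta>: "\<eta> \<in> l2 A"
  obtain c where c: "bnd A T c" using bounded_bnd[OF T] by blast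
  note T = bounded_lin[OF T]
  note A = adj_bound[OF T c \<eta>]
  have "cmod (l2_inner (T \<xi>) \<eta> - l2_inner \<xi> (adj A T \<eta>)) \<le> e" if e: "0 < e" for e
  proof -
    \<comment> \<open>The two error terms add up to 2 c d |\<eta>|; the added 1 keeps the
      denominator positive when c |\<eta>| = 0.\<close>
    define d where "d = e / (2 * c * l2_norm \<eta> + 1)"
    have c0: "0 \<le> c * l2_norm \<eta>" using c by (simp add: bnd_def)
    have d: "0 < d" unfolding d_def using e c0 by (intro divide_pos_pos) linarith+
    obtain F where F: "finite F" "F \<subseteq> A" "l2_norm (\<lambda>i. \<xi> i - (if i \<in> F then \<xi> i else 0)) \<le> d"
      using l2_truncate[OF \<xi> d] by blast
    define \<zeta> where "\<zeta> = (\<lambda>i. if i \<in> F then \<xi> i else 0)"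
    define \<theta> where "\<theta> = (\<lambda>i. \<xi> i - \<zeta> i)"
    have \<zeta>: "\<zeta> \<in> l2 A" unfolding \<zeta>_def using l2_finite_support F by auto
    have \<theta>: "\<theta> \<in> l2 A" "l2_norm \<theta> \<le> d" unfolding \<theta>_def using l2_diff(1)[OF \<xi> \<zeta>] F by (auto simp: \<zeta>_def)
    have \<zeta>s: "\<zeta> = (\<lambda>j. \<Sum>i\<in>F. \<xi> i * l2_delta i j)"
      unfolding \<zeta>_def by (rule finite_support_eq_sum[OF F(1)])
    have "l2_inner (T \<zeta>) \<eta> = (\<Sum>i\<in>F. \<xi> i * l2_inner (T (l2_delta i)) \<eta>)"
      unfolding \<zeta>s lin_op_finite_sum[OF T F(1,2)]
      by (rule inner_fun_sum(2)) (use F \<eta> T lin_op_in in auto)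
    also have "\<dots> = (\<Sum>i\<in>F. \<xi> i * l2_inner (l2_delta i) (adj A T \<eta>))"
    proof (rule sum.cong[OF refl])
      fix i assume "i \<in> F"
      then have "adj A T \<eta> i = l2_inner \<eta> (T (l2_delta i))" using F \<eta> by (auto simp: adj_def)
      then show "\<xi> i * l2_inner (T (l2_delta i)) \<eta> = \<xi> i * l2_inner (l2_delta i) (adj A T \<eta>)"
        using inner_delta_right[of "adj A T \<eta>" i] inner_cnj[of "l2_delta i" "adj A T \<eta>"]
          inner_cnj[of "T (l2_delta i)" \<eta>] by simp
    qed
    also have "\<dots> = l2_inner \<zeta> (adj A T \<eta>)"
      unfolding \<zeta>s by (rule inner_fun_sum(2)[symmetric]) (use F A in \<open>auto intro: l2_delta_in\<close>)
    finally have eq: "l2_inner (T \<zeta>) \<eta> = l2_inner \<zeta> (adj A T \<eta>)" .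
    have x: "\<xi> = (\<lambda>i. \<zeta> i + \<theta> i)" by (simp add: \<theta>_def)
    have "l2_inner (T \<xi>) \<eta> - l2_inner \<xi> (adj A T \<eta>) = l2_inner (T \<theta>) \<eta> - l2_inner \<theta> (adj A T \<eta>)"
      unfolding x lin_op_add[OF T \<zeta> \<theta>(1)]
        inner_add_left[OF lin_op_in[OF T] lin_op_in[OF T] \<eta>] inner_add_left[OF \<zeta> \<theta>(1) A(1)]
      using eq by simp
    also have "cmod \<dots> \<le> l2_norm (T \<theta>) * l2_norm \<eta> + l2_norm \<theta> * l2_norm (adj A T \<eta>)"
      by (intro order_trans[OF norm_triangle_ineq4] add_mono inner_summable(2)[of _ A _ A] lin_op_in[OF T] \<theta> \<eta> A)
    also have "\<dots> \<le> (c * d) * l2_norm \<eta> + d * (c * l2_norm \<eta>)"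
    proof (intro add_mono mult_mono)
      show "l2_norm (T \<theta>) \<le> c * d"
        using bndD[OF c \<theta>(1)] \<theta>(2) c by (auto simp: bnd_def intro: order_trans mult_left_mono)
    qed (use \<theta> A d c in \<open>auto simp: bnd_def\<close>)
    also have "\<dots> = d * (2 * c * l2_norm \<eta>)" by simp
    also have "\<dots> \<le> e"
    proof -
      have "d * (2 * c * l2_norm \<eta> + 1) = e" using c0 by (simp add: d_def add_nonneg_eq_0_iff)
      then show ?thesis using d by (simp add: distrib_left)
    qed
    finally show ?thesis .
  qed
  then have "cmod (l2_inner (T \<xi>) \<eta> - l2_inner \<xi> (adj A T \<eta>)) \<le> 0" by (rule field_le_epsilon) simp
  then show "l2_inner (T \<xi>) \<eta> = l2_inner \<xi> (adj A T \<eta>)" by simp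
qed

text \<open>Pairing with basis vectors reads off the coordinates of \<open>S\<close>; elsewhere both
  sides are zero by convention.\<close>

lemma adj_unique:
  assumes T: "T \<in> bounded_ops A" and S: "lin_op A S" and a: "is_adjoint A T S"
  shows "S = adj A T"
proof (intro ext)
  fix \<eta> i
  show "S \<eta> i = adj A T \<eta> i"
  proof (cases "\<eta> \<in> l2 A \<and> i \<in> A")
    case True
    then have "l2_inner (l2_delta i) (S \<eta>) = l2_inner (T (l2_delta i)) \<eta>"
      using a l2_delta_in[of i A] by (auto simp: is_adjoint_def)
    then have "S \<eta> i = l2_inner \<eta> (T (l2_delta i))"
      by (metis inner_cnj inner_delta_right)
    then show ?thesis using True by (simp add: adj_def)
  next
    case False
    then show ?thesis using lin_op_out[OF S] l2_zero[OF lin_op_in[OF S]] by (auto simp: adj_def)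
  qed
qed

text \<open>Boundedness enters through the adjoint: its entries are inner products with the vectors
  T delta_i, so it vanishes, and then every coordinate <T\<xi>, delta_i> is an inner product with
  0.\<close>

lemma bounded_op_eq_zero:
  assumes T: "T \<in> bounded_ops A" and z: "\<And>i. i \<in> A \<Longrightarrow> T (l2_delta i) = (\<lambda>_. 0)"
  shows "T = zero_op"
proof -
  have adj0: "adj A T \<eta> = (\<lambda>_. 0)" for \<eta>
    using z by (auto simp: adj_def l2_inner_def)
  show ?thesis
  proof (intro ext)
    fix \<xi> i
    show "T \<xi> i = zero_op \<xi> i"
    proof (cases "\<xi> \<in> l2 A \<and> i \<in> A")
      case True
      then have "l2_inner (T \<xi>) (l2_delta i) = l2_inner \<xi> (adj A T (l2_delta i))"
        using adj_is_adjoint[OF T] l2_delta_in[of i A] by (simp add: is_adjoint_def)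
      then show ?thesis by (simp add: adj0 inner_delta_right zero_op_def) (simp add: l2_inner_def)
    next
      case False
      then show ?thesis using lin_op_out[OF bounded_lin[OF T]] l2_zero[OF lin_op_in[OF bounded_lin[OF T]]]
        by (auto simp: zero_op_def)
    qed
  qed
qed

section \<open>Limits, damping and transport of operators\<close>

text \<open>The shape shared by transport along a bijection and by rho_x of a function living on one
  bisection: a weighted partial permutation of coordinates. Injectivity counts each coordinate of
  \<xi> at most once, so a bound on the weights bounds the norm.\<close>

lemma l2_weighted_pinj:
  assumes \<xi>: "\<xi> \<in> l2 B" and inj: "inj_on \<tau> D" and c: "\<And>i. i \<in> D \<Longrightarrow> cmod (c i) \<le> C"
    and C: "0 \<le> C" and D: "D \<subseteq> A"
  shows "(\<lambda>i. if i \<in> D then c i * \<xi> (\<tau> i) else 0) \<in> l2 A"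
    and "l2_norm (\<lambda>i. if i \<in> D then c i * \<xi> (\<tau> i) else 0) \<le> C * l2_norm \<xi>"
proof -
  let ?f = "\<lambda>i. if i \<in> D then c i * \<xi> (\<tau> i) else 0"
  have b: "L2_set (\<lambda>i. cmod (?f i)) F \<le> C * l2_norm \<xi>" if F: "finite F" for F
  proof -
    have "L2_set (\<lambda>i. cmod (?f i)) F = L2_set (\<lambda>i. cmod (?f i)) (F \<inter> D)"
      unfolding L2_set_def by (rule arg_cong[where f=sqrt], rule sum.mono_neutral_right)
        (use F in auto)
    also have "\<dots> \<le> L2_set (\<lambda>i. C * cmod (\<xi> (\<tau> i))) (F \<inter> D)"
      by (rule L2_set_mono) (auto simp: norm_mult intro: mult_right_mono c)
    also have "\<dots> = C * L2_set (\<lambda>i. cmod (\<xi> i)) (\<tau> ` (F \<inter> D))"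
      unfolding L2_set_right_distrib[OF C, symmetric]
      unfolding L2_set_def by (subst sum.reindex) (auto intro: inj_on_subset[OF inj])
    also have "\<dots> \<le> C * l2_norm \<xi>" by (rule mult_left_mono[OF L2_set_le_l2_norm[OF \<xi>] C])
    finally show ?thesis .
  qed
  have z: "?f i = 0" if "i \<notin> A" for i using that D by auto
  show "?f \<in> l2 A" using z b by (rule l2_bound(1))
  show "l2_norm ?f \<le> C * l2_norm \<xi>" using z b by (rule l2_bound(2))
qed

text \<open>The limit is taken coordinate by coordinate. The Cauchy estimate is restricted to
  finitely many coordinates, where it passes to the limit in m, and is then reassembled by
  \<open>l2_bound\<close>; so the rate \<open>e n\<close> survives unchanged.\<close>

lemma bounded_ops_limit:
  fixes T :: "nat \<Rightarrow> 'i l2_op"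
  assumes T: "\<And>n. T n \<in> bounded_ops A"
    and e: "\<And>m n. n \<le> m \<Longrightarrow> bnd A (diff_op (T m) (T n)) (e n)" and e0: "e \<longlonglongrightarrow> 0"
  defines "L \<equiv> \<lambda>\<xi> i. lim (\<lambda>n. T n \<xi> i)"
  shows "L \<in> bounded_ops A" and "bnd A (diff_op L (T n)) (e n)"
proof -
  note lin = bounded_lin[OF T]
  have en: "0 \<le> e n" for n using e[of n n] by (simp add: bnd_def)
  have tend: "(\<lambda>n. T n \<xi> i) \<longlonglongrightarrow> L \<xi> i" for \<xi> i
  proof (cases "\<xi> \<in> l2 A")
    case True
    have "Cauchy (\<lambda>n. T n \<xi> i)" unfolding Cauchy_altdef2
    proof (intro allI impI)
      fix \<epsilon> :: real assume "0 < \<epsilon>"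
      have "(\<lambda>n. e n * l2_norm \<xi>) \<longlonglongrightarrow> 0" using tendsto_mult_left_zero[OF e0] .
      then obtain N where N: "e N * l2_norm \<xi> < \<epsilon>"
        using \<open>0 < \<epsilon>\<close> by (metis eventually_sequentially order_refl order_tendstoD(2))
      have "dist (T m \<xi> i) (T N \<xi> i) < \<epsilon>" if "N \<le> m" for m
      proof -
        have "cmod (T m \<xi> i - T N \<xi> i) \<le> l2_norm (\<lambda>i. T m \<xi> i - T N \<xi> i)"
          by (rule cmod_le_l2_norm[OF l2_diff(1)[OF lin_op_in[OF lin] lin_op_in[OF lin]]])
        also have "\<dots> \<le> e N * l2_norm \<xi>" using bndD[OF e[OF that] True] by (simp add: diff_op_def)
        finally show ?thesis using N by (simp add: dist_norm)
      qed
      then show "\<exists>N. \<forall>n\<ge>N. dist (T n \<xi> i) (T N \<xi> i) < \<epsilon>" by blast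
    qed
    then show ?thesis unfolding L_def by (simp add: Cauchy_convergent_iff convergent_LIMSEQ_iff)
  next
    case False
    then have "(\<lambda>n. T n \<xi> i) = (\<lambda>_. 0)" using lin_op_out[OF lin] by simp
    then show ?thesis by (simp add: L_def)
  qed
  have out: "L \<xi> i = 0" if "\<xi> \<notin> l2 A \<or> i \<notin> A" for \<xi> i
  proof -
    have "(\<lambda>n. T n \<xi> i) = (\<lambda>_. 0)"
      using that lin_op_out[OF lin] l2_zero[OF lin_op_in[OF lin]] by (intro ext) auto
    then show ?thesis by (simp add: L_def)
  qed
  have bd: "L2_set (\<lambda>i. cmod (L \<xi> i - T n \<xi> i)) F \<le> e n * l2_norm \<xi>" if \<xi>: "\<xi> \<in> l2 A" for \<xi> n F
  proof (rule tendsto_upperbound)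
    show "(\<lambda>m. L2_set (\<lambda>i. cmod (T m \<xi> i - T n \<xi> i)) F) \<longlonglongrightarrow> L2_set (\<lambda>i. cmod (L \<xi> i - T n \<xi> i)) F"
      unfolding L2_set_def by (intro tendsto_intros tend)
    have "L2_set (\<lambda>i. cmod (T m \<xi> i - T n \<xi> i)) F \<le> e n * l2_norm \<xi>" if "n \<le> m" for m
      using order_trans[OF L2_set_le_l2_norm[OF l2_diff(1)[OF lin_op_in[OF lin] lin_op_in[OF lin]]]
          bndD[OF e[OF that] \<xi>, unfolded diff_op_def]] .
    then show "\<forall>\<^sub>F m in sequentially. L2_set (\<lambda>i. cmod (T m \<xi> i - T n \<xi> i)) F \<le> e n * l2_norm \<xi>"
      by (auto simp: eventually_sequentially)
  qed simp
  have z: "L \<xi> i - T n \<xi> i = 0" if "i \<notin> A" for \<xi> i n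
    using that out l2_zero[OF lin_op_in[OF lin]] by simp
  have df: "(\<lambda>i. L \<xi> i - T n \<xi> i) \<in> l2 A" "l2_norm (\<lambda>i. L \<xi> i - T n \<xi> i) \<le> e n * l2_norm \<xi>"
    if "\<xi> \<in> l2 A" for \<xi> n
    using l2_bound[OF z bd[OF that]] by auto
  show bn: "bnd A (diff_op L (T n)) (e n)" for n
    unfolding bnd_def diff_op_def using en df by auto
  have Lin: "L \<xi> \<in> l2 A" if "\<xi> \<in> l2 A" for \<xi>
    using l2_add(1)[OF df(1)[OF that, of 0] lin_op_in[OF lin[of 0], of \<xi>]] by simp
  have L: "lin_op A L"
    unfolding lin_op_def
  proof (intro conjI allI ballI impI ext)
    fix \<xi> \<eta> i assume *: "\<xi> \<in> l2 A" "\<eta> \<in> l2 A"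
    have "(\<lambda>n. T n (\<lambda>i. \<xi> i + \<eta> i) i) \<longlonglongrightarrow> L \<xi> i + L \<eta> i"
      unfolding lin_op_add[OF lin *] by (intro tendsto_add tend)
    then show "L (\<lambda>i. \<xi> i + \<eta> i) i = L \<xi> i + L \<eta> i" using tend LIMSEQ_unique by blast
  next
    fix c \<xi> i assume *: "\<xi> \<in> l2 A"
    have "(\<lambda>n. T n (\<lambda>i. c * \<xi> i) i) \<longlonglongrightarrow> c * L \<xi> i"
      unfolding lin_op_scale[OF lin *] by (intro tendsto_mult tendsto_const tend)
    then show "L (\<lambda>i. c * \<xi> i) i = c * L \<xi> i" using tend LIMSEQ_unique by blast
  qed (auto simp: Lin out)
  obtain c where c: "bnd A (T 0) c" using bounded_bnd[OF T] by blast
  have "L = add_op (diff_op L (T 0)) (T 0)" by (simp add: add_op_def diff_op_def)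
  then have "bnd A L (e 0 + c)"
    using bnd_add_op[OF lin_op_diff_op[OF L lin] lin bn c] by metis
  then show "L \<in> bounded_ops A" by (rule bounded_opsI[OF L])
qed

text \<open>The operators $T(1 - T^*T/R)^n$.\<close>

fun damp :: "'i set \<Rightarrow> real \<Rightarrow> 'i l2_op \<Rightarrow> nat \<Rightarrow> 'i l2_op" where
  "damp A R T 0 = T"
| "damp A R T (Suc n) =
     diff_op (damp A R T n) (scale_op (of_real (1 / R)) (damp A R T n \<circ> (adj A T \<circ> T)))"

lemma damp_bounded: "T \<in> bounded_ops A \<Longrightarrow> damp A R T n \<in> bounded_ops A"
  by (induction n) (auto intro!: bounded_ops_diff bounded_ops_scale bounded_ops_comp adj_bounded)

text \<open>
  For $0 \le K \le 1$ the moments $q_j = \langle K^j\xi,\xi\rangle$ are decreasing and convex, which gives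
  $(2n + 1)(q_{2n} - q_{2n+1}) \le \|\xi\|^2$; here $K = 1 - T^*T/R$.
\<close>

lemma damp_estimates:
  assumes T: "T \<in> bounded_ops A" and M: "bnd A T (sqrt R)" and R: "0 < R"
  shows "bnd A (damp A R T n) (sqrt (R / (2 * n + 1)))"
    and "bnd A T c \<Longrightarrow> bnd A (damp A R T n) c"
proof -
  note lin = bounded_lin[OF T]
  note linA = adj_lin[OF T]
  \<comment> \<open>K is the operator 1 - T*T/R; \<open>dK\<close> below rewrites the damped
    operator as T K^n.\<close>
  define K where "K \<xi> = (\<lambda>i. \<xi> i - of_real (1 / R) * adj A T (T \<xi>) i)" for \<xi>
  have Kin: "K \<xi> \<in> l2 A" if "\<xi> \<in> l2 A" for \<xi>
    unfolding K_def by (intro l2_diff(1) l2_scale that lin_op_in[OF linA])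
  have Kn: "(K ^^ n) \<xi> \<in> l2 A" if "\<xi> \<in> l2 A" for \<xi> n
    by (induction n) (auto simp: that Kin)
  have dK: "damp A R T n \<xi> = T ((K ^^ n) \<xi>)" if "\<xi> \<in> l2 A" for n \<xi>
    using that
  proof (induction n arbitrary: \<xi>)
    case (Suc n)
    note D = bounded_lin[OF damp_bounded[OF T, of R n]]
    have "damp A R T (Suc n) \<xi> = damp A R T n (K \<xi>)"
      unfolding K_def lin_op_diff[OF D Suc.prems l2_scale[OF lin_op_in[OF linA]]]
        lin_op_scale[OF D lin_op_in[OF linA]]
      by (simp add: diff_op_def scale_op_def)
    then show ?case using Suc.IH[OF Kin[OF Suc.prems]] by (simp add: funpow_swap1)
  qed simp
  have TT: "l2_inner (adj A T (T \<xi>)) \<eta> = l2_inner (T \<xi>) (T \<eta>)"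
    and TT': "l2_inner \<xi> (adj A T (T \<eta>)) = l2_inner (T \<xi>) (T \<eta>)" if "\<xi> \<in> l2 A" "\<eta> \<in> l2 A" for \<xi> \<eta>
    using adj_is_adjoint[OF T] that lin_op_in[OF lin] inner_cnj[of "adj A T (T \<xi>)" \<eta>]
      inner_cnj[of "T \<xi>" "T \<eta>"] by (auto simp: is_adjoint_def)
  have Kl: "l2_inner (K \<xi>) \<eta> = l2_inner \<xi> \<eta> - of_real (1 / R) * l2_inner (T \<xi>) (T \<eta>)"
    if "\<xi> \<in> l2 A" "\<eta> \<in> l2 A" for \<xi> \<eta>
    unfolding K_def inner_diff_left[OF that(1) l2_scale[OF lin_op_in[OF linA]] that(2)]
      inner_scale_left TT[OF that] ..
  have Kr: "l2_inner \<xi> (K \<eta>) = l2_inner \<xi> \<eta> - of_real (1 / R) * l2_inner (T \<xi>) (T \<eta>)"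
    if "\<xi> \<in> l2 A" "\<eta> \<in> l2 A" for \<xi> \<eta>
    unfolding K_def inner_diff_right[OF that(2) l2_scale[OF lin_op_in[OF linA]] that(1)]
      inner_scale_right TT'[OF that] by simp
  have sa: "l2_inner (K \<xi>) \<eta> = l2_inner \<xi> (K \<eta>)" if "\<xi> \<in> l2 A" "\<eta> \<in> l2 A" for \<xi> \<eta>
    using Kl[OF that] Kr[OF that] by simp
  have san: "l2_inner ((K ^^ (i + j)) \<xi>) \<eta> = l2_inner ((K ^^ i) \<xi>) ((K ^^ j) \<eta>)"
    if "\<xi> \<in> l2 A" "\<eta> \<in> l2 A" for \<xi> \<eta> i j
    using that
  proof (induction j arbitrary: \<eta>)
    case (Suc j)
    have "l2_inner ((K ^^ (i + Suc j)) \<xi>) \<eta> = l2_inner ((K ^^ (i + j)) \<xi>) (K \<eta>)"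
      using sa[OF Kn[OF Suc.prems(1)] Suc.prems(2)] by simp
    then show ?case using Suc.IH[OF Suc.prems(1) Kin[OF Suc.prems(2)]] by (simp add: funpow_swap1)
  qed simp
  have K1: "Re (l2_inner (K \<xi>) \<xi>) = (l2_norm \<xi>)\<^sup>2 - (l2_norm (T \<xi>))\<^sup>2 / R" if "\<xi> \<in> l2 A" for \<xi>
    using Kl[OF that that] inner_self[OF that] inner_self[OF lin_op_in[OF lin]]
    by (simp flip: of_real_power)
  \<comment> \<open>The bound \<open>sqrt R\<close> on T is what makes K nonnegative.\<close>
  have Kpos: "0 \<le> Re (l2_inner (K \<xi>) \<xi>)" if "\<xi> \<in> l2 A" for \<xi>
  proof -
    have "(l2_norm (T \<xi>))\<^sup>2 \<le> (sqrt R * l2_norm \<xi>)\<^sup>2" using bndD[OF M that] by (intro power_mono) auto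
    then have "(l2_norm (T \<xi>))\<^sup>2 \<le> R * (l2_norm \<xi>)\<^sup>2" using R by (simp add: power_mult_distrib)
    then show ?thesis using R by (simp add: K1[OF that] divide_le_eq mult.commute)
  qed
  define q where "q \<xi> n = Re (l2_inner ((K ^^ n) \<xi>) \<xi>)" for \<xi> n
  have q0: "q \<xi> 0 = (l2_norm \<xi>)\<^sup>2" if "\<xi> \<in> l2 A" for \<xi>
    using inner_self[OF that] by (simp add: q_def flip: of_real_power)
  have q_even: "q \<xi> (2 * i) = (l2_norm ((K ^^ i) \<xi>))\<^sup>2" if "\<xi> \<in> l2 A" for \<xi> i
    unfolding q_def mult_2 san[OF that that] inner_self[OF Kn[OF that]] by simp
  have q_odd: "q \<xi> (2 * i + 1) = Re (l2_inner (K ((K ^^ i) \<xi>)) ((K ^^ i) \<xi>))" if "\<xi> \<in> l2 A" for \<xi> i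
    using san[OF that that, of "Suc i" i] by (simp add: q_def mult_2)
  have q_pos: "0 \<le> q \<xi> n" if "\<xi> \<in> l2 A" for \<xi> n
  proof (cases "even n")
    case True then show ?thesis using q_even[OF that] by (auto elim!: evenE)
  next
    case False
    then obtain i where "n = 2 * i + 1" by (blast elim: oddE)
    then show ?thesis unfolding \<open>n = _\<close> q_odd[OF that] by (intro Kpos Kn that)
  qed
  \<comment> \<open>The second difference of the moments of \<xi> is a moment of the vector \<xi> -
    K\<xi>, hence nonnegative.\<close>
  have conv: "q \<xi> (Suc j) - q \<xi> (Suc (Suc j)) \<le> q \<xi> j - q \<xi> (Suc j)" if \<xi>: "\<xi> \<in> l2 A" for \<xi> j
  proof -
    let ?\<eta> = "\<lambda>i. \<xi> i - K \<xi> i"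
    have \<eta>: "?\<eta> \<in> l2 A" by (intro l2_diff(1) \<xi> Kin)
    have Kj: "l2_inner ((K ^^ j) \<zeta>) \<theta> = l2_inner \<zeta> ((K ^^ j) \<theta>)" if "\<zeta> \<in> l2 A" "\<theta> \<in> l2 A" for \<zeta> \<theta>
      using san[OF that, of 0 j] by simp
    have a: "l2_inner (K \<xi>) ((K ^^ j) \<xi>) = l2_inner ((K ^^ Suc j) \<xi>) \<xi>"
      using san[OF \<xi> \<xi>, of 1 j] by simp
    have b: "l2_inner \<xi> ((K ^^ j) (K \<xi>)) = l2_inner ((K ^^ Suc j) \<xi>) \<xi>"
      using san[OF \<xi> \<xi>, of 0 "Suc j"] by (simp add: funpow_swap1)
    have c: "l2_inner (K \<xi>) ((K ^^ j) (K \<xi>)) = l2_inner ((K ^^ Suc (Suc j)) \<xi>) \<xi>"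
      using san[OF \<xi> \<xi>, of 1 "Suc j"] by (simp add: funpow_swap1)
    have "l2_inner ((K ^^ j) ?\<eta>) ?\<eta> = l2_inner ?\<eta> ((K ^^ j) ?\<eta>)" by (rule Kj[OF \<eta> \<eta>])
    also have "\<dots> = l2_inner \<xi> ((K ^^ j) ?\<eta>) - l2_inner (K \<xi>) ((K ^^ j) ?\<eta>)"
      by (intro inner_diff_left[of _ A] \<xi> Kin Kn \<eta>)
    also have "\<dots> = l2_inner ((K ^^ j) \<xi>) ?\<eta> - l2_inner ((K ^^ j) (K \<xi>)) ?\<eta>"
      by (simp add: Kj \<xi> Kin \<eta>)
    also have "\<dots> = l2_inner ((K ^^ j) \<xi>) \<xi> - l2_inner ((K ^^ j) \<xi>) (K \<xi>) -
        (l2_inner ((K ^^ j) (K \<xi>)) \<xi> - l2_inner ((K ^^ j) (K \<xi>)) (K \<xi>))"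
      by (simp only: inner_diff_right[OF \<xi> Kin[OF \<xi>] Kn[OF \<xi>]]
          inner_diff_right[OF \<xi> Kin[OF \<xi>] Kn[OF Kin[OF \<xi>]]])
    also have "\<dots> = l2_inner ((K ^^ j) \<xi>) \<xi> - 2 * l2_inner ((K ^^ Suc j) \<xi>) \<xi> + l2_inner ((K ^^ Suc (Suc j)) \<xi>) \<xi>"
      using a b c Kj[OF \<xi> Kin[OF \<xi>]] Kj[OF Kin[OF \<xi>] \<xi>] Kj[OF Kin[OF \<xi>] Kin[OF \<xi>]] by simp
    finally have "q ?\<eta> j = q \<xi> j - 2 * q \<xi> (Suc j) + q \<xi> (Suc (Suc j))" by (simp add: q_def)
    then show ?thesis using q_pos[OF \<eta>, of j] by simp
  qed
  have dec: "q \<xi> k - q \<xi> (Suc k) \<le> q \<xi> j - q \<xi> (Suc j)" if "\<xi> \<in> l2 A" "j \<le> k" for \<xi> j k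
    using that(2) by (induction rule: dec_induct) (auto intro: order_trans[OF conv[OF that(1)]])
  \<comment> \<open>With v = K^n \<xi>, the squared norm of Tv is R times <v - Kv, v>, a drop
    between consecutive moments.\<close>
  have TK: "(l2_norm (T ((K ^^ n) \<xi>)))\<^sup>2 = R * (q \<xi> (2 * n) - q \<xi> (Suc (2 * n)))" if "\<xi> \<in> l2 A" for \<xi>
    using q_even[OF that, of n] q_odd[OF that, of n] K1[OF Kn[OF that]] R by (simp add: field_simps)
  show "bnd A (damp A R T n) (sqrt (R / (2 * n + 1)))"
    unfolding bnd_def
  proof (intro conjI ballI)
    fix \<xi> assume \<xi>: "\<xi> \<in> l2 A"
    \<comment> \<open>By convexity the drops decrease, so each of the 2n + 1 drops up to this one is
      at least as large; together they telescope to at most q_0 = |\<xi>|^2.\<close>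
    have "(2 * n + 1) * (q \<xi> (2 * n) - q \<xi> (Suc (2 * n))) = (\<Sum>j<2 * n + 1. q \<xi> (2 * n) - q \<xi> (Suc (2 * n)))"
      by simp
    also have "\<dots> \<le> (\<Sum>j<2 * n + 1. q \<xi> j - q \<xi> (Suc j))"
      by (intro sum_mono dec \<xi>) auto
    also have "\<dots> = q \<xi> 0 - q \<xi> (2 * n + 1)" by (rule sum_lessThan_telescope')
    also have "\<dots> \<le> (l2_norm \<xi>)\<^sup>2" using q_pos[OF \<xi>, of "2 * n + 1"] q0[OF \<xi>] by simp
    finally have "q \<xi> (2 * n) - q \<xi> (Suc (2 * n)) \<le> (l2_norm \<xi>)\<^sup>2 / (2 * n + 1)"
      by (intro mult_imp_le_div_pos) (auto simp: algebra_simps)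
    then have "R * (q \<xi> (2 * n) - q \<xi> (Suc (2 * n))) \<le> R * ((l2_norm \<xi>)\<^sup>2 / (2 * n + 1))"
      using R by (intro mult_left_mono) auto
    then have "(l2_norm (damp A R T n \<xi>))\<^sup>2 \<le> (sqrt (R / (2 * n + 1)) * l2_norm \<xi>)\<^sup>2"
      using R unfolding dK[OF \<xi>] TK[OF \<xi>] by (simp add: power_mult_distrib)
    then show "l2_norm (damp A R T n \<xi>) \<le> sqrt (R / (2 * n + 1)) * l2_norm \<xi>"
      by (rule power2_le_imp_le) (use R in simp)
  qed (use R in simp)
  assume c: "bnd A T c"
  \<comment> \<open>A drop at an even index 2j is a squared norm divided by R, and the drop at j
    dominates it. Hence the moments decrease and K^n is a contraction.\<close>
  have b0: "0 \<le> q \<xi> j - q \<xi> (Suc j)" if "\<xi> \<in> l2 A" for \<xi> j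
  proof -
    have "0 \<le> (l2_norm (T ((K ^^ j) \<xi>)))\<^sup>2 / R" using R by simp
    also have "\<dots> = q \<xi> (2 * j) - q \<xi> (Suc (2 * j))"
      using q_even[OF that, of j] q_odd[OF that, of j] K1[OF Kn[OF that]] by simp
    also have "\<dots> \<le> q \<xi> j - q \<xi> (Suc j)" by (rule dec[OF that]) simp
    finally show ?thesis .
  qed
  have "q \<xi> j \<le> q \<xi> 0" if "\<xi> \<in> l2 A" for \<xi> j
    by (induction j) (use b0[OF that] in \<open>auto intro: order_trans\<close>)
  then have contr: "l2_norm ((K ^^ n) \<xi>) \<le> l2_norm \<xi>" if "\<xi> \<in> l2 A" for \<xi>
    using q_even[OF that, of n] q0[OF that] that by (metis l2_norm_nonneg power2_le_imp_le)
  show "bnd A (damp A R T n) c"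
    unfolding bnd_def
  proof (intro conjI ballI)
    fix \<xi> assume \<xi>: "\<xi> \<in> l2 A"
    have "l2_norm (damp A R T n \<xi>) \<le> c * l2_norm ((K ^^ n) \<xi>)"
      unfolding dK[OF \<xi>] by (rule bndD[OF c Kn[OF \<xi>]])
    also have "\<dots> \<le> c * l2_norm \<xi>" using contr[OF \<xi>] c by (intro mult_left_mono) (auto simp: bnd_def)
    finally show "l2_norm (damp A R T n \<xi>) \<le> c * l2_norm \<xi>" .
  qed (use c in \<open>simp add: bnd_def\<close>)
qed

text \<open>One damping step changes the operator by D T*T/R, where D is the current damped
  operator; since D is bounded by c as well, each step costs at most c^3/R.\<close>

lemma damp_diff:
  assumes T: "T \<in> bounded_ops A" and M: "bnd A T (sqrt R)" and R: "0 < R" and c: "bnd A T c"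
  shows "bnd A (diff_op T (damp A R T n)) (n * c ^ 3 / R)"
proof (induction n)
  case 0
  then show ?case by (auto simp: bnd_def diff_op_def)
next
  case (Suc n)
  note lin = bounded_lin[OF T]
  let ?D = "damp A R T n"
  note D = damp_bounded[OF T, of R n]
  let ?S = "scale_op (of_real (1 / R)) (?D \<circ> (adj A T \<circ> T))"
  have S: "bnd A ?S (cmod (of_real (1 / R)) * (c * (c * c)))"
    by (intro bnd_scale_op bnd_comp damp_estimates[OF T M R] c adj_bnd lin lin_op_comp adj_lin T)
  have linS: "lin_op A ?S" by (intro bounded_lin bounded_ops_scale bounded_ops_comp D adj_bounded T)
  have "bnd A (add_op (diff_op T ?D) ?S) (n * c ^ 3 / R + cmod (of_real (1 / R)) * (c * (c * c)))"
    by (intro bnd_add_op lin_op_diff_op lin bounded_lin[OF D] linS Suc.IH S)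
  moreover have "add_op (diff_op T ?D) ?S = diff_op T (damp A R T (Suc n))"
    by (simp add: add_op_def diff_op_def fun_eq_iff)
  moreover have "n * c ^ 3 / R + cmod (of_real (1 / R)) * (c * (c * c)) = Suc n * c ^ 3 / R"
    using R by (simp add: field_simps power3_eq_cube norm_divide)
  ultimately show ?case by simp
qed

text \<open>A larger n improves the norm bound sqrt(R/(2n + 1)) and worsens the distance n c^3/R; n
  close to R/(4c^2) balances the two. R and n depend only on c and M, so the same polynomial serves
  all index sets.\<close>

lemma damp_lift:
  fixes c M :: real
  assumes c: "0 < c"
  obtains R n where "0 < R" "M \<le> sqrt R" "\<And>(A :: 'x set) T. T \<in> bounded_ops A \<Longrightarrow> bnd A T (sqrt R) \<Longrightarrow> bnd A (damp A R T n) (2 * c)"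
    "\<And>(A :: 'y set) T. T \<in> bounded_ops A \<Longrightarrow> bnd A T (sqrt R) \<Longrightarrow> bnd A T c \<Longrightarrow> bnd A (diff_op T (damp A R T n)) (c / 4)"
proof -
  \<comment> \<open>M^2 gives M \<le> sqrt R, and 4c^2 makes R positive even if M = 0.\<close>
  define R where "R = M\<^sup>2 + 4 * c\<^sup>2"
  define n where "n = nat \<lfloor>R / (4 * c\<^sup>2)\<rfloor>"
  have R: "0 < R" unfolding R_def using c by (simp add: add_nonneg_pos)
  have M: "M \<le> sqrt R" unfolding R_def by (rule real_le_rsqrt) simp
  have q0: "0 \<le> R / (4 * c\<^sup>2)" using R by simp
  have n1: "n \<le> R / (4 * c\<^sup>2)" unfolding n_def using q0 by simp
  have n2: "R / (4 * c\<^sup>2) < n + 1" unfolding n_def using q0 by linarith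
  have n3: "1 \<le> R / (4 * c\<^sup>2)" unfolding R_def using c by simp
  have A: "R / (2 * n + 1) \<le> (2 * c)\<^sup>2"
  proof -
    have "R / (4 * c\<^sup>2) \<le> 2 * n + 1" using n2 n3 by linarith
    then show ?thesis using c by (simp add: field_simps power_mult_distrib)
  qed
  have B: "n * c ^ 3 / R \<le> c / 4"
    using n1 c R by (simp add: field_simps power2_eq_square power3_eq_cube)
  show thesis
  proof (rule that[OF R M])
    fix A :: "'x set" and T assume T: "T \<in> bounded_ops A" "bnd A T (sqrt R)"
    have "sqrt (R / (2 * n + 1)) \<le> 2 * c" by (rule real_le_lsqrt) (use A c R in auto)
    then show "bnd A (damp A R T n) (2 * c)" using damp_estimates(1)[OF T R] bnd_mono by blast
  next
    fix A :: "'y set" and T assume T: "T \<in> bounded_ops A" "bnd A T (sqrt R)" "bnd A T c"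
    show "bnd A (diff_op T (damp A R T n)) (c / 4)"
      by (rule bnd_mono[OF damp_diff[OF T(1,2) R T(3)] B])
  qed
qed

section \<open>Transport of operators along a bijection of index sets\<close>

lemma infsum_transport:
  fixes f :: "'g \<Rightarrow> 'b::{topological_comm_monoid_add,t2_space}"
  assumes "inj \<phi>" "\<And>g. g \<notin> range \<phi> \<Longrightarrow> f g = 0"
  shows "(\<Sum>\<^sub>\<infinity>s. f (\<phi> s)) = (\<Sum>\<^sub>\<infinity>g. f g)"
proof -
  have "(\<Sum>\<^sub>\<infinity>s. f (\<phi> s)) = infsum f (range \<phi>)"
    using infsum_reindex[OF assms(1), of f] by (simp add: o_def)
  also have "\<dots> = infsum f UNIV" by (rule infsum_cong_neutral) (use assms(2) in auto)
  finally show ?thesis .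
qed

context
  fixes \<phi> :: "'s \<Rightarrow> 'g" and A :: "'g set"
  assumes bij: "bij_betw \<phi> UNIV A"
begin

lemma inj_phi: "inj \<phi>" and range_phi: "range \<phi> = A"
  using bij by (auto simp: bij_betw_def)

definition push :: "('s \<Rightarrow> complex) \<Rightarrow> 'g \<Rightarrow> complex" where
  "push \<xi> = (\<lambda>g. \<Sum>t | \<phi> t = g. \<xi> t)"

lemma push_phi [simp]: "push \<xi> (\<phi> s) = \<xi> s"
proof -
  have "{t. \<phi> t = \<phi> s} = {s}" using inj_phi by (auto simp: inj_def)
  then show ?thesis by (simp add: push_def)
qed

lemma push_out: "g \<notin> A \<Longrightarrow> push \<xi> g = 0"
proof -
  assume "g \<notin> A"
  then have "{t. \<phi> t = g} = {}" using range_phi by auto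
  then show ?thesis by (simp add: push_def)
qed

lemma push_comp: "\<eta> \<in> l2 A \<Longrightarrow> push (\<eta> \<circ> \<phi>) = \<eta>"
proof
  fix g assume "\<eta> \<in> l2 A"
  then show "push (\<eta> \<circ> \<phi>) g = \<eta> g"
    by (cases "g \<in> A") (auto simp: push_out l2_zero simp flip: range_phi)
qed

lemma l2_comp_phi:
  assumes "\<eta> \<in> l2 A" shows "\<eta> \<circ> \<phi> \<in> l2 UNIV" and "l2_norm (\<eta> \<circ> \<phi>) = l2_norm \<eta>"
proof -
  have "(\<lambda>i. if i \<in> UNIV then 1 * \<eta> (\<phi> i) else 0) \<in> l2 UNIV"
    by (rule l2_weighted_pinj(1)[OF assms, of _ _ _ 1]) (use inj_phi in auto)
  then show "\<eta> \<circ> \<phi> \<in> l2 UNIV" by (simp add: o_def)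
  show "l2_norm (\<eta> \<circ> \<phi>) = l2_norm \<eta>"
    unfolding l2_norm_def o_def
    by (rule arg_cong[OF infsum_transport[OF inj_phi]]) (use l2_zero[OF assms] range_phi in auto)
qed

lemma l2_push:
  assumes "\<xi> \<in> l2 UNIV" shows "push \<xi> \<in> l2 A" and "l2_norm (push \<xi>) = l2_norm \<xi>"
proof -
  have "(\<lambda>i. if i \<in> A then 1 * \<xi> (inv \<phi> i) else 0) \<in> l2 A"
    by (rule l2_weighted_pinj(1)[OF assms, of _ _ _ 1])
      (use range_phi in \<open>auto intro: inj_on_inv_into\<close>)
  moreover have "(\<lambda>i. if i \<in> A then 1 * \<xi> (inv \<phi> i) else 0) = push \<xi>"
    using inj_phi by (auto simp: fun_eq_iff push_out simp flip: range_phi)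
  ultimately show "push \<xi> \<in> l2 A" by simp
  have "push \<xi> \<circ> \<phi> = \<xi>" by (simp add: fun_eq_iff)
  then show "l2_norm (push \<xi>) = l2_norm \<xi>" using l2_comp_phi(2)[OF \<open>push \<xi> \<in> l2 A\<close>] by simp
qed

lemma transport_eq: "transport_op \<phi> T \<xi> = (if \<xi> \<in> l2 UNIV then T (push \<xi>) \<circ> \<phi> else (\<lambda>_. 0))"
  by (simp add: transport_op_def push_def o_def)

lemma push_add: "push (\<lambda>i. \<xi> i + \<eta> i) = (\<lambda>g. push \<xi> g + push \<eta> g)"
  by (simp add: push_def sum.distrib)

lemma push_scale: "push (\<lambda>i. c * \<xi> i) = (\<lambda>g. c * push \<xi> g)"
  by (simp add: push_def sum_distrib_left)

lemma transport_lin: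
  assumes T: "lin_op A T" shows "lin_op UNIV (transport_op \<phi> T)"
  unfolding lin_op_def transport_eq
  by (auto simp: l2_add l2_scale push_add push_scale lin_op_add[OF T] lin_op_scale[OF T] l2_push
      l2_comp_phi(1)[OF lin_op_in[OF T]])

text \<open>Transport is conjugation by a unitary, hence isometric. The direction back to
  \<open>T\<close> later shows that an element with zero image on l^2(S) vanishes at chi_e.\<close>

lemma transport_bnd:
  assumes T: "lin_op A T" shows "bnd UNIV (transport_op \<phi> T) c \<longleftrightarrow> bnd A T c"
proof
  assume *: "bnd UNIV (transport_op \<phi> T) c"
  show "bnd A T c" unfolding bnd_def
  proof (intro conjI ballI)
    fix \<eta> assume \<eta>: "\<eta> \<in> l2 A"
    have "l2_norm (transport_op \<phi> T (\<eta> \<circ> \<phi>)) \<le> c * l2_norm (\<eta> \<circ> \<phi>)"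
      by (rule bndD[OF *]) (rule l2_comp_phi[OF \<eta>])
    then show "l2_norm (T \<eta>) \<le> c * l2_norm \<eta>"
      by (simp add: transport_eq l2_comp_phi \<eta> push_comp lin_op_in[OF T])
  qed (use * in \<open>simp add: bnd_def\<close>)
next
  assume *: "bnd A T c"
  then show "bnd UNIV (transport_op \<phi> T) c"
    using bndD[OF * l2_push(1)]
    by (auto simp: bnd_def transport_eq l2_comp_phi(2)[OF lin_op_in[OF T]] l2_push(2))
qed

lemma transport_bounded: "T \<in> bounded_ops A \<Longrightarrow> transport_op \<phi> T \<in> bounded_ops UNIV"
  unfolding bounded_ops_iff using transport_lin transport_bnd by blast

lemma transport_add_op: "transport_op \<phi> (add_op S T) = add_op (transport_op \<phi> S) (transport_op \<phi> T)"
  by (auto simp: fun_eq_iff transport_eq add_op_def)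

lemma transport_diff_op: "transport_op \<phi> (diff_op S T) = diff_op (transport_op \<phi> S) (transport_op \<phi> T)"
  by (auto simp: fun_eq_iff transport_eq diff_op_def)

lemma transport_scale_op: "transport_op \<phi> (scale_op c T) = scale_op c (transport_op \<phi> T)"
  by (auto simp: fun_eq_iff transport_eq scale_op_def)

lemma transport_zero_op: "transport_op \<phi> zero_op = zero_op"
  by (auto simp: fun_eq_iff transport_eq zero_op_def)

lemma transport_comp:
  assumes S: "lin_op A S" and T: "lin_op A T"
  shows "transport_op \<phi> (S \<circ> T) = transport_op \<phi> S \<circ> transport_op \<phi> T"
proof
  fix \<xi>
  have "transport_op \<phi> S (\<lambda>_. 0) = (\<lambda>_. 0)"
    using lin_op_zero[OF transport_lin[OF S]] .
  then show "transport_op \<phi> (S \<circ> T) \<xi> = (transport_op \<phi> S \<circ> transport_op \<phi> T) \<xi>"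
    using l2_comp_phi(1)[OF lin_op_in[OF T]] push_comp[OF lin_op_in[OF T]]
    by (auto simp: transport_eq)
qed

lemma transport_adjoint:
  assumes S: "lin_op A S" and T: "lin_op A T" and adj: "is_adjoint A S T"
  shows "is_adjoint UNIV (transport_op \<phi> S) (transport_op \<phi> T)"
proof -
  have inner: "l2_inner (\<eta> \<circ> \<phi>) (\<zeta> \<circ> \<phi>) = l2_inner \<eta> \<zeta>" if "\<eta> \<in> l2 A" for \<eta> \<zeta>
    unfolding l2_inner_def o_def
    by (rule infsum_transport[OF inj_phi]) (use l2_zero[OF that] range_phi in auto)
  show ?thesis unfolding is_adjoint_def
  proof (intro ballI)
    fix \<xi> \<eta> :: "'s \<Rightarrow> complex" assume *: "\<xi> \<in> l2 UNIV" "\<eta> \<in> l2 UNIV"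
    have p: "push \<xi> \<circ> \<phi> = \<xi>" "push \<eta> \<circ> \<phi> = \<eta>" by (simp_all add: fun_eq_iff)
    have "l2_inner (S (push \<xi>)) (push \<eta>) = l2_inner (push \<xi>) (T (push \<eta>))"
      using adj * l2_push by (auto simp: is_adjoint_def)
    then show "l2_inner (transport_op \<phi> S \<xi>) \<eta> = l2_inner \<xi> (transport_op \<phi> T \<eta>)"
      using inner[OF lin_op_in[OF S], of "push \<xi>" "push \<eta>"] inner[OF l2_push(1)[OF *(1)], of "T (push \<eta>)"] *
      by (simp add: transport_eq p)
  qed
qed

end

section \<open>The left inverse hull and its characters\<close>

text \<open>In a power of a discrete space, a neighbourhood of a point prescribes finitely many
  coordinates. The subspace is left arbitrary so that the criterion applies to all characters, to
  \<Omega>(S) and to the full power.\<close>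

lemma openin_sub_product_discrete:
  assumes A: "A \<subseteq> I \<rightarrow>\<^sub>E D"
  shows "openin (subtopology (product_topology (\<lambda>_. discrete_topology D) I) A) U \<longleftrightarrow>
    U \<subseteq> A \<and> (\<forall>x\<in>U. \<exists>P. finite P \<and> P \<subseteq> I \<and> (\<forall>y\<in>A. (\<forall>p\<in>P. y p = x p) \<longrightarrow> y \<in> U))"
    (is "?L \<longleftrightarrow> ?R")
proof
  assume ?L
  then obtain W where W: "openin (product_topology (\<lambda>_. discrete_topology D) I) W" "U = W \<inter> A"
    by (auto simp: openin_subtopology)
  show ?R
  proof (intro conjI ballI)
    fix x assume "x \<in> U"
    then obtain B where B: "finite {i \<in> I. B i \<noteq> D}" "x \<in> Pi\<^sub>E I B" "Pi\<^sub>E I B \<subseteq> W"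
      using W(1)[unfolded openin_product_topology_alt] W(2) by fastforce
    show "\<exists>P. finite P \<and> P \<subseteq> I \<and> (\<forall>y\<in>A. (\<forall>p\<in>P. y p = x p) \<longrightarrow> y \<in> U)"
    proof (intro exI conjI ballI impI)
      fix y assume y: "y \<in> A" "\<forall>p\<in>{i \<in> I. B i \<noteq> D}. y p = x p"
      then have "y \<in> I \<rightarrow>\<^sub>E D" using A by auto
      have "y \<in> Pi\<^sub>E I B"
      proof (rule PiE_I)
        fix i assume i: "i \<in> I"
        show "y i \<in> B i" using y(2) i B(2) \<open>y \<in> I \<rightarrow>\<^sub>E D\<close> by (cases "B i = D") (auto simp: PiE_iff)
      qed (use \<open>y \<in> I \<rightarrow>\<^sub>E D\<close> in \<open>auto simp: PiE_iff extensional_def\<close>)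
      then show "y \<in> U" using B(3) W(2) y(1) by auto
    qed (use B in auto)
  qed (use W in auto)
next
  assume R: ?R
  \<comment> \<open>The union, in the full product, of the cylinders that witness the condition; it
    meets \<open>A\<close> exactly in \<open>U\<close>.\<close>
  define W where "W = {y \<in> I \<rightarrow>\<^sub>E D. \<exists>x\<in>U. \<exists>P. finite P \<and> P \<subseteq> I \<and>
    (\<forall>y\<in>A. (\<forall>p\<in>P. y p = x p) \<longrightarrow> y \<in> U) \<and> (\<forall>p\<in>P. y p = x p)}"
  have "openin (product_topology (\<lambda>_. discrete_topology D) I) W"
    unfolding openin_product_topology_alt
  proof
    fix y assume "y \<in> W"
    then obtain x P where *: "y \<in> I \<rightarrow>\<^sub>E D" "x \<in> U" "finite P" "P \<subseteq> I"
      "\<forall>y\<in>A. (\<forall>p\<in>P. y p = x p) \<longrightarrow> y \<in> U" "\<forall>p\<in>P. y p = x p"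
      by (auto simp: W_def)
    let ?B = "\<lambda>i. if i \<in> P then {y i} else D"
    have "Pi\<^sub>E I ?B \<subseteq> W"
    proof
      fix z assume z: "z \<in> Pi\<^sub>E I ?B"
      have "?B i \<subseteq> D" if "i \<in> I" for i using *(1) that by (auto simp: PiE_iff)
      then have "Pi\<^sub>E I ?B \<subseteq> I \<rightarrow>\<^sub>E D" by (rule PiE_mono)
      then have "z \<in> I \<rightarrow>\<^sub>E D" using z by blast
      moreover have "z p = x p" if "p \<in> P" for p
        using PiE_mem[OF z, of p] that *(4,6) by auto
      ultimately show "z \<in> W" using * unfolding W_def by blast
    qed
    moreover have "finite {i \<in> I. ?B i \<noteq> D}" by (rule finite_subset[OF _ *(3)]) auto
    moreover have "y \<in> Pi\<^sub>E I ?B" using *(1) by (auto simp: PiE_iff)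
    moreover have "openin (discrete_topology D) (?B i)" if "i \<in> I" for i
      using *(1) that by (auto simp: PiE_iff)
    ultimately show "\<exists>U. finite {i \<in> I. U i \<noteq> topspace (discrete_topology D)} \<and>
      (\<forall>i\<in>I. openin (discrete_topology D) (U i)) \<and> y \<in> Pi\<^sub>E I U \<and> Pi\<^sub>E I U \<subseteq> W"
      by (intro exI[of _ ?B]) simp
  qed
  moreover have "U = W \<inter> A"
  proof
    show "U \<subseteq> W \<inter> A"
    proof
      fix x assume x: "x \<in> U"
      then obtain P where "finite P" "P \<subseteq> I" "\<forall>y\<in>A. (\<forall>p\<in>P. y p = x p) \<longrightarrow> y \<in> U" using R by blast
      moreover have "x \<in> A" using x R by blast
      ultimately show "x \<in> W \<inter> A" using x A unfolding W_def by blast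
    qed
    show "W \<inter> A \<subseteq> U" unfolding W_def by blast
  qed
  ultimately show ?L by (auto simp: openin_subtopology)
qed

section \<open>Partial maps and the left inverse hull\<close>

lemma map_eqI: "(\<And>x y. f x = Some y \<longleftrightarrow> g x = Some y) \<Longrightarrow> f = g"
  by (rule ext) (metis not_Some_eq)

declare map_comp_Some_iff [simp]

lemma map_comp_assoc: "(f \<circ>\<^sub>m g) \<circ>\<^sub>m h = f \<circ>\<^sub>m (g \<circ>\<^sub>m h)"
  by (rule map_eqI) auto

lemma Some_comp [simp]: "Some \<circ>\<^sub>m f = f" "f \<circ>\<^sub>m Some = f"
  by (rule map_eqI; auto)+

lemma pinv_Some_iff:
  assumes "\<And>x y z. g x = Some z \<Longrightarrow> g y = Some z \<Longrightarrow> x = y"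
  shows "pinv g y = Some x \<longleftrightarrow> g x = Some y"
proof (cases "y \<in> ran g")
  case True
  then obtain z where z: "g z = Some y" by (auto simp: ran_def)
  then have "(THE x. g x = Some y) = z" using assms by blast
  then show ?thesis using True z assms[of z y x] by (auto simp: pinv_def)
next
  case False
  then show ?thesis by (auto simp: pinv_def ran_def)
qed

lemma ltrans_1: "ltrans 1 = Some"
  by (auto simp: ltrans_def)

lemma Some_hull [simp]: "Some \<in> inv_hull"
  using inv_hull.intros(1)[of 1] by (simp add: ltrans_1)

text \<open>The \<open>itself\<close> parameter fixes the monoid type once for all statements of the
  locale.\<close>

locale left_cancellative =
  fixes S_type :: "'s::monoid_mult itself"
  assumes left_cancel: "\<And>a b c :: 's. a * b = a * c \<Longrightarrow> b = c"
begin

text \<open>\<open>pinv\<close> inverts only injective maps, so in the inverse case the induction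
  hypothesis for g is needed before \<open>pinv g\<close> can be unfolded.\<close>

lemma hull_inj:
  fixes g :: "'s \<rightharpoonup> 's"
  assumes "g \<in> inv_hull" "g x = Some z" "g y = Some z" shows "x = y"
  using assms
proof (induction arbitrary: x y z)
  case (1 s) then show ?case using left_cancel by (simp add: ltrans_def) metis
next
  case (2 g)
  have "pinv g y = Some x \<longleftrightarrow> g x = Some y" for x y
    by (rule pinv_Some_iff) (rule "2.IH")
  then show ?case using 2 by simp
next
  case (3 g h) then show ?case by simp metis
qed

lemma pinv_iff: "(g :: 's \<rightharpoonup> 's) \<in> inv_hull \<Longrightarrow> pinv g y = Some x \<longleftrightarrow> g x = Some y"
  by (rule pinv_Some_iff) (rule hull_inj)

text \<open>Left translations commute with right ones, and inverses and composites inherit this.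
  Consequently domains and ranges are right ideals, and an element is determined on sS by its value
  at s.\<close>

lemma hull_right:
  fixes g :: "'s \<rightharpoonup> 's"
  assumes "g \<in> inv_hull" "g x = Some y" shows "g (x * s) = Some (y * s)"
  using assms
proof (induction arbitrary: x y)
  case (1 s) then show ?case by (auto simp: ltrans_def mult.assoc)
next
  case (2 g) then show ?case using pinv_iff[OF 2(1)] by simp
qed auto

text \<open>By \<open>hull_right\<close> the value at the identity determines the whole map; this
  makes the source fibre over chi_e a copy of S.\<close>

lemma hull_ltrans: "(g :: 's \<rightharpoonup> 's) \<in> inv_hull \<Longrightarrow> g 1 = Some v \<Longrightarrow> g = ltrans v"
  using hull_right[of g 1 v] by (auto simp: ltrans_def)

lemma pinv_comp:
  "(g :: 's \<rightharpoonup> 's) \<in> inv_hull \<Longrightarrow> h \<in> inv_hull \<Longrightarrow> pinv (g \<circ>\<^sub>m h) = pinv h \<circ>\<^sub>m pinv g"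
  by (rule map_eqI) (auto simp: pinv_iff inv_hull.intros)

lemma pinv_pinv: "(g :: 's \<rightharpoonup> 's) \<in> inv_hull \<Longrightarrow> pinv (pinv g) = g"
  by (rule map_eqI) (simp add: pinv_iff inv_hull.intros)

lemma idem_hull: "p \<in> idems \<Longrightarrow> p \<in> inv_hull"
  by (simp add: idems_def)

text \<open>From p(p(x)) = p(x), injectivity cancels one p.\<close>

lemma idem_id:
  assumes "(p :: 's \<rightharpoonup> 's) \<in> idems" "p x = Some y" shows "y = x"
proof -
  have "(p \<circ>\<^sub>m p) x = Some y" using assms by (simp add: idems_def)
  then have "p y = Some y" using assms by simp
  then show ?thesis using assms hull_inj[OF idem_hull] by blast
qed

lemma idem_iff: "(p :: 's \<rightharpoonup> 's) \<in> idems \<Longrightarrow> p x = Some y \<longleftrightarrow> y = x \<and> x \<in> dom p"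
  using idem_id by blast

lemma idemI: "(g :: 's \<rightharpoonup> 's) \<in> inv_hull \<Longrightarrow> (\<And>x y. g x = Some y \<Longrightarrow> y = x) \<Longrightarrow> g \<in> idems"
  unfolding idems_def by (simp, rule map_eqI) fastforce

lemma idem_Some [simp]: "(Some :: 's \<rightharpoonup> 's) \<in> idems"
  by (rule idemI) auto

lemma idem_comp: "(p :: 's \<rightharpoonup> 's) \<in> idems \<Longrightarrow> q \<in> idems \<Longrightarrow> p \<circ>\<^sub>m q \<in> idems"
  by (rule idemI) (auto simp: idem_hull inv_hull.intros dest!: idem_id)

lemma idem_source: "(g :: 's \<rightharpoonup> 's) \<in> inv_hull \<Longrightarrow> pinv g \<circ>\<^sub>m g \<in> idems"
  by (rule idemI) (auto simp: pinv_iff inv_hull.intros dest: hull_inj)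

lemma idem_conj: "(g :: 's \<rightharpoonup> 's) \<in> inv_hull \<Longrightarrow> p \<in> idems \<Longrightarrow> pinv g \<circ>\<^sub>m p \<circ>\<^sub>m g \<in> idems"
  by (rule idemI) (auto simp: pinv_iff inv_hull.intros idem_hull dest: hull_inj dest!: idem_id)

lemma dom_source: "(g :: 's \<rightharpoonup> 's) \<in> inv_hull \<Longrightarrow> dom (pinv g \<circ>\<^sub>m g) = dom g"
  by (auto simp: dom_def pinv_iff)

lemma dom_conj:
  "(g :: 's \<rightharpoonup> 's) \<in> inv_hull \<Longrightarrow> p \<in> idems \<Longrightarrow>
    dom (pinv g \<circ>\<^sub>m p \<circ>\<^sub>m g) = {x. \<exists>y. g x = Some y \<and> y \<in> dom p}"
  by (fastforce simp: dom_def pinv_iff dest: idem_id)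

lemma dom_idem_comp: "(p :: 's \<rightharpoonup> 's) \<in> idems \<Longrightarrow> q \<in> idems \<Longrightarrow> dom (p \<circ>\<^sub>m q) = dom p \<inter> dom q"
  by (fastforce simp: dom_def dest: idem_id)

lemma idem_Inter:
  assumes "finite P" "P \<subseteq> (idems :: ('s \<rightharpoonup> 's) set)"
  shows "\<exists>q\<in>idems. dom q = (\<Inter>p\<in>P. dom p)"
  using assms
proof (induction P)
  case empty then show ?case using idem_Some by (auto intro!: bexI[of _ Some])
next
  case (insert p P)
  then obtain q where "q \<in> idems" "dom q = (\<Inter>p\<in>P. dom p)" by auto
  then show ?case using insert.prems
    by (intro bexI[of _ "p \<circ>\<^sub>m q"]) (auto simp: dom_idem_comp idem_comp)
qed

lemma pid_dom: "(p :: 's \<rightharpoonup> 's) \<in> idems \<Longrightarrow> pid (dom p) = p"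
  by (rule map_eqI) (auto simp: pid_def restrict_map_def idem_iff)

text \<open>Images and preimages are carried through the induction together because
  \<open>pinv\<close> exchanges them.\<close>

lemma hull_constructible:
  assumes "(g :: 's \<rightharpoonup> 's) \<in> inv_hull" "X \<in> constructible"
  shows "{y. \<exists>x\<in>X. g x = Some y} \<in> constructible" and "{x. \<exists>y\<in>X. g x = Some y} \<in> constructible"
proof -
  have "(\<forall>X\<in>constructible. {y. \<exists>x\<in>X. g x = Some y} \<in> constructible) \<and>
    (\<forall>X\<in>constructible. {x. \<exists>y\<in>X. g x = Some y} \<in> constructible)"
    using assms(1)
  proof induction
    case (1 s)
    show ?case
    proof (intro conjI ballI)
      fix X :: "'s set" assume X: "X \<in> constructible"
      \<comment> \<open>sX is written as 1^{-1}sX, and below s^{-1}X as s^{-1}1X, to match the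
        constructor of \<open>constructible\<close>.\<close>
      have "{y. \<exists>x\<in>X. ltrans s x = Some y} = {x. 1 * x \<in> (*) s ` X}" by (auto simp: ltrans_def)
      then show "{y. \<exists>x\<in>X. ltrans s x = Some y} \<in> constructible"
        using constructible.intros(2)[OF X] by metis
      have "{x. \<exists>y\<in>X. ltrans s x = Some y} = {x. s * x \<in> (*) 1 ` X}" by (auto simp: ltrans_def)
      then show "{x. \<exists>y\<in>X. ltrans s x = Some y} \<in> constructible"
        using constructible.intros(2)[OF X] by metis
    qed
  next
    case (2 g) then show ?case by (simp add: pinv_iff)
  next
    case (3 g h)
    show ?case
    proof (intro conjI ballI)
      fix X :: "'s set" assume X: "X \<in> constructible"
      have "{y. \<exists>x\<in>X. (g \<circ>\<^sub>m h) x = Some y} = {y. \<exists>z\<in>{z. \<exists>x\<in>X. h x = Some z}. g z = Some y}" by auto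
      then show "{y. \<exists>x\<in>X. (g \<circ>\<^sub>m h) x = Some y} \<in> constructible" using 3 X by (simp only:)
      have "{x. \<exists>y\<in>X. (g \<circ>\<^sub>m h) x = Some y} = {x. \<exists>z\<in>{z. \<exists>y\<in>X. g z = Some y}. h x = Some z}" by auto
      then show "{x. \<exists>y\<in>X. (g \<circ>\<^sub>m h) x = Some y} \<in> constructible" using 3 X by (simp only:)
    qed
  qed
  then show "{y. \<exists>x\<in>X. g x = Some y} \<in> constructible" "{x. \<exists>y\<in>X. g x = Some y} \<in> constructible"
    using assms(2) by auto
qed

lemma constructible_dom: "(g :: 's \<rightharpoonup> 's) \<in> inv_hull \<Longrightarrow> dom g \<in> constructible"
  using hull_constructible(2)[of g UNIV] constructible.intros(1) by (simp add: dom_def)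

lemma constructible_ran: "(g :: 's \<rightharpoonup> 's) \<in> inv_hull \<Longrightarrow> ran g \<in> constructible"
  using hull_constructible(1)[of g UNIV] constructible.intros(1) by (simp add: ran_def)

lemma constructible_idem:
  assumes "(X :: 's set) \<in> constructible" obtains p where "p \<in> idems" "dom p = X"
proof -
  have "\<exists>p\<in>idems. dom p = X" using assms
  proof induction
    case 1 then show ?case by (auto intro!: bexI[of _ Some])
  next
    case (2 X s t)
    then obtain p where p: "p \<in> idems" "dom p = X" by auto
    \<comment> \<open>s^{-1}tX is the preimage of X under t^{-1}s, hence the domain of the conjugate
      of p by this map.\<close>
    let ?g = "pinv (ltrans t) \<circ>\<^sub>m ltrans s"
    have g: "?g \<in> inv_hull" by (intro inv_hull.intros)
    have "dom (pinv ?g \<circ>\<^sub>m p \<circ>\<^sub>m ?g) = {x. s * x \<in> (*) t ` X}"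
      unfolding dom_conj[OF g p(1)] p(2)
      by (auto simp: pinv_iff[OF inv_hull.intros(1)] image_iff) (auto simp: ltrans_def, metis)
    then show ?case using idem_conj[OF g p(1)] by blast
  qed
  then show ?thesis using that by blast
qed

section \<open>Characters and the compact space \<Omega>(S)\<close>

lemma chars_subset: "(chars :: 's chr set) \<subseteq> idems \<rightarrow>\<^sub>E {0, 1}"
  by (auto simp: chars_def)

lemma Omega_chars: "\<omega> \<in> Omega \<Longrightarrow> (\<omega> :: 's chr) \<in> chars"
  by (auto simp: Omega_def closure_of_def chars_top_def)

lemma Omega_subset: "(Omega :: 's chr set) \<subseteq> idems \<rightarrow>\<^sub>E {0, 1}"
  using Omega_chars chars_subset by blast

lemma openin_chars_top:
  "openin chars_top (U :: 's chr set) \<longleftrightarrow> U \<subseteq> chars \<and>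
    (\<forall>\<omega>\<in>U. \<exists>P. finite P \<and> P \<subseteq> idems \<and> (\<forall>\<psi>\<in>chars. (\<forall>p\<in>P. \<psi> p = \<omega> p) \<longrightarrow> \<psi> \<in> U))"
  unfolding chars_top_def by (rule openin_sub_product_discrete[OF chars_subset])

lemma topspace_chars_top: "topspace (chars_top :: 's chr topology) = chars"
  using chars_subset by (simp add: chars_top_def Int_absorb1)

lemma point_char_apply: "p \<in> idems \<Longrightarrow> point_char s p = (if s \<in> dom p then 1 else 0)"
  by (simp add: point_char_def)

text \<open>Membership in the closure, tested on finite sets of idempotents. Multiplicativity and
  nonvanishing follow from the test, as each concerns finitely many values, which are those of a
  point character.\<close>

lemma Omega_iff:
  "(\<omega> :: 's chr) \<in> Omega \<longleftrightarrow> \<omega> \<in> extensional idems \<and>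
    (\<forall>P. finite P \<longrightarrow> P \<subseteq> idems \<longrightarrow> (\<exists>s. \<forall>p\<in>P. \<omega> p = point_char s p))" (is "?L \<longleftrightarrow> ?R")
proof
  assume ?L
  then have \<omega>: "\<omega> \<in> chars" and cl: "\<And>T. openin chars_top T \<Longrightarrow> \<omega> \<in> T \<Longrightarrow> \<exists>s. point_char s \<in> T"
    by (auto simp: Omega_def closure_of_def topspace_chars_top)
  show ?R
  proof (intro conjI allI impI)
    show "\<omega> \<in> extensional idems" using \<omega> chars_subset by (auto simp: PiE_iff)
    fix P :: "('s \<rightharpoonup> 's) set" assume P: "finite P" "P \<subseteq> idems"
    let ?T = "{\<psi> \<in> chars. \<forall>p\<in>P. \<psi> p = \<omega> p}"
    have "openin chars_top ?T" unfolding openin_chars_top using P by auto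
    then obtain s where "point_char s \<in> ?T" using cl[of ?T] \<omega> by auto
    then have "\<forall>p\<in>P. point_char s p = \<omega> p" by blast
    then show "\<exists>s. \<forall>p\<in>P. \<omega> p = point_char s p" by (intro exI[of _ s]) simp
  qed
next
  assume R: ?R
  have fin: "\<exists>s. \<forall>p\<in>P. \<omega> p = point_char s p" if "finite P" "P \<subseteq> idems" for P using R that by blast
  have "\<omega> \<in> chars" unfolding chars_def
  proof (intro CollectI conjI ballI)
    show "\<omega> \<in> idems \<rightarrow>\<^sub>E {0, 1}"
    proof (rule PiE_I)
      fix p :: "'s \<rightharpoonup> 's" assume "p \<in> idems"
      then obtain s where "\<omega> p = point_char s p" using fin[of "{p}"] by auto
      then show "\<omega> p \<in> {0, 1}" using \<open>p \<in> idems\<close> by (simp add: point_char_apply)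
    qed (use R in \<open>auto simp: extensional_def\<close>)
    have "\<omega> Some = 1" using fin[of "{Some}"] by (auto simp: point_char_apply)
    then show "\<exists>p\<in>idems. \<omega> p \<noteq> 0" by (intro bexI[of _ Some]) auto
    fix p q :: "'s \<rightharpoonup> 's" assume pq: "p \<in> idems" "q \<in> idems"
    then obtain s where s: "\<forall>r\<in>{p, q, p \<circ>\<^sub>m q}. \<omega> r = point_char s r"
      using fin[of "{p, q, p \<circ>\<^sub>m q}"] idem_comp[OF pq] by auto
    then show "\<omega> (p \<circ>\<^sub>m q) = \<omega> p * \<omega> q"
      using pq idem_comp[OF pq] dom_idem_comp[OF pq] by (simp add: point_char_apply)
  qed
  then show ?L unfolding Omega_def closure_of_def topspace_chars_top
  proof (intro CollectI conjI allI impI)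
    fix T assume T: "\<omega> \<in> T \<and> openin chars_top T"
    then obtain P where P: "finite P" "P \<subseteq> idems" "\<forall>\<psi>\<in>chars. (\<forall>p\<in>P. \<psi> p = \<omega> p) \<longrightarrow> \<psi> \<in> T"
      using T[unfolded openin_chars_top] by blast
    obtain s where s: "\<forall>p\<in>P. \<omega> p = point_char s p" using fin[OF P(1,2)] by blast
    have "point_char s \<in> chars" unfolding chars_def
    proof (intro CollectI conjI ballI)
      fix p q :: "'s \<rightharpoonup> 's" assume pq: "p \<in> idems" "q \<in> idems"
      then show "point_char s (p \<circ>\<^sub>m q) = point_char s p * point_char s q"
        using idem_comp[OF pq] dom_idem_comp[OF pq] by (simp add: point_char_apply)
    next
      show "\<exists>p\<in>idems. point_char s p \<noteq> 0" by (intro bexI[of _ Some]) (auto simp: point_char_apply)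
    qed (auto simp: point_char_def)
    then show "\<exists>y\<in>range point_char. y \<in> T" using P(3) s by auto
  qed
qed

lemma Omega_01: "(\<omega> :: 's chr) \<in> Omega \<Longrightarrow> p \<in> idems \<Longrightarrow> \<omega> p = 0 \<or> \<omega> p = 1"
  using PiE_mem[OF subsetD[OF chars_subset Omega_chars], of \<omega> p] by auto

lemma point_char_Omega [simp]: "(point_char s :: 's chr) \<in> Omega"
  unfolding Omega_iff by (auto simp: point_char_def)

definition Otop :: "'s chr topology" where
  "Otop = subtopology chars_top Omega"

lemma Otop_eq: "Otop = subtopology (product_topology (\<lambda>_. discrete_topology {0, 1}) idems) Omega"
proof -
  have "chars \<inter> Omega = (Omega :: 's chr set)" using Omega_chars by auto
  then show ?thesis by (simp add: Otop_def chars_top_def subtopology_subtopology)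
qed

lemma openin_Otop:
  "openin Otop U \<longleftrightarrow> U \<subseteq> Omega \<and>
    (\<forall>\<omega>\<in>U. \<exists>P. finite P \<and> P \<subseteq> idems \<and> (\<forall>\<psi>\<in>Omega. (\<forall>p\<in>P. \<psi> p = \<omega> p) \<longrightarrow> \<psi> \<in> U))"
  unfolding Otop_eq
  by (rule openin_sub_product_discrete[OF Omega_subset])

lemma topspace_Otop [simp]: "topspace Otop = Omega"
  using Omega_chars topspace_chars_top by (auto simp: Otop_def)

lemma Hausdorff_Otop: "Hausdorff_space Otop"
  unfolding Otop_eq by (intro Hausdorff_space_subtopology) (auto simp: Hausdorff_space_product_topology)

text \<open>Failing a finite test is an open condition, so \<Omega>(S) is closed in the full power
  of {0, 1}, which is compact.\<close>

lemma compact_Otop: "compact_space Otop"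
proof -
  let ?X = "product_topology (\<lambda>_. discrete_topology {0, 1::nat}) (idems :: ('s \<rightharpoonup> 's) set)"
  have "openin (subtopology ?X (idems \<rightarrow>\<^sub>E {0, 1})) ((idems \<rightarrow>\<^sub>E {0, 1}) - Omega)"
    unfolding openin_sub_product_discrete[OF order_refl]
  proof (intro conjI ballI)
    fix \<omega> :: "'s chr" assume "\<omega> \<in> (idems \<rightarrow>\<^sub>E {0, 1}) - Omega"
    then obtain P where P: "finite P" "P \<subseteq> idems" "\<not> (\<exists>s. \<forall>p\<in>P. \<omega> p = point_char s p)"
      by (auto simp: Omega_iff PiE_iff)
    then have "\<psi> \<notin> Omega" if "\<forall>p\<in>P. \<psi> p = \<omega> p" for \<psi>
      using that by (auto simp: Omega_iff dest!: spec[of _ P])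
    then show "\<exists>P. finite P \<and> P \<subseteq> idems \<and>
      (\<forall>y\<in>idems \<rightarrow>\<^sub>E {0, 1}. (\<forall>p\<in>P. y p = \<omega> p) \<longrightarrow> y \<in> (idems \<rightarrow>\<^sub>E {0, 1}) - Omega)"
      using P by blast
  qed auto
  moreover have "subtopology ?X (idems \<rightarrow>\<^sub>E {0, 1}) = ?X" by (rule subtopology_superset) simp
  ultimately have "closedin ?X Omega"
    using Omega_subset by (simp add: closedin_def)
  moreover have "compact_space ?X"
    by (auto simp: compact_space_product_topology compact_space_discrete_topology)
  ultimately show ?thesis unfolding Otop_eq
    by (intro compact_space_subtopology closedin_compact_space)
qed

text \<open>
  \<open>evn \<omega> Q\<close> says that \<open>Q\<close> holds on the trace on \<open>S\<close> of a neighbourhood of \<open>\<omega>\<close>, where \<open>s\<close> is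
  identified with its point character.  For \<open>\<omega> \<in> Omega\<close> these traces form a proper filter, which
  turns identities at \<open>\<omega>\<close> into identities between partial maps at points of \<open>S\<close>.
\<close>

definition evn :: "'s chr \<Rightarrow> ('s \<Rightarrow> bool) \<Rightarrow> bool" where
  "evn \<omega> Q \<longleftrightarrow> (\<exists>P. finite P \<and> P \<subseteq> idems \<and> (\<forall>s. (\<forall>p\<in>P. \<omega> p = point_char s p) \<longrightarrow> Q s))"

lemma evn_ex: "\<omega> \<in> Omega \<Longrightarrow> evn \<omega> Q \<Longrightarrow> \<exists>s. Q s"
  unfolding evn_def Omega_iff by meson

lemma evn_mono: "evn \<omega> Q \<Longrightarrow> (\<And>s. Q s \<Longrightarrow> R s) \<Longrightarrow> evn \<omega> R"
  unfolding evn_def by meson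

lemma evn_conj:
  assumes "evn \<omega> Q" "evn \<omega> R" shows "evn \<omega> (\<lambda>s. Q s \<and> R s)"
proof -
  obtain P where P: "finite P" "P \<subseteq> idems" "\<And>s. (\<forall>p\<in>P. \<omega> p = point_char s p) \<Longrightarrow> Q s"
    using assms(1) by (auto simp: evn_def)
  obtain P' where P': "finite P'" "P' \<subseteq> idems" "\<And>s. (\<forall>p\<in>P'. \<omega> p = point_char s p) \<Longrightarrow> R s"
    using assms(2) by (auto simp: evn_def)
  show ?thesis unfolding evn_def
    by (rule exI[of _ "P \<union> P'"]) (use P P' in auto)
qed

lemma evn_True: "(\<And>s. Q s) \<Longrightarrow> evn \<omega> Q"
  unfolding evn_def by (intro exI[of _ "{}"]) auto

lemma evn_dom: "p \<in> idems \<Longrightarrow> \<omega> p = 1 \<Longrightarrow> evn \<omega> (\<lambda>s. s \<in> dom p)"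
  unfolding evn_def by (intro exI[of _ "{p}"]) (auto simp: point_char_apply split: if_splits)

lemma evn_not_dom: "p \<in> idems \<Longrightarrow> \<omega> p \<noteq> 1 \<Longrightarrow> evn \<omega> (\<lambda>s. s \<notin> dom p)"
  unfolding evn_def by (intro exI[of _ "{p}"]) (auto simp: point_char_apply split: if_splits)

text \<open>Properness of the filter excludes that the points near \<omega> lie both inside and
  outside the domain.\<close>

lemma evn_dom_iff: "\<omega> \<in> Omega \<Longrightarrow> p \<in> idems \<Longrightarrow> evn \<omega> (\<lambda>s. s \<in> dom p) \<longleftrightarrow> \<omega> p = 1"
  using evn_dom evn_not_dom evn_ex[OF _ evn_conj] by blast

text \<open>The finite set of idempotents that witnesses \<open>Q\<close> near \<omega> also
  witnesses it at every character with the same values there.\<close>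

lemma openin_evn: "openin Otop {\<omega> \<in> Omega. evn \<omega> Q}"
  unfolding openin_Otop
proof (intro conjI ballI)
  fix \<omega> assume "\<omega> \<in> {\<omega> \<in> Omega. evn \<omega> Q}"
  then obtain P where P: "finite P" "P \<subseteq> idems" "\<And>s. (\<forall>p\<in>P. \<omega> p = point_char s p) \<Longrightarrow> Q s"
    by (auto simp: evn_def)
  have "evn \<psi> Q" if "\<forall>p\<in>P. \<psi> p = \<omega> p" for \<psi>
    unfolding evn_def using P that by (intro exI[of _ P]) simp
  then show "\<exists>P. finite P \<and> P \<subseteq> idems \<and>
      (\<forall>\<psi>\<in>Omega. (\<forall>p\<in>P. \<psi> p = \<omega> p) \<longrightarrow> \<psi> \<in> {\<omega> \<in> Omega. evn \<omega> Q})"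
    using P(1,2) by (intro exI[of _ P]) simp
qed simp

lemma openin_idem: "p \<in> idems \<Longrightarrow> openin Otop {\<omega> \<in> Omega. \<omega> p = 1}"
  using openin_evn[of "\<lambda>s. s \<in> dom p"] evn_dom_iff[of _ p] by (simp cong: conj_cong)

lemma openin_not_idem: "p \<in> idems \<Longrightarrow> openin Otop {\<omega> \<in> Omega. \<omega> p \<noteq> 1}"
  unfolding openin_Otop by (intro conjI ballI exI[of _ "{p}"]) auto

lemma closedin_idem: "p \<in> idems \<Longrightarrow> closedin Otop {\<omega> \<in> Omega. \<omega> p = 1}"
proof -
  assume "p \<in> idems"
  moreover have "Omega - {\<omega> \<in> Omega. \<omega> p = 1} = {\<omega> \<in> Omega. \<omega> p \<noteq> 1}" by auto
  ultimately show ?thesis using openin_not_idem by (auto simp: closedin_def)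
qed

lemma Omega_eqI:
  assumes "(\<omega> :: 's chr) \<in> Omega" "\<psi> \<in> Omega" "\<And>p. p \<in> idems \<Longrightarrow> \<omega> p = 1 \<longleftrightarrow> \<psi> p = 1"
  shows "\<omega> = \<psi>"
proof (rule extensionalityI[of _ idems])
  fix p :: "'s \<rightharpoonup> 's" assume "p \<in> idems"
  then show "\<omega> p = \<psi> p" using Omega_01[OF assms(1)] Omega_01[OF assms(2)] assms(3) by metis
qed (use assms in \<open>auto simp: Omega_iff\<close>)

text \<open>The source set of the bisection given by g, as a subset of \<Omega>(S).\<close>

definition Om :: "('s \<rightharpoonup> 's) \<Rightarrow> 's chr set" where
  "Om g = {\<omega> \<in> Omega. \<omega> (pinv g \<circ>\<^sub>m g) = 1}"

lemma Om_Omega: "\<omega> \<in> Om g \<Longrightarrow> \<omega> \<in> Omega"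
  by (simp add: Om_def)

lemma Om_iff: "g \<in> inv_hull \<Longrightarrow> \<omega> \<in> Om g \<longleftrightarrow> \<omega> \<in> Omega \<and> evn \<omega> (\<lambda>s. s \<in> dom g)"
  using evn_dom_iff[OF _ idem_source, of \<omega> g] by (auto simp: Om_def dom_source)

lemma openin_Om: "g \<in> inv_hull \<Longrightarrow> openin Otop (Om g)"
  unfolding Om_def by (rule openin_idem[OF idem_source])

lemma closedin_Om: "g \<in> inv_hull \<Longrightarrow> closedin Otop (Om g)"
  unfolding Om_def by (rule closedin_idem[OF idem_source])

lemma Om_Some [simp]: "Om Some = Omega"
  using Om_iff[OF Some_hull] by (auto intro: evn_True)

section \<open>Point characters and the action of the hull\<close>

lemma evn_point: "evn (point_char s) Q \<Longrightarrow> Q s"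
  unfolding evn_def by blast

lemma idem_ideal:
  obtains p where "p \<in> idems" "dom p = range ((*) (s :: 's))"
proof (rule that)
  let ?p = "pinv (pinv (ltrans s)) \<circ>\<^sub>m pinv (ltrans s)"
  show "?p \<in> idems" by (intro idem_source inv_hull.intros)
  show "dom ?p = range ((*) s)"
    unfolding dom_source[OF inv_hull.intros(2)[OF inv_hull.intros(1)]]
    by (auto simp: dom_def pinv_iff[OF inv_hull.intros(1)]) (auto simp: ltrans_def)
qed

text \<open>sS is the domain of an idempotent with value 1 at chi_s, so it is the trace of a
  neighbourhood of chi_s.\<close>

lemma evn_point_ideal:
  assumes "\<And>r. Q (s * r)" shows "evn (point_char s) Q"
proof -
  obtain p where p: "p \<in> idems" "dom p = range ((*) s)" using idem_ideal .
  have "s \<in> dom p" unfolding p(2) by (rule range_eqI[of _ _ 1]) simp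
  then have "evn (point_char s) (\<lambda>r. r \<in> dom p)" by (intro evn_dom p) (simp add: point_char_apply p)
  then show ?thesis by (rule evn_mono) (use p(2) assms in auto)
qed

lemma point_char_Om: "g \<in> inv_hull \<Longrightarrow> point_char s \<in> Om g \<longleftrightarrow> s \<in> dom g"
  using dom_source[of g] by (simp add: Om_def point_char_apply idem_source)

text \<open>Idempotents tested at the moved character pull back to their conjugates by g at
  \<omega>: if s agrees with \<omega> on the conjugates, then g(s) agrees with the moved character
  on the original ones.\<close>

lemma evn_act:
  assumes g: "g \<in> inv_hull" and "evn (act g \<omega>) Q"
  shows "evn \<omega> (\<lambda>s. \<forall>t. g s = Some t \<longrightarrow> Q t)"
proof -
  obtain P where P: "finite P" "P \<subseteq> idems" "\<And>s. (\<forall>p\<in>P. act g \<omega> p = point_char s p) \<Longrightarrow> Q s"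
    using assms(2) by (auto simp: evn_def)
  let ?c = "\<lambda>p. pinv g \<circ>\<^sub>m p \<circ>\<^sub>m g"
  show ?thesis unfolding evn_def
  proof (intro exI[of _ "?c ` P"] conjI allI impI)
    fix s t assume s: "\<forall>p\<in>?c ` P. \<omega> p = point_char s p" and t: "g s = Some t"
    have "act g \<omega> p = point_char t p" if "p \<in> P" for p
    proof -
      have p: "p \<in> idems" using that P by auto
      have "act g \<omega> p = point_char s (?c p)" using s that p by (simp add: act_def)
      then show ?thesis
        using dom_conj[OF g p] t by (simp add: point_char_apply p idem_conj[OF g p])
    qed
    then show "Q t" using P(3) by blast
  qed (use P idem_conj[OF g] in auto)
qed

lemma act_value:
  assumes "g \<in> inv_hull" "\<omega> \<in> Omega" "p \<in> idems"
  shows "act g \<omega> p = 1 \<longleftrightarrow> evn \<omega> (\<lambda>s. \<exists>t. g s = Some t \<and> t \<in> dom p)"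
  using evn_dom_iff[OF assms(2) idem_conj[OF assms(1,3)]] assms(3)
  by (simp add: act_def dom_conj[OF assms(1,3)])

lemma act_Omega:
  assumes g: "g \<in> inv_hull" and \<omega>: "\<omega> \<in> Om g"
  shows "act g \<omega> \<in> Omega"
  unfolding Omega_iff
proof (intro conjI allI impI)
  show "act g \<omega> \<in> extensional idems" by (simp add: act_def)
  fix P :: "('s \<rightharpoonup> 's) set" assume P: "finite P" "P \<subseteq> idems"
  let ?c = "\<lambda>p. pinv g \<circ>\<^sub>m p \<circ>\<^sub>m g"
  \<comment> \<open>Including g^{-1}g forces the approximating point s into the domain of g; its
    image g(s) then approximates the moved character.\<close>
  let ?P = "insert (pinv g \<circ>\<^sub>m g) (?c ` P)"
  have "?P \<subseteq> idems" "finite ?P" using P idem_conj[OF g] idem_source[OF g] by auto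
  then obtain s where s: "\<forall>p\<in>?P. \<omega> p = point_char s p"
    using Om_Omega[OF \<omega>, unfolded Omega_iff, THEN conjunct2, rule_format, of ?P] by blast
  then have "\<omega> (pinv g \<circ>\<^sub>m g) = point_char s (pinv g \<circ>\<^sub>m g)" by blast
  then have "s \<in> dom (pinv g \<circ>\<^sub>m g)"
    using \<omega> idem_source[OF g] unfolding Om_def by (simp only: point_char_apply split: if_splits) simp
  then have "s \<in> dom g" unfolding dom_source[OF g] .
  then obtain t where t: "g s = Some t" by auto
  have "act g \<omega> p = point_char t p" if "p \<in> P" for p
  proof -
    have p: "p \<in> idems" using that P by auto
    have "act g \<omega> p = point_char s (?c p)" using s that p by (simp add: act_def)
    then show ?thesis
      using dom_conj[OF g p] t by (simp add: point_char_apply p idem_conj[OF g p])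
  qed
  then show "\<exists>t. \<forall>p\<in>P. act g \<omega> p = point_char t p" by blast
qed

lemma act_act:
  assumes "(g :: 's \<rightharpoonup> 's) \<in> inv_hull" "h \<in> inv_hull"
  shows "act g (act h \<omega>) = act (g \<circ>\<^sub>m h) \<omega>"
proof
  fix p
  show "act g (act h \<omega>) p = act (g \<circ>\<^sub>m h) \<omega> p"
    using idem_conj[OF assms(1)] by (simp add: act_def pinv_comp[OF assms] map_comp_assoc)
qed

lemma act_Some: "(\<omega> :: 's chr) \<in> Omega \<Longrightarrow> act Some \<omega> = \<omega>"
proof
  fix p :: "'s \<rightharpoonup> 's" assume "\<omega> \<in> Omega"
  moreover have "pinv (Some :: 's \<rightharpoonup> 's) = Some" by (rule map_eqI) (auto simp: pinv_iff)
  ultimately show "act Some \<omega> p = \<omega> p"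
    by (cases "p \<in> idems") (auto simp: act_def Omega_iff extensional_def)
qed

lemma act_point:
  assumes g: "(g :: 's \<rightharpoonup> 's) \<in> inv_hull" and "g s = Some t" shows "act g (point_char s) = point_char t"
proof
  fix p
  show "act g (point_char s) p = point_char t p"
  proof (cases "p \<in> idems")
    case True
    then show ?thesis using dom_conj[OF g True] assms by (simp add: act_def point_char_apply idem_conj)
  qed (simp add: act_def point_char_def)
qed

text \<open>By \<open>act_value\<close> the action is read off from values of the map near \<omega>;
  hence all representatives of an arrow, in either groupoid, act alike.\<close>

lemma act_cong:
  assumes "g \<in> inv_hull" "h \<in> inv_hull" "\<omega> \<in> Om g" "evn \<omega> (\<lambda>s. g s = h s)"
  shows "\<omega> \<in> Om h" and "act g \<omega> = act h \<omega>"
proof -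
  have \<omega>: "\<omega> \<in> Omega" using assms Om_Omega by blast
  have "evn \<omega> (\<lambda>s. s \<in> dom g)" using assms(1,3) Om_iff by blast
  then have "evn \<omega> (\<lambda>s. s \<in> dom h)" by (rule evn_mono[OF evn_conj[OF _ assms(4)]]) (metis domIff)
  then show h: "\<omega> \<in> Om h" using Om_iff assms(2) \<omega> by blast
  have "evn \<omega> (\<lambda>s. \<exists>t. g s = Some t \<and> t \<in> dom p) \<longleftrightarrow> evn \<omega> (\<lambda>s. \<exists>t. h s = Some t \<and> t \<in> dom p)" for p :: "'s \<rightharpoonup> 's"
    by (rule iffI; erule evn_mono[OF evn_conj[OF _ assms(4)]]; metis)
  then show "act g \<omega> = act h \<omega>"
    by (intro Omega_eqI act_Omega assms h) (simp add: act_value assms \<omega> del: One_nat_def)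
qed

lemma Om_comp:
  assumes "g \<in> inv_hull" "h \<in> inv_hull" "\<omega> \<in> Om h"
  shows "\<omega> \<in> Om (g \<circ>\<^sub>m h) \<longleftrightarrow> act h \<omega> \<in> Om g"
proof -
  have \<omega>: "\<omega> \<in> Omega" using assms Om_Omega by blast
  have "act h \<omega> \<in> Om g \<longleftrightarrow> evn \<omega> (\<lambda>s. \<exists>t. h s = Some t \<and> t \<in> dom g)"
    using act_value[OF assms(2) \<omega> idem_source[OF assms(1)]] act_Omega[OF assms(2,3)]
    by (simp add: Om_def dom_source[OF assms(1)] del: map_comp_Some_iff)
  also have "\<dots> \<longleftrightarrow> evn \<omega> (\<lambda>s. s \<in> dom (g \<circ>\<^sub>m h))"
    by (rule arg_cong[where f = "evn \<omega>"], rule ext) (auto simp: dom_def)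
  finally show ?thesis using Om_iff[OF inv_hull.intros(3)[OF assms(1,2)]] \<omega> by blast
qed

lemma Om_compD:
  assumes "g \<in> inv_hull" "h \<in> inv_hull" "\<omega> \<in> Om (g \<circ>\<^sub>m h)" shows "\<omega> \<in> Om h"
proof -
  have "evn \<omega> (\<lambda>s. s \<in> dom (g \<circ>\<^sub>m h))" "\<omega> \<in> Omega"
    using assms Om_iff[OF inv_hull.intros(3)[OF assms(1,2)]] by auto
  then have "evn \<omega> (\<lambda>s. s \<in> dom h)" by (elim evn_mono) auto
  then show ?thesis using Om_iff[OF assms(2)] \<open>\<omega> \<in> Omega\<close> by blast
qed

lemma evn_source:
  assumes "g \<in> inv_hull" "\<omega> \<in> Om g" shows "evn \<omega> (\<lambda>s. (pinv g \<circ>\<^sub>m g) s = Some s)"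
  by (rule evn_mono[of _ "\<lambda>s. s \<in> dom g"]) (use assms in \<open>auto simp: Om_iff pinv_iff\<close>)

text \<open>Near \<omega> the map g^{-1}g agrees with the identity, and \<open>act_cong\<close>
  compares the two.\<close>

lemma Om_pinv:
  assumes g: "g \<in> inv_hull" and \<omega>: "\<omega> \<in> Om g"
  shows "act g \<omega> \<in> Om (pinv g)" and "act (pinv g) (act g \<omega>) = \<omega>"
proof -
  have pg: "pinv g \<in> inv_hull" by (intro inv_hull.intros g)
  have W: "\<omega> \<in> Omega" using \<omega> Om_Omega by blast
  have e: "evn \<omega> (\<lambda>s. Some s = (pinv g \<circ>\<^sub>m g) s)"
    using evn_source[OF assms] by (rule evn_mono) (erule sym)
  have c: "pinv g \<circ>\<^sub>m g \<in> inv_hull" by (intro inv_hull.intros g)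
  note ac = act_cong[OF Some_hull c _ e]
  show "act g \<omega> \<in> Om (pinv g)" using Om_comp[OF pg g \<omega>] ac(1) W by simp
  show "act (pinv g) (act g \<omega>) = \<omega>"
    unfolding act_act[OF pg g] using ac(2) W act_Some[OF W] by simp
qed

text \<open>The sets of \<open>constructible_bar\<close> with value 1 at \<omega> are traces of
  neighbourhoods of \<omega>, and they include the traces of the basic ones. So the relation that
  defines the quotient groupoid says that g and h agree on S near \<omega>.\<close>

lemma bar_evn:
  assumes "\<omega> \<in> Omega"
  shows "(\<exists>X\<in>constructible_bar. char_ext \<omega> X \<and> g |` X = h |` X) \<longleftrightarrow> evn \<omega> (\<lambda>s. g s = h s)"
proof
  assume "\<exists>X\<in>constructible_bar. char_ext \<omega> X \<and> g |` X = h |` X"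
  then obtain X F where X: "X \<in> constructible" "finite F" "F \<subseteq> constructible" "\<omega> (pid X) = 1"
    "\<forall>Y\<in>F. \<omega> (pid Y) = 0" "g |` (X - \<Union>F) = h |` (X - \<Union>F)"
    by (auto simp: char_ext_def)
  have m: "pid Y \<in> idems \<and> dom (pid Y) = Y" if "Y \<in> constructible" for Y :: "'s set"
    using constructible_idem[OF that] pid_dom by metis
  have "evn \<omega> (\<lambda>s. s \<in> X)" using evn_dom[of "pid X" \<omega>] m[OF X(1)] X(4) by simp
  moreover have "evn \<omega> (\<lambda>s. s \<notin> \<Union>F)" using X(2,3,5)
  proof (induction F)
    case empty then show ?case by (simp add: evn_True)
  next
    case (insert Y F)
    have "evn \<omega> (\<lambda>s. s \<notin> Y)" using evn_not_dom[of "pid Y" \<omega>] m[of Y] insert by simp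
    moreover have "evn \<omega> (\<lambda>s. s \<notin> \<Union>F)" using insert by simp
    ultimately show ?case by (rule evn_mono[OF evn_conj]) auto
  qed
  ultimately show "evn \<omega> (\<lambda>s. g s = h s)"
  proof (rule evn_mono[OF evn_conj])
    fix s assume "s \<in> X \<and> s \<notin> \<Union>F"
    then show "g s = h s" using fun_cong[OF X(6), of s] by (auto simp: restrict_map_def)
  qed
next
  assume "evn \<omega> (\<lambda>s. g s = h s)"
  then obtain P where P: "finite P" "P \<subseteq> idems" "\<And>s. (\<forall>p\<in>P. \<omega> p = point_char s p) \<Longrightarrow> g s = h s"
    by (auto simp: evn_def)
  \<comment> \<open>Ideals with value 1 are intersected into one and those with value 0 removed;
    what remains are exactly the points that agree with \<omega> on \<open>P\<close>.\<close>
  obtain q where q: "q \<in> idems" "dom q = (\<Inter>p\<in>{p \<in> P. \<omega> p = 1}. dom p)"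
    using idem_Inter[of "{p \<in> P. \<omega> p = 1}"] P by auto
  let ?F = "dom ` {p \<in> P. \<omega> p \<noteq> 1}"
  let ?X = "dom q - \<Union>?F"
  have m: "dom p \<in> constructible" if "p \<in> idems" for p :: "'s \<rightharpoonup> 's"
    using that constructible_dom idem_hull by blast
  have F: "finite ?F" "?F \<subseteq> constructible" using P m by auto
  have "evn \<omega> (\<lambda>s. s \<in> dom q)" unfolding evn_def q(2)
  proof (intro exI[of _ P] conjI allI impI P(1,2))
    fix s assume s: "\<forall>p\<in>P. \<omega> p = point_char s p"
    have "s \<in> dom p" if "p \<in> P" "\<omega> p = 1" for p
    proof -
      have "p \<in> idems" "point_char s p = 1" using that s P(2) by auto
      then show ?thesis by (simp add: point_char_apply split: if_splits)
    qed
    then show "s \<in> (\<Inter>p\<in>{p \<in> P. \<omega> p = 1}. dom p)" by blast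
  qed
  then have "\<omega> q = 1" using evn_dom_iff[OF assms q(1)] by blast
  moreover have "\<omega> p = 0" if "p \<in> P" "\<omega> p \<noteq> 1" for p using Omega_01[OF assms] P that by blast
  ultimately have "char_ext \<omega> ?X"
    unfolding char_ext_def using F m q(1) pid_dom P(2)
    by (intro bexI[of _ "dom q"] exI[of _ ?F]) (auto simp: subset_iff)
  moreover have "?X \<in> constructible_bar" using F m q(1) unfolding constructible_bar_def by blast
  moreover have "g |` ?X = h |` ?X"
  proof
    fix s
    show "(g |` ?X) s = (h |` ?X) s"
    proof (cases "s \<in> ?X")
      case True
      have "\<omega> p = point_char s p" if p: "p \<in> P" for p
      proof (cases "\<omega> p = 1")
        case 1: True
        then have "s \<in> dom p" using True p q(2) by auto
        then show ?thesis using 1 p P(2) by (simp add: point_char_apply subset_iff)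
      next
        case False
        then have "s \<notin> dom p" using True p by blast
        moreover have "\<omega> p = 0" using False p Omega_01[OF assms] P(2) by blast
        ultimately show ?thesis using p P(2) by (simp add: point_char_apply subset_iff)
      qed
      then show ?thesis using P(3) True by (simp add: restrict_map_def)
    qed simp
  qed
  ultimately show "\<exists>X\<in>constructible_bar. char_ext \<omega> X \<and> g |` X = h |` X" by blast
qed

end

section \<open>Groupoids of germs\<close>

text \<open>
  The common structure of the two groupoids: \<open>a g \<omega>\<close> is the arrow represented by
  \<open>g\<close> at \<open>\<omega>\<close>.  Two representatives may be identified as soon as they agree on an idempotent
  with value 1 at \<open>\<omega>\<close>, and must agree near \<open>\<omega>\<close> on \<open>S\<close>.
\<close>

locale germ_groupoid = left_cancellative S_type
  for S_type :: "'s::monoid_mult itself" +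
  fixes G :: "'g groupoid" and a :: "('s \<rightharpoonup> 's) \<Rightarrow> 's chr \<Rightarrow> 'g"
  assumes arrows_eq: "arrows G = {a g \<omega> | g \<omega>. g \<in> inv_hull \<and> \<omega> \<in> Om g}"
    and src: "g \<in> inv_hull \<Longrightarrow> \<omega> \<in> Om g \<Longrightarrow> gsrc G (a g \<omega>) = a Some \<omega>"
    and rng: "g \<in> inv_hull \<Longrightarrow> \<omega> \<in> Om g \<Longrightarrow> grng G (a g \<omega>) = a Some (act g \<omega>)"
    and mul: "g \<in> inv_hull \<Longrightarrow> h \<in> inv_hull \<Longrightarrow> \<omega> \<in> Om h \<Longrightarrow> act h \<omega> \<in> Om g \<Longrightarrow>
      gmul G (a g (act h \<omega>)) (a h \<omega>) = a (g \<circ>\<^sub>m h) \<omega>"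
    and inv: "g \<in> inv_hull \<Longrightarrow> \<omega> \<in> Om g \<Longrightarrow> ginv G (a g \<omega>) = a (pinv g) (act g \<omega>)"
    and unit_inj: "\<omega> \<in> Omega \<Longrightarrow> \<psi> \<in> Omega \<Longrightarrow> a Some \<omega> = a Some \<psi> \<Longrightarrow> \<omega> = \<psi>"
    and eqI: "g \<in> inv_hull \<Longrightarrow> h \<in> inv_hull \<Longrightarrow> \<omega> \<in> Om g \<Longrightarrow> \<omega> \<in> Om h \<Longrightarrow> p \<in> idems \<Longrightarrow>
      \<omega> p = 1 \<Longrightarrow> g \<circ>\<^sub>m p = h \<circ>\<^sub>m p \<Longrightarrow> a g \<omega> = a h \<omega>"
    and eqD: "g \<in> inv_hull \<Longrightarrow> h \<in> inv_hull \<Longrightarrow> \<omega> \<in> Om g \<Longrightarrow> \<omega> \<in> Om h \<Longrightarrow> a g \<omega> = a h \<omega> \<Longrightarrow>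
      evn \<omega> (\<lambda>s. g s = h s)"
    and open_eq: "g \<in> inv_hull \<Longrightarrow> h \<in> inv_hull \<Longrightarrow>
      openin Otop {\<omega> \<in> Om g \<inter> Om h. a g \<omega> = a h \<omega>}"
    and openin_iff: "openin (gtop G) W \<longleftrightarrow>
      W \<subseteq> arrows G \<and> (\<forall>g\<in>inv_hull. openin Otop {\<omega> \<in> Om g. a g \<omega> \<in> W})"
begin

section \<open>Arrows, units and bisections\<close>

lemma arrowI [intro]: "g \<in> inv_hull \<Longrightarrow> \<omega> \<in> Om g \<Longrightarrow> a g \<omega> \<in> arrows G"
  using arrows_eq by auto

lemma arrowE:
  assumes "\<gamma> \<in> arrows G" obtains g \<omega> where "g \<in> inv_hull" "\<omega> \<in> Om g" "\<gamma> = a g \<omega>"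
  using assms arrows_eq by auto

lemma src_inj:
  assumes "g \<in> inv_hull" "h \<in> inv_hull" "\<omega> \<in> Om g" "\<psi> \<in> Om h" "a g \<omega> = a h \<psi>"
  shows "\<omega> = \<psi>"
  using src[OF assms(1,3)] src[OF assms(2,4)] assms(5) unit_inj[OF Om_Omega[OF assms(3)] Om_Omega[OF assms(4)]]
  by simp

lemma gunits_eq: "gunits G = a Some ` Omega"
proof
  show "gunits G \<subseteq> a Some ` Omega"
    unfolding gunits_def using src Om_Omega by (auto elim!: arrowE)
  show "a Some ` Omega \<subseteq> gunits G"
  proof safe
    fix \<omega> assume "\<omega> \<in> (Omega :: 's chr set)"
    then have "a Some \<omega> \<in> arrows G" "gsrc G (a Some \<omega>) = a Some \<omega>"
      using src[OF Some_hull] arrowI[OF Some_hull] by auto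
    then show "a Some \<omega> \<in> gunits G" unfolding gunits_def by (metis imageI)
  qed
qed

lemma sfibre_eq: "\<omega> \<in> Omega \<Longrightarrow> sfibre G (a Some \<omega>) = {a g \<omega> | g. g \<in> inv_hull \<and> \<omega> \<in> Om g}"
  unfolding sfibre_def using src Om_Omega unit_inj by (auto elim!: arrowE) metis+

lemma sfibre_out: "x \<notin> gunits G \<Longrightarrow> sfibre G x = {}"
  by (auto simp: sfibre_def gunits_def)

text \<open>
  Left multiplication by the inverse of the bisection \<open>{a k \<omega> | \<omega>}\<close> is the injection \<open>shift k\<close>,
  defined on the arrows \<open>shift_dom k\<close> whose range lies in the range of the bisection.
\<close>

definition range_char :: "'g \<Rightarrow> 's chr" where
  "range_char \<gamma> = (THE \<eta>. \<eta> \<in> Omega \<and> grng G \<gamma> = a Some \<eta>)"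

lemma range_char_eq: "g \<in> inv_hull \<Longrightarrow> \<omega> \<in> Om g \<Longrightarrow> range_char (a g \<omega>) = act g \<omega>"
  unfolding range_char_def using rng[of g \<omega>] act_Omega[of g \<omega>] unit_inj by (intro the_equality) auto

definition shift_dom :: "('s \<rightharpoonup> 's) \<Rightarrow> 'g set" where
  "shift_dom k = {\<gamma> \<in> arrows G. range_char \<gamma> \<in> Om (pinv k)}"

definition shift :: "('s \<rightharpoonup> 's) \<Rightarrow> 'g \<Rightarrow> 'g" where
  "shift k \<gamma> = gmul G (a (pinv k) (range_char \<gamma>)) \<gamma>"

lemma shift_dom_iff:
  assumes "k \<in> inv_hull" "g \<in> inv_hull" "\<omega> \<in> Om g"
  shows "a g \<omega> \<in> shift_dom k \<longleftrightarrow> \<omega> \<in> Om (pinv k \<circ>\<^sub>m g)"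
  using assms Om_comp[of "pinv k" g \<omega>] by (auto simp: shift_dom_def range_char_eq inv_hull.intros)

lemma shift_eq:
  assumes "k \<in> inv_hull" "g \<in> inv_hull" "\<omega> \<in> Om (pinv k \<circ>\<^sub>m g)"
  shows "shift k (a g \<omega>) = a (pinv k \<circ>\<^sub>m g) \<omega>"
proof -
  have pk: "pinv k \<in> inv_hull" using assms inv_hull.intros by blast
  have g: "\<omega> \<in> Om g" by (rule Om_compD[OF pk assms(2,3)])
  show ?thesis unfolding shift_def range_char_eq[OF assms(2) g]
    by (rule mul[OF pk assms(2) g]) (use Om_comp[OF pk assms(2) g] assms(3) in simp)
qed

text \<open>The maps k k^{-1} g and g agree on the domain of k^{-1} g, and the idempotent of that
  domain has value 1 at \<omega>.\<close>

lemma cancel_left: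
  assumes k: "k \<in> inv_hull" and g: "g \<in> inv_hull" and \<omega>: "\<omega> \<in> Om (pinv k \<circ>\<^sub>m g)"
  shows "\<omega> \<in> Om (k \<circ>\<^sub>m (pinv k \<circ>\<^sub>m g))" and "a (k \<circ>\<^sub>m (pinv k \<circ>\<^sub>m g)) \<omega> = a g \<omega>"
proof -
  have pk: "pinv k \<in> inv_hull" using k inv_hull.intros by blast
  let ?m = "pinv k \<circ>\<^sub>m g"
  have m: "?m \<in> inv_hull" by (intro inv_hull.intros pk g)
  have km: "k \<circ>\<^sub>m ?m \<in> inv_hull" by (intro inv_hull.intros k m)
  have W: "\<omega> \<in> Omega" using \<omega> Om_Omega by blast
  have og: "\<omega> \<in> Om g" by (rule Om_compD[OF pk g \<omega>])
  have "evn \<omega> (\<lambda>s. s \<in> dom ?m)" using \<omega> Om_iff[OF m] by blast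
  then have "evn \<omega> (\<lambda>s. s \<in> dom (k \<circ>\<^sub>m ?m))"
    by (rule evn_mono) (auto simp: dom_def pinv_iff[OF k])
  then show ok: "\<omega> \<in> Om (k \<circ>\<^sub>m ?m)" using Om_iff[OF km] W by blast
  let ?p = "pinv ?m \<circ>\<^sub>m ?m"
  have p: "?p \<in> idems" by (rule idem_source[OF m])
  have "(k \<circ>\<^sub>m ?m) \<circ>\<^sub>m ?p = g \<circ>\<^sub>m ?p"
  proof (rule map_eqI)
    fix x y
    have px: "?p x = Some z \<longleftrightarrow> z = x \<and> x \<in> dom ?m" for z
      using idem_iff[OF p, of x z] dom_source[OF m] by simp
    show "((k \<circ>\<^sub>m ?m) \<circ>\<^sub>m ?p) x = Some y \<longleftrightarrow> (g \<circ>\<^sub>m ?p) x = Some y"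
      unfolding map_comp_Some_iff[of _ ?p] px by (auto simp: pinv_iff[OF k])
  qed
  moreover have "\<omega> ?p = 1" using \<omega> by (simp add: Om_def)
  ultimately show "a (k \<circ>\<^sub>m ?m) \<omega> = a g \<omega>" using eqI[OF km g ok og p] by blast
qed

text \<open>Multiplications by the bisections of k^{-1} and of k undo each other, by
  \<open>cancel_left\<close>; sources do not change, so \<open>shift k\<close> acts within each
  source fibre.\<close>

lemma shift_props:
  assumes k: "k \<in> inv_hull" and \<gamma>: "\<gamma> \<in> shift_dom k"
  shows "shift k \<gamma> \<in> shift_dom (pinv k)" and "shift (pinv k) (shift k \<gamma>) = \<gamma>" and "gsrc G (shift k \<gamma>) = gsrc G \<gamma>"
proof -
  have pk: "pinv k \<in> inv_hull" using k inv_hull.intros by blast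
  obtain g \<omega> where g: "g \<in> inv_hull" "\<omega> \<in> Om g" "\<gamma> = a g \<omega>" using \<gamma> by (auto simp: shift_dom_def elim: arrowE)
  let ?m = "pinv k \<circ>\<^sub>m g"
  have m: "?m \<in> inv_hull" by (intro inv_hull.intros pk g)
  have \<omega>: "\<omega> \<in> Om ?m" using \<gamma> shift_dom_iff[OF k g(1,2)] g(3) by simp
  have t: "shift k \<gamma> = a ?m \<omega>" unfolding g(3) by (rule shift_eq[OF k g(1) \<omega>])
  note c = cancel_left[OF k g(1) \<omega>]
  show "shift k \<gamma> \<in> shift_dom (pinv k)"
    unfolding t shift_dom_iff[OF pk m \<omega>] pinv_pinv[OF k] by (rule c(1))
  show "shift (pinv k) (shift k \<gamma>) = \<gamma>"
    unfolding t using shift_eq[OF pk m] c pinv_pinv[OF k] g(3) by simp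
  show "gsrc G (shift k \<gamma>) = gsrc G \<gamma>"
    using t g(3) src[OF m \<omega>] src[OF g(1,2)] by simp
qed

lemma shift_inj: "k \<in> inv_hull \<Longrightarrow> inj_on (shift k) (shift_dom k)"
  by (rule inj_on_inverseI) (rule shift_props(2))

lemma shift_sfibre: "k \<in> inv_hull \<Longrightarrow> \<gamma> \<in> shift_dom k \<Longrightarrow> shift k \<gamma> \<in> sfibre G x \<longleftrightarrow> \<gamma> \<in> sfibre G x"
  using shift_props(1,3)[of k \<gamma>] by (auto simp: sfibre_def shift_dom_def)

definition supp_on :: "('s \<rightharpoonup> 's) \<Rightarrow> ('g \<Rightarrow> complex) \<Rightarrow> bool" where
  "supp_on k f \<longleftrightarrow> (\<forall>h. h \<notin> a k ` Om k \<longrightarrow> f h = 0)"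

text \<open>\<open>act k\<close> is injective on \<open>Om k\<close>, so a bisection meets a range
  fibre in at most one arrow, whose source is found by acting with k^{-1} on the range.\<close>

lemma bisection_rfibre:
  assumes k: "k \<in> inv_hull" and \<gamma>: "\<gamma> \<in> arrows G"
  shows "rfibre G (grng G \<gamma>) \<inter> a k ` Om k =
    (if \<gamma> \<in> shift_dom k then {a k (act (pinv k) (range_char \<gamma>))} else {})"
proof -
  have pk: "pinv k \<in> inv_hull" using k inv_hull.intros by blast
  obtain g \<omega> where g: "g \<in> inv_hull" "\<omega> \<in> Om g" "\<gamma> = a g \<omega>" using \<gamma> by (auto elim: arrowE)
  let ?\<eta> = "act g \<omega>"
  have \<eta>: "?\<eta> \<in> Omega" by (rule act_Omega[OF g(1,2)])
  have r: "grng G \<gamma> = a Some ?\<eta>" "range_char \<gamma> = ?\<eta>" using g rng range_char_eq by auto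
  have *: "a k \<psi> \<in> rfibre G (grng G \<gamma>) \<longleftrightarrow> act k \<psi> = ?\<eta>" if "\<psi> \<in> Om k" for \<psi>
    using that rng[OF k that] unit_inj[OF act_Omega[OF k that] \<eta>] arrowI[OF k that] by (auto simp: rfibre_def r)
  have S: "rfibre G (grng G \<gamma>) \<inter> a k ` Om k = a k ` {\<psi> \<in> Om k. act k \<psi> = ?\<eta>}"
    using * by blast
  show ?thesis
  proof (cases "\<gamma> \<in> shift_dom k")
    case True
    then have e: "?\<eta> \<in> Om (pinv k)" using r by (simp add: shift_dom_def)
    have "act (pinv k) ?\<eta> \<in> Om k" "act k (act (pinv k) ?\<eta>) = ?\<eta>"
      using Om_pinv[OF pk e] pinv_pinv[OF k] by auto
    moreover have "\<psi> = act (pinv k) ?\<eta>" if "\<psi> \<in> Om k" "act k \<psi> = ?\<eta>" for \<psi>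
      using Om_pinv(2)[OF k that(1)] that(2) by simp
    ultimately have "{\<psi> \<in> Om k. act k \<psi> = ?\<eta>} = {act (pinv k) ?\<eta>}" by blast
    then show ?thesis unfolding S using True r(2) by simp
  next
    case False
    have "\<gamma> \<in> shift_dom k" if "\<psi> \<in> Om k" "act k \<psi> = ?\<eta>" for \<psi>
      using Om_pinv(1)[OF k that(1)] that(2) \<gamma> r(2) by (simp add: shift_dom_def)
    then have "{\<psi> \<in> Om k. act k \<psi> = ?\<eta>} = {}" using False by blast
    then show ?thesis unfolding S using False by simp
  qed
qed

text \<open>The convolution sum over the range fibre collapses to the single arrow of
  \<open>bisection_rfibre\<close>, and multiplying by its inverse is the shift.\<close>

lemma rho_bisection:
  assumes k: "k \<in> inv_hull" and f: "supp_on k f" and \<xi>: "\<xi> \<in> l2 (sfibre G x)"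
  shows "rho G x f \<xi> = (\<lambda>\<gamma>. if \<gamma> \<in> shift_dom k \<inter> sfibre G x
    then f (a k (act (pinv k) (range_char \<gamma>))) * \<xi> (shift k \<gamma>) else 0)"
proof
  fix \<gamma>
  show "rho G x f \<xi> \<gamma> = (if \<gamma> \<in> shift_dom k \<inter> sfibre G x then f (a k (act (pinv k) (range_char \<gamma>))) * \<xi> (shift k \<gamma>) else 0)"
  proof (cases "\<gamma> \<in> sfibre G x")
    case True
    then have \<gamma>: "\<gamma> \<in> arrows G" by (simp add: sfibre_def)
    let ?t = "\<lambda>h. f h * \<xi> (gmul G (ginv G h) \<gamma>)"
    have "rho G x f \<xi> \<gamma> = infsum ?t (rfibre G (grng G \<gamma>))"
      using True \<xi> by (simp add: rho_def)
    also have "\<dots> = infsum ?t (rfibre G (grng G \<gamma>) \<inter> a k ` Om k)"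
      by (rule infsum_cong_neutral) (use f in \<open>auto simp: supp_on_def\<close>)
    also have "\<dots> = (if \<gamma> \<in> shift_dom k then ?t (a k (act (pinv k) (range_char \<gamma>))) else 0)"
      unfolding bisection_rfibre[OF k \<gamma>] by simp
    also have "\<dots> = (if \<gamma> \<in> shift_dom k then f (a k (act (pinv k) (range_char \<gamma>))) * \<xi> (shift k \<gamma>) else 0)"
    proof (rule if_cong[OF refl _ refl])
      assume "\<gamma> \<in> shift_dom k"
      then have e: "range_char \<gamma> \<in> Om (pinv k)" by (simp add: shift_dom_def)
      have "act (pinv k) (range_char \<gamma>) \<in> Om k" "act k (act (pinv k) (range_char \<gamma>)) = range_char \<gamma>"
        using Om_pinv[OF inv_hull.intros(2)[OF k] e] pinv_pinv[OF k] by auto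
      then show "?t (a k (act (pinv k) (range_char \<gamma>))) = f (a k (act (pinv k) (range_char \<gamma>))) * \<xi> (shift k \<gamma>)"
        using inv[OF k] by (simp add: shift_def)
    qed
    finally show ?thesis using True by simp
  qed (use \<xi> in \<open>simp add: rho_def\<close>)
qed

lemma rho_out: "\<xi> \<notin> l2 (sfibre G x) \<Longrightarrow> rho G x f \<xi> = (\<lambda>_. 0)"
  by (simp add: rho_def)

text \<open>A function on one bisection acts as a weighted partial permutation, so in every fibre
  its operator norm is at most any bound on its values. This turns uniform approximation of
  functions into approximation in the reduced norm.\<close>

lemma rho_bounded:
  assumes k: "k \<in> inv_hull" and f: "supp_on k f" and C: "\<And>h. cmod (f h) \<le> C"
  shows "lin_op (sfibre G x) (rho G x f)" and "bnd (sfibre G x) (rho G x f) C"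
proof -
  have C0: "0 \<le> C" using order_trans[OF norm_ge_zero C] .
  note r = rho_bisection[OF k f]
  have inj: "inj_on (shift k) (shift_dom k \<inter> sfibre G x)" by (rule inj_on_subset[OF shift_inj[OF k]]) auto
  note w = l2_weighted_pinj[OF _ inj, where c = "\<lambda>\<gamma>. f (a k (act (pinv k) (range_char \<gamma>)))"
      and C = C and A = "sfibre G x", OF _ C C0]
  show "lin_op (sfibre G x) (rho G x f)"
    unfolding lin_op_def
  proof (intro conjI ballI allI impI)
    fix \<xi> assume \<xi>: "\<xi> \<in> l2 (sfibre G x)"
    show "rho G x f \<xi> \<in> l2 (sfibre G x)" unfolding r[OF \<xi>] by (rule w(1)[OF \<xi>]) auto
  qed (auto simp: rho_out r l2_add l2_scale algebra_simps)
  show "bnd (sfibre G x) (rho G x f) C"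
    unfolding bnd_def using C0 w(2) by (auto simp: r)
qed

text \<open>\<open>rho\<close> is an infinite sum, and additivity is applied to summable terms;
  finitely many nonzero values on each range fibre guarantee this and are inherited by sums.\<close>

definition rfin :: "('g \<Rightarrow> complex) \<Rightarrow> bool" where
  "rfin f \<longleftrightarrow> (\<forall>\<gamma>\<in>arrows G. finite {h \<in> rfibre G (grng G \<gamma>). f h \<noteq> 0})"

lemma rfin_supp_on: "k \<in> inv_hull \<Longrightarrow> supp_on k f \<Longrightarrow> rfin f"
  unfolding rfin_def
proof
  fix \<gamma> assume *: "k \<in> inv_hull" "supp_on k f" "\<gamma> \<in> arrows G"
  then have "{h \<in> rfibre G (grng G \<gamma>). f h \<noteq> 0} \<subseteq> rfibre G (grng G \<gamma>) \<inter> a k ` Om k"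
    by (auto simp: supp_on_def)
  then show "finite {h \<in> rfibre G (grng G \<gamma>). f h \<noteq> 0}"
    unfolding bisection_rfibre[OF *(1,3)] by (rule finite_subset) auto
qed

lemma rfin_add: "rfin f \<Longrightarrow> rfin g \<Longrightarrow> rfin (\<lambda>h. f h + g h)"
  unfolding rfin_def
proof
  fix \<gamma> assume *: "\<forall>\<gamma>\<in>arrows G. finite {h \<in> rfibre G (grng G \<gamma>). f h \<noteq> 0}"
    "\<forall>\<gamma>\<in>arrows G. finite {h \<in> rfibre G (grng G \<gamma>). g h \<noteq> 0}" "\<gamma> \<in> arrows G"
  have "{h \<in> rfibre G (grng G \<gamma>). f h + g h \<noteq> 0} \<subseteq>
    {h \<in> rfibre G (grng G \<gamma>). f h \<noteq> 0} \<union> {h \<in> rfibre G (grng G \<gamma>). g h \<noteq> 0}" by auto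
  then show "finite {h \<in> rfibre G (grng G \<gamma>). f h + g h \<noteq> 0}"
    by (rule finite_subset) (use * in auto)
qed

lemma rfin_scale: "rfin f \<Longrightarrow> rfin (\<lambda>h. c * f h)"
  unfolding rfin_def by (metis (mono_tags, lifting) Collect_mono finite_subset mult_zero_right)

lemma rho_add:
  assumes "rfin f" "rfin g" shows "rho G x (\<lambda>h. f h + g h) = add_op (rho G x f) (rho G x g)"
proof (intro ext)
  fix \<xi> \<gamma>
  show "rho G x (\<lambda>h. f h + g h) \<xi> \<gamma> = add_op (rho G x f) (rho G x g) \<xi> \<gamma>"
  proof (cases "\<xi> \<in> l2 (sfibre G x) \<and> \<gamma> \<in> sfibre G x")
    case True
    then have \<gamma>: "\<gamma> \<in> arrows G" by (simp add: sfibre_def)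
    have s: "(\<lambda>h. f h * \<xi> (gmul G (ginv G h) \<gamma>)) summable_on rfibre G (grng G \<gamma>)" if "rfin f" for f
    proof -
      have "(\<lambda>h. f h * \<xi> (gmul G (ginv G h) \<gamma>)) summable_on {h \<in> rfibre G (grng G \<gamma>). f h \<noteq> 0}"
        using that \<gamma> by (auto simp: rfin_def)
      then show ?thesis by (rule summable_on_cong_neutral[THEN iffD1, rotated -1]) auto
    qed
    show ?thesis using True infsum_add[OF s[OF assms(1)] s[OF assms(2)]]
      by (simp add: rho_def add_op_def distrib_right)
  qed (auto simp: rho_def add_op_def)
qed

lemma rho_scale: "rho G x (\<lambda>h. c * f h) = scale_op c (rho G x f)"
  by (auto simp: fun_eq_iff rho_def scale_op_def mult.assoc infsum_cmult_right')

text \<open>The function \<psi> on the unit space, moved to the bisection of k along the source map.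
  The description is unique because an arrow determines its source.\<close>

definition wt :: "('s \<rightharpoonup> 's) \<Rightarrow> ('s chr \<Rightarrow> complex) \<Rightarrow> 'g \<Rightarrow> complex" where
  "wt k \<psi> = (\<lambda>\<gamma>. if \<gamma> \<in> a k ` Om k then \<psi> (THE \<omega>. \<omega> \<in> Om k \<and> \<gamma> = a k \<omega>) else 0)"

lemma wt_apply: "k \<in> inv_hull \<Longrightarrow> \<omega> \<in> Om k \<Longrightarrow> wt k \<psi> (a k \<omega>) = \<psi> \<omega>"
proof -
  assume *: "k \<in> inv_hull" "\<omega> \<in> Om k"
  then have "(THE \<omega>'. \<omega>' \<in> Om k \<and> a k \<omega> = a k \<omega>') = \<omega>"
    using src_inj by (intro the_equality) auto
  then show ?thesis using * by (simp add: wt_def)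
qed

lemma wt_supp: "supp_on k (wt k \<psi>)"
  by (simp add: supp_on_def wt_def)

abbreviation ind :: "('s \<rightharpoonup> 's) \<Rightarrow> 'g \<Rightarrow> complex" where
  "ind k \<equiv> wt k (\<lambda>_. 1)"

lemma ind_eq: "ind k = (\<lambda>\<gamma>. if \<gamma> \<in> a k ` Om k then 1 else 0)"
  by (simp add: wt_def)

text \<open>The image of the hull element k in the reduced algebra, as a family over the
  fibres.\<close>

definition R :: "('s \<rightharpoonup> 's) \<Rightarrow> 'g op_family" where
  "R k x = rho G x (ind k)"

lemma R_apply:
  assumes k: "k \<in> inv_hull" and \<xi>: "\<xi> \<in> l2 (sfibre G x)"
  shows "R k x \<xi> = (\<lambda>\<gamma>. if \<gamma> \<in> shift_dom k \<inter> sfibre G x then \<xi> (shift k \<gamma>) else 0)"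
proof -
  have "ind k (a k (act (pinv k) (range_char \<gamma>))) = 1" if "\<gamma> \<in> shift_dom k" for \<gamma>
    using that Om_pinv(1)[OF inv_hull.intros(2)[OF k], of "range_char \<gamma>"] pinv_pinv[OF k]
    by (intro wt_apply k) (simp add: shift_dom_def)
  then show ?thesis unfolding R_def rho_bisection[OF k wt_supp \<xi>] by auto
qed

lemma R_lin: "k \<in> inv_hull \<Longrightarrow> lin_op (sfibre G x) (R k x)"
  and R_bnd: "k \<in> inv_hull \<Longrightarrow> bnd (sfibre G x) (R k x) 1"
  unfolding R_def by (rule rho_bounded[OF _ wt_supp, where C = 1]; simp add: ind_eq)+

lemma R_bounded: "k \<in> inv_hull \<Longrightarrow> R k x \<in> bounded_ops (sfibre G x)"
  using bounded_opsI R_lin R_bnd by blast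

lemma R_out: "x \<notin> gunits G \<Longrightarrow> R k x = zero_op"
  by (auto simp: fun_eq_iff R_def rho_def sfibre_out zero_op_def)

text \<open>\<open>R k\<close> precomposes with \<open>shift k\<close>, which multiplies by k^{-1}.
  Successive precompositions reverse the order, and (kl)^{-1} = l^{-1}k^{-1} reverses it
  back.\<close>

lemma R_comp:
  assumes k: "k \<in> inv_hull" and l: "l \<in> inv_hull"
  shows "R k x \<circ> R l x = R (k \<circ>\<^sub>m l) x"
proof (intro ext)
  fix \<xi> \<gamma>
  have kl: "k \<circ>\<^sub>m l \<in> inv_hull" by (intro inv_hull.intros k l)
  show "(R k x \<circ> R l x) \<xi> \<gamma> = R (k \<circ>\<^sub>m l) x \<xi> \<gamma>"
  proof (cases "\<xi> \<in> l2 (sfibre G x) \<and> \<gamma> \<in> sfibre G x")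
    case True
    then have \<xi>: "\<xi> \<in> l2 (sfibre G x)" and \<gamma>: "\<gamma> \<in> sfibre G x" by auto
    obtain g \<omega> where g: "g \<in> inv_hull" "\<omega> \<in> Om g" "\<gamma> = a g \<omega>" using \<gamma> by (auto simp: sfibre_def elim: arrowE)
    have pk: "pinv k \<in> inv_hull" "pinv l \<in> inv_hull" using k l inv_hull.intros by blast+
    let ?m = "pinv k \<circ>\<^sub>m g"
    have m: "?m \<in> inv_hull" by (intro inv_hull.intros pk g)
    have e: "pinv (k \<circ>\<^sub>m l) \<circ>\<^sub>m g = pinv l \<circ>\<^sub>m ?m" by (simp add: pinv_comp k l map_comp_assoc)
    have 1: "(R k x \<circ> R l x) \<xi> \<gamma> = (if \<gamma> \<in> shift_dom k \<and> shift k \<gamma> \<in> shift_dom l then \<xi> (shift l (shift k \<gamma>)) else 0)"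
      using \<gamma> shift_sfibre[OF k, of \<gamma> x]
      by (simp add: R_apply[OF k lin_op_in[OF R_lin[OF l]]]) (simp add: R_apply[OF l \<xi>])
    have 2: "R (k \<circ>\<^sub>m l) x \<xi> \<gamma> = (if \<gamma> \<in> shift_dom (k \<circ>\<^sub>m l) then \<xi> (shift (k \<circ>\<^sub>m l) \<gamma>) else 0)"
      using \<gamma> by (simp add: R_apply[OF kl \<xi>])
    have 3: "\<gamma> \<in> shift_dom k \<and> shift k \<gamma> \<in> shift_dom l \<longleftrightarrow> \<gamma> \<in> shift_dom (k \<circ>\<^sub>m l)"
      unfolding g(3) shift_dom_iff[OF k g(1,2)] shift_dom_iff[OF kl g(1,2)] e
      using shift_eq[OF k g(1)] shift_dom_iff[OF l m] Om_compD[OF pk(2) m] by auto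
    have 4: "shift l (shift k \<gamma>) = shift (k \<circ>\<^sub>m l) \<gamma>" if "\<gamma> \<in> shift_dom (k \<circ>\<^sub>m l)"
    proof -
      have o: "\<omega> \<in> Om (pinv l \<circ>\<^sub>m ?m)" using that shift_dom_iff[OF kl g(1,2)] g(3) e by simp
      have "\<omega> \<in> Om ?m" by (rule Om_compD[OF pk(2) m o])
      then show ?thesis using shift_eq[OF k g(1)] shift_eq[OF l m o] shift_eq[OF kl g(1)] o g(3) e by simp
    qed
    show ?thesis unfolding 1 2 using 3 4 by auto
  next
    case False
    then show ?thesis
      using l2_zero[OF lin_op_in[OF R_lin[OF k]]] l2_zero[OF lin_op_in[OF R_lin[OF kl]]]
      by (auto simp: lin_op_out[OF R_lin[OF l]] lin_op_out[OF R_lin[OF kl]] lin_op_zero[OF R_lin[OF k]])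
  qed
qed

lemma R_delta:
  assumes k: "k \<in> inv_hull" and i: "i \<in> sfibre G x"
  shows "R k x (l2_delta i) = (if i \<in> shift_dom (pinv k) then l2_delta (shift (pinv k) i) else (\<lambda>_. 0))"
proof
  fix \<gamma>
  have pk: "pinv k \<in> inv_hull" using k inv_hull.intros by blast
  have "\<gamma> \<in> shift_dom k \<inter> sfibre G x \<and> shift k \<gamma> = i \<longleftrightarrow> i \<in> shift_dom (pinv k) \<and> \<gamma> = shift (pinv k) i"
    using shift_props[OF k, of \<gamma>] shift_props[OF pk, of i] pinv_pinv[OF k] shift_sfibre[OF pk, of i x] i by auto
  then show "R k x (l2_delta i) \<gamma> = (if i \<in> shift_dom (pinv k) then l2_delta (shift (pinv k) i) else (\<lambda>_. 0)) \<gamma>"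
    unfolding R_apply[OF k l2_delta_in[OF i]] by (auto simp: l2_delta_def)
qed

text \<open>\<open>shift k\<close> and \<open>shift (pinv k)\<close> are mutually inverse partial
  bijections of the fibre, so the matrix of one is the transpose of the other.\<close>

lemma R_adj:
  assumes k: "k \<in> inv_hull" shows "adj (sfibre G x) (R k x) = R (pinv k) x"
proof (intro ext)
  fix \<eta> i
  have pk: "pinv k \<in> inv_hull" using k inv_hull.intros by blast
  show "adj (sfibre G x) (R k x) \<eta> i = R (pinv k) x \<eta> i"
  proof (cases "\<eta> \<in> l2 (sfibre G x) \<and> i \<in> sfibre G x")
    case True
    then show ?thesis
      by (simp add: adj_def R_delta[OF k] R_apply[OF pk] inner_delta_right) (simp add: l2_inner_def)
  next
    case False
    then show ?thesis using lin_op_out[OF R_lin[OF pk]] l2_zero[OF lin_op_in[OF R_lin[OF pk]]]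
      by (auto simp: adj_def)
  qed
qed

text \<open>The linear span of the \<open>R k\<close>, built by adding one multiple of a generator
  at a time, so that the algebra properties follow by induction.\<close>

inductive_set A0 :: "'g op_family set" where
  A0_zero: "(\<lambda>x. zero_op) \<in> A0"
| A0_step: "T \<in> A0 \<Longrightarrow> k \<in> inv_hull \<Longrightarrow> (\<lambda>x. add_op (T x) (scale_op c (R k x))) \<in> A0"

lemma A0_out: "T \<in> A0 \<Longrightarrow> x \<notin> gunits G \<Longrightarrow> T x = zero_op"
  by (induction rule: A0.induct) (auto simp: R_out zero_op_def add_op_def scale_op_def)

lemma A0_bounded: "T \<in> A0 \<Longrightarrow> T x \<in> bounded_ops (sfibre G x)"
  by (induction rule: A0.induct)
    (auto intro!: bounded_ops_zero bounded_ops_add bounded_ops_scale R_bounded)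

lemma A0_add: "T \<in> A0 \<Longrightarrow> S \<in> A0 \<Longrightarrow> (\<lambda>x. add_op (S x) (T x)) \<in> A0"
proof (induction rule: A0.induct)
  case A0_zero then show ?case by (simp add: add_op_def zero_op_def)
next
  case (A0_step T k c)
  have "(\<lambda>x. add_op (add_op (S x) (T x)) (scale_op c (R k x))) \<in> A0"
    by (rule A0.A0_step) (use A0_step in auto)
  then show ?case by (simp add: add_op_def add.assoc)
qed

lemma A0_scale: "T \<in> A0 \<Longrightarrow> (\<lambda>x. scale_op d (T x)) \<in> A0"
proof (induction rule: A0.induct)
  case A0_zero then show ?case using A0.A0_zero by (simp add: scale_op_def zero_op_def)
next
  case (A0_step T k c)
  have "(\<lambda>x. add_op (scale_op d (T x)) (scale_op (d * c) (R k x))) \<in> A0"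
    by (rule A0.A0_step) (use A0_step in auto)
  then show ?case by (simp add: add_op_def scale_op_def algebra_simps)
qed

lemma A0_R: "k \<in> inv_hull \<Longrightarrow> R k \<in> A0"
  using A0.A0_step[OF A0.A0_zero, of k 1] by (simp add: add_op_def zero_op_def scale_op_def)

text \<open>Two nested inductions: the outer one reduces the right factor to a generator, the inner
  one runs over the left factor and uses \<open>R_comp\<close>.\<close>

lemma A0_comp: "T \<in> A0 \<Longrightarrow> S \<in> A0 \<Longrightarrow> (\<lambda>x. S x \<circ> T x) \<in> A0"
proof (induction rule: A0.induct)
  case A0_zero
  have "(\<lambda>x. S x \<circ> zero_op) = (\<lambda>x. zero_op)"
    using lin_op_zero[OF bounded_lin[OF A0_bounded[OF A0_zero]]] by (auto simp: fun_eq_iff zero_op_def)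
  then show ?case using A0.A0_zero by (simp only:)
next
  case (A0_step T k c)
  have SR: "(\<lambda>x. S x \<circ> R k x) \<in> A0" using A0_step.prems
  proof (induction rule: A0.induct)
    case A0_zero
    then show ?case using A0.A0_zero by (simp add: zero_op_def o_def)
  next
    case (A0_step S l d)
    have "(\<lambda>x. add_op (S x \<circ> R k x) (scale_op d (R (l \<circ>\<^sub>m k) x))) \<in> A0"
      by (rule A0.A0_step[OF A0_step.IH]) (intro inv_hull.intros \<open>k \<in> inv_hull\<close> A0_step.hyps)
    moreover have "(\<lambda>x. add_op (S x \<circ> R k x) (scale_op d (R (l \<circ>\<^sub>m k) x))) =
        (\<lambda>x. add_op (S x) (scale_op d (R l x)) \<circ> R k x)"
      using R_comp[OF A0_step.hyps(2) \<open>k \<in> inv_hull\<close>]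
      by (auto simp: add_op_def scale_op_def o_def fun_eq_iff)
    ultimately show ?case by (simp only:)
  qed
  have "(\<lambda>x. add_op (S x \<circ> T x) (scale_op c (S x \<circ> R k x))) \<in> A0"
    by (intro A0_add A0_scale SR A0_step)
  moreover have "(\<lambda>x. add_op (S x \<circ> T x) (scale_op c (S x \<circ> R k x))) =
      (\<lambda>x. S x \<circ> add_op (T x) (scale_op c (R k x)))"
  proof (intro ext)
    fix x \<xi> i
    note S = bounded_lin[OF A0_bounded[OF A0_step.prems], of x]
    note T = lin_op_in[OF bounded_lin[OF A0_bounded[OF A0_step.hyps(1)]], of x \<xi>]
    note Rk = lin_op_in[OF R_lin[OF A0_step.hyps(2)], of x \<xi>]
    show "add_op (S x \<circ> T x) (scale_op c (S x \<circ> R k x)) \<xi> i = (S x \<circ> add_op (T x) (scale_op c (R k x))) \<xi> i"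
      using lin_op_add[OF S T l2_scale[OF Rk, of c]] lin_op_scale[OF S Rk, of c]
      by (simp add: add_op_def scale_op_def)
  qed
  ultimately show ?case by (simp only:)
qed

lemma adj_add_op:
  assumes "lin_op A S" "lin_op A T" shows "adj A (add_op S T) = add_op (adj A S) (adj A T)"
  by (auto simp: fun_eq_iff adj_def add_op_def inner_add_right[OF lin_op_in[OF assms(1)] lin_op_in[OF assms(2)]])

lemma adj_scale_op: "adj A (scale_op c T) = scale_op (cnj c) (adj A T)"
  by (auto simp: fun_eq_iff adj_def scale_op_def inner_scale_right)

lemma A0_adj: "T \<in> A0 \<Longrightarrow> (\<lambda>x. adj (sfibre G x) (T x)) \<in> A0"
proof (induction rule: A0.induct)
  case A0_zero
  have "(\<lambda>x. adj (sfibre G x) zero_op) = (\<lambda>x. zero_op)"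
    by (auto simp: adj_def zero_op_def l2_inner_def fun_eq_iff)
  then show ?case using A0.A0_zero by simp
next
  case (A0_step T k c)
  have "(\<lambda>x. add_op (adj (sfibre G x) (T x)) (scale_op (cnj c) (R (pinv k) x))) \<in> A0"
    by (rule A0.A0_step) (use A0_step in \<open>auto intro: inv_hull.intros\<close>)
  moreover have "adj (sfibre G x) (add_op (T x) (scale_op c (R k x))) =
      add_op (adj (sfibre G x) (T x)) (scale_op (cnj c) (R (pinv k) x))" for x
    unfolding adj_add_op[OF bounded_lin[OF A0_bounded[OF A0_step.hyps(1)]] lin_op_scale_op[OF R_lin[OF A0_step.hyps(2)]]]
    by (simp add: adj_scale_op R_adj[OF A0_step.hyps(2)])
  ultimately show ?case by simp
qed

end

section \<open>Density of the span of the bisections\<close>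

lemma continuous_map_clopen_if:
  assumes C: "openin X C" "closedin X C" and f: "continuous_map (subtopology X C) Y f"
    and g: "continuous_map (subtopology X (topspace X - C)) Y g"
  shows "continuous_map X Y (\<lambda>x. if x \<in> C then f x else g x)"
  unfolding continuous_map_def
proof (intro conjI allI impI)
  have C': "openin X (topspace X - C)" using C by auto
  have sub: "C \<subseteq> topspace X" using C by (simp add: openin_subset)
  show "(\<lambda>x. if x \<in> C then f x else g x) \<in> topspace X \<rightarrow> topspace Y"
    using f g sub by (auto simp: continuous_map_def)
  fix U assume U: "openin Y U"
  have "openin X {x \<in> C. f x \<in> U}"
    using openin_continuous_map_preimage[OF f U] C(1) sub
    by (simp add: openin_open_subtopology Int_absorb1 topspace_subtopology)
  moreover have "openin X {x \<in> topspace X - C. g x \<in> U}"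
    using openin_continuous_map_preimage[OF g U] C'
    by (simp add: openin_open_subtopology Int_absorb1 topspace_subtopology)
  ultimately have "openin X ({x \<in> C. f x \<in> U} \<union> {x \<in> topspace X - C. g x \<in> U})" by (rule openin_Un)
  also have "{x \<in> C. f x \<in> U} \<union> {x \<in> topspace X - C. g x \<in> U} =
      {x \<in> topspace X. (if x \<in> C then f x else g x) \<in> U}" using sub by auto
  finally show "openin X {x \<in> topspace X. (if x \<in> C then f x else g x) \<in> U}" .
qed

context left_cancellative
begin

text \<open>The span of the indicators of the clopen sets \<open>\<omega> p = 1\<close>. The
  congruence rule lets only the values on \<Omega>(S) count.\<close>

inductive_set Fun :: "('s chr \<Rightarrow> complex) set" where
  Fun_zero: "(\<lambda>_. 0) \<in> Fun"
| Fun_step: "\<psi> \<in> Fun \<Longrightarrow> p \<in> idems \<Longrightarrow> (\<lambda>\<omega>. \<psi> \<omega> + c * (if \<omega> p = 1 then 1 else 0)) \<in> Fun"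
| Fun_cong: "\<psi> \<in> Fun \<Longrightarrow> (\<And>\<omega>. \<omega> \<in> Omega \<Longrightarrow> \<psi> \<omega> = \<psi>' \<omega>) \<Longrightarrow> \<psi>' \<in> Fun"

lemma Fun_add: "\<psi> \<in> Fun \<Longrightarrow> \<theta> \<in> Fun \<Longrightarrow> (\<lambda>\<omega>. \<theta> \<omega> + \<psi> \<omega>) \<in> Fun"
proof (induction rule: Fun.induct)
  case (Fun_step \<psi> p c)
  have "(\<lambda>\<omega>. (\<theta> \<omega> + \<psi> \<omega>) + c * (if \<omega> p = 1 then 1 else 0)) \<in> Fun"
    by (rule Fun.Fun_step) (use Fun_step in auto)
  then show ?case by (simp add: add.assoc)
next
  case (Fun_cong \<psi> \<psi>')
  show ?case by (rule Fun.Fun_cong[OF Fun_cong.IH[OF Fun_cong.prems]]) (simp add: Fun_cong)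
qed simp

lemma Fun_scale: "\<psi> \<in> Fun \<Longrightarrow> (\<lambda>\<omega>. d * \<psi> \<omega>) \<in> Fun"
proof (induction rule: Fun.induct)
  case (Fun_step \<psi> p c)
  have "(\<lambda>\<omega>. d * \<psi> \<omega> + (d * c) * (if \<omega> p = 1 then 1 else 0)) \<in> Fun"
    by (rule Fun.Fun_step) (use Fun_step in auto)
  then show ?case by (simp add: distrib_left mult.assoc)
next
  case (Fun_cong \<psi> \<psi>')
  show ?case by (rule Fun.Fun_cong[OF Fun_cong.IH]) (simp add: Fun_cong)
qed (simp add: Fun.Fun_zero)

lemma Fun_const: "(\<lambda>_. c) \<in> Fun"
proof -
  have "(\<lambda>\<omega> :: 's chr. 0 + c * (if \<omega> Some = 1 then 1 else 0)) \<in> Fun" by (intro Fun.intros) simp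
  then show ?thesis
    by (rule Fun_cong) (use evn_dom_iff[OF _ idem_Some] in \<open>auto intro: evn_True\<close>)
qed

lemma Omega_mult:
  "\<omega> \<in> Omega \<Longrightarrow> (p :: 's \<rightharpoonup> 's) \<in> idems \<Longrightarrow> q \<in> idems \<Longrightarrow> \<omega> (p \<circ>\<^sub>m q) = 1 \<longleftrightarrow> \<omega> p = 1 \<and> \<omega> q = 1"
  using Omega_chars[of \<omega>] by (auto simp: chars_def)

lemma Fun_mult: "\<psi> \<in> Fun \<Longrightarrow> q \<in> idems \<Longrightarrow> (\<lambda>\<omega>. if \<omega> q = 1 then \<psi> \<omega> else 0) \<in> Fun"
proof (induction rule: Fun.induct)
  case Fun_zero
  then show ?case by (simp add: Fun.Fun_zero)
next
  case (Fun_step \<psi> p c)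
  have "(\<lambda>\<omega>. (if \<omega> q = 1 then \<psi> \<omega> else 0) + c * (if \<omega> (p \<circ>\<^sub>m q) = 1 then 1 else 0)) \<in> Fun"
    by (rule Fun.Fun_step) (use Fun_step idem_comp in auto)
  then show ?case
    by (rule Fun.Fun_cong) (use Fun_step in \<open>auto simp: Omega_mult simp del: One_nat_def\<close>)
next
  case (Fun_cong \<psi> \<psi>')
  show ?case by (rule Fun.Fun_cong[OF Fun_cong.IH[OF Fun_cong.prems]]) (simp add: Fun_cong)
qed

text \<open>A condition \<open>\<omega> p = 1\<close> is imposed by multiplication, a condition
  \<open>\<omega> p = 0\<close> by subtracting the part where the value is 1.\<close>

lemma Fun_cylinder:
  assumes "finite P" "P \<subseteq> idems" "\<omega> \<in> Omega" "\<psi> \<in> Fun"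
  shows "(\<lambda>\<omega>'. if \<forall>p\<in>P. \<omega>' p = \<omega> p then \<psi> \<omega>' else 0) \<in> Fun"
  using assms(1,2)
proof (induction P)
  case empty
  then show ?case by (simp add: assms)
next
  case (insert p P)
  let ?f = "\<lambda>\<omega>'. if \<forall>p\<in>P. \<omega>' p = \<omega> p then \<psi> \<omega>' else 0"
  have f: "?f \<in> Fun" and p: "p \<in> idems" using insert by auto
  have fp: "(\<lambda>\<omega>'. if \<omega>' p = 1 then ?f \<omega>' else 0) \<in> Fun" by (rule Fun_mult[OF f p])
  show ?case
  proof (cases "\<omega> p = 1")
    case True
    show ?thesis by (rule Fun_cong[OF fp]) (use True in auto)
  next
    case False
    then have "\<omega> p = 0" using Omega_01[OF assms(3) p] by simp
    have "(\<lambda>\<omega>'. ?f \<omega>' + (-1) * (if \<omega>' p = 1 then ?f \<omega>' else 0)) \<in> Fun"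
      by (intro Fun_add Fun_scale f fp)
    then show ?thesis
    proof (rule Fun_cong)
      fix \<omega>' :: "'s chr" assume "\<omega>' \<in> Omega"
      then have "\<omega>' p = 0 \<or> \<omega>' p = 1" using Omega_01 p by blast
      then show "?f \<omega>' + (-1) * (if \<omega>' p = 1 then ?f \<omega>' else 0) =
          (if \<forall>p\<in>insert p P. \<omega>' p = \<omega> p then \<psi> \<omega>' else 0)"
        using \<open>\<omega> p = 0\<close> by auto
    qed
  qed
qed

definition cyl :: "('s \<rightharpoonup> 's) set \<Rightarrow> 's chr \<Rightarrow> 's chr set" where
  "cyl P \<omega> = {\<omega>' \<in> Omega. \<forall>p\<in>P. \<omega>' p = \<omega> p}"

lemma clopen_cyl:
  assumes "finite P" "P \<subseteq> idems"
  shows "openin Otop (cyl P \<omega>)" and "closedin Otop (cyl P \<omega>)"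
proof -
  show "openin Otop (cyl P \<omega>)"
    unfolding openin_Otop cyl_def using assms by (intro conjI ballI exI[of _ P]) auto
  have "openin Otop (Omega - cyl P \<omega>)"
    unfolding openin_Otop cyl_def using assms by (intro conjI ballI exI[of _ P]) auto
  then show "closedin Otop (cyl P \<omega>)" by (auto simp: closedin_def cyl_def)
qed

lemma openin_cyl:
  assumes "openin Otop U" "\<omega> \<in> U"
  obtains P where "finite P" "P \<subseteq> idems" "cyl P \<omega> \<subseteq> U" "\<omega> \<in> cyl P \<omega>"
proof -
  obtain P where "finite P" "P \<subseteq> idems" "\<forall>\<psi>\<in>Omega. (\<forall>p\<in>P. \<psi> p = \<omega> p) \<longrightarrow> \<psi> \<in> U"
    using assms unfolding openin_Otop by blast
  moreover have "\<omega> \<in> Omega" using assms openin_subset by fastforce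
  ultimately show ?thesis using that[of P] unfolding cyl_def by blast
qed

text \<open>Cylinders form a basis of the compact space \<Omega>(S), so finitely many of them, on
  each of which the function stays within e of one of its values, form a cover; these constants are
  then written in one cylinder after another.\<close>

lemma Fun_approx:
  assumes \<phi>: "continuous_map Otop euclidean \<phi>" and e: "0 < e"
  shows "\<exists>\<psi>\<in>Fun. \<forall>\<omega>\<in>Omega. cmod (\<phi> \<omega> - \<psi> \<omega>) \<le> e"
proof -
  let ?U = "{cyl P \<omega> | P \<omega>. finite P \<and> P \<subseteq> idems \<and> \<omega> \<in> Omega \<and> (\<forall>\<omega>'\<in>cyl P \<omega>. cmod (\<phi> \<omega>' - \<phi> \<omega>) \<le> e)}"
  have cov: "Omega \<subseteq> \<Union>?U"
  proof
    fix \<omega> :: "'s chr" assume \<omega>: "\<omega> \<in> Omega"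
    have "openin Otop {\<omega>' \<in> topspace Otop. \<phi> \<omega>' \<in> ball (\<phi> \<omega>) e}"
      by (rule openin_continuous_map_preimage[OF \<phi>]) simp
    moreover have "\<omega> \<in> {\<omega>' \<in> topspace Otop. \<phi> \<omega>' \<in> ball (\<phi> \<omega>) e}" using \<omega> e by simp
    ultimately obtain P where P: "finite P" "P \<subseteq> idems" "cyl P \<omega> \<subseteq> {\<omega>' \<in> topspace Otop. \<phi> \<omega>' \<in> ball (\<phi> \<omega>) e}"
      "\<omega> \<in> cyl P \<omega>" by (rule openin_cyl)
    then have "\<forall>\<omega>'\<in>cyl P \<omega>. cmod (\<phi> \<omega>' - \<phi> \<omega>) \<le> e"
      by (auto simp: dist_norm norm_minus_commute subset_iff less_imp_le)
    then show "\<omega> \<in> \<Union>?U" using P \<omega> by blast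
  qed
  have "compactin Otop Omega" using compact_Otop by (simp add: compact_space_def)
  then have "\<exists>F. finite F \<and> F \<subseteq> ?U \<and> Omega \<subseteq> \<Union>F"
    by (rule compactinD[OF _ _ cov]) (use clopen_cyl in auto)
  then obtain F where F: "finite F" "F \<subseteq> ?U" "Omega \<subseteq> \<Union>F" by blast
  have "\<exists>\<psi>\<in>Fun. \<forall>\<omega>\<in>\<Union>F. cmod (\<phi> \<omega> - \<psi> \<omega>) \<le> e"
    using F(1,2)
  proof (induction F)
    case empty then show ?case using Fun_zero by auto
  next
    case (insert C F)
    then obtain \<psi> where \<psi>: "\<psi> \<in> Fun" "\<forall>\<omega>\<in>\<Union>F. cmod (\<phi> \<omega> - \<psi> \<omega>) \<le> e" by auto
    obtain P \<omega> where P: "C = cyl P \<omega>" "finite P" "P \<subseteq> idems" "\<omega> \<in> Omega"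
      "\<forall>\<omega>'\<in>cyl P \<omega>. cmod (\<phi> \<omega>' - \<phi> \<omega>) \<le> e" using insert.prems by auto
    \<comment> \<open>Erases the old values on the cylinder and writes the constant \<phi>(\<omega>)
      there, so overlapping cylinders do no harm.\<close>
    let ?\<theta> = "\<lambda>\<omega>'. (\<psi> \<omega>' + (-1) * (if \<forall>p\<in>P. \<omega>' p = \<omega> p then \<psi> \<omega>' else 0)) +
      (if \<forall>p\<in>P. \<omega>' p = \<omega> p then \<phi> \<omega> else 0)"
    have "?\<theta> \<in> Fun"
      by (intro Fun_add Fun_scale Fun_cylinder P \<psi> Fun_const)
    moreover have "cmod (\<phi> \<omega>' - ?\<theta> \<omega>') \<le> e" if "\<omega>' \<in> \<Union>(insert C F)" for \<omega>'
    proof (cases "\<omega>' \<in> C")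
      case True
      then have "\<forall>p\<in>P. \<omega>' p = \<omega> p" by (simp add: P(1) cyl_def)
      then show ?thesis using True P by simp
    next
      case False
      then have "\<omega>' \<in> \<Union>F" using that by blast
      then have "\<omega>' \<in> Omega" using insert.prems by (auto simp: cyl_def)
      then have "\<not> (\<forall>p\<in>P. \<omega>' p = \<omega> p)" using False P(1) by (simp add: cyl_def)
      then have "?\<theta> \<omega>' = \<psi> \<omega>'" by (simp only: if_False) simp
      moreover have "cmod (\<phi> \<omega>' - \<psi> \<omega>') \<le> e" using \<psi>(2) \<open>\<omega>' \<in> \<Union>F\<close> by blast
      ultimately show ?thesis by (simp only:)
    qed
    ultimately show ?case by (intro bexI[of _ ?\<theta>] ballI)
  qed
  then show ?thesis using F(3) by (meson subsetD)
qed

end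

section \<open>From functions on the unit space to operators\<close>

context germ_groupoid
begin

text \<open>The part of the bisection of k over \<open>\<omega> p = 1\<close> is the bisection of
  kp, so a step function on a bisection is a combination of indicators of bisections.\<close>

lemma wt_Fun:
  assumes k: "k \<in> inv_hull" and "\<psi> \<in> Fun" shows "\<exists>b\<in>A0. \<forall>x. rho G x (wt k \<psi>) = b x"
  using assms(2)
proof (induction rule: Fun.induct)
  case Fun_zero
  have "wt k (\<lambda>_. 0) = (\<lambda>_. 0)" by (simp add: wt_def)
  then have "rho G x (wt k (\<lambda>_. 0)) = zero_op" for x by (simp add: fun_eq_iff rho_def zero_op_def)
  then show ?case using A0_zero by auto
next
  case (Fun_step \<psi> p c)
  then obtain b where b: "b \<in> A0" "\<forall>x. rho G x (wt k \<psi>) = b x" by blast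
  have ph: "p \<in> inv_hull" using idem_hull[OF Fun_step.hyps(2)] .
  have kp: "k \<circ>\<^sub>m p \<in> inv_hull" by (intro inv_hull.intros k ph)
  have Omp: "\<omega> \<in> Om (k \<circ>\<^sub>m p) \<longleftrightarrow> \<omega> \<in> Om k \<and> \<omega> p = 1" for \<omega>
  proof -
    have 1: "s \<in> dom (k \<circ>\<^sub>m p) \<longleftrightarrow> s \<in> dom k \<and> s \<in> dom p" for s
      using idem_id[OF Fun_step.hyps(2)] by (fastforce simp: dom_def)
    have "evn \<omega> (\<lambda>s. s \<in> dom k \<and> s \<in> dom p) \<longleftrightarrow> evn \<omega> (\<lambda>s. s \<in> dom k) \<and> evn \<omega> (\<lambda>s. s \<in> dom p)"
      using evn_conj by (blast intro: evn_mono)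
    then show ?thesis
      using Om_iff[OF kp] Om_iff[OF k] evn_dom_iff[OF _ Fun_step.hyps(2)] 1 by auto
  qed
  have akp: "a (k \<circ>\<^sub>m p) \<omega> = a k \<omega>" if "\<omega> \<in> Om (k \<circ>\<^sub>m p)" for \<omega>
  proof (rule eqI[OF kp k that _ Fun_step.hyps(2)])
    show "(k \<circ>\<^sub>m p) \<circ>\<^sub>m p = k \<circ>\<^sub>m p" using Fun_step.hyps(2) by (simp add: map_comp_assoc idems_def)
  qed (use that Omp in auto)
  have w: "wt k (\<lambda>\<omega>. \<psi> \<omega> + c * (if \<omega> p = 1 then 1 else 0)) = (\<lambda>h. wt k \<psi> h + c * ind (k \<circ>\<^sub>m p) h)"
  proof
    fix h
    show "wt k (\<lambda>\<omega>. \<psi> \<omega> + c * (if \<omega> p = 1 then 1 else 0)) h = wt k \<psi> h + c * ind (k \<circ>\<^sub>m p) h"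
    proof (cases "h \<in> a k ` Om k")
      case True
      then obtain \<omega> where \<omega>: "\<omega> \<in> Om k" "h = a k \<omega>" by auto
      have "h \<in> a (k \<circ>\<^sub>m p) ` Om (k \<circ>\<^sub>m p) \<longleftrightarrow> \<omega> p = 1"
      proof
        assume "h \<in> a (k \<circ>\<^sub>m p) ` Om (k \<circ>\<^sub>m p)"
        then obtain \<omega>' where "\<omega>' \<in> Om (k \<circ>\<^sub>m p)" "h = a (k \<circ>\<^sub>m p) \<omega>'" by auto
        then show "\<omega> p = 1" using src_inj[OF k kp \<omega>(1)] \<omega>(2) Omp by auto
      next
        assume "\<omega> p = 1"
        then show "h \<in> a (k \<circ>\<^sub>m p) ` Om (k \<circ>\<^sub>m p)" using \<omega> Omp akp by (metis imageI)
      qed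
      then show ?thesis using \<omega> by (simp add: wt_apply[OF k]) (simp add: ind_eq)
    next
      case False
      then have "h \<notin> a (k \<circ>\<^sub>m p) ` Om (k \<circ>\<^sub>m p)" using Omp akp by auto
      then show ?thesis using False by (simp add: wt_def)
    qed
  qed
  have "rho G x (wt k (\<lambda>\<omega>. \<psi> \<omega> + c * (if \<omega> p = 1 then 1 else 0))) = add_op (b x) (scale_op c (R (k \<circ>\<^sub>m p) x))" for x
    unfolding w using b(2) rfin_supp_on[OF k wt_supp] rfin_supp_on[OF kp wt_supp]
    by (simp add: rho_add rfin_scale rho_scale R_def)
  then show ?case using A0_step[OF b(1) kp] by (intro bexI[of _ "\<lambda>x. add_op (b x) (scale_op c (R (k \<circ>\<^sub>m p) x))"]) auto
next
  case (Fun_cong \<psi> \<psi>')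
  have "wt k \<psi> = wt k \<psi>'"
  proof
    fix h show "wt k \<psi> h = wt k \<psi>' h"
    proof (cases "h \<in> a k ` Om k")
      case True
      then show ?thesis using Fun_cong.hyps(2)[OF Om_Omega] by (auto simp: wt_apply[OF k])
    qed (simp add: wt_def)
  qed
  then show ?case using Fun_cong.IH by simp
qed

text \<open>One element of the span must approximate in all fibres at once, that is, in the reduced
  norm. The finiteness and linearity clauses are what sums of such functions call for.\<close>

definition approximable :: "('g \<Rightarrow> complex) \<Rightarrow> bool" where
  "approximable f \<longleftrightarrow> rfin f \<and> (\<forall>x. lin_op (sfibre G x) (rho G x f)) \<and>
    (\<forall>e>0. \<exists>b\<in>A0. \<forall>x. bnd (sfibre G x) (diff_op (rho G x f) (b x)) e)"

lemma approximable_add: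
  assumes "approximable f" "approximable g" shows "approximable (\<lambda>h. f h + g h)"
  unfolding approximable_def
proof (intro conjI allI impI)
  have fin: "rfin f" "rfin g" using assms by (auto simp: approximable_def)
  have lin: "lin_op (sfibre G x) (rho G x f)" "lin_op (sfibre G x) (rho G x g)" for x
    using assms by (auto simp: approximable_def)
  show "rfin (\<lambda>h. f h + g h)" by (intro rfin_add fin)
  show "lin_op (sfibre G x) (rho G x (\<lambda>h. f h + g h))" for x
    unfolding rho_add[OF fin] by (intro lin_op_add_op lin)
  fix e :: real assume "0 < e"
  then have e2: "0 < e / 2" by simp
  obtain b where b: "b \<in> A0" "\<forall>x. bnd (sfibre G x) (diff_op (rho G x f) (b x)) (e / 2)"
    using assms(1) e2 unfolding approximable_def by blast
  obtain c where c: "c \<in> A0" "\<forall>x. bnd (sfibre G x) (diff_op (rho G x g) (c x)) (e / 2)"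
    using assms(2) e2 unfolding approximable_def by blast
  have "bnd (sfibre G x) (diff_op (rho G x (\<lambda>h. f h + g h)) (add_op (b x) (c x))) e" for x
  proof -
    have "bnd (sfibre G x) (add_op (diff_op (rho G x f) (b x)) (diff_op (rho G x g) (c x))) (e / 2 + e / 2)"
      by (intro bnd_add_op lin_op_diff_op lin bounded_lin[OF A0_bounded] b c b(2)[rule_format] c(2)[rule_format])
    moreover have "diff_op (rho G x (\<lambda>h. f h + g h)) (add_op (b x) (c x)) =
        add_op (diff_op (rho G x f) (b x)) (diff_op (rho G x g) (c x))"
      unfolding rho_add[OF fin] by (simp add: add_op_def diff_op_def fun_eq_iff)
    ultimately show ?thesis by simp
  qed
  then show "\<exists>b\<in>A0. \<forall>x. bnd (sfibre G x) (diff_op (rho G x (\<lambda>h. f h + g h)) (b x)) e"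
    using A0_add[OF c(1) b(1)] by (intro bexI[of _ "\<lambda>x. add_op (b x) (c x)"]) auto
qed

lemma approximable_scale:
  assumes "approximable f" shows "approximable (\<lambda>h. d * f h)"
  unfolding approximable_def
proof (intro conjI allI impI)
  have lin: "lin_op (sfibre G x) (rho G x f)" for x using assms by (auto simp: approximable_def)
  show "rfin (\<lambda>h. d * f h)" using assms by (simp add: approximable_def rfin_scale)
  show "lin_op (sfibre G x) (rho G x (\<lambda>h. d * f h))" for x
    unfolding rho_scale by (intro lin_op_scale_op lin)
  fix e :: real assume e: "0 < e"
  \<comment> \<open>The added 1 covers d = 0.\<close>
  let ?e = "e / (cmod d + 1)"
  have e1: "0 < ?e" using e by (simp add: add_nonneg_pos)
  have e2: "cmod d * ?e \<le> e"
  proof -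
    have "cmod d * e \<le> e * (cmod d + 1)" using e by (simp add: algebra_simps)
    then show ?thesis by (simp add: divide_le_eq add_nonneg_pos)
  qed
  obtain b where b: "b \<in> A0" "\<forall>x. bnd (sfibre G x) (diff_op (rho G x f) (b x)) ?e"
    using assms e1 unfolding approximable_def by blast
  have "bnd (sfibre G x) (diff_op (rho G x (\<lambda>h. d * f h)) (scale_op d (b x))) e" for x
  proof -
    have "bnd (sfibre G x) (scale_op d (diff_op (rho G x f) (b x))) (cmod d * ?e)"
      by (intro bnd_scale_op b(2)[rule_format])
    moreover have "diff_op (rho G x (\<lambda>h. d * f h)) (scale_op d (b x)) = scale_op d (diff_op (rho G x f) (b x))"
      unfolding rho_scale by (simp add: scale_op_def diff_op_def fun_eq_iff algebra_simps)
    ultimately show ?thesis using e2 bnd_mono by metis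
  qed
  then show "\<exists>b\<in>A0. \<forall>x. bnd (sfibre G x) (diff_op (rho G x (\<lambda>h. d * f h)) (b x)) e"
    using A0_scale[OF b(1)] by (intro bexI[of _ "\<lambda>x. scale_op d (b x)"]) auto
qed

lemma approximable_zero: "approximable (\<lambda>_. 0)"
proof -
  have "rho G x (\<lambda>_. 0) = zero_op" for x by (simp add: fun_eq_iff rho_def zero_op_def)
  moreover have "bnd A (diff_op zero_op zero_op) e" if "0 < e" for A :: "'g set" and e
    using that by (simp add: bnd_def diff_op_def zero_op_def)
  ultimately show ?thesis
    unfolding approximable_def using A0_zero
    by (auto simp: rfin_def lin_op_zero_op intro!: bexI[of _ "\<lambda>x. zero_op"])
qed

text \<open>The extension by zero is continuous on \<Omega>(S), hence a uniform limit of step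
  functions. The difference is still carried by one bisection, so \<open>rho_bounded\<close> turns
  the uniform error into an operator bound.\<close>

lemma approximable_bisection:
  assumes k: "k \<in> inv_hull" and C: "C \<subseteq> Om k"
    and f: "\<And>h. h \<notin> a k ` C \<Longrightarrow> f h = 0"
    and cont: "continuous_map Otop euclidean (\<lambda>\<omega>. if \<omega> \<in> C then f (a k \<omega>) else 0)"
  shows "approximable f"
  unfolding approximable_def
proof (intro conjI allI impI)
  have sf: "supp_on k f" using f C by (auto simp: supp_on_def)
  show "rfin f" by (rule rfin_supp_on[OF k sf])
  have fa: "f (a k \<omega>) = (if \<omega> \<in> C then f (a k \<omega>) else 0)" if "\<omega> \<in> Om k" for \<omega>
  proof (cases "\<omega> \<in> C")
    case False
    then have "a k \<omega> \<notin> a k ` C" using src_inj[OF k k that] C by auto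
    then show ?thesis using f False by simp
  qed simp
  have ap: "\<exists>\<psi>\<in>Fun. \<forall>h. cmod (f h + (-1) * wt k \<psi> h) \<le> e" if e: "0 < e" for e
  proof -
    obtain \<psi> where \<psi>: "\<psi> \<in> Fun" "\<forall>\<omega>\<in>Omega. cmod ((if \<omega> \<in> C then f (a k \<omega>) else 0) - \<psi> \<omega>) \<le> e"
      using Fun_approx[OF cont e] by blast
    have "cmod (f h + (-1) * wt k \<psi> h) \<le> e" for h
    proof (cases "h \<in> a k ` Om k")
      case True
      then obtain \<omega> where \<omega>: "\<omega> \<in> Om k" "h = a k \<omega>" by auto
      have "cmod ((if \<omega> \<in> C then f (a k \<omega>) else 0) - \<psi> \<omega>) \<le> e" using \<psi>(2) Om_Omega[OF \<omega>(1)] by blast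
      then have "cmod (f (a k \<omega>) - \<psi> \<omega>) \<le> e" using fa[OF \<omega>(1)] by (cases "\<omega> \<in> C") auto
      then show ?thesis using \<omega> wt_apply[OF k, of \<omega> \<psi>] by simp
    next
      case False
      then show ?thesis using sf e by (simp add: supp_on_def wt_def)
    qed
    then show ?thesis using \<psi>(1) by blast
  qed
  have lin_wt: "lin_op (sfibre G x) (rho G x (wt k \<psi>))" if "\<psi> \<in> Fun" for \<psi> x
    using wt_Fun[OF k that] bounded_lin[OF A0_bounded] by metis
  have d: "rho G x (\<lambda>h. f h + (-1) * wt k \<psi> h) = diff_op (rho G x f) (rho G x (wt k \<psi>))" for x \<psi>
    unfolding rho_add[OF rfin_supp_on[OF k sf] rfin_scale[OF rfin_supp_on[OF k wt_supp]]] rho_scale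
    by (simp add: add_op_def diff_op_def scale_op_def)
  have sd: "supp_on k (\<lambda>h. f h + (-1) * wt k \<psi> h)" for \<psi>
    using sf wt_supp[of k \<psi>] by (simp add: supp_on_def)
  fix e :: real assume "0 < e"
  then obtain \<psi> where \<psi>: "\<psi> \<in> Fun" "\<forall>h. cmod (f h + (-1) * wt k \<psi> h) \<le> e" using ap by blast
  then have "bnd (sfibre G x) (diff_op (rho G x f) (rho G x (wt k \<psi>))) e" for x
    using rho_bounded(2)[OF k sd, of \<psi> e] d by metis
  then show "\<exists>b\<in>A0. \<forall>x. bnd (sfibre G x) (diff_op (rho G x f) (b x)) e"
    using wt_Fun[OF k \<psi>(1)] by metis
next
  fix x
  have sf: "supp_on k f" using f C by (auto simp: supp_on_def)
  \<comment> \<open>Linearity is obtained from \<open>rho_bounded\<close>, which asks for a bound on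
    the values of f; compactness of \<Omega>(S) provides it.\<close>
  have "compactin euclidean ((\<lambda>\<omega>. if \<omega> \<in> C then f (a k \<omega>) else 0) ` Omega)"
    using image_compactin[OF _ cont] compact_Otop by (simp add: compact_space_def)
  then have "bounded ((\<lambda>\<omega>. if \<omega> \<in> C then f (a k \<omega>) else 0) ` Omega)"
    by (intro compact_imp_bounded) (simp only: compactin_euclidean_iff)
  then obtain B where B: "\<And>\<omega>. \<omega> \<in> Omega \<Longrightarrow> cmod (if \<omega> \<in> C then f (a k \<omega>) else 0) \<le> B"
    unfolding bounded_iff by (metis (no_types, lifting) imageI)
  have "cmod (f h) \<le> max B 0" for h
  proof (cases "h \<in> a k ` C")
    case True
    then obtain \<omega> where "\<omega> \<in> C" "h = a k \<omega>" by auto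
    then show ?thesis using B[of \<omega>] C Om_Omega by fastforce
  qed (simp add: f)
  then show "lin_op (sfibre G x) (rho G x f)" by (rule rho_bounded(1)[OF k sf])
qed

text \<open>Openness is tested along each g, where the bisection of k appears as the set on which g
  and k define the same arrow, cut down to \<open>U\<close>.\<close>

lemma openin_bisection:
  assumes k: "k \<in> inv_hull" and U: "openin Otop U" "U \<subseteq> Om k" shows "openin (gtop G) (a k ` U)"
  unfolding openin_iff
proof (intro conjI ballI)
  show "a k ` U \<subseteq> arrows G" using k U by auto
  fix g :: "'s \<rightharpoonup> 's" assume g: "g \<in> inv_hull"
  have "{\<omega> \<in> Om g. a g \<omega> \<in> a k ` U} = {\<omega> \<in> Om g \<inter> Om k. a g \<omega> = a k \<omega>} \<inter> U"
  proof (intro set_eqI iffI)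
    fix \<omega> assume "\<omega> \<in> {\<omega> \<in> Om g. a g \<omega> \<in> a k ` U}"
    then obtain \<psi> where "\<omega> \<in> Om g" "\<psi> \<in> U" "a g \<omega> = a k \<psi>" by auto
    moreover from this have "\<omega> = \<psi>" using src_inj[OF g k] U(2) by blast
    ultimately show "\<omega> \<in> {\<omega> \<in> Om g \<inter> Om k. a g \<omega> = a k \<omega>} \<inter> U" using U(2) by auto
  qed auto
  then show "openin Otop {\<omega> \<in> Om g. a g \<omega> \<in> a k ` U}" using openin_Int[OF open_eq[OF g k] U(1)] by simp
qed

lemma continuous_a: "k \<in> inv_hull \<Longrightarrow> continuous_map (subtopology Otop (Om k)) (gtop G) (a k)"
  unfolding continuous_map_def
proof (intro conjI allI impI)
  assume k: "k \<in> inv_hull"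
  show "a k \<in> topspace (subtopology Otop (Om k)) \<rightarrow> topspace (gtop G)"
    using arrowI[OF k] by (auto simp: arrows_def)
  fix U assume "openin (gtop G) U"
  then have "openin Otop {\<omega> \<in> Om k. a k \<omega> \<in> U}" using openin_iff k by blast
  moreover have "{\<omega> \<in> topspace (subtopology Otop (Om k)). a k \<omega> \<in> U} = {\<omega> \<in> Om k. a k \<omega> \<in> U}"
    using Om_Omega by auto
  ultimately show "openin (subtopology Otop (Om k)) {\<omega> \<in> topspace (subtopology Otop (Om k)). a k \<omega> \<in> U}"
    using openin_Om[OF k] by (simp add: openin_open_subtopology)
qed

lemma compactin_bisection:
  assumes k: "k \<in> inv_hull" and C: "closedin Otop C" "C \<subseteq> Om k" shows "compactin (gtop G) (a k ` C)"
proof (rule image_compactin[OF _ continuous_a[OF k]])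
  show "compactin (subtopology Otop (Om k)) C"
    unfolding compactin_subtopology using closedin_compact_space[OF compact_Otop C(1)] C(2) by simp
qed

text \<open>The source map is injective on a bisection, so separation is pulled back from
  \<Omega>(S). Arrows with equal source in different bisections are outside its reach.\<close>

lemma Hausdorff_bisection:
  assumes k: "k \<in> inv_hull" shows "Hausdorff_space (subtopology (gtop G) (a k ` Om k))"
  unfolding Hausdorff_space_def
proof (intro allI impI)
  fix x y assume *: "x \<in> topspace (subtopology (gtop G) (a k ` Om k)) \<and>
    y \<in> topspace (subtopology (gtop G) (a k ` Om k)) \<and> x \<noteq> y"
  then obtain \<omega> \<psi> where o: "\<omega> \<in> Om k" "\<psi> \<in> Om k" "x = a k \<omega>" "y = a k \<psi>" "\<omega> \<noteq> \<psi>" by auto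
  then obtain U V where UV: "openin Otop U" "openin Otop V" "\<omega> \<in> U" "\<psi> \<in> V" "disjnt U V"
    using Hausdorff_Otop Om_Omega unfolding Hausdorff_space_def topspace_Otop by metis
  have op: "openin (subtopology (gtop G) (a k ` Om k)) (a k ` (W \<inter> Om k))" if "openin Otop W" for W
    using openin_bisection[OF k openin_Int[OF that openin_Om[OF k]]]
      openin_bisection[OF k openin_Om[OF k]] by (auto simp: openin_open_subtopology)
  have "disjnt (a k ` (U \<inter> Om k)) (a k ` (V \<inter> Om k))"
    unfolding disjnt_iff
  proof (intro allI notI)
    fix z assume "z \<in> a k ` (U \<inter> Om k) \<and> z \<in> a k ` (V \<inter> Om k)"
    then obtain u v where u: "u \<in> U" "v \<in> V" "u \<in> Om k" "v \<in> Om k" "a k u = a k v" by auto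
    have "u = v" by (rule src_inj[OF k k u(3-5)])
    then show False using u UV(5) by (auto simp: disjnt_iff)
  qed
  then show "\<exists>U V. openin (subtopology (gtop G) (a k ` Om k)) U \<and>
    openin (subtopology (gtop G) (a k ` Om k)) V \<and> x \<in> U \<and> y \<in> V \<and> disjnt U V"
    using op[OF UV(1)] op[OF UV(2)] UV o by (intro exI conjI) auto
qed

section \<open>C_c(G) and the span of the bisections\<close>

abbreviation cc_gens :: "('g \<Rightarrow> complex) set" where
  "cc_gens \<equiv> \<Union>V\<in>{V. openin (gtop G) V \<and> Hausdorff_space (subtopology (gtop G) V)}. cc_on (gtop G) V"

text \<open>\<open>Om k\<close> is clopen in a compact space, so the bisection is compact, open and
  Hausdorff.\<close>

lemma ind_cc: "k \<in> inv_hull \<Longrightarrow> ind k \<in> cc_gens"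
proof -
  assume k: "k \<in> inv_hull"
  let ?D = "a k ` Om k"
  have D: "openin (gtop G) ?D" by (rule openin_bisection[OF k openin_Om[OF k]]) simp
  have ts: "topspace (subtopology (gtop G) ?D) = ?D" using openin_subset[OF D] by auto
  have "continuous_map (subtopology (gtop G) ?D) euclidean (ind k)"
    by (rule continuous_map_eq[of _ _ "\<lambda>_. 1"]) (auto simp: ind_eq)
  moreover have "{g \<in> ?D. ind k g \<noteq> 0} = ?D" by (auto simp: ind_eq)
  moreover have "subtopology (gtop G) ?D closure_of ?D = ?D"
    using closure_of_topspace[of "subtopology (gtop G) ?D"] unfolding ts .
  moreover have "compactin (subtopology (gtop G) ?D) ?D"
    unfolding compactin_subtopology using compactin_bisection[OF k closedin_Om[OF k]] by simp
  ultimately have "ind k \<in> cc_on (gtop G) ?D" unfolding cc_on_def by (simp add: ind_eq)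
  then show ?thesis using D Hausdorff_bisection[OF k] by blast
qed

lemma cc_add_scale:
  assumes "f \<in> cc G" "h \<in> cc_gens" shows "(\<lambda>g. f g + d * h g) \<in> cc G"
proof -
  obtain c F where f: "f = (\<lambda>g. \<Sum>f\<in>F. c f * f g)" and F: "finite F" "F \<subseteq> cc_gens"
    using assms(1) unfolding cc_def by blast
  \<comment> \<open>\<open>cc\<close> indexes coefficients by the functions themselves; if h already
    occurs in \<open>F\<close>, its two coefficients have to be added.\<close>
  let ?c = "\<lambda>f. (if f \<in> F then c f else 0) + (if f = h then d else 0)"
  have "(\<lambda>g. f g + d * h g) = (\<lambda>g. \<Sum>f\<in>insert h F. ?c f * f g)"
  proof
    fix g
    have "(\<Sum>f\<in>insert h F. ?c f * f g) =
      (\<Sum>f\<in>insert h F. (if f \<in> F then c f * f g else 0)) + (\<Sum>f\<in>insert h F. (if f = h then d * f g else 0))"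
      unfolding sum.distrib[symmetric] by (rule sum.cong) (auto simp: distrib_right)
    also have "(\<Sum>f\<in>insert h F. (if f \<in> F then c f * f g else 0)) = (\<Sum>f\<in>F. c f * f g)"
      by (rule sum.mono_neutral_cong_right) (use F in auto)
    also have "(\<Sum>f\<in>insert h F. (if f = h then d * f g else 0)) = d * h g"
      using F by (simp add: sum.delta)
    finally show "f g + d * h g = (\<Sum>f\<in>insert h F. ?c f * f g)" unfolding f by simp
  qed
  then show ?thesis unfolding cc_def using F assms(2)
    by (intro CollectI exI[of _ ?c] exI[of _ "insert h F"]) simp
qed

lemma A0_cc: "T \<in> A0 \<Longrightarrow> \<exists>f\<in>cc G. rfin f \<and> (\<forall>x. T x = rho G x f)"
proof (induction rule: A0.induct)
  case A0_zero
  have "(\<lambda>_. 0) \<in> cc G" unfolding cc_def by (intro CollectI exI[of _ "\<lambda>_. 0"] exI[of _ "{}"]) simp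
  moreover have "rho G x (\<lambda>_. 0) = zero_op" for x by (simp add: fun_eq_iff rho_def zero_op_def)
  ultimately show ?case by (intro bexI[of _ "\<lambda>_. 0"]) (auto simp: rfin_def)
next
  case (A0_step T k c)
  then obtain f where f: "f \<in> cc G" "rfin f" "\<forall>x. T x = rho G x f" by blast
  have r: "rfin (\<lambda>h. c * ind k h)" by (intro rfin_scale rfin_supp_on[OF A0_step.hyps(2) wt_supp])
  have "(\<lambda>g. f g + c * ind k g) \<in> cc G" by (rule cc_add_scale[OF f(1) ind_cc[OF A0_step.hyps(2)]])
  moreover have "add_op (T x) (scale_op c (R k x)) = rho G x (\<lambda>g. f g + c * ind k g)" for x
    using f(3) rho_add[OF f(2) r] by (simp add: R_def rho_scale)
  ultimately show ?case using rfin_add[OF f(2) r] by (intro bexI[of _ "\<lambda>g. f g + c * ind k g"]) auto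
qed

text \<open>The compact support is covered by finitely many compact open bisections inside V. As V
  is Hausdorff, they are closed in V, so f can be cut along them into continuous pieces, each
  carried by one bisection.\<close>

lemma cc_on_approximable:
  assumes V: "openin (gtop G) V" and H: "Hausdorff_space (subtopology (gtop G) V)"
    and f: "f \<in> cc_on (gtop G) V"
  shows "approximable f"
proof -
  let ?X = "subtopology (gtop G) V"
  have Vt: "V \<subseteq> arrows G" using openin_subset[OF V] by (simp add: arrows_def)
  have tX: "topspace ?X = V" using Vt by (auto simp: arrows_def)
  let ?D = "{a k ` C | k C. k \<in> inv_hull \<and> openin Otop C \<and> closedin Otop C \<and> C \<subseteq> Om k \<and> a k ` C \<subseteq> V}"
  have cov: "V \<subseteq> \<Union>?D"
  proof
    fix \<gamma> assume \<gamma>: "\<gamma> \<in> V"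
    then obtain k \<omega> where k: "k \<in> inv_hull" "\<omega> \<in> Om k" "\<gamma> = a k \<omega>" using Vt by (blast elim: arrowE)
    have "openin Otop {\<omega> \<in> Om k. a k \<omega> \<in> V}" using V k(1) unfolding openin_iff by blast
    then obtain P where P: "finite P" "P \<subseteq> idems" "cyl P \<omega> \<subseteq> {\<omega> \<in> Om k. a k \<omega> \<in> V}" "\<omega> \<in> cyl P \<omega>"
      by (rule openin_cyl) (use k \<gamma> in auto)
    have "a k ` cyl P \<omega> \<in> ?D"
      using clopen_cyl[OF P(1,2), of \<omega>] P(3) k(1) by (intro CollectI exI[of _ k] exI[of _ "cyl P \<omega>"]) auto
    then show "\<gamma> \<in> \<Union>?D" using k(3) P(4) by blast
  qed
  have opD: "openin ?X D" if D: "D \<in> ?D" for D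
    using D openin_bisection V by (auto simp: openin_open_subtopology)
  have clD: "closedin ?X D" if D: "D \<in> ?D" for D
  proof (rule compactin_imp_closedin[OF H])
    show "compactin ?X D" unfolding compactin_subtopology using D compactin_bisection by auto
  qed
  have main: "approximable f" if "finite F" "F \<subseteq> ?D" "continuous_map ?X euclidean f" "\<And>g. g \<notin> \<Union>F \<Longrightarrow> f g = 0" for F f
    using that
  proof (induction F arbitrary: f)
    case empty
    then have "f = (\<lambda>_. 0)" by auto
    then show ?case using approximable_zero by simp
  next
    case (insert D F)
    then have D: "D \<in> ?D" by simp
    then obtain k C where k: "D = a k ` C" "k \<in> inv_hull" "openin Otop C" "closedin Otop C" "C \<subseteq> Om k" "a k ` C \<subseteq> V"
      by blast
    \<comment> \<open>The piece on \<open>D\<close> lies on one bisection; the remainder stays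
      continuous because \<open>D\<close> is clopen in V, and it vanishes off the smaller
      family.\<close>
    let ?f1 = "\<lambda>g. if g \<in> D then f g else 0" and ?f2 = "\<lambda>g. if g \<in> D then 0 else f g"
    have "approximable ?f1"
    proof (rule approximable_bisection[OF k(2,5)])
      show "?f1 h = 0" if "h \<notin> a k ` C" for h using that k(1) by simp
      have ca: "continuous_map (subtopology Otop C) ?X (a k)"
        unfolding continuous_map_in_subtopology
      proof
        show "continuous_map (subtopology Otop C) (gtop G) (a k)"
          using continuous_map_from_subtopology_mono[OF continuous_a[OF k(2)] k(5)] .
      qed (use k(6) in auto)
      have "continuous_map Otop euclidean (\<lambda>\<omega>. if \<omega> \<in> C then f (a k \<omega>) else 0)"
        by (rule continuous_map_clopen_if[OF k(3,4)])
          (use continuous_map_compose[OF ca insert.prems(2)] in \<open>auto simp: o_def\<close>)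
      moreover have "(\<lambda>\<omega>. if \<omega> \<in> C then ?f1 (a k \<omega>) else 0) = (\<lambda>\<omega>. if \<omega> \<in> C then f (a k \<omega>) else 0)"
        using k(1) by auto
      ultimately show "continuous_map Otop euclidean (\<lambda>\<omega>. if \<omega> \<in> C then ?f1 (a k \<omega>) else 0)" by simp
    qed
    moreover have "approximable ?f2"
    proof (rule insert.IH)
      show "continuous_map ?X euclidean ?f2"
        by (rule continuous_map_clopen_if[OF opD[OF D] clD[OF D]])
          (use insert.prems(2) in \<open>auto intro: continuous_map_from_subtopology\<close>)
    qed (use insert.prems in auto)
    ultimately have "approximable (\<lambda>g. ?f1 g + ?f2 g)" by (rule approximable_add)
    moreover have "(\<lambda>g. ?f1 g + ?f2 g) = f" by auto
    ultimately show ?case by simp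
  qed
  let ?K = "?X closure_of {g \<in> V. f g \<noteq> 0}"
  have f0: "\<And>g. g \<notin> V \<Longrightarrow> f g = 0" and fc: "continuous_map ?X euclidean f" and K: "compactin ?X ?K"
    using f by (auto simp: cc_on_def)
  have "?K \<subseteq> V" using closure_of_subset_topspace[of ?X] tX by metis
  then have KD: "?K \<subseteq> \<Union>?D" using cov by (rule subset_trans)
  have "\<exists>F. finite F \<and> F \<subseteq> ?D \<and> ?K \<subseteq> \<Union>F" by (rule compactinD[OF K opD KD])
  then obtain F where F: "finite F" "F \<subseteq> ?D" "?K \<subseteq> \<Union>F" by blast
  have "{g \<in> V. f g \<noteq> 0} \<subseteq> ?K" by (rule closure_of_subset) (simp only: tX, blast)
  then have sub: "{g \<in> V. f g \<noteq> 0} \<subseteq> \<Union>F" using F(3) by (rule subset_trans)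
  have "f g = 0" if "g \<notin> \<Union>F" for g
  proof (rule ccontr)
    assume "f g \<noteq> 0"
    then have "g \<in> {g \<in> V. f g \<noteq> 0}" using f0 by (intro CollectI conjI) metis+
    then show False using sub that by (meson subsetD)
  qed
  then show ?thesis using main[OF F(1,2) fc] by blast
qed

lemma cc_approximable: "f \<in> cc G \<Longrightarrow> approximable f"
proof -
  assume "f \<in> cc G"
  then obtain c F where f: "f = (\<lambda>g. \<Sum>f\<in>F. c f * f g)" and F: "finite F" "F \<subseteq> cc_gens"
    unfolding cc_def by blast
  show ?thesis unfolding f using F
  proof (induction F)
    case empty
    then show ?case by (simp add: approximable_zero)
  next
    case (insert h F)
    have "approximable h" using insert.prems cc_on_approximable by auto
    then show ?case using insert by (simp add: approximable_add approximable_scale)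
  qed
qed

lemma family_norm_le_iff:
  assumes "\<And>x. x \<in> gunits G \<Longrightarrow> lin_op (sfibre G x) (T x)" "0 \<le> e"
  shows "family_norm G T \<le> ennreal e \<longleftrightarrow> (\<forall>x\<in>gunits G. bnd (sfibre G x) (T x) e)"
  unfolding family_norm_def SUP_le_iff
proof (rule ball_cong[OF refl])
  fix x assume "x \<in> gunits G"
  then show "op_norm (sfibre G x) (T x) \<le> ennreal e \<longleftrightarrow> bnd (sfibre G x) (T x) e"
    by (intro op_norm_le_iff assms(2) lin_op_scale[OF assms(1)])
qed

text \<open>The span \<open>A0\<close> comes from C_c(G) and is dense in its image, so it may
  replace C_c(G) in the definition of the completion.\<close>

lemma cstar_r_iff:
  "T \<in> cstar_r G \<longleftrightarrow> (\<forall>x\<in>gunits G. T x \<in> bounded_ops (sfibre G x)) \<and>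
     (\<forall>x. x \<notin> gunits G \<longrightarrow> T x = zero_op) \<and>
     (\<forall>e>0. \<exists>b\<in>A0. \<forall>x\<in>gunits G. bnd (sfibre G x) (diff_op (T x) (b x)) e)"
proof -
  have "(\<forall>\<epsilon>>0. \<exists>f\<in>cc G. family_norm G (\<lambda>x. diff_op (T x) (rho G x f)) < \<epsilon>) \<longleftrightarrow>
    (\<forall>e>0. \<exists>b\<in>A0. \<forall>x\<in>gunits G. bnd (sfibre G x) (diff_op (T x) (b x)) e)"
    if T: "\<forall>x\<in>gunits G. T x \<in> bounded_ops (sfibre G x)"
    unfolding ennreal_eps_iff
  proof (intro iffI allI impI)
    have lin: "lin_op (sfibre G x) (diff_op (T x) (rho G x f))" if "f \<in> cc G" "x \<in> gunits G" for f x
      using cc_approximable[OF that(1)] T that(2) bounded_lin by (auto simp: approximable_def intro!: lin_op_diff_op)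
    have fn: "family_norm G (\<lambda>x. diff_op (T x) (rho G x f)) \<le> ennreal e \<longleftrightarrow>
      (\<forall>x\<in>gunits G. bnd (sfibre G x) (diff_op (T x) (rho G x f)) e)" if "f \<in> cc G" "0 < e" for f e
      by (rule family_norm_le_iff) (use lin that in auto)
    fix e :: real assume e: "0 < e"
    {
      assume L: "\<forall>e>0. \<exists>f\<in>cc G. family_norm G (\<lambda>x. diff_op (T x) (rho G x f)) \<le> ennreal e"
      have e2: "0 < e / 2" using e by simp
      obtain f where f: "f \<in> cc G" "\<forall>x\<in>gunits G. bnd (sfibre G x) (diff_op (T x) (rho G x f)) (e / 2)"
        using L e2 fn by meson
      obtain b where b: "b \<in> A0" "\<forall>x. bnd (sfibre G x) (diff_op (rho G x f) (b x)) (e / 2)"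
        using cc_approximable[OF f(1)] e2 unfolding approximable_def by blast
      have "bnd (sfibre G x) (diff_op (T x) (b x)) e" if x: "x \<in> gunits G" for x
      proof -
        have "lin_op (sfibre G x) (diff_op (rho G x f) (b x))"
          using cc_approximable[OF f(1)] bounded_lin[OF A0_bounded[OF b(1)]]
          by (auto simp: approximable_def intro!: lin_op_diff_op)
        then have "bnd (sfibre G x) (add_op (diff_op (T x) (rho G x f)) (diff_op (rho G x f) (b x))) (e / 2 + e / 2)"
          using f b x by (intro bnd_add_op lin) auto
        then show ?thesis by (simp add: add_op_def diff_op_def)
      qed
      then show "\<exists>b\<in>A0. \<forall>x\<in>gunits G. bnd (sfibre G x) (diff_op (T x) (b x)) e" using b(1) by blast
    next
      assume "\<forall>e>0. \<exists>b\<in>A0. \<forall>x\<in>gunits G. bnd (sfibre G x) (diff_op (T x) (b x)) e"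
      then obtain b where b: "b \<in> A0" "\<forall>x\<in>gunits G. bnd (sfibre G x) (diff_op (T x) (b x)) e" using e by blast
      obtain f where f: "f \<in> cc G" "\<forall>x. b x = rho G x f" using A0_cc[OF b(1)] by blast
      then show "\<exists>f\<in>cc G. family_norm G (\<lambda>x. diff_op (T x) (rho G x f)) \<le> ennreal e"
        using fn[OF f(1) e] b(2) by auto
    }
  qed
  then show ?thesis unfolding cstar_r_def by auto
qed

end

section \<open>The reduced C*-algebra and its image\<close>

lemma bnd_all_zero:
  assumes T: "lin_op A T" and e: "\<And>e. 0 < e \<Longrightarrow> bnd A T e" shows "T = zero_op"
proof
  fix \<xi>
  show "T \<xi> = zero_op \<xi>"
  proof (cases "\<xi> \<in> l2 A")
    case True
    have "l2_norm (T \<xi>) \<le> 0 + \<epsilon>" if "0 < \<epsilon>" for \<epsilon>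
    proof -
      have "0 < \<epsilon> / (l2_norm \<xi> + 1)" using that by (simp add: add_nonneg_pos)
      then have "l2_norm (T \<xi>) \<le> \<epsilon> / (l2_norm \<xi> + 1) * l2_norm \<xi>" using e bndD True by blast
      also have "\<dots> \<le> \<epsilon> / (l2_norm \<xi> + 1) * (l2_norm \<xi> + 1)"
        by (rule mult_left_mono) (use that in \<open>auto intro!: divide_nonneg_nonneg add_nonneg_nonneg\<close>)
      also have "\<dots> = \<epsilon>" using l2_norm_nonneg[of \<xi>] by (simp add: add_nonneg_eq_0_iff)
      finally show ?thesis by simp
    qed
    then have "l2_norm (T \<xi>) \<le> 0" by (rule field_le_epsilon)
    then have "l2_norm (T \<xi>) = 0" using l2_norm_nonneg[of "T \<xi>"] by linarith
    then show ?thesis using l2_norm_eq_0[OF lin_op_in[OF T]] by (simp add: zero_op_def)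
  next
    case False
    then show ?thesis using lin_op_out[OF T] by (simp add: zero_op_def)
  qed
qed

lemma op_closure_iff:
  assumes T: "T \<in> bounded_ops A" and B: "B \<subseteq> bounded_ops A"
  shows "(\<forall>\<epsilon>>0. \<exists>S\<in>B. op_norm A (diff_op T S) < \<epsilon>) \<longleftrightarrow> (\<forall>e>0. \<exists>S\<in>B. bnd A (diff_op T S) e)"
proof -
  have "op_norm A (diff_op T S) \<le> ennreal e \<longleftrightarrow> bnd A (diff_op T S) e" if "S \<in> B" "0 < e" for S e
    by (rule op_norm_le_iff[OF lin_op_scale]) (use that B T in \<open>auto intro!: lin_op_diff_op dest: bounded_lin\<close>)
  then show ?thesis unfolding ennreal_eps_iff by (metis (no_types, lifting))
qed

lemma bounded_ops_empty: "T \<in> bounded_ops {} \<Longrightarrow> T = zero_op"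
  by (rule bounded_op_eq_zero) auto

lemma adj_diff_op:
  assumes "lin_op A S" "lin_op A T" shows "adj A (diff_op S T) = diff_op (adj A S) (adj A T)"
  by (auto simp: fun_eq_iff adj_def diff_op_def inner_diff_right[OF lin_op_in[OF assms(1)] lin_op_in[OF assms(2)]])

lemma bnd_diff_trans:
  assumes "lin_op A S" "lin_op A T" "lin_op A U" "bnd A (diff_op S T) c" "bnd A (diff_op T U) d"
  shows "bnd A (diff_op S U) (c + d)"
proof -
  have "bnd A (add_op (diff_op S T) (diff_op T U)) (c + d)"
    by (intro bnd_add_op lin_op_diff_op assms)
  then show ?thesis by (simp add: add_op_def diff_op_def)
qed

lemma bnd_diff_commute: "bnd A (diff_op S T) c \<Longrightarrow> bnd A (diff_op T S) c"
proof -
  assume "bnd A (diff_op S T) c"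
  then have "bnd A (scale_op (-1) (diff_op S T)) (cmod (-1) * c)" by (rule bnd_scale_op)
  then show ?thesis by (simp add: scale_op_def diff_op_def)
qed

context germ_groupoid
begin

text \<open>Off the unit space the fibres are empty and bounded operators on them are zero, so
  conditions over the units can be stated for all x.\<close>

lemma cstar_r_iff':
  "T \<in> cstar_r G \<longleftrightarrow> (\<forall>x. T x \<in> bounded_ops (sfibre G x)) \<and>
     (\<forall>e>0. \<exists>b\<in>A0. \<forall>x. bnd (sfibre G x) (diff_op (T x) (b x)) e)" (is "?L \<longleftrightarrow> ?R")
proof
  assume L: ?L
  have z: "T x = zero_op" "b x = zero_op" if "b \<in> A0" "x \<notin> gunits G" for b x
    using L that A0_out unfolding cstar_r_iff by auto
  show ?R
  proof (intro conjI allI impI)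
    show "T x \<in> bounded_ops (sfibre G x)" for x
      using L bounded_ops_zero unfolding cstar_r_iff by metis
    fix e :: real assume e: "0 < e"
    then obtain b where b: "b \<in> A0" "\<forall>x\<in>gunits G. bnd (sfibre G x) (diff_op (T x) (b x)) e"
      using L unfolding cstar_r_iff by blast
    have "bnd (sfibre G x) (diff_op (T x) (b x)) e" for x
    proof (cases "x \<in> gunits G")
      case False
      then show ?thesis using z[OF b(1)] e by (simp add: bnd_def diff_op_def zero_op_def)
    qed (use b in auto)
    then show "\<exists>b\<in>A0. \<forall>x. bnd (sfibre G x) (diff_op (T x) (b x)) e" using b(1) by blast
  qed
next
  assume R: ?R
  have "T x = zero_op" if "x \<notin> gunits G" for x
    using R sfibre_out[OF that] bounded_ops_empty by metis
  then show ?L using R unfolding cstar_r_iff by blast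
qed

lemma cstar_r_bounded: "T \<in> cstar_r G \<Longrightarrow> T x \<in> bounded_ops (sfibre G x)"
  by (simp add: cstar_r_iff')

lemma cstar_r_lin: "T \<in> cstar_r G \<Longrightarrow> lin_op (sfibre G x) (T x)"
  using cstar_r_bounded bounded_lin by blast

lemma cstar_r_approx:
  assumes "T \<in> cstar_r G" "0 < e"
  obtains b where "b \<in> A0" "\<And>x. bnd (sfibre G x) (diff_op (T x) (b x)) e"
  using assms unfolding cstar_r_iff' by blast

lemma A0_cstar_r: "b \<in> A0 \<Longrightarrow> b \<in> cstar_r G"
  unfolding cstar_r_iff' using A0_bounded
  by (auto intro!: bexI[of _ b] simp: bnd_def diff_op_def)

lemma A0_lin: "b \<in> A0 \<Longrightarrow> lin_op (sfibre G x) (b x)"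
  using A0_bounded bounded_lin by blast

lemma A0_bnd: "b \<in> A0 \<Longrightarrow> \<exists>M. \<forall>x. bnd (sfibre G x) (b x) M"
proof (induction rule: A0.induct)
  case A0_zero then show ?case using bnd_zero_op[of 0] by blast
next
  case (A0_step T k c)
  then obtain M where "\<forall>x. bnd (sfibre G x) (T x) M" by blast
  then have "bnd (sfibre G x) (add_op (T x) (scale_op c (R k x))) (M + cmod c * 1)" for x
    by (intro bnd_add_op bnd_scale_op R_bnd lin_op_scale_op R_lin A0_lin A0_step.hyps) auto
  then show ?case by blast
qed

lemma cstar_r_bnd:
  assumes "T \<in> cstar_r G" shows "\<exists>M. \<forall>x. bnd (sfibre G x) (T x) M"
proof -
  obtain b where b: "b \<in> A0" "\<And>x. bnd (sfibre G x) (diff_op (T x) (b x)) 1"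
    using cstar_r_approx[OF assms, of 1] by auto
  obtain M where M: "\<forall>x. bnd (sfibre G x) (b x) M" using A0_bnd[OF b(1)] by blast
  have "bnd (sfibre G x) (add_op (diff_op (T x) (b x)) (b x)) (1 + M)" for x
    by (intro bnd_add_op lin_op_diff_op cstar_r_lin assms A0_lin b M[rule_format])
  then show ?thesis by (auto simp: add_op_def diff_op_def)
qed

section \<open>The reduced algebra is closed under the algebra operations and limits\<close>

lemma cstar_r_add:
  assumes "S \<in> cstar_r G" "T \<in> cstar_r G" shows "(\<lambda>x. add_op (S x) (T x)) \<in> cstar_r G"
  unfolding cstar_r_iff'
proof (intro conjI allI impI)
  show "add_op (S x) (T x) \<in> bounded_ops (sfibre G x)" for x
    by (intro bounded_ops_add cstar_r_bounded assms)
  fix e :: real assume "0 < e"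
  then have e: "0 < e / 2" by simp
  obtain b where b: "b \<in> A0" "\<And>x. bnd (sfibre G x) (diff_op (S x) (b x)) (e / 2)"
    using cstar_r_approx[OF assms(1) e] by blast
  obtain c where c: "c \<in> A0" "\<And>x. bnd (sfibre G x) (diff_op (T x) (c x)) (e / 2)"
    using cstar_r_approx[OF assms(2) e] by blast
  have "bnd (sfibre G x) (add_op (diff_op (S x) (b x)) (diff_op (T x) (c x))) (e / 2 + e / 2)" for x
    by (intro bnd_add_op lin_op_diff_op cstar_r_lin assms A0_lin b c)
  moreover have "add_op (diff_op (S x) (b x)) (diff_op (T x) (c x)) =
      diff_op (add_op (S x) (T x)) (add_op (b x) (c x))" for x
    by (simp add: add_op_def diff_op_def fun_eq_iff)
  ultimately show "\<exists>b\<in>A0. \<forall>x. bnd (sfibre G x) (diff_op (add_op (S x) (T x)) (b x)) e"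
    using A0_add[OF c(1) b(1)] by (intro bexI[of _ "\<lambda>x. add_op (b x) (c x)"]) auto
qed

lemma cstar_r_comp:
  assumes "S \<in> cstar_r G" "T \<in> cstar_r G" shows "(\<lambda>x. S x \<circ> T x) \<in> cstar_r G"
  unfolding cstar_r_iff'
proof (intro conjI allI impI)
  show "S x \<circ> T x \<in> bounded_ops (sfibre G x)" for x
    by (intro bounded_ops_comp cstar_r_bounded assms)
  fix e :: real assume e: "0 < e"
  obtain M where M: "\<And>x. bnd (sfibre G x) (S x) M" using cstar_r_bnd[OF assms(1)] by blast
  have M0: "0 \<le> M" using M by (simp add: bnd_def)
  \<comment> \<open>T is approximated first, with an error matched to the bound M of S; only then is
    a bound N of the approximant available, from which the error for S is fixed.\<close>
  define d where "d = e / 2 / (M + 1)"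
  have d: "0 < d" unfolding d_def using e M0 by simp
  obtain c where c: "c \<in> A0" "\<And>x. bnd (sfibre G x) (diff_op (T x) (c x)) d"
    using cstar_r_approx[OF assms(2) d] by blast
  obtain N where N: "\<And>x. bnd (sfibre G x) (c x) N" using A0_bnd[OF c(1)] by blast
  have N0: "0 \<le> N" using N by (simp add: bnd_def)
  define d' where "d' = e / 2 / (N + 1)"
  have d': "0 < d'" unfolding d'_def using e N0 by simp
  obtain b where b: "b \<in> A0" "\<And>x. bnd (sfibre G x) (diff_op (S x) (b x)) d'"
    using cstar_r_approx[OF assms(1) d'] by blast
  have le: "M * d + d' * N \<le> e"
  proof -
    have "M * d \<le> d * (M + 1)" "d' * N \<le> d' * (N + 1)" using d d' by (simp_all add: algebra_simps)
    moreover have "d * (M + 1) = e / 2"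
      using nonzero_eq_divide_eq[of "M + 1" d "e / 2"] M0 d_def by simp
    moreover have "d' * (N + 1) = e / 2"
      using nonzero_eq_divide_eq[of "N + 1" d' "e / 2"] N0 d'_def by simp
    ultimately show ?thesis by linarith
  qed
  have "bnd (sfibre G x) (diff_op (S x \<circ> T x) (b x \<circ> c x)) e" for x
  proof -
    note lin = cstar_r_lin[OF assms(1)] cstar_r_lin[OF assms(2)] A0_lin[OF b(1)] A0_lin[OF c(1)]
    have "bnd (sfibre G x) (add_op (S x \<circ> diff_op (T x) (c x)) (diff_op (S x) (b x) \<circ> c x)) (M * d + d' * N)"
      by (intro bnd_add_op bnd_comp lin_op_comp lin_op_diff_op lin M N b c)
    moreover have "add_op (S x \<circ> diff_op (T x) (c x)) (diff_op (S x) (b x) \<circ> c x) = diff_op (S x \<circ> T x) (b x \<circ> c x)"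
    proof (intro ext)
      fix \<xi> i
      show "add_op (S x \<circ> diff_op (T x) (c x)) (diff_op (S x) (b x) \<circ> c x) \<xi> i = diff_op (S x \<circ> T x) (b x \<circ> c x) \<xi> i"
        using lin_op_diff[OF lin(1) lin_op_in[OF lin(2)] lin_op_in[OF lin(4)], of x \<xi> \<xi>]
        by (simp add: add_op_def diff_op_def)
    qed
    ultimately show ?thesis using le bnd_mono by metis
  qed
  then show "\<exists>b\<in>A0. \<forall>x. bnd (sfibre G x) (diff_op (S x \<circ> T x) (b x)) e"
    using A0_comp[OF c(1) b(1)] by (intro bexI[of _ "\<lambda>x. b x \<circ> c x"]) auto
qed

lemma cstar_r_scale:
  assumes "T \<in> cstar_r G" shows "(\<lambda>x. scale_op d (T x)) \<in> cstar_r G"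
  unfolding cstar_r_iff'
proof (intro conjI allI impI)
  show "scale_op d (T x) \<in> bounded_ops (sfibre G x)" for x
    by (intro bounded_ops_scale cstar_r_bounded assms)
  fix e :: real assume e: "0 < e"
  have d: "0 < e / (cmod d + 1)" using e by (simp add: add_nonneg_pos)
  have le: "cmod d * (e / (cmod d + 1)) \<le> e"
  proof -
    have "cmod d * e \<le> e * (cmod d + 1)" using e by (simp add: algebra_simps)
    then show ?thesis by (simp add: divide_le_eq add_nonneg_pos)
  qed
  obtain b where b: "b \<in> A0" "\<And>x. bnd (sfibre G x) (diff_op (T x) (b x)) (e / (cmod d + 1))"
    using cstar_r_approx[OF assms d] by blast
  have "bnd (sfibre G x) (diff_op (scale_op d (T x)) (scale_op d (b x))) e" for x
    using bnd_mono[OF bnd_scale_op[OF b(2)[of x], of d] le]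
    by (simp add: scale_op_def diff_op_def right_diff_distrib)
  then show "\<exists>b\<in>A0. \<forall>x. bnd (sfibre G x) (diff_op (scale_op d (T x)) (b x)) e"
    using A0_scale[OF b(1), of d] by (intro bexI[of _ "\<lambda>x. scale_op d (b x)"]) auto
qed

lemma cstar_r_diff:
  assumes "S \<in> cstar_r G" "T \<in> cstar_r G" shows "(\<lambda>x. diff_op (S x) (T x)) \<in> cstar_r G"
  using cstar_r_add[OF assms(1) cstar_r_scale[OF assms(2), of "-1"]]
  by (simp add: add_op_def scale_op_def diff_op_def)

lemma cstar_r_adj:
  assumes "T \<in> cstar_r G" shows "(\<lambda>x. adj (sfibre G x) (T x)) \<in> cstar_r G"
  unfolding cstar_r_iff'
proof (intro conjI allI impI)
  show "adj (sfibre G x) (T x) \<in> bounded_ops (sfibre G x)" for x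
    by (intro adj_bounded cstar_r_bounded assms)
  fix e :: real assume e: "0 < e"
  obtain b where b: "b \<in> A0" "\<And>x. bnd (sfibre G x) (diff_op (T x) (b x)) e"
    using cstar_r_approx[OF assms e] by blast
  note lin = cstar_r_lin[OF assms] A0_lin[OF b(1)]
  have "bnd (sfibre G x) (diff_op (adj (sfibre G x) (T x)) (adj (sfibre G x) (b x))) e" for x
    unfolding adj_diff_op[OF lin, symmetric] by (intro adj_bnd lin_op_diff_op lin b)
  then show "\<exists>b\<in>A0. \<forall>x. bnd (sfibre G x) (diff_op (adj (sfibre G x) (T x)) (b x)) e"
    using A0_adj[OF b(1)] by (intro bexI[of _ "\<lambda>x. adj (sfibre G x) (b x)"]) auto
qed

lemma cstar_r_damp: "T \<in> cstar_r G \<Longrightarrow> (\<lambda>x. damp (sfibre G x) r (T x) n) \<in> cstar_r G"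
proof (induction n)
  case (Suc n)
  then show ?case unfolding damp.simps
    by (intro cstar_r_diff cstar_r_scale cstar_r_comp[OF _ cstar_r_comp] cstar_r_adj) auto
qed simp

text \<open>Completeness: limits exist in each fibre, and as the rate does not depend on x, they are
  again approximated by the span uniformly.\<close>

lemma cstar_r_limit:
  fixes T :: "nat \<Rightarrow> 'g op_family"
  assumes T: "\<And>n. T n \<in> cstar_r G" and e0: "e \<longlonglongrightarrow> 0"
    and e: "\<And>m n x. n \<le> m \<Longrightarrow> bnd (sfibre G x) (diff_op (T m x) (T n x)) (e n)"
  obtains L where "L \<in> cstar_r G" "\<And>n x. bnd (sfibre G x) (diff_op (L x) (T n x)) (e n)"
proof -
  define L where "L x = (\<lambda>\<xi> i. lim (\<lambda>n. T n x \<xi> i))" for x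
  note lim = bounded_ops_limit[of "\<lambda>n. T n x" "sfibre G x" e for x, OF cstar_r_bounded[OF T] e e0, folded L_def]
  have "L \<in> cstar_r G"
    unfolding cstar_r_iff'
  proof (intro conjI allI impI)
    show "L x \<in> bounded_ops (sfibre G x)" for x by (rule lim(1))
    fix d :: real assume d: "0 < d"
    then obtain n where n: "e n < d / 2"
      using order_tendstoD(2)[OF e0, of "d / 2"] by (auto simp: eventually_sequentially)
    obtain b where b: "b \<in> A0" "\<And>x. bnd (sfibre G x) (diff_op (T n x) (b x)) (d / 2)"
      using cstar_r_approx[OF T, of "d / 2" n] d by auto
    have "bnd (sfibre G x) (diff_op (L x) (b x)) (e n + d / 2)" for x
      by (rule bnd_diff_trans[OF bounded_lin[OF lim(1)] cstar_r_lin[OF T] A0_lin[OF b(1)] lim(2) b(2)])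
    then have "bnd (sfibre G x) (diff_op (L x) (b x)) d" for x
      by (rule bnd_mono) (use n in simp)
    then show "\<exists>b\<in>A0. \<forall>x. bnd (sfibre G x) (diff_op (L x) (b x)) d" using b(1) by blast
  qed
  then show thesis using that lim(2) by blast
qed

section \<open>The representation at chi_e on l^2(S)\<close>

abbreviation x0 :: 'g where "x0 \<equiv> a Some (point_char 1)"

definition fib :: "'s \<Rightarrow> 'g" where "fib s = a (ltrans s) (point_char 1)"

lemma ltrans_hull [simp]: "ltrans (s :: 's) \<in> inv_hull"
  by (rule inv_hull.intros)

lemma pinv_hull: "(g :: 's \<rightharpoonup> 's) \<in> inv_hull \<Longrightarrow> pinv g \<in> inv_hull"
  by (rule inv_hull.intros)

lemma comp_hull: "(g :: 's \<rightharpoonup> 's) \<in> inv_hull \<Longrightarrow> h \<in> inv_hull \<Longrightarrow> g \<circ>\<^sub>m h \<in> inv_hull"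
  by (rule inv_hull.intros)

lemma point_Om_ltrans [simp]: "point_char r \<in> Om (ltrans (s :: 's))"
  unfolding point_char_Om[OF ltrans_hull] by (simp add: ltrans_def)

lemma x0_unit: "x0 \<in> gunits G"
  unfolding gunits_eq by auto

text \<open>Equal arrows over chi_e have representatives that agree near chi_e, in particular at 1,
  which gives injectivity. Conversely, a representative of an arrow over chi_e has 1 in its domain
  and is therefore a translation.\<close>

lemma bij_fib: "bij_betw fib UNIV (sfibre G x0)"
  unfolding bij_betw_def
proof
  show "inj fib"
  proof (rule injI)
    fix s t assume "fib s = fib t"
    then have "evn (point_char 1) (\<lambda>r. ltrans s r = ltrans t r)"
      unfolding fib_def by (intro eqD) auto
    then have "ltrans s 1 = ltrans t 1" by (rule evn_point)
    then show "s = t" by (simp add: ltrans_def)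
  qed
  show "range fib = sfibre G x0"
  proof
    show "range fib \<subseteq> sfibre G x0" unfolding sfibre_eq[OF point_char_Omega] fib_def by auto
    show "sfibre G x0 \<subseteq> range fib"
    proof
      fix \<gamma> assume "\<gamma> \<in> sfibre G x0"
      then obtain g where g: "g \<in> inv_hull" "point_char 1 \<in> Om g" "\<gamma> = a g (point_char 1)"
        unfolding sfibre_eq[OF point_char_Omega] by blast
      then obtain v where "g 1 = Some v" using point_char_Om by blast
      then have "g = ltrans v" by (rule hull_ltrans[OF g(1)])
      then show "\<gamma> \<in> range fib" using g(3) by (simp add: fib_def)
    qed
  qed
qed

lemma fib_in: "fib s \<in> sfibre G x0"
  using bij_fib by (auto simp: bij_betw_def)

text \<open>Through \<open>fib\<close> the shift by k becomes k^{-1} acting on S, so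
  \<open>R k\<close> becomes the partial isometry from delta_t to delta_{k(t)}.\<close>

lemma fib_shift_dom: assumes k: "k \<in> inv_hull" shows "fib r \<in> shift_dom k \<longleftrightarrow> r \<in> ran k"
proof -
  have "fib r \<in> shift_dom k \<longleftrightarrow> 1 \<in> dom (pinv k \<circ>\<^sub>m ltrans r)"
    unfolding fib_def shift_dom_iff[OF k ltrans_hull point_Om_ltrans] by (intro point_char_Om comp_hull pinv_hull k) simp
  also have "\<dots> \<longleftrightarrow> r \<in> ran k" by (auto simp: dom_def ran_def pinv_iff[OF k]) (auto simp: ltrans_def)
  finally show ?thesis .
qed

lemma fib_shift: assumes k: "k \<in> inv_hull" and t: "k t = Some r" shows "shift k (fib r) = fib t"
proof -
  let ?m = "pinv k \<circ>\<^sub>m ltrans r"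
  have m: "?m \<in> inv_hull" by (intro comp_hull pinv_hull k) simp
  have m1: "?m 1 = Some t" using t by (simp add: ltrans_def pinv_iff[OF k])
  have "point_char 1 \<in> Om ?m" unfolding point_char_Om[OF m] using m1 by blast
  then have "shift k (fib r) = a ?m (point_char 1)" unfolding fib_def by (intro shift_eq k) simp
  then show ?thesis using hull_ltrans[OF m m1] by (simp add: fib_def)
qed

abbreviation "pirep T \<equiv> rho_monoid x0 fib T"

lemma pi_def': "pirep T = transport_op fib (T x0)"
  by (simp add: rho_monoid_def)

lemma pi_R_ltrans: "pirep (R (ltrans s)) = left_reg s"
proof (intro ext)
  fix \<xi> r
  show "pirep (R (ltrans s)) \<xi> r = left_reg s \<xi> r"
  proof (cases "\<xi> \<in> l2 UNIV")
    case True
    note p = l2_push(1)[OF bij_fib True]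
    have 1: "pirep (R (ltrans s)) \<xi> r = (if fib r \<in> shift_dom (ltrans s) then push fib \<xi> (shift (ltrans s) (fib r)) else 0)"
      using True fib_in[of r] by (simp add: pi_def' transport_eq[OF bij_fib] R_apply[OF ltrans_hull p])
    show ?thesis
    proof (cases "\<exists>t. s * t = r")
      case True
      then obtain t where t: "s * t = r" by blast
      then have "{t. s * t = r} = {t}" using left_cancel by auto
      moreover have "fib r \<in> shift_dom (ltrans s)" unfolding fib_shift_dom[OF ltrans_hull] using t by (auto simp: ran_def ltrans_def)
      moreover have "shift (ltrans s) (fib r) = fib t" by (rule fib_shift[OF ltrans_hull]) (simp add: t ltrans_def)
      ultimately show ?thesis using \<open>\<xi> \<in> l2 UNIV\<close> 1 by (simp add: left_reg_def push_phi[OF bij_fib])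
    next
      case False
      then have "{t. s * t = r} = {}" by auto
      moreover have "fib r \<notin> shift_dom (ltrans s)" unfolding fib_shift_dom[OF ltrans_hull] using False by (auto simp: ran_def ltrans_def)
      ultimately show ?thesis using \<open>\<xi> \<in> l2 UNIV\<close> 1 by (simp add: left_reg_def)
    qed
  next
    case False
    then show ?thesis by (simp add: pi_def' transport_eq[OF bij_fib] left_reg_def)
  qed
qed

lemma pi_bounded: "T \<in> cstar_r G \<Longrightarrow> pirep T \<in> bounded_ops UNIV"
  unfolding pi_def' by (intro transport_bounded[OF bij_fib] cstar_r_bounded)

lemma pi_add: "pirep (\<lambda>y. add_op (S y) (T y)) = add_op (pirep S) (pirep T)"
  by (simp add: pi_def' transport_add_op[OF bij_fib])

lemma pi_diff: "pirep (\<lambda>y. diff_op (S y) (T y)) = diff_op (pirep S) (pirep T)"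
  by (simp add: pi_def' transport_diff_op[OF bij_fib])

lemma pi_scale: "pirep (\<lambda>y. scale_op c (T y)) = scale_op c (pirep T)"
  by (simp add: pi_def' transport_scale_op[OF bij_fib])

lemma pi_comp: "S \<in> cstar_r G \<Longrightarrow> T \<in> cstar_r G \<Longrightarrow> pirep (\<lambda>y. S y \<circ> T y) = pirep S \<circ> pirep T"
  unfolding pi_def' by (intro transport_comp[OF bij_fib] cstar_r_lin)

lemma pi_adjoint:
  "S \<in> cstar_r G \<Longrightarrow> T \<in> cstar_r G \<Longrightarrow> is_adjoint (sfibre G x0) (S x0) (T x0) \<Longrightarrow> is_adjoint UNIV (pirep S) (pirep T)"
  unfolding pi_def' by (intro transport_adjoint[OF bij_fib] cstar_r_lin)

lemma pi_adj: "T \<in> cstar_r G \<Longrightarrow> pirep (\<lambda>x. adj (sfibre G x) (T x)) = adj UNIV (pirep T)"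
  by (intro adj_unique pi_bounded bounded_lin[OF pi_bounded] cstar_r_adj pi_adjoint adj_is_adjoint cstar_r_bounded)

lemma pi_bnd: "T \<in> cstar_r G \<Longrightarrow> bnd UNIV (pirep T) c \<longleftrightarrow> bnd (sfibre G x0) (T x0) c"
  unfolding pi_def' by (intro transport_bnd[OF bij_fib] cstar_r_lin)

text \<open>Follows the generation of the hull: translations give the generators, inverses give
  adjoints and composites give products. Sums and limits are then absorbed by the algebra.\<close>

lemma pi_subset:
  assumes B: "cstar_subalgebra UNIV B" "range left_reg \<subseteq> B" and T: "T \<in> cstar_r G"
  shows "pirep T \<in> B"
proof -
  note B1 = B(1)[unfolded cstar_subalgebra_def]
  have Bb: "B \<subseteq> bounded_ops UNIV" using B1 by (rule conjunct1)
  note B2 = B1[THEN conjunct2]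
  have B0: "zero_op \<in> B" using B2 by (rule conjunct1)
  note B3 = B2[THEN conjunct2]
  note Badd = B3[THEN conjunct1, rule_format]
  note B4 = B3[THEN conjunct2]
  note Bscale = B4[THEN conjunct1, rule_format]
  note B5 = B4[THEN conjunct2]
  note Bcomp = B5[THEN conjunct1, rule_format]
  note B6 = B5[THEN conjunct2]
  note Badj = B6[THEN conjunct1, rule_format]
  note Bcl = B6[THEN conjunct2, THEN bspec, THEN mp]
  have BR: "pirep (R h) \<in> B" if "h \<in> inv_hull" for h
    using that
  proof induction
    case (1 s) then show ?case using B(2) pi_R_ltrans by auto
  next
    case (2 g)
    have Rg: "R g \<in> cstar_r G" by (rule A0_cstar_r[OF A0_R[OF 2(1)]])
    have "pirep (\<lambda>x. adj (sfibre G x) (R g x)) = pirep (R (pinv g))"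
      unfolding pi_def' R_adj[OF 2(1)] ..
    then have "pirep (R (pinv g)) = adj UNIV (pirep (R g))" using pi_adj[OF Rg] by (simp only:)
    then show ?case
      using Badj[OF 2(2) adj_bounded[OF pi_bounded[OF Rg]] adj_is_adjoint[OF pi_bounded[OF Rg]]] by simp
  next
    case (3 g h)
    have Rgh: "R g \<in> cstar_r G" "R h \<in> cstar_r G" using A0_cstar_r A0_R 3 by auto
    have "pirep (R (g \<circ>\<^sub>m h)) = pirep (R g) \<circ> pirep (R h)"
      using pi_comp[OF Rgh] by (simp add: R_comp[OF 3(1,2)] pi_def')
    then show ?case using Bcomp[OF 3(3,4)] by (simp only:)
  qed
  have BA0: "pirep b \<in> B" if "b \<in> A0" for b
    using that
  proof (induction rule: A0.induct)
    case A0_zero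
    then show ?case using B0 by (simp add: pi_def' transport_zero_op[OF bij_fib])
  next
    case (A0_step T k c)
    then show ?case unfolding pi_add pi_scale by (intro Badd Bscale BR)
  qed
  show ?thesis
  proof (rule Bcl[OF pi_bounded[OF T]], unfold op_closure_iff[OF pi_bounded[OF T] Bb], intro allI impI)
    fix e :: real assume "0 < e"
    then obtain b where b: "b \<in> A0" "\<And>x. bnd (sfibre G x) (diff_op (T x) (b x)) e"
      using cstar_r_approx[OF T] by blast
    have "bnd UNIV (diff_op (pirep T) (pirep b)) e"
      unfolding pi_diff[symmetric] using pi_bnd[OF cstar_r_diff[OF T A0_cstar_r[OF b(1)]]] b(2) by simp
    then show "\<exists>S\<in>B. bnd UNIV (diff_op (pirep T) S) e" using BA0[OF b(1)] by blast
  qed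
qed

text \<open>
  Damping replaces the fact that an injective *-homomorphism of C*-algebras is isometric: lifts of
  controlled norm can be summed up, so the image is closed.
\<close>

lemma approximate_lift:
  assumes T: "T \<in> cstar_r G" and c: "0 < c" "bnd (sfibre G x0) (T x0) c"
  obtains T' where "T' \<in> cstar_r G" "\<And>x. bnd (sfibre G x) (T' x) (2 * c)"
    "bnd (sfibre G x0) (diff_op (T x0) (T' x0)) (c / 4)"
proof -
  obtain M where M: "\<And>x. bnd (sfibre G x) (T x) M" using cstar_r_bnd[OF T] by blast
  \<comment> \<open>M bounds T in all fibres, so one pair r, n serves them all; the bound 2c then
    holds everywhere although c is known as a bound only at chi_e.\<close>
  obtain r n where r: "0 < r" "M \<le> sqrt r"
    "\<And>(A :: 'g set) T. T \<in> bounded_ops A \<Longrightarrow> bnd A T (sqrt r) \<Longrightarrow> bnd A (damp A r T n) (2 * c)"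
    "\<And>(A :: 'g set) T. T \<in> bounded_ops A \<Longrightarrow> bnd A T (sqrt r) \<Longrightarrow> bnd A T c \<Longrightarrow> bnd A (diff_op T (damp A r T n)) (c / 4)"
    using damp_lift[OF c(1), of M] by metis
  have M': "bnd (sfibre G x) (T x) (sqrt r)" for x using bnd_mono[OF M r(2)] .
  show thesis
    by (rule that[OF cstar_r_damp[OF T, of r n]]) (intro r cstar_r_bounded T M' c)+
qed

text \<open>Successive approximation: each error is corrected by a lift whose norm in all fibres is
  controlled by the size of the error at chi_e alone, so the corrections add up to a convergent
  series in the reduced algebra.\<close>

lemma pi_closed:
  assumes Y: "Y \<in> bounded_ops UNIV" and ap: "\<And>e. 0 < e \<Longrightarrow> \<exists>T\<in>cstar_r G. bnd UNIV (diff_op Y (pirep T)) e"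
  shows "Y \<in> pirep ` cstar_r G"
proof -
  \<comment> \<open>The invariants of the sequence: after n steps the error is at most 2^{-n}, and
    consecutive lifts differ by at most three times 2^{-n} in every fibre.\<close>
  let ?P = "\<lambda>n T. T \<in> cstar_r G \<and> bnd UNIV (diff_op Y (pirep T)) ((1/2) ^ n)"
  let ?Q = "\<lambda>n T T'. \<forall>x. bnd (sfibre G x) (diff_op (T' x) (T x)) (3 * (1/2) ^ n)"
  note linY = bounded_lin[OF Y]
  note linpi = bounded_lin[OF pi_bounded]
  have "\<exists>f. \<forall>n. ?P n (f n) \<and> ?Q n (f n) (f (Suc n))"
  proof (rule dependent_nat_choice)
    show "\<exists>T. ?P 0 T" using ap[of 1] by auto
    fix T n assume PT: "?P n T"
    define d :: real where "d = (1/2) ^ n"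
    have d: "0 < d" by (simp add: d_def)
    \<comment> \<open>With accuracy d/8 the difference to be lifted has norm at most 9d/8 at chi_e.
      Its lift is bounded by 9d/4 \<le> 3d everywhere, and the new error is at most d/8 + 9d/32
      \<le> d/2.\<close>
    obtain S where S: "S \<in> cstar_r G" "bnd UNIV (diff_op Y (pirep S)) (d / 8)" using ap[of "d / 8"] d by auto
    have T: "T \<in> cstar_r G" "bnd UNIV (diff_op Y (pirep T)) d" using PT by (auto simp: d_def)
    let ?D = "\<lambda>x. diff_op (S x) (T x)"
    have D: "?D \<in> cstar_r G" by (rule cstar_r_diff[OF S(1) T(1)])
    have "bnd UNIV (diff_op (pirep S) (pirep T)) (d / 8 + d)"
      by (rule bnd_diff_trans[OF linpi[OF S(1)] linY linpi[OF T(1)] bnd_diff_commute[OF S(2)] T(2)])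
    then have "bnd (sfibre G x0) (?D x0) (d / 8 + d)" using pi_bnd[OF D] unfolding pi_diff by simp
    then obtain D' where D': "D' \<in> cstar_r G" "\<And>x. bnd (sfibre G x) (D' x) (2 * (d / 8 + d))"
      "bnd (sfibre G x0) (diff_op (?D x0) (D' x0)) ((d / 8 + d) / 4)"
      using approximate_lift[OF D, of "d / 8 + d"] d by auto
    let ?T = "\<lambda>x. add_op (T x) (D' x)"
    have T': "?T \<in> cstar_r G" by (rule cstar_r_add[OF T(1) D'(1)])
    have "bnd (sfibre G x) (diff_op (?T x) (T x)) (3 * (1/2) ^ n)" for x
    proof -
      have "diff_op (?T x) (T x) = D' x" by (simp add: diff_op_def add_op_def)
      then show ?thesis using bnd_mono[OF D'(2), of "3 * (1/2) ^ n" x] d by (simp add: d_def)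
    qed
    moreover have "bnd UNIV (diff_op Y (pirep ?T)) ((1/2) ^ Suc n)"
    proof -
      have "bnd UNIV (pirep (\<lambda>x. diff_op (?D x) (D' x))) ((d / 8 + d) / 4)"
        using pi_bnd[OF cstar_r_diff[OF D D'(1)]] D'(3) by simp
      moreover have "pirep (\<lambda>x. diff_op (?D x) (D' x)) = diff_op (pirep S) (pirep ?T)"
        by (simp add: pi_def' flip: transport_diff_op[OF bij_fib])
          (simp add: diff_op_def add_op_def diff_diff_eq)
      ultimately have "bnd UNIV (diff_op (pirep S) (pirep ?T)) ((d / 8 + d) / 4)" by (simp only:)
      then have "bnd UNIV (diff_op Y (pirep ?T)) (d / 8 + (d / 8 + d) / 4)"
        by (rule bnd_diff_trans[OF linY linpi[OF S(1)] linpi[OF T'] S(2)])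
      then show ?thesis by (rule bnd_mono) (use d in \<open>simp add: d_def\<close>)
    qed
    ultimately show "\<exists>T'. ?P (Suc n) T' \<and> ?Q n T T'" using T' by blast
  qed
  then obtain f where f: "\<And>n. f n \<in> cstar_r G" "\<And>n. bnd UNIV (diff_op Y (pirep (f n))) ((1/2) ^ n)"
    "\<And>n x. bnd (sfibre G x) (diff_op (f (Suc n) x) (f n x)) (3 * (1/2) ^ n)" by blast
  \<comment> \<open>The subtracted term is the exact tail of the geometric series, which lets the
    induction close.\<close>
  have cau: "bnd (sfibre G x) (diff_op (f m x) (f n x)) (6 * (1/2) ^ n - 6 * (1/2) ^ m)" if "n \<le> m" for m n x
    using that
  proof (induction rule: dec_induct)
    case base then show ?case by (simp add: bnd_def diff_op_def)
  next
    case (step m)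
    have "bnd (sfibre G x) (diff_op (f (Suc m) x) (f n x)) (3 * (1/2) ^ m + (6 * (1/2) ^ n - 6 * (1/2) ^ m))"
      by (rule bnd_diff_trans[OF cstar_r_lin[OF f(1)] cstar_r_lin[OF f(1)] cstar_r_lin[OF f(1)] f(3) step.IH])
    then show ?case by simp
  qed
  have "bnd (sfibre G x) (diff_op (f m x) (f n x)) (6 * (1/2) ^ n)" if "n \<le> m" for m n x
    by (rule bnd_mono[OF cau[OF that]]) simp
  moreover have lim6: "(\<lambda>n. 6 * (1/2) ^ n) \<longlonglongrightarrow> (0 :: real)"
    by (intro tendsto_mult_right_zero LIMSEQ_realpow_zero) auto
  ultimately obtain L where L: "L \<in> cstar_r G" "\<And>n x. bnd (sfibre G x) (diff_op (L x) (f n x)) (6 * (1/2) ^ n)"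
    using cstar_r_limit[of f "\<lambda>n. 6 * (1/2) ^ n"] f(1) by blast
  have "bnd UNIV (diff_op Y (pirep L)) e" if e: "0 < e" for e
  proof -
    have "(\<lambda>n. (1/2) ^ n + 6 * (1/2) ^ n) \<longlonglongrightarrow> (0 + 0 :: real)"
      by (intro tendsto_add lim6 LIMSEQ_realpow_zero) auto
    from order_tendstoD(2)[OF this, of e] e obtain n where n: "(1/2) ^ n + 6 * (1/2) ^ n < e"
      by (auto simp: eventually_sequentially)
    have "bnd UNIV (diff_op (pirep L) (pirep (f n))) (6 * (1/2) ^ n)"
      unfolding pi_diff[symmetric] using pi_bnd[OF cstar_r_diff[OF L(1) f(1)]] L(2) by simp
    then have "bnd UNIV (diff_op Y (pirep L)) ((1/2) ^ n + 6 * (1/2) ^ n)"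
      using bnd_diff_trans[OF linY linpi[OF f(1)] linpi[OF L(1)] f(2)] bnd_diff_commute by blast
    then show ?thesis by (rule bnd_mono) (use n in simp)
  qed
  then have "diff_op Y (pirep L) = zero_op"
    by (intro bnd_all_zero[of UNIV] lin_op_diff_op linY linpi L)
  then have "Y = pirep L" by (simp add: diff_op_def zero_op_def fun_eq_iff)
  then show ?thesis using L(1) by blast
qed

text \<open>\<open>pi_subset\<close> gives one inclusion. The other is minimality of the generated
  algebra, for which the image must be norm closed.\<close>

lemma pi_image: "pirep ` cstar_r G = (cstar_r_monoid :: 's l2_op set)"
proof
  show "pirep ` cstar_r G \<subseteq> cstar_r_monoid"
    unfolding cstar_r_monoid_def cstar_generated_def using pi_subset by blast
  let ?B = "pirep ` cstar_r G"
  have Bb: "?B \<subseteq> bounded_ops UNIV" using pi_bounded by blast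
  have "cstar_subalgebra UNIV ?B"
    unfolding cstar_subalgebra_def
  proof (intro conjI ballI allI impI Bb)
    have "pirep (\<lambda>x. zero_op) = zero_op" by (simp add: pi_def' transport_zero_op[OF bij_fib])
    then show "zero_op \<in> ?B" using A0_cstar_r[OF A0_zero] by (metis imageI)
  next
    fix S T assume "S \<in> ?B" "T \<in> ?B"
    then show "add_op S T \<in> ?B" using cstar_r_add by (auto simp flip: pi_add)
  next
    fix c T assume "T \<in> ?B"
    then show "scale_op c T \<in> ?B" using cstar_r_scale by (auto simp flip: pi_scale)
  next
    fix S T assume "S \<in> ?B" "T \<in> ?B"
    then obtain S' T' where *: "S' \<in> cstar_r G" "T' \<in> cstar_r G" "S = pirep S'" "T = pirep T'" by blast
    then have "S \<circ> T = pirep (\<lambda>y. S' y \<circ> T' y)" by (simp add: pi_comp)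
    then show "S \<circ> T \<in> ?B" using cstar_r_comp[OF *(1,2)] by blast
  next
    fix T T' assume "T \<in> ?B" and T': "T' \<in> bounded_ops UNIV" "is_adjoint UNIV T T'"
    then obtain U where U: "U \<in> cstar_r G" "T = pirep U" by blast
    then have "T' = adj UNIV (pirep U)" using adj_unique[OF pi_bounded[OF U(1)] bounded_lin[OF T'(1)]] T'(2) by simp
    then have "T' = pirep (\<lambda>x. adj (sfibre G x) (U x))" using pi_adj[OF U(1)] by simp
    then show "T' \<in> ?B" using cstar_r_adj[OF U(1)] by blast
  next
    fix T assume T: "T \<in> bounded_ops UNIV" "\<forall>\<epsilon>>0. \<exists>S\<in>?B. op_norm UNIV (diff_op T S) < \<epsilon>"
    then have "\<forall>e>0. \<exists>S\<in>?B. bnd UNIV (diff_op T S) e" using op_closure_iff[OF T(1) Bb] by blast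
    then show "T \<in> ?B" by (intro pi_closed T) blast
  qed
  moreover have "range left_reg \<subseteq> ?B"
  proof
    fix T :: "'s l2_op" assume "T \<in> range left_reg"
    then obtain s where "T = pirep (R (ltrans s))" using pi_R_ltrans by auto
    then show "T \<in> ?B" using A0_cstar_r[OF A0_R[OF ltrans_hull]] by blast
  qed
  ultimately show "cstar_r_monoid \<subseteq> ?B" unfolding cstar_r_monoid_def cstar_generated_def by blast
qed

end

section \<open>The kernel\<close>

lemma meager_in_countable:
  assumes "countable \<N>" "\<And>N. N \<in> \<N> \<Longrightarrow> N \<subseteq> topspace X \<and> X interior_of (X closure_of N) = {}"
  shows "meager_in X (\<Union>\<N>)"
proof (cases "\<N> = {}")
  case True
  then show ?thesis unfolding meager_in_def by (intro exI[of _ "\<lambda>_. {}"]) auto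
next
  case False
  then show ?thesis unfolding meager_in_def
    using assms from_nat_into[OF False] range_from_nat_into[OF False assms(1)]
    by (intro exI[of _ "from_nat_into \<N>"]) auto
qed

text \<open>An open subset of the boundary misses the open set \<open>S\<close>, hence also its
  closure, in which it lies.\<close>

lemma interior_of_frontier_of_open:
  assumes "openin X S" shows "X interior_of (X frontier_of S) = {}"
proof -
  let ?I = "X interior_of (X frontier_of S)"
  have "?I \<subseteq> X closure_of S - S"
    using interior_of_subset[of X "X frontier_of S"] assms by (simp add: frontier_of_def interior_of_openin)
  moreover from this have "?I \<inter> X closure_of S = {}"
    unfolding openin_Int_closure_of_eq_empty[OF openin_interior_of] by blast
  ultimately show ?thesis by blast
qed

text \<open>\<open>J_sing\<close> speaks of the units as a subspace of the groupoid, the arguments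
  take place in \<Omega>(S); this passes from one to the other.\<close>

lemma meager_in_homeomorphic:
  assumes f: "homeomorphic_map X Y f" and A: "A \<subseteq> topspace X"
  shows "meager_in Y (f ` A) \<longleftrightarrow> meager_in X A"
proof -
  have nd: "Y interior_of (Y closure_of (f ` N)) = {} \<longleftrightarrow> X interior_of (X closure_of N) = {}"
    if "N \<subseteq> topspace X" for N
    using homeomorphic_map_closure_of[OF f that] homeomorphic_map_interior_of[OF f closure_of_subset_topspace, of N]
    by simp
  have inj: "inj_on f (topspace X)" and im: "f ` topspace X = topspace Y"
    using homeomorphic_imp_injective_map[OF f] homeomorphic_imp_surjective_map[OF f] by simp_all
  show ?thesis
  proof
    assume "meager_in X A"
    then obtain N where "\<forall>n. N n \<subseteq> topspace X \<and> X interior_of (X closure_of N n) = {}"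
      and NA: "A = (\<Union>n :: nat. N n)" unfolding meager_in_def by blast
    then have N: "N n \<subseteq> topspace X" "X interior_of (X closure_of N n) = {}" for n by auto
    have "f ` N n \<subseteq> topspace Y" for n using N(1) im by blast
    then show "meager_in Y (f ` A)" unfolding meager_in_def
      using nd[OF N(1)] N(2) NA by (intro exI[of _ "\<lambda>n. f ` N n"]) auto
  next
    assume "meager_in Y (f ` A)"
    then obtain N where "\<forall>n. N n \<subseteq> topspace Y \<and> Y interior_of (Y closure_of N n) = {}"
      and NA: "f ` A = (\<Union>n :: nat. N n)" unfolding meager_in_def by blast
    then have N: "N n \<subseteq> topspace Y" "Y interior_of (Y closure_of N n) = {}" for n by auto
    let ?M = "\<lambda>n. {x \<in> topspace X. f x \<in> N n}"
    have fM: "f ` ?M n = N n" for n using N(1)[of n] im by auto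
    have "A = (\<Union>n. ?M n)"
    proof
      show "A \<subseteq> (\<Union>n. ?M n)" using NA A by blast
      show "(\<Union>n. ?M n) \<subseteq> A"
      proof
        fix x assume "x \<in> (\<Union>n. ?M n)"
        then have x: "x \<in> topspace X" "f x \<in> f ` A" using NA by auto
        then show "x \<in> A" using inj A by (auto dest: inj_onD)
      qed
    qed
    then show "meager_in X A" unfolding meager_in_def
      using nd[of "?M _"] fM N(2) by (intro exI[of _ ?M]) auto
  qed
qed

text \<open>Baire's theorem for compact Hausdorff spaces, applied to the closures of the nowhere
  dense pieces.\<close>

lemma meager_in_interior:
  assumes "compact_space X" "Hausdorff_space X" "meager_in X A"
  shows "X interior_of A = {}"
proof -
  obtain N where "\<forall>n. N n \<subseteq> topspace X \<and> X interior_of (X closure_of N n) = {}" and A: "A = (\<Union>n :: nat. N n)"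
    using assms(3) unfolding meager_in_def by blast
  then have N: "N n \<subseteq> topspace X" "X interior_of (X closure_of N n) = {}" for n by auto
  let ?G = "range (\<lambda>n. X closure_of N n)"
  have "X interior_of \<Union>?G = {}"
  proof (rule Baire_category_alt)
    show "completely_metrizable_space X \<or> locally_compact_space X \<and> regular_space X"
      using assms compact_imp_locally_compact_space compact_Hausdorff_or_regular_imp_normal_space
        compact_Hausdorff_imp_regular_space by blast
  qed (use N in auto)
  moreover have "A \<subseteq> \<Union>?G" unfolding A using closure_of_subset[OF N(1)] by blast
  ultimately show ?thesis using interior_of_mono by blast
qed

section \<open>Countability of the hull, density of point characters, fixed points\<close>

context left_cancellative
begin

lemma countable_inv_hull:
  assumes "countable (UNIV :: 's set)" shows "countable (inv_hull :: ('s \<rightharpoonup> 's) set)"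
proof -
  \<comment> \<open>Stage n contains what n rounds of inverses and products produce from
    translations; every stage is countable.\<close>
  define L :: "nat \<Rightarrow> ('s \<rightharpoonup> 's) set" where
    "L = rec_nat (range ltrans) (\<lambda>_ A. A \<union> pinv ` A \<union> (\<lambda>(g, h). g \<circ>\<^sub>m h) ` (A \<times> A))"
  have L0: "L 0 = range ltrans" and LS: "L (Suc n) = L n \<union> pinv ` L n \<union> (\<lambda>(g, h). g \<circ>\<^sub>m h) ` (L n \<times> L n)" for n
    by (simp_all add: L_def)
  have mono: "L n \<subseteq> L m" if "n \<le> m" for n m
    using that by (rule lift_Suc_mono_le[rotated]) (auto simp: LS)
  have "countable (L n)" for n
    by (induction n) (use assms in \<open>auto simp: L0 LS\<close>)
  moreover have "g \<in> (\<Union>n. L n)" if "g \<in> inv_hull" for g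
    using that
  proof induction
    case (1 s) then show ?case using L0 by blast
  next
    case (2 g)
    then obtain n where "g \<in> L n" by blast
    then have "pinv g \<in> L (Suc n)" unfolding LS by blast
    then show ?case by blast
  next
    case (3 g h)
    then obtain n m where "g \<in> L n" "h \<in> L m" by blast
    then have "(g, h) \<in> L (max n m) \<times> L (max n m)" using mono[of n "max n m"] mono[of m "max n m"] by auto
    then have "g \<circ>\<^sub>m h \<in> L (Suc (max n m))" unfolding LS by force
    then show ?case by blast
  qed
  ultimately show ?thesis by (intro countable_subset[of inv_hull "\<Union>n. L n"]) auto
qed

lemma point_char_dense: "openin Otop U \<Longrightarrow> U \<noteq> {} \<Longrightarrow> \<exists>s. point_char s \<in> U"
proof -
  assume U: "openin Otop U" "U \<noteq> {}"
  then obtain \<omega> where \<omega>: "\<omega> \<in> U" by blast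
  then have W: "\<omega> \<in> Omega" using openin_subset[OF U(1)] by auto
  obtain P where P: "finite P" "P \<subseteq> idems" "cyl P \<omega> \<subseteq> U" "\<omega> \<in> cyl P \<omega>"
    by (rule openin_cyl[OF U(1) \<omega>])
  obtain s where "\<forall>p\<in>P. \<omega> p = point_char s p" 
    using W[unfolded Omega_iff, THEN conjunct2, rule_format, OF P(1,2)] by blast
  then have "point_char s \<in> cyl P \<omega>" by (simp add: cyl_def)
  then show ?thesis using P(3) by blast
qed

text \<open>
  A partial bijection that does not fix \<open>1\<close> either misses \<open>1\<close> in its domain or range, or is
  the translation by a nontrivial unit.
\<close>

lemma moves_points:
  assumes units_act: "\<And>(U :: 's set) X. finite U \<Longrightarrow> U \<subseteq> monoid_units - {1} \<Longrightarrow>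
      X \<in> constructible_bar \<Longrightarrow> 1 \<in> X \<Longrightarrow>
      \<exists>Z\<in>constructible_bar. Z \<noteq> {} \<and> Z \<subseteq> X \<and> (\<forall>s\<in>Z. \<forall>u\<in>U. u * s \<noteq> s)"
    and K: "finite K" "K \<subseteq> (inv_hull :: ('s \<rightharpoonup> 's) set)"
  obtains Z where "Z \<in> constructible_bar" "Z \<noteq> {}"
    "\<And>m z. m \<in> K \<Longrightarrow> m 1 \<noteq> Some 1 \<Longrightarrow> z \<in> Z \<Longrightarrow> m z \<noteq> Some z"
proof -
  \<comment> \<open>Domains and ranges that miss 1 are constructible; removing them leaves a set of
    \<open>constructible_bar\<close> that contains 1 and on which the corresponding maps have no
    fixed point.\<close>
  let ?F = "dom ` {m \<in> K. 1 \<notin> dom m} \<union> ran ` {m \<in> K. 1 \<notin> ran m}"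
  let ?X = "UNIV - \<Union>?F"
  let ?U = "{v. v \<noteq> 1 \<and> (\<exists>m\<in>K. m 1 = Some v \<and> 1 \<in> ran m)}"
  have "finite ?F" "?F \<subseteq> constructible" using K constructible_dom constructible_ran by auto
  then have X: "?X \<in> constructible_bar" using constructible.intros(1) unfolding constructible_bar_def by blast
  have "?U \<subseteq> (\<lambda>m. the (m 1)) ` K" by force
  then have fU: "finite ?U" by (rule finite_subset) (use K in auto)
  have sU: "?U \<subseteq> monoid_units - {1}"
  proof
    fix v assume "v \<in> ?U"
    then obtain m where m: "m \<in> K" "m 1 = Some v" "1 \<in> ran m" "v \<noteq> 1" by blast
    then have "m = ltrans v" using hull_ltrans K by blast
    then obtain w where w: "v * w = 1" using m(3) by (auto simp: ran_def ltrans_def)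
    \<comment> \<open>By left cancellation a right inverse of v is also a left inverse.\<close>
    then have "v * (w * v) = v * 1" by (simp flip: mult.assoc)
    then have "w * v = 1" by (rule left_cancel)
    then show "v \<in> monoid_units - {1}" using w m(4) by (auto simp: monoid_units_def)
  qed
  have oX: "1 \<in> ?X" by blast
  obtain Z where Z: "Z \<in> constructible_bar" "Z \<noteq> {}" "Z \<subseteq> ?X" "\<forall>s\<in>Z. \<forall>u\<in>?U. u * s \<noteq> s"
    using units_act[OF fU sU X oX] by (elim bexE conjE)
  have "m z \<noteq> Some z" if m: "m \<in> K" "m 1 \<noteq> Some 1" and z: "z \<in> Z" for m z
  proof
    assume mz: "m z = Some z"
    then have "z \<in> dom m" "z \<in> ran m" by (auto simp: ran_def)
    moreover have "z \<in> ?X" using z Z(3) by blast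
    ultimately have "1 \<in> dom m" "1 \<in> ran m" using m(1) by auto
    then obtain v where v: "m 1 = Some v" by blast
    then have "v \<in> ?U" using m \<open>1 \<in> ran m\<close> by auto
    moreover have "m = ltrans v" using hull_ltrans v K m(1) by blast
    ultimately show False using mz Z(4) z by (auto simp: ltrans_def)
  qed
  then show thesis using that Z by blast
qed

text \<open>Such a set is the trace of a neighbourhood of each of its points: lying in X and missing
  each removed ideal are finitely many conditions on the character of z.\<close>

lemma evn_point_bar:
  assumes "(Z :: 's set) \<in> constructible_bar" "z \<in> Z" shows "evn (point_char z) (\<lambda>r. r \<in> Z)"
proof -
  obtain X F where Z: "Z = X - \<Union>F" "X \<in> constructible" "finite F" "F \<subseteq> constructible"
    using assms(1) by (auto simp: constructible_bar_def)
  obtain p where p: "p \<in> idems" "dom p = X" using constructible_idem[OF Z(2)] .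
  have A: "evn (point_char z) (\<lambda>r. r \<in> X)"
    using evn_dom[OF p(1), of "point_char z"] p Z(1) assms(2) by (simp add: point_char_apply)
  have B: "evn (point_char z) (\<lambda>r. r \<notin> \<Union>F)"
    if "finite F" "F \<subseteq> constructible" "z \<notin> \<Union>F" for F
    using that
  proof (induction F)
    case empty then show ?case by (simp add: evn_True)
  next
    case (insert Y F)
    obtain q where q: "q \<in> idems" "dom q = Y" using constructible_idem[of Y] insert.prems by auto
    have "evn (point_char z) (\<lambda>r. r \<notin> Y)"
      using evn_not_dom[OF q(1), of "point_char z"] q insert.prems by (simp add: point_char_apply)
    moreover have "evn (point_char z) (\<lambda>r. r \<notin> \<Union>F)" using insert by simp
    ultimately show ?case by (rule evn_mono[OF evn_conj]) auto
  qed
  have "z \<notin> \<Union>F" using Z(1) assms(2) by blast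
  from evn_conj[OF A B[OF Z(3,4) this]] show ?thesis unfolding Z(1) by (rule evn_mono) blast
qed

lemma comp_idem_cong:
  assumes "(p :: 's \<rightharpoonup> 's) \<in> idems" "\<And>x. x \<in> dom p \<Longrightarrow> g x = h x"
  shows "g \<circ>\<^sub>m p = h \<circ>\<^sub>m p"
proof
  fix x
  show "(g \<circ>\<^sub>m p) x = (h \<circ>\<^sub>m p) x"
    using assms(2)[of x] idem_id[OF assms(1), of x] by (cases "p x") (auto simp: map_comp_def)
qed

end

section \<open>Coefficients on the groupoid and the singular ideal\<close>

context germ_groupoid
begin

text \<open>The value at [g, \<omega>] of the function on the groupoid that \<open>T\<close>
  represents; on C_c(G) it returns the function itself.\<close>

definition germ_coeff :: "'g op_family \<Rightarrow> ('s \<rightharpoonup> 's) \<Rightarrow> 's chr \<Rightarrow> complex" where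
  "germ_coeff T g \<omega> = T (a Some \<omega>) (l2_delta (a Some \<omega>)) (a g \<omega>)"

text \<open>Open by \<open>open_eq\<close>, but in general not closed; its boundary is where
  coefficients may jump.\<close>

definition coincidence :: "('s \<rightharpoonup> 's) \<Rightarrow> ('s \<rightharpoonup> 's) \<Rightarrow> 's chr set" where
  "coincidence g k = {\<omega> \<in> Om g \<inter> Om k. a g \<omega> = a k \<omega>}"

lemma unit_sfibre: "\<omega> \<in> Omega \<Longrightarrow> a Some \<omega> \<in> sfibre G (a Some \<omega>)"
  using sfibre_eq by auto

lemma germ_coeff_R:
  assumes k: "k \<in> inv_hull" and g: "g \<in> inv_hull" and \<omega>: "\<omega> \<in> Om g"
  shows "germ_coeff (R k) g \<omega> = (if \<omega> \<in> coincidence g k then 1 else 0)"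
proof -
  have W: "\<omega> \<in> Omega" using \<omega> Om_Omega by blast
  have 1: "a Some \<omega> \<in> shift_dom (pinv k) \<longleftrightarrow> \<omega> \<in> Om k"
    using shift_dom_iff[OF pinv_hull[OF k] Some_hull, of \<omega>] W pinv_pinv[OF k] by simp
  have 2: "shift (pinv k) (a Some \<omega>) = a k \<omega>" if "\<omega> \<in> Om k"
    using shift_eq[OF pinv_hull[OF k] Some_hull, of \<omega>] that pinv_pinv[OF k] by simp
  show ?thesis
    unfolding germ_coeff_def R_delta[OF k unit_sfibre[OF W]] using 1 2 \<omega>
    by (auto simp: l2_delta_def coincidence_def)
qed

lemma germ_coeff_approx:
  assumes T: "lin_op (sfibre G (a Some \<omega>)) (T (a Some \<omega>))" "lin_op (sfibre G (a Some \<omega>)) (b (a Some \<omega>))"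
    and \<omega>: "\<omega> \<in> Omega" and e: "bnd (sfibre G (a Some \<omega>)) (diff_op (T (a Some \<omega>)) (b (a Some \<omega>))) e"
  shows "cmod (germ_coeff T g \<omega> - germ_coeff b g \<omega>) \<le> e"
proof -
  let ?x = "a Some \<omega>"
  have d: "l2_delta ?x \<in> l2 (sfibre G ?x)" by (rule l2_delta_in[OF unit_sfibre[OF \<omega>]])
  have "cmod (germ_coeff T g \<omega> - germ_coeff b g \<omega>) = cmod (diff_op (T ?x) (b ?x) (l2_delta ?x) (a g \<omega>))"
    by (simp add: germ_coeff_def diff_op_def)
  also have "\<dots> \<le> l2_norm (diff_op (T ?x) (b ?x) (l2_delta ?x))"
    by (rule cmod_le_l2_norm[OF lin_op_in[OF lin_op_diff_op[OF T]]])
  also have "\<dots> \<le> e * 1" using bndD[OF e d] by (simp add: l2_norm_delta)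
  finally show ?thesis by simp
qed

text \<open>By \<open>germ_coeff_R\<close> a generator contributes the indicator of a coincidence
  set, so a finite combination sees only which of finitely many such sets contain the character. The
  set \<open>K\<close> is the same for all g.\<close>

lemma A0_finite_dependence:
  "b \<in> A0 \<Longrightarrow> \<exists>K. finite K \<and> K \<subseteq> inv_hull \<and> (\<forall>g\<in>inv_hull. \<forall>\<omega>\<in>Om g. \<forall>\<psi>\<in>Om g.
    (\<forall>k\<in>K. \<omega> \<in> coincidence g k \<longleftrightarrow> \<psi> \<in> coincidence g k) \<longrightarrow> germ_coeff b g \<omega> = germ_coeff b g \<psi>)"
proof (induction rule: A0.induct)
  case A0_zero
  then show ?case by (intro exI[of _ "{}"]) (simp add: germ_coeff_def zero_op_def)
next
  case (A0_step T k c)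
  then obtain K where K: "finite K" "K \<subseteq> inv_hull" "\<forall>g\<in>inv_hull. \<forall>\<omega>\<in>Om g. \<forall>\<psi>\<in>Om g.
    (\<forall>k\<in>K. \<omega> \<in> coincidence g k \<longleftrightarrow> \<psi> \<in> coincidence g k) \<longrightarrow> germ_coeff T g \<omega> = germ_coeff T g \<psi>" by blast
  have s: "germ_coeff (\<lambda>x. add_op (T x) (scale_op c (R k x))) g \<omega> = germ_coeff T g \<omega> + c * germ_coeff (R k) g \<omega>" for g \<omega>
    by (simp add: germ_coeff_def add_op_def scale_op_def)
  show ?case
  proof (intro exI[of _ "insert k K"] conjI ballI impI)
    fix g \<omega> \<psi> assume g: "g \<in> inv_hull" "\<omega> \<in> Om g" "\<psi> \<in> Om g"
      "\<forall>k\<in>insert k K. \<omega> \<in> coincidence g k \<longleftrightarrow> \<psi> \<in> coincidence g k"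
    have "germ_coeff T g \<omega> = germ_coeff T g \<psi>" using K(3)[rule_format, OF g(1-3)] g(4) by simp
    moreover have "germ_coeff (R k) g \<omega> = germ_coeff (R k) g \<psi>"
      using germ_coeff_R[OF A0_step.hyps(2) g(1)] g(2-4) by simp
    ultimately show "germ_coeff (\<lambda>x. add_op (T x) (scale_op c (R k x))) g \<omega> =
        germ_coeff (\<lambda>x. add_op (T x) (scale_op c (R k x))) g \<psi>" unfolding s by simp
  qed (use K A0_step.hyps in auto)
qed

text \<open>Right multiplication by [s, chi_e] carries the fibre over chi_s onto the one over chi_e,
  so coefficients at chi_s are matrix entries of the operator at chi_e. This is checked on
  generators and extended by approximation.\<close>

lemma germ_coeff_point:
  assumes T: "T \<in> cstar_r G" and g: "g \<in> inv_hull" "g s = Some t"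
  shows "germ_coeff T g (point_char s) = T x0 (l2_delta (fib s)) (fib t)"
proof -
  have sg: "point_char s \<in> Om g" unfolding point_char_Om[OF g(1)] using g(2) by blast
  have R: "germ_coeff (R k) g (point_char s) = R k x0 (l2_delta (fib s)) (fib t)" if k: "k \<in> inv_hull" for k
  proof -
    have 1: "point_char s \<in> coincidence g k \<longleftrightarrow> k s = Some t"
    proof
      assume "point_char s \<in> coincidence g k"
      then have "evn (point_char s) (\<lambda>r. g r = k r)" unfolding coincidence_def using eqD[OF g(1) k] by blast
      then have "g s = k s" by (rule evn_point)
      then show "k s = Some t" using g(2) by simp
    next
      assume ks: "k s = Some t"
      then have sk: "point_char s \<in> Om k" unfolding point_char_Om[OF k] by blast
      \<comment> \<open>Both g and k send s to t, hence agree on all of sS, the domain of an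
        idempotent with value 1 at chi_s.\<close>
      obtain p where p: "p \<in> idems" "dom p = range ((*) s)" using idem_ideal .
      have "s \<in> dom p" unfolding p(2) by (rule range_eqI[of _ _ 1]) simp
      then have p1: "point_char s p = 1" using p(1) by (simp add: point_char_apply)
      have "g \<circ>\<^sub>m p = k \<circ>\<^sub>m p"
      proof (rule comp_idem_cong[OF p(1)])
        fix x assume "x \<in> dom p"
        then obtain r where "x = s * r" unfolding p(2) by blast
        then show "g x = k x" using hull_right[OF g] hull_right[OF k ks] by simp
      qed
      then have "a g (point_char s) = a k (point_char s)" by (rule eqI[OF g(1) k sg sk p(1) p1])
      then show "point_char s \<in> coincidence g k" using sg sk by (simp add: coincidence_def)
    qed
    have pk: "pinv k \<in> inv_hull" by (rule pinv_hull[OF k])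
    have 2: "fib s \<in> shift_dom (pinv k) \<longleftrightarrow> s \<in> dom k"
      unfolding fib_shift_dom[OF pk] by (auto simp: ran_def pinv_iff[OF k])
    have 3: "shift (pinv k) (fib s) = fib v" if "k s = Some v" for v
      by (rule fib_shift[OF pk]) (simp add: pinv_iff[OF k] that)
    have inj: "fib t = fib v \<longleftrightarrow> t = v" for v using bij_fib by (auto simp: bij_betw_def inj_def)
    show ?thesis
    proof (cases "k s")
      case None
      then show ?thesis
        unfolding germ_coeff_R[OF k g(1) sg] R_delta[OF k fib_in] using 1 2 by auto
    next
      case (Some v)
      then show ?thesis
        unfolding germ_coeff_R[OF k g(1) sg] R_delta[OF k fib_in] using 1 2 3 inj
        by (auto simp: l2_delta_def)
    qed
  qed
  have A: "germ_coeff b g (point_char s) = b x0 (l2_delta (fib s)) (fib t)" if "b \<in> A0" for b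
    using that
  proof (induction rule: A0.induct)
    case A0_zero
    then show ?case by (simp add: germ_coeff_def zero_op_def)
  next
    case (A0_step T k c)
    then show ?case using R[OF A0_step.hyps(2)] by (simp add: germ_coeff_def add_op_def scale_op_def)
  qed
  have "cmod (germ_coeff T g (point_char s) - T x0 (l2_delta (fib s)) (fib t)) \<le> 0 + e" if e: "0 < e" for e
  proof -
    have "0 < e / 2" using e by simp
    then obtain b where b: "b \<in> A0" "\<And>x. bnd (sfibre G x) (diff_op (T x) (b x)) (e / 2)"
      using cstar_r_approx[OF T] by blast
    have 1: "cmod (germ_coeff T g (point_char s) - germ_coeff b g (point_char s)) \<le> e / 2"
      by (intro germ_coeff_approx cstar_r_lin T A0_lin b) simp
    have "cmod (T x0 (l2_delta (fib s)) (fib t) - b x0 (l2_delta (fib s)) (fib t)) \<le>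
        l2_norm (diff_op (T x0) (b x0) (l2_delta (fib s)))"
      unfolding diff_op_def
      by (rule cmod_le_l2_norm[OF l2_diff(1)[OF lin_op_in[OF cstar_r_lin[OF T]] lin_op_in[OF A0_lin[OF b(1)]]]])
    also have "\<dots> \<le> e / 2" using bndD[OF b(2) l2_delta_in[OF fib_in]] by (simp add: l2_norm_delta)
    finally have 2: "cmod (T x0 (l2_delta (fib s)) (fib t) - b x0 (l2_delta (fib s)) (fib t)) \<le> e / 2" .
    have "germ_coeff T g (point_char s) - T x0 (l2_delta (fib s)) (fib t) =
      (germ_coeff T g (point_char s) - germ_coeff b g (point_char s)) - (T x0 (l2_delta (fib s)) (fib t) - b x0 (l2_delta (fib s)) (fib t))"
      using A[OF b(1)] by simp
    then show ?thesis using norm_triangle_ineq4 1 2 by (smt (verit) field_sum_of_halves)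
  qed
  then have "cmod (germ_coeff T g (point_char s) - T x0 (l2_delta (fib s)) (fib t)) \<le> 0" by (rule field_le_epsilon)
  then show ?thesis by simp
qed

lemma homeomorphic_units: "homeomorphic_map Otop (subtopology (gtop G) (gunits G)) (a Some)"
proof (rule bijective_open_imp_homeomorphic_map)
  have sub: "gunits G \<subseteq> topspace (gtop G)"
    unfolding gunits_eq using arrowI[OF Some_hull] by (auto simp: arrows_def)
  show "continuous_map Otop (subtopology (gtop G) (gunits G)) (a Some)"
    unfolding continuous_map_in_subtopology using continuous_a[OF Some_hull] gunits_eq
    by (auto simp: subtopology_superset[of Otop Omega])
  show "open_map Otop (subtopology (gtop G) (gunits G)) (a Some)"
    unfolding open_map_def
  proof (intro allI impI)
    fix U assume U: "openin Otop U"
    then have s: "U \<subseteq> Omega" using openin_subset by fastforce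
    have "openin (gtop G) (a Some ` U)" using openin_bisection[OF Some_hull U] s by simp
    moreover have "a Some ` U \<subseteq> gunits G" using s gunits_eq by auto
    ultimately show "openin (subtopology (gtop G) (gunits G)) (a Some ` U)"
      by (simp add: openin_subset_topspace_eq openin_subtopology Int_absorb2) (metis Int_absorb2)
  qed
  show "a Some ` topspace Otop = topspace (subtopology (gtop G) (gunits G))"
    using sub gunits_eq by auto
  show "inj_on (a Some) (topspace Otop)" using unit_inj by (auto simp: inj_on_def)
qed

text \<open>The set in the definition of \<open>J_sing\<close>, read in \<Omega>(S).\<close>

definition singular :: "'g op_family \<Rightarrow> 's chr set" where
  "singular T = {\<omega> \<in> Omega. \<exists>g\<in>inv_hull. \<omega> \<in> Om g \<and> germ_coeff T g \<omega> \<noteq> 0}"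

lemma J_sing_iff:
  assumes T: "T \<in> cstar_r G" shows "T \<in> J_sing G \<longleftrightarrow> meager_in Otop (singular T)"
proof -
  have "{x \<in> gunits G. T x (l2_delta x) \<noteq> (\<lambda>_. 0)} = a Some ` singular T"
  proof
    show "{x \<in> gunits G. T x (l2_delta x) \<noteq> (\<lambda>_. 0)} \<subseteq> a Some ` singular T"
    proof
      fix x assume x: "x \<in> {x \<in> gunits G. T x (l2_delta x) \<noteq> (\<lambda>_. 0)}"
      then obtain \<omega> where \<omega>: "\<omega> \<in> Omega" "x = a Some \<omega>" unfolding gunits_eq by blast
      obtain \<gamma> where \<gamma>: "T x (l2_delta x) \<gamma> \<noteq> 0" using x by blast
      then have "\<gamma> \<in> sfibre G x" using l2_zero[OF lin_op_in[OF cstar_r_lin[OF T]]] by blast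
      then obtain g where "g \<in> inv_hull" "\<omega> \<in> Om g" "\<gamma> = a g \<omega>" unfolding \<omega>(2) sfibre_eq[OF \<omega>(1)] by blast
      then show "x \<in> a Some ` singular T" using \<gamma> \<omega> by (auto simp: singular_def germ_coeff_def)
    qed
    show "a Some ` singular T \<subseteq> {x \<in> gunits G. T x (l2_delta x) \<noteq> (\<lambda>_. 0)}"
      unfolding gunits_eq by (auto simp: singular_def germ_coeff_def)
  qed
  then show ?thesis
    unfolding J_sing_def using T meager_in_homeomorphic[OF homeomorphic_units, of "singular T"]
    by (auto simp: singular_def)
qed

text \<open>Off all boundaries, a nonzero coefficient at \<omega> would be nearly attained at point
  characters, which are dense; but there coefficients are matrix entries of the zero
  operator.\<close>

lemma kernel_subset:
  assumes countable: "countable (UNIV :: 's set)" and T: "T \<in> cstar_r G" and z: "T x0 = zero_op"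
  shows "meager_in Otop (singular T)"
proof -
  \<comment> \<open>The boundaries for all pairs from the hull. They are intersected with the
    singular set below because \<open>meager_in\<close> asks for a union equal to the set.\<close>
  let ?B = "\<lambda>g k. Otop frontier_of coincidence g k"
  let ?N = "(\<lambda>(g, k). ?B g k \<inter> singular T) ` (inv_hull \<times> inv_hull)"
  have openE: "openin Otop (coincidence g k)" if "g \<in> inv_hull" "k \<in> inv_hull" for g k
    unfolding coincidence_def by (rule open_eq[OF that])
  have "countable ?N" using countable_inv_hull[OF countable] by auto
  moreover have "N \<subseteq> topspace Otop \<and> Otop interior_of (Otop closure_of N) = {}" if N: "N \<in> ?N" for N
  proof -
    obtain g k where gk: "g \<in> inv_hull" "k \<in> inv_hull" "N = ?B g k \<inter> singular T" using N by auto
    have "Otop closure_of N \<subseteq> Otop closure_of (?B g k)" unfolding gk(3) by (rule closure_of_mono) auto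
    also have "\<dots> = ?B g k" by (simp add: closure_of_closedin closedin_frontier_of)
    finally have "Otop interior_of (Otop closure_of N) \<subseteq> Otop interior_of (?B g k)" by (rule interior_of_mono)
    also have "\<dots> = {}" using openE[OF gk(1,2)] by (intro interior_of_frontier_of_open)
    finally show ?thesis using gk(3) by (auto simp: singular_def)
  qed
  ultimately have m: "meager_in Otop (\<Union>?N)" by (rule meager_in_countable)
  have "singular T \<subseteq> \<Union>?N"
  proof
    fix \<omega> assume s: "\<omega> \<in> singular T"
    then obtain g where g: "g \<in> inv_hull" "\<omega> \<in> Om g" "germ_coeff T g \<omega> \<noteq> 0" by (auto simp: singular_def)
    have W: "\<omega> \<in> Omega" using g(2) Om_Omega by blast
    show "\<omega> \<in> \<Union>?N"
    proof (rule ccontr)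
      assume n: "\<omega> \<notin> \<Union>?N"
      \<comment> \<open>A third leaves room for two approximation errors, at \<omega> and at the
        point character.\<close>
      define e where "e = cmod (germ_coeff T g \<omega>) / 3"
      have e: "0 < e" using g(3) by (simp add: e_def)
      obtain b where b: "b \<in> A0" "\<And>x. bnd (sfibre G x) (diff_op (T x) (b x)) e"
        using cstar_r_approx[OF T e] by blast
      obtain K where K: "finite K" "K \<subseteq> inv_hull" "\<forall>g\<in>inv_hull. \<forall>\<omega>\<in>Om g. \<forall>\<psi>\<in>Om g.
        (\<forall>k\<in>K. \<omega> \<in> coincidence g k \<longleftrightarrow> \<psi> \<in> coincidence g k) \<longrightarrow> germ_coeff b g \<omega> = germ_coeff b g \<psi>"
        using A0_finite_dependence[OF b(1)] by blast
      \<comment> \<open>Off the boundary, membership in a coincidence set is constant near \<omega>: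
        either the set itself or the complement of its closure is a neighbourhood.\<close>
      let ?V = "\<lambda>k. if \<omega> \<in> coincidence g k then coincidence g k else Omega - Otop closure_of coincidence g k"
      have V: "openin Otop (?V k) \<and> \<omega> \<in> ?V k" if k: "k \<in> K" for k
      proof -
        have kh: "k \<in> inv_hull" using k K by blast
        have "\<omega> \<notin> ?B g k" using n s g(1) kh by auto
        then have "\<omega> \<notin> Otop closure_of coincidence g k" if "\<omega> \<notin> coincidence g k"
          using that openE[OF g(1) kh] by (simp add: frontier_of_def interior_of_openin)
        moreover have "openin Otop (Omega - Otop closure_of coincidence g k)"
          using openin_diff[of Otop Omega "Otop closure_of coincidence g k"] openin_topspace[of Otop] by simp
        ultimately show ?thesis using openE[OF g(1) kh] W by simp
      qed
      let ?U = "Om g \<inter> \<Inter>(?V ` K)"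
      have "openin Otop (Om g \<inter> \<Inter>(?V ` K))"
      proof (cases "K = {}")
        case False
        have "openin Otop X" if "X \<in> ?V ` K" for X using that V by blast
        then show ?thesis using K(1) False by (intro openin_Int openin_Om[OF g(1)] openin_Inter) auto
      qed (simp add: openin_Om[OF g(1)])
      moreover have "\<omega> \<in> X" if "X \<in> ?V ` K" for X using that V by blast
      then have "\<omega> \<in> ?U" using g(2) by blast
      ultimately obtain s where s: "point_char s \<in> ?U" using point_char_dense[of ?U] by blast
      then have sg: "point_char s \<in> Om g" by blast
      have "\<omega> \<in> coincidence g k \<longleftrightarrow> point_char s \<in> coincidence g k" if "k \<in> K" for k
      proof -
        have "point_char s \<in> ?V k" using s that by blast
        moreover have "coincidence g k \<subseteq> Otop closure_of coincidence g k"
          by (rule closure_of_subset) (auto simp: coincidence_def Om_def)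
        ultimately show ?thesis by (auto split: if_splits)
      qed
      then have eq: "germ_coeff b g \<omega> = germ_coeff b g (point_char s)" using K(3) g(1,2) sg by blast
      obtain t where "g s = Some t" using sg point_char_Om[OF g(1)] by blast
      then have "germ_coeff T g (point_char s) = 0" using germ_coeff_point[OF T g(1)] z by (simp add: zero_op_def)
      moreover have "cmod (germ_coeff T g (point_char s) - germ_coeff b g (point_char s)) \<le> e"
        by (intro germ_coeff_approx cstar_r_lin T A0_lin b) simp
      moreover have "cmod (germ_coeff T g \<omega> - germ_coeff b g \<omega>) \<le> e"
        by (intro germ_coeff_approx cstar_r_lin T A0_lin b W)
      ultimately have "cmod (germ_coeff T g \<omega>) \<le> 2 * e"
        using eq norm_triangle_sub[of "germ_coeff T g \<omega>" "germ_coeff b g \<omega>"] by simp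
      then show False using e by (simp add: e_def)
    qed
  qed
  then have "singular T = \<Union>?N" by auto
  then show ?thesis using m by simp
qed

text \<open>A nonzero matrix entry from delta_s to delta_t forces nonzero coefficients on a nonempty
  open set, against meagerness. The hypothesis on units speaks of sets around e; left multiplication
  by s moves its conclusion into sS.\<close>

lemma kernel_supset:
  assumes units_act: "\<And>(U :: 's set) X. finite U \<Longrightarrow> U \<subseteq> monoid_units - {1} \<Longrightarrow>
      X \<in> constructible_bar \<Longrightarrow> 1 \<in> X \<Longrightarrow>
      \<exists>Z\<in>constructible_bar. Z \<noteq> {} \<and> Z \<subseteq> X \<and> (\<forall>s\<in>Z. \<forall>u\<in>U. u * s \<noteq> s)"
    and T: "T \<in> cstar_r G" and m: "meager_in Otop (singular T)"
  shows "T x0 = zero_op"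
proof (rule bounded_op_eq_zero[OF cstar_r_bounded[OF T]], rule ext)
  fix i j assume "i \<in> sfibre G x0"
  then obtain s where s: "i = fib s" using bij_fib by (auto simp: bij_betw_def)
  show "T x0 (l2_delta i) j = 0"
  proof (cases "j \<in> sfibre G x0")
    case False
    then show ?thesis using l2_zero[OF lin_op_in[OF cstar_r_lin[OF T]]] by blast
  next
    case True
    then obtain t where t: "j = fib t" using bij_fib by (auto simp: bij_betw_def)
    \<comment> \<open>This element is defined on sS and sends s to t, so its coefficient at chi_s is
      the matrix entry in question.\<close>
    let ?g = "ltrans t \<circ>\<^sub>m pinv (ltrans s)"
    have g: "?g \<in> inv_hull" by (intro comp_hull pinv_hull ltrans_hull)
    have gsr: "?g (s * r) = Some (t * r)" for r
    proof -
      have "pinv (ltrans s) (s * r) = Some r" by (simp add: pinv_iff[OF ltrans_hull]) (simp add: ltrans_def)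
      then show ?thesis by (simp add: ltrans_def)
    qed
    have gs: "?g s = Some t" using gsr[of 1] by simp
    show ?thesis
    proof (rule ccontr)
      assume "T x0 (l2_delta i) j \<noteq> 0"
      then have nz: "germ_coeff T ?g (point_char s) \<noteq> 0" using germ_coeff_point[OF T g gs] s t by simp
      define e where "e = cmod (germ_coeff T ?g (point_char s)) / 3"
      have e: "0 < e" using nz by (simp add: e_def)
      obtain b where b: "b \<in> A0" "\<And>x. bnd (sfibre G x) (diff_op (T x) (b x)) e"
        using cstar_r_approx[OF T e] by blast
      obtain K where K: "finite K" "K \<subseteq> inv_hull" "\<forall>g\<in>inv_hull. \<forall>\<omega>\<in>Om g. \<forall>\<psi>\<in>Om g.
        (\<forall>k\<in>K. \<omega> \<in> coincidence g k \<longleftrightarrow> \<psi> \<in> coincidence g k) \<longrightarrow> germ_coeff b g \<omega> = germ_coeff b g \<psi>"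
        using A0_finite_dependence[OF b(1)] by blast
      \<comment> \<open>\<open>?m k\<close> fixes z exactly when k and \<open>?g\<close> agree at
        sz; in particular it fixes 1 exactly when they agree at s.\<close>
      let ?m = "\<lambda>k. pinv (ltrans t) \<circ>\<^sub>m (k \<circ>\<^sub>m ltrans s)"
      have m_iff: "?m k z = Some w \<longleftrightarrow> k (s * z) = Some (t * w)" for k z w
        by (auto simp: pinv_iff[OF ltrans_hull]) (auto simp: ltrans_def)
      have mK: "finite (?m ` K)" "?m ` K \<subseteq> inv_hull"
        using K(1,2) by (auto intro!: comp_hull pinv_hull ltrans_hull)
      obtain Z where Z: "Z \<in> constructible_bar" "Z \<noteq> {}"
        "\<And>m z. m \<in> ?m ` K \<Longrightarrow> m 1 \<noteq> Some 1 \<Longrightarrow> z \<in> Z \<Longrightarrow> m z \<noteq> Some z"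
        using moves_points[OF units_act mK] by blast
      \<comment> \<open>The characters supported on sZ, an open set by \<open>openin_evn\<close>. It
        contains the point characters of sz for z in Z, but possibly not that of s.\<close>
      let ?V = "{\<omega> \<in> Omega. evn \<omega> (\<lambda>r. r \<in> (*) s ` Z)}"
      obtain p where p: "p \<in> idems" "dom p = range ((*) s)" using idem_ideal .
      have "?V \<subseteq> singular T"
      proof
        fix \<omega> assume \<omega>: "\<omega> \<in> ?V"
        then have W: "\<omega> \<in> Omega" and ev: "evn \<omega> (\<lambda>r. r \<in> (*) s ` Z)" by auto
        have "evn \<omega> (\<lambda>r. r \<in> dom ?g)" using ev by (rule evn_mono) (use gsr in blast)
        then have og: "\<omega> \<in> Om ?g" using Om_iff[OF g] W by blast
        have "evn \<omega> (\<lambda>r. r \<in> dom p)" using ev by (rule evn_mono) (auto simp: p(2))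
        then have p1: "\<omega> p = 1" using evn_dom_iff[OF W p(1)] by blast
        have sg: "point_char s \<in> Om ?g" unfolding point_char_Om[OF g] using gs by blast
        \<comment> \<open>If k(s) = t, then k and \<open>?g\<close> agree on all of sS and both
          characters lie in the coincidence set; otherwise they agree neither at s nor at any point
          of sZ, and neither character does.\<close>
        have mem: "\<omega> \<in> coincidence ?g k \<longleftrightarrow> point_char s \<in> coincidence ?g k" if kK: "k \<in> K" for k
        proof -
          have k: "k \<in> inv_hull" using kK K by blast
          show ?thesis
          proof (cases "?m k 1 = Some 1")
            case True
            then have ks: "k s = Some t" using m_iff[of k 1 1] by simp
            have gp: "?g \<circ>\<^sub>m p = k \<circ>\<^sub>m p"
            proof (rule comp_idem_cong[OF p(1)])
              fix x assume "x \<in> dom p"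
              then obtain r where "x = s * r" unfolding p(2) by blast
              then show "?g x = k x" using gsr hull_right[OF k ks] by simp
            qed
            have in_E: "\<psi> \<in> coincidence ?g k" if "\<psi> \<in> Om ?g" "\<psi> p = 1" for \<psi>
            proof -
              have "evn \<psi> (\<lambda>r. r \<in> dom p)" using evn_dom[OF p(1)] that by blast
              then have "evn \<psi> (\<lambda>r. r \<in> dom k)"
                by (rule evn_mono) (use p(2) hull_right[OF k ks] in auto)
              then have "\<psi> \<in> Om k" using Om_iff[OF k] Om_Omega[OF that(1)] by blast
              then show ?thesis using eqI[OF g k that(1) _ p(1) that(2) gp] that(1) by (simp add: coincidence_def)
            qed
            have "s \<in> dom p" unfolding p(2) by (rule range_eqI[of _ _ 1]) simp
            then have "point_char s p = 1" using p(1) by (simp add: point_char_apply)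
            then show ?thesis using in_E[OF og p1] in_E[OF sg] by blast
          next
            case False
            have 1: "\<omega> \<notin> coincidence ?g k"
            proof
              assume "\<omega> \<in> coincidence ?g k"
              then have "evn \<omega> (\<lambda>r. ?g r = k r)" unfolding coincidence_def using eqD[OF g k] by blast
              then obtain r where "?g r = k r" "r \<in> (*) s ` Z" using evn_ex[OF W evn_conj[OF _ ev]] by blast
              then obtain z where z1: "z \<in> Z" "?g (s * z) = k (s * z)" by blast
              then have z: "z \<in> Z" "k (s * z) = Some (t * z)" using trans[OF sym[OF z1(2)] gsr] by auto
              then have "?m k z = Some z" using m_iff by blast
              then show False using Z(3)[OF imageI[OF kK] False z(1)] by blast
            qed
            have "point_char s \<notin> coincidence ?g k"
            proof
              assume "point_char s \<in> coincidence ?g k"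
              then have "evn (point_char s) (\<lambda>r. ?g r = k r)" unfolding coincidence_def using eqD[OF g k] by blast
              then have "?g s = k s" by (rule evn_point)
              then have "?m k 1 = Some 1" using m_iff[of k 1 1] gs by simp
              then show False using False by blast
            qed
            then show ?thesis using 1 by blast
          qed
        qed
        then have eq: "germ_coeff b ?g \<omega> = germ_coeff b ?g (point_char s)" using K(3) g og sg by blast
        have "cmod (germ_coeff T ?g (point_char s) - germ_coeff b ?g (point_char s)) \<le> e"
          by (intro germ_coeff_approx cstar_r_lin T A0_lin b) simp
        moreover have "cmod (germ_coeff T ?g \<omega> - germ_coeff b ?g \<omega>) \<le> e"
          by (intro germ_coeff_approx cstar_r_lin T A0_lin b W)
        moreover have "cmod (germ_coeff T ?g (point_char s)) = 3 * e" by (simp add: e_def)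
        ultimately have "germ_coeff T ?g \<omega> \<noteq> 0"
          using eq e norm_triangle_sub[of "germ_coeff T ?g (point_char s)" "germ_coeff b ?g (point_char s)"] by auto
        then show "\<omega> \<in> singular T" unfolding singular_def using W g og by blast
      qed
      then have "?V \<subseteq> Otop interior_of singular T" using openin_evn by (simp add: interior_of_maximal)
      then have "?V = {}" using meager_in_interior[OF compact_Otop Hausdorff_Otop m] by simp
      moreover obtain z where z: "z \<in> Z" using Z(2) by blast
      \<comment> \<open>Z is the trace of a neighbourhood of the character of z. Pulled back along
        s^{-1} and combined with the ideal sS, it gives sZ near the character of sz.\<close>
      have "point_char (s * z) \<in> ?V"
      proof -
        have "pinv (ltrans s) (s * z) = Some z" by (simp add: pinv_iff[OF ltrans_hull]) (simp add: ltrans_def)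
        then have ac: "act (pinv (ltrans s)) (point_char (s * z)) = point_char z"
          by (rule act_point[OF pinv_hull[OF ltrans_hull]])
        have "evn (point_char (s * z)) (\<lambda>r. \<forall>q. pinv (ltrans s) r = Some q \<longrightarrow> q \<in> Z)"
          by (rule evn_act[OF pinv_hull[OF ltrans_hull]]) (simp add: ac evn_point_bar[OF Z(1) z])
        moreover have "evn (point_char (s * z)) (\<lambda>r. r \<in> range ((*) s))"
          by (rule evn_point_ideal) (simp add: mult.assoc)
        ultimately have "evn (point_char (s * z)) (\<lambda>r. r \<in> (*) s ` Z)"
        proof (rule evn_mono[OF evn_conj])
          fix r assume r: "(\<forall>q. pinv (ltrans s) r = Some q \<longrightarrow> q \<in> Z) \<and> r \<in> range ((*) s)"
          then obtain q where q: "r = s * q" by blast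
          then have "pinv (ltrans s) r = Some q" by (simp add: pinv_iff[OF ltrans_hull]) (simp add: ltrans_def)
          then show "r \<in> (*) s ` Z" using r q by blast
        qed
        then show ?thesis by simp
      qed
      ultimately show False by blast
    qed
  qed
qed

theorem ess_iso:
  assumes countable: "countable (UNIV :: 's set)"
    and units_act: "\<And>(U :: 's set) X. finite U \<Longrightarrow> U \<subseteq> monoid_units - {1} \<Longrightarrow>
      X \<in> constructible_bar \<Longrightarrow> 1 \<in> X \<Longrightarrow>
      \<exists>Z\<in>constructible_bar. Z \<noteq> {} \<and> Z \<subseteq> X \<and> (\<forall>s\<in>Z. \<forall>u\<in>U. u * s \<noteq> s)"
  shows "defines_ess_iso G x0 fib"
  unfolding defines_ess_iso_def
proof (intro conjI ballI allI impI)
  show "pirep ` cstar_r G = cstar_r_monoid" by (rule pi_image)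
  \<comment> \<open>Transport to l^2(S) is isometric, so the image is zero exactly when the operator
    at chi_e is.\<close>
  have z: "pirep T = zero_op \<longleftrightarrow> T x0 = zero_op" if T: "T \<in> cstar_r G" for T
  proof
    assume "pirep T = zero_op"
    then have "bnd UNIV (pirep T) e" if "0 < e" for e using that bnd_zero_op[of e] by simp
    then show "T x0 = zero_op" using pi_bnd[OF T] by (intro bnd_all_zero[OF cstar_r_lin[OF T]]) auto
  qed (simp add: pi_def' transport_zero_op[OF bij_fib])
  show "{T \<in> cstar_r G. pirep T = zero_op} = J_sing G"
  proof (intro set_eqI iffI)
    fix T assume "T \<in> {T \<in> cstar_r G. pirep T = zero_op}"
    then have T: "T \<in> cstar_r G" "T x0 = zero_op" using z by auto
    then show "T \<in> J_sing G" using J_sing_iff kernel_subset[OF countable] by blast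
  next
    fix T assume TJ: "T \<in> J_sing G"
    then have T: "T \<in> cstar_r G" by (simp add: J_sing_def)
    then have "T x0 = zero_op" using TJ J_sing_iff kernel_supset[OF units_act] by blast
    then show "T \<in> {T \<in> cstar_r G. pirep T = zero_op}" using z T by blast
  qed
  fix S T assume ST: "S \<in> cstar_r G" "T \<in> cstar_r G"
  show "pirep (\<lambda>y. add_op (S y) (T y)) = add_op (pirep S) (pirep T)" by (rule pi_add)
  show "pirep (\<lambda>y. S y \<circ> T y) = pirep S \<circ> pirep T" by (rule pi_comp[OF ST])
  assume "\<forall>y\<in>gunits G. is_adjoint (sfibre G y) (S y) (T y)"
  then show "is_adjoint UNIV (pirep S) (pirep T)" using x0_unit by (intro pi_adjoint ST) auto
qed (rule pi_scale)

end

section \<open>The two groupoids of a monoid\<close>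

lemma the_elem_image: "x \<in> A \<Longrightarrow> (\<And>y. y \<in> A \<Longrightarrow> f y = c) \<Longrightarrow> the_elem (f ` A) = c"
proof -
  assume "x \<in> A" "\<And>y. y \<in> A \<Longrightarrow> f y = c"
  then have "f ` A = {c}" by auto
  then show ?thesis by simp
qed

section \<open>The Paterson groupoid and its restriction to \<Omega>(S)\<close>

context left_cancellative
begin

text \<open>The analogue of \<open>Om\<close> over all characters, as the Paterson groupoid is built
  before the restriction to \<Omega>(S).\<close>

definition char_dom :: "('s \<rightharpoonup> 's) \<Rightarrow> 's chr set" where
  "char_dom g = {\<omega> \<in> chars. \<omega> (pinv g \<circ>\<^sub>m g) = 1}"

lemma Om_char_dom: "Om g = char_dom g \<inter> Omega"
  using Omega_chars by (auto simp: Om_def char_dom_def)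

lemma openin_char_dom: "g \<in> inv_hull \<Longrightarrow> openin chars_top (char_dom g)"
  unfolding openin_chars_top char_dom_def
  by (intro conjI ballI exI[of _ "{pinv g \<circ>\<^sub>m g}"]) (auto simp: idem_source)

lemma char_mult: "\<omega> \<in> chars \<Longrightarrow> (p :: 's \<rightharpoonup> 's) \<in> idems \<Longrightarrow> q \<in> idems \<Longrightarrow>
    \<omega> p = 1 \<Longrightarrow> \<omega> q = 1 \<Longrightarrow> \<omega> (p \<circ>\<^sub>m q) = 1"
  by (auto simp: chars_def)

lemma agree_on: "(p :: 's \<rightharpoonup> 's) \<in> idems \<Longrightarrow> g \<circ>\<^sub>m p = h \<circ>\<^sub>m p \<Longrightarrow> x \<in> dom p \<Longrightarrow> g x = h x"
proof -
  assume *: "p \<in> idems" "g \<circ>\<^sub>m p = h \<circ>\<^sub>m p" "x \<in> dom p"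
  then have "p x = Some x" by (simp add: idem_iff)
  then show ?thesis using fun_cong[OF *(2), of x] by (simp add: map_comp_def)
qed

lemma agree_evn:
  "(p :: 's \<rightharpoonup> 's) \<in> idems \<Longrightarrow> \<omega> p = 1 \<Longrightarrow> g \<circ>\<^sub>m p = h \<circ>\<^sub>m p \<Longrightarrow> evn \<omega> (\<lambda>s. g s = h s)"
  by (rule evn_mono[OF evn_dom]) (auto dest: agree_on)

lemma germ_self: "g \<in> inv_hull \<Longrightarrow> \<omega> \<in> char_dom g \<Longrightarrow> (g, \<omega>) \<in> germ g \<omega>"
  using idem_source[of g] by (auto simp: germ_def char_dom_def)

lemma germ_memD:
  assumes "(h, \<psi>) \<in> germ g \<omega>" "\<omega> \<in> (chars :: 's chr set)"
  shows "h \<in> inv_hull" "\<psi> = \<omega>" "\<omega> \<in> char_dom h" "\<exists>p\<in>idems. \<omega> p = 1 \<and> g \<circ>\<^sub>m p = h \<circ>\<^sub>m p"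
  using assms by (auto simp: germ_def char_dom_def)

text \<open>Transitivity is the point: agreement on p and on q gives agreement on the product of p
  and q, which again has value 1.\<close>

lemma germ_eq_iff:
  assumes g: "(g :: 's \<rightharpoonup> 's) \<in> inv_hull" "\<omega> \<in> char_dom g" and h: "h \<in> inv_hull" "\<psi> \<in> char_dom h"
  shows "germ g \<omega> = germ h \<psi> \<longleftrightarrow> \<omega> = \<psi> \<and> (\<exists>p\<in>idems. \<omega> p = 1 \<and> g \<circ>\<^sub>m p = h \<circ>\<^sub>m p)"
proof
  assume eq: "germ g \<omega> = germ h \<psi>"
  have "\<psi> \<in> chars" using h by (simp add: char_dom_def)
  then show "\<omega> = \<psi> \<and> (\<exists>p\<in>idems. \<omega> p = 1 \<and> g \<circ>\<^sub>m p = h \<circ>\<^sub>m p)"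
    using germ_memD[of g \<omega> h \<psi>] germ_self[OF g] eq by metis
next
  assume "\<omega> = \<psi> \<and> (\<exists>p\<in>idems. \<omega> p = 1 \<and> g \<circ>\<^sub>m p = h \<circ>\<^sub>m p)"
  then obtain p where p: "\<omega> = \<psi>" "p \<in> idems" "\<omega> p = 1" "g \<circ>\<^sub>m p = h \<circ>\<^sub>m p" by blast
  have c: "\<omega> \<in> chars" using g by (simp add: char_dom_def)
  have tr: "\<exists>q\<in>idems. \<omega> q = 1 \<and> v \<circ>\<^sub>m q = k \<circ>\<^sub>m q"
    if uk: "\<exists>q\<in>idems. \<omega> q = 1 \<and> u \<circ>\<^sub>m q = k \<circ>\<^sub>m q" and uv: "u \<circ>\<^sub>m p = v \<circ>\<^sub>m p" for u v k :: "'s \<rightharpoonup> 's"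
  proof -
    obtain q where q: "q \<in> idems" "\<omega> q = 1" "u \<circ>\<^sub>m q = k \<circ>\<^sub>m q" using uk by blast
    have pq: "p \<circ>\<^sub>m q \<in> idems" by (rule idem_comp[OF p(2) q(1)])
    have "v \<circ>\<^sub>m (p \<circ>\<^sub>m q) = k \<circ>\<^sub>m (p \<circ>\<^sub>m q)"
    proof (rule comp_idem_cong[OF pq])
      fix x assume "x \<in> dom (p \<circ>\<^sub>m q)"
      then have "x \<in> dom p" "x \<in> dom q" unfolding dom_idem_comp[OF p(2) q(1)] by auto
      then show "v x = k x" using agree_on[OF p(2) uv] agree_on[OF q(1,3)] by metis
    qed
    then show ?thesis using pq char_mult[OF c p(2) q(1) p(3) q(2)] by blast
  qed
  show "germ g \<omega> = germ h \<psi>"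
    unfolding germ_def p(1)[symmetric] using tr[OF _ p(4)] tr[OF _ p(4)[symmetric]] by blast
qed

lemma chars_paterson_src:
  assumes "g \<in> inv_hull" "\<omega> \<in> char_dom g" shows "gsrc paterson (germ g \<omega>) = germ Some \<omega>"
proof -
  have "\<omega> \<in> chars" using assms by (simp add: char_dom_def)
  then show ?thesis unfolding paterson_def groupoid.select_convs
    by (intro the_elem_image[OF germ_self[OF assms]]) (auto dest: germ_memD)
qed

lemma arrows_paterson: "arrows (paterson :: 's germ groupoid) = {germ g \<omega> | g \<omega>. g \<in> inv_hull \<and> \<omega> \<in> char_dom g}"
proof -
  have "arrows (paterson :: 's germ groupoid) = \<Union>{basic_open g U | g U. g \<in> inv_hull \<and> openin chars_top U \<and> U \<subseteq> char_dom g}"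
    by (simp add: arrows_def paterson_def topology_generated_by_topspace char_dom_def)
  also have "\<dots> = {germ g \<omega> | g \<omega>. g \<in> inv_hull \<and> \<omega> \<in> char_dom g}"
  proof (intro equalityI subsetI)
    fix \<gamma> :: "'s germ"
    assume "\<gamma> \<in> {germ g \<omega> | g \<omega>. g \<in> inv_hull \<and> \<omega> \<in> char_dom g}"
    then obtain g \<omega> where g: "g \<in> inv_hull" "\<omega> \<in> char_dom g" "\<gamma> = germ g \<omega>" by blast
    then have "\<gamma> \<in> basic_open g (char_dom g)" by (simp add: basic_open_def)
    then show "\<gamma> \<in> \<Union>{basic_open g U | g U. g \<in> inv_hull \<and> openin chars_top U \<and> U \<subseteq> char_dom g}"
      using openin_char_dom[OF g(1)] g(1) by (intro UnionI[of "basic_open g (char_dom g)"]) auto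
  next
    fix \<gamma> :: "'s germ"
    assume "\<gamma> \<in> \<Union>{basic_open g U | g U. g \<in> inv_hull \<and> openin chars_top U \<and> U \<subseteq> char_dom g}"
    then obtain g U where "g \<in> inv_hull" "U \<subseteq> char_dom g" "\<gamma> \<in> basic_open g U" by blast
    then show "\<gamma> \<in> {germ g \<omega> | g \<omega>. g \<in> inv_hull \<and> \<omega> \<in> char_dom g}" unfolding basic_open_def by blast
  qed
  finally show ?thesis .
qed

text \<open>For some p the value \<omega>(p) is nonzero, and it equals \<omega>(p) times the value
  at the identity map, which is therefore 1.\<close>

lemma char_dom_Some: "\<omega> \<in> chars \<Longrightarrow> \<omega> \<in> char_dom (Some :: 's \<rightharpoonup> 's)"
proof -
  assume c: "\<omega> \<in> chars"
  have 1: "pinv (Some :: 's \<rightharpoonup> 's) = Some" by (rule map_eqI) (auto simp: pinv_iff)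
  obtain p where p: "p \<in> idems" "\<omega> p \<noteq> 0" using c by (auto simp: chars_def)
  have "\<omega> (p \<circ>\<^sub>m Some) = \<omega> p * \<omega> Some" using c p idem_Some unfolding chars_def by blast
  then have "\<omega> p * \<omega> Some = \<omega> p * 1" by (simp only: Some_comp mult_1_right)
  then have "\<omega> Some = 1" using p(2) by auto
  then show ?thesis using c by (simp add: char_dom_def 1)
qed

lemma arrows_G_P: "arrows (G_P :: 's germ groupoid) = {germ g \<omega> | g \<omega>. g \<in> inv_hull \<and> \<omega> \<in> Om g}"
proof -
  have "arrows (G_P :: 's germ groupoid) = {\<gamma> \<in> arrows paterson. gsrc paterson \<gamma> \<in> germ Some ` Omega}"
    by (auto simp: arrows_def G_P_def groupoid_restrict_def)
  also have "\<dots> = {germ g \<omega> | g \<omega>. g \<in> inv_hull \<and> \<omega> \<in> Om g}"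
  proof (intro set_eqI iffI)
    fix \<gamma> :: "'s germ" assume "\<gamma> \<in> {\<gamma> \<in> arrows paterson. gsrc paterson \<gamma> \<in> germ Some ` Omega}"
    then obtain g \<omega> \<psi> where *: "g \<in> inv_hull" "\<omega> \<in> char_dom g" "\<gamma> = germ g \<omega>" "\<psi> \<in> Omega" "gsrc paterson \<gamma> = germ Some \<psi>"
      unfolding arrows_paterson by blast
    then have "germ Some \<omega> = germ Some \<psi>" using chars_paterson_src by simp
    then have "\<omega> = \<psi>"
      using germ_eq_iff[OF Some_hull char_dom_Some Some_hull char_dom_Some] * Omega_chars by (auto simp: char_dom_def)
    then show "\<gamma> \<in> {germ g \<omega> | g \<omega>. g \<in> inv_hull \<and> \<omega> \<in> Om g}" using * Om_char_dom by auto
  next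
    fix \<gamma> :: "'s germ" assume "\<gamma> \<in> {germ g \<omega> | g \<omega>. g \<in> inv_hull \<and> \<omega> \<in> Om g}"
    then obtain g \<omega> where "g \<in> inv_hull" "\<omega> \<in> char_dom g" "\<omega> \<in> Omega" "\<gamma> = germ g \<omega>" using Om_char_dom by auto
    then show "\<gamma> \<in> {\<gamma> \<in> arrows paterson. gsrc paterson \<gamma> \<in> germ Some ` Omega}"
      using chars_paterson_src arrows_paterson by auto
  qed
  finally show ?thesis .
qed

lemma G_P_fields: "gsrc G_P = gsrc paterson" "grng G_P = grng paterson" "gmul G_P = gmul paterson" "ginv G_P = ginv paterson"
  by (simp_all add: G_P_def groupoid_restrict_def)

text \<open>The structure maps of \<open>paterson\<close> are evaluated on representatives; these
  facts make the results independent of the choice.\<close>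

lemma germ_Om:
  assumes "g \<in> inv_hull" "\<omega> \<in> Om g" "(h, \<psi>) \<in> germ g \<omega>"
  shows "h \<in> inv_hull" "\<psi> = \<omega>" "\<omega> \<in> Om h" "evn \<omega> (\<lambda>s. g s = h s)" "act h \<omega> = act g \<omega>"
    "\<exists>p\<in>idems. \<omega> p = 1 \<and> g \<circ>\<^sub>m p = h \<circ>\<^sub>m p"
proof -
  have W: "\<omega> \<in> Omega" using assms Om_Omega by blast
  note m = germ_memD[OF assms(3) Omega_chars[OF W]]
  show h: "h \<in> inv_hull" "\<psi> = \<omega>" "\<omega> \<in> Om h" "\<exists>p\<in>idems. \<omega> p = 1 \<and> g \<circ>\<^sub>m p = h \<circ>\<^sub>m p"
    using m W Om_char_dom by auto
  show e: "evn \<omega> (\<lambda>s. g s = h s)" using h(4) agree_evn by blast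
  show "act h \<omega> = act g \<omega>" using act_cong(2)[OF assms(1) h(1) assms(2) e] by simp
qed

lemma germ_OmI: "g \<in> inv_hull \<Longrightarrow> \<omega> \<in> Om g \<Longrightarrow> (g, \<omega>) \<in> germ g \<omega>"
  using germ_self Om_char_dom by auto

lemma germ_Om_eq_iff:
  assumes "g \<in> inv_hull" "h \<in> inv_hull" "\<omega> \<in> Om g" "\<psi> \<in> Om h"
  shows "germ g \<omega> = germ h \<psi> \<longleftrightarrow> \<omega> = \<psi> \<and> (\<exists>p\<in>idems. \<omega> p = 1 \<and> g \<circ>\<^sub>m p = h \<circ>\<^sub>m p)"
  using germ_eq_iff assms Om_char_dom by auto

text \<open>Induction over the generation of the topology. A basic set D(h, U) pulls back along g to
  the part of U in \<open>char_dom g\<close> with value 1 on some idempotent where g and h agree,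
  which is an open condition.\<close>

lemma openin_paterson_preimage:
  assumes "openin (gtop paterson) W" "g \<in> inv_hull"
  shows "openin chars_top {\<omega> \<in> char_dom g. germ g \<omega> \<in> (W :: 's germ set)}"
proof -
  have "generate_topology_on {basic_open g U | g U. g \<in> inv_hull \<and> openin chars_top U \<and>
      U \<subseteq> {\<omega> \<in> chars. \<omega> (pinv g \<circ>\<^sub>m g) = 1}} W"
    using assms(1) by (simp add: paterson_def openin_topology_generated_by_iff)
  then show ?thesis
  proof induction
    case Empty then show ?case by simp
  next
    case (Int A B)
    have "{\<omega> \<in> char_dom g. germ g \<omega> \<in> A \<inter> B} = {\<omega> \<in> char_dom g. germ g \<omega> \<in> A} \<inter> {\<omega> \<in> char_dom g. germ g \<omega> \<in> B}" by auto
    then show ?case using openin_Int[OF Int.IH] by simp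
  next
    case (UN K)
    have "{\<omega> \<in> char_dom g. germ g \<omega> \<in> \<Union>K} = (\<Union>A\<in>K. {\<omega> \<in> char_dom g. germ g \<omega> \<in> A})" by auto
    then show ?case using openin_Union[of "(\<lambda>A. {\<omega> \<in> char_dom g. germ g \<omega> \<in> A}) ` K"] UN by auto
  next
    case (Basis A)
    then obtain h U where h: "A = basic_open h U" "h \<in> inv_hull" "openin chars_top U" "U \<subseteq> char_dom h"
      by (auto simp: char_dom_def)
    have eq: "{\<omega> \<in> char_dom g. germ g \<omega> \<in> A} = char_dom g \<inter> U \<inter> {\<omega> \<in> chars. \<exists>p\<in>idems. \<omega> p = 1 \<and> g \<circ>\<^sub>m p = h \<circ>\<^sub>m p}"
    proof (intro set_eqI iffI)
      fix \<omega> assume "\<omega> \<in> {\<omega> \<in> char_dom g. germ g \<omega> \<in> A}"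
      then obtain \<psi> where "\<omega> \<in> char_dom g" "\<psi> \<in> U" "germ g \<omega> = germ h \<psi>" by (auto simp: h(1) basic_open_def)
      then show "\<omega> \<in> char_dom g \<inter> U \<inter> {\<omega> \<in> chars. \<exists>p\<in>idems. \<omega> p = 1 \<and> g \<circ>\<^sub>m p = h \<circ>\<^sub>m p}"
        using germ_eq_iff[OF assms(2) _ h(2)] h(4) by (auto simp: char_dom_def)
    next
      fix \<omega> assume *: "\<omega> \<in> char_dom g \<inter> U \<inter> {\<omega> \<in> chars. \<exists>p\<in>idems. \<omega> p = 1 \<and> g \<circ>\<^sub>m p = h \<circ>\<^sub>m p}"
      then have "germ g \<omega> = germ h \<omega>" using germ_eq_iff[OF assms(2) _ h(2)] h(4) by blast
      then show "\<omega> \<in> {\<omega> \<in> char_dom g. germ g \<omega> \<in> A}" using * by (auto simp: h(1) basic_open_def)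
    qed
    have "openin chars_top {\<omega> \<in> chars. \<exists>p\<in>idems. \<omega> p = 1 \<and> g \<circ>\<^sub>m p = h \<circ>\<^sub>m p}"
      unfolding openin_chars_top
    proof (intro conjI ballI)
      fix \<omega> assume "\<omega> \<in> {\<omega> \<in> chars. \<exists>p\<in>idems. \<omega> p = 1 \<and> g \<circ>\<^sub>m p = h \<circ>\<^sub>m p}"
      then obtain p where "p \<in> idems" "\<omega> p = 1" "g \<circ>\<^sub>m p = h \<circ>\<^sub>m p" by blast
      then show "\<exists>P. finite P \<and> P \<subseteq> idems \<and> (\<forall>\<psi>\<in>chars. (\<forall>p\<in>P. \<psi> p = \<omega> p) \<longrightarrow>
          \<psi> \<in> {\<omega> \<in> chars. \<exists>p\<in>idems. \<omega> p = 1 \<and> g \<circ>\<^sub>m p = h \<circ>\<^sub>m p})"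
        by (intro exI[of _ "{p}"]) auto
    qed auto
    then show ?case unfolding eq by (intro openin_Int openin_char_dom assms(2) h(3))
  qed
qed

text \<open>The topology is final for the maps that send \<omega> to [g, \<omega>]. For the
  converse, open subsets of \<Omega>(S) are extended to open sets of all characters, where the basic
  sets are formed.\<close>

lemma openin_G_P:
  "openin (gtop G_P) (W :: 's germ set) \<longleftrightarrow>
    W \<subseteq> arrows G_P \<and> (\<forall>g\<in>inv_hull. openin Otop {\<omega> \<in> Om g. germ g \<omega> \<in> W})" (is "?L \<longleftrightarrow> ?R")
proof
  have gt: "gtop G_P = subtopology (gtop paterson) {\<gamma> \<in> arrows paterson. gsrc paterson \<gamma> \<in> germ Some ` (Omega :: 's chr set)}"
    by (simp add: G_P_def groupoid_restrict_def)
  have A: "arrows G_P = {\<gamma> \<in> arrows paterson. gsrc paterson \<gamma> \<in> germ Some ` (Omega :: 's chr set)}"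
    unfolding arrows_def[of G_P] gt by (auto simp: arrows_def)
  note gt = gt[folded A]
  {
    assume ?L
    then obtain W' where W': "openin (gtop paterson) W'" "W = W' \<inter> arrows G_P"
      unfolding gt openin_subtopology by blast
    show ?R
    proof (intro conjI ballI)
      fix g :: "'s \<rightharpoonup> 's" assume g: "g \<in> inv_hull"
      have "{\<omega> \<in> Om g. germ g \<omega> \<in> W} = {\<omega> \<in> char_dom g. germ g \<omega> \<in> W'} \<inter> Omega"
        unfolding W'(2) arrows_G_P using g Om_char_dom by auto
      then show "openin Otop {\<omega> \<in> Om g. germ g \<omega> \<in> W}"
        unfolding Otop_def openin_subtopology using openin_paterson_preimage[OF W'(1) g] by blast
    qed (use W' in auto)
  }
  assume R: ?R
  have "\<forall>g\<in>inv_hull. \<exists>Q. openin chars_top Q \<and> {\<omega> \<in> Om g. germ g \<omega> \<in> W} = Q \<inter> Omega"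
    using R unfolding Otop_def openin_subtopology by blast
  from bchoice[OF this] obtain Q where "\<forall>g\<in>inv_hull. openin chars_top (Q g) \<and>
    {\<omega> \<in> Om g. germ g \<omega> \<in> W} = Q g \<inter> Omega" by (rule exE)
  then have Q: "openin chars_top (Q g)" "{\<omega> \<in> Om g. germ g \<omega> \<in> W} = Q g \<inter> Omega"
    if "g \<in> inv_hull" for g using that by auto
  let ?W = "\<Union>g\<in>inv_hull. basic_open g (Q g \<inter> char_dom g)"
  have "openin (gtop paterson) (basic_open g (Q g \<inter> char_dom g))" if "g \<in> inv_hull" for g
  proof -
    have "openin chars_top (Q g \<inter> char_dom g)" using Q(1) openin_char_dom that by blast
    then have "basic_open g (Q g \<inter> char_dom g) \<in> {basic_open g U | g U. g \<in> inv_hull \<and> openin chars_top U \<and>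
      U \<subseteq> {\<omega> \<in> chars. \<omega> (pinv g \<circ>\<^sub>m g) = 1}}" using that by (auto simp: char_dom_def)
    then show ?thesis unfolding paterson_def groupoid.select_convs by (rule topology_generated_by_Basis)
  qed
  then have "openin (gtop paterson) ?W" by (intro openin_Union) auto
  moreover have "W = ?W \<inter> arrows G_P"
  proof
    show "W \<subseteq> ?W \<inter> arrows G_P"
    proof
      fix \<gamma> assume \<gamma>: "\<gamma> \<in> W"
      then have "\<gamma> \<in> arrows G_P" using R by blast
      then obtain g \<omega> where g: "g \<in> inv_hull" "\<omega> \<in> Om g" "\<gamma> = germ g \<omega>" unfolding arrows_G_P by blast
      then have "\<omega> \<in> Q g \<inter> char_dom g" using Q(2)[OF g(1)] \<gamma> Om_char_dom by blast
      then have "\<gamma> \<in> basic_open g (Q g \<inter> char_dom g)" unfolding g(3) basic_open_def by (rule imageI)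
      then show "\<gamma> \<in> ?W \<inter> arrows G_P" using g(1) \<open>\<gamma> \<in> arrows G_P\<close> by blast
    qed
    show "?W \<inter> arrows G_P \<subseteq> W"
    proof
      fix \<gamma> assume \<gamma>: "\<gamma> \<in> ?W \<inter> arrows G_P"
      then obtain g where "g \<in> inv_hull" "\<gamma> \<in> basic_open g (Q g \<inter> char_dom g)" by blast
      then obtain \<omega> where g: "g \<in> inv_hull" "\<omega> \<in> Q g" "\<omega> \<in> char_dom g" "\<gamma> = germ g \<omega>"
        unfolding basic_open_def by blast
      obtain h \<psi> where h: "h \<in> inv_hull" "\<psi> \<in> Om h" "\<gamma> = germ h \<psi>" using \<gamma> unfolding arrows_G_P by blast
      then have "\<omega> = \<psi>" using germ_eq_iff[OF g(1,3) h(1)] g(4) Om_char_dom by auto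
      then have "\<omega> \<in> Omega" using h(2) Om_Omega by blast
      then show "\<gamma> \<in> W" using Q(2)[OF g(1)] g by blast
    qed
  qed
  ultimately show ?L unfolding gt openin_subtopology by blast
qed

sublocale P: germ_groupoid S_type "G_P :: 's germ groupoid" germ
proof
  fix g h :: "'s \<rightharpoonup> 's" and \<omega> \<psi> :: "'s chr" and p :: "'s \<rightharpoonup> 's" and W :: "'s germ set"
  show "arrows (G_P :: 's germ groupoid) = {germ g \<omega> | g \<omega>. g \<in> inv_hull \<and> \<omega> \<in> Om g}" by (rule arrows_G_P)
  show "openin (gtop G_P) W \<longleftrightarrow> W \<subseteq> arrows G_P \<and> (\<forall>g\<in>inv_hull. openin Otop {\<omega> \<in> Om g. germ g \<omega> \<in> W})"
    by (rule openin_G_P)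
  show "gsrc G_P (germ g \<omega>) = germ Some \<omega>" if "g \<in> inv_hull" "\<omega> \<in> Om g"
    unfolding G_P_fields using chars_paterson_src that Om_char_dom by auto
  show "grng G_P (germ g \<omega>) = germ Some (act g \<omega>)" if "g \<in> inv_hull" "\<omega> \<in> Om g"
    unfolding G_P_fields paterson_def groupoid.select_convs
  proof (rule the_elem_image[OF germ_OmI[OF that]])
    fix y assume "y \<in> germ g \<omega>"
    then obtain h \<psi> where y: "y = (h, \<psi>)" "(h, \<psi>) \<in> germ g \<omega>" by (cases y) auto
    then show "(case y of (g, \<omega>) \<Rightarrow> germ Some (act g \<omega>)) = germ Some (act g \<omega>)"
      using germ_Om(2,5)[OF that y(2)] by simp
  qed
  show "gmul G_P (germ g (act h \<omega>)) (germ h \<omega>) = germ (g \<circ>\<^sub>m h) \<omega>"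
    if g: "g \<in> inv_hull" and h: "h \<in> inv_hull" and \<omega>: "\<omega> \<in> Om h" and a: "act h \<omega> \<in> Om g"
  proof -
    have gh: "g \<circ>\<^sub>m h \<in> inv_hull" "\<omega> \<in> Om (g \<circ>\<^sub>m h)"
      using g h inv_hull.intros Om_comp[OF g h \<omega>] a by auto
    have W: "\<omega> \<in> Omega" using \<omega> Om_Omega by blast
    have *: "germ (g' \<circ>\<^sub>m h') \<omega> = germ (g \<circ>\<^sub>m h) \<omega>"
      if g': "(g', act h \<omega>) \<in> germ g (act h \<omega>)" and h': "(h', \<omega>) \<in> germ h \<omega>" for g' h'
    proof -
      note Mg = germ_Om[OF g a g'] and Mh = germ_Om[OF h \<omega> h']
      have gh': "g' \<circ>\<^sub>m h' \<in> inv_hull" "\<omega> \<in> Om (g' \<circ>\<^sub>m h')"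
        using Mg(1) Mh(1) inv_hull.intros Om_comp[OF Mg(1) Mh(1,3)] Mg(3) Mh(5) by auto
      obtain p where p: "p \<in> idems" "act h \<omega> p = 1" "g \<circ>\<^sub>m p = g' \<circ>\<^sub>m p" using Mg(6) by blast
      obtain q where q: "q \<in> idems" "\<omega> q = 1" "h \<circ>\<^sub>m q = h' \<circ>\<^sub>m q" using Mh(6) by blast
      \<comment> \<open>p is tested at the range of h; its conjugate by h is tested at \<omega>, and
        multiplied by q it is an idempotent on which the two products agree.\<close>
      let ?c = "pinv h \<circ>\<^sub>m p \<circ>\<^sub>m h"
      have c: "?c \<in> idems" by (rule idem_conj[OF h p(1)])
      have "\<omega> ?c = 1" using p(1,2) by (simp add: act_def)
      then have 1: "\<omega> (?c \<circ>\<^sub>m q) = 1" by (rule char_mult[OF Omega_chars[OF W] c q(1) _ q(2)])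
      have cq: "?c \<circ>\<^sub>m q \<in> idems" by (rule idem_comp[OF c q(1)])
      have "(g' \<circ>\<^sub>m h') \<circ>\<^sub>m (?c \<circ>\<^sub>m q) = (g \<circ>\<^sub>m h) \<circ>\<^sub>m (?c \<circ>\<^sub>m q)"
      proof (rule comp_idem_cong[OF cq])
        fix x assume "x \<in> dom (?c \<circ>\<^sub>m q)"
        then have x: "x \<in> dom ?c" "x \<in> dom q" unfolding dom_idem_comp[OF c q(1)] by auto
        then obtain y where y: "h x = Some y" "y \<in> dom p" unfolding dom_conj[OF h p(1)] by blast
        have "h' x = Some y" using agree_on[OF q(1,3) x(2)] y(1) by simp
        then show "(g' \<circ>\<^sub>m h') x = (g \<circ>\<^sub>m h) x" using agree_on[OF p(1,3) y(2)] y(1) by (simp add: map_comp_def)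
      qed
      then show ?thesis using germ_Om_eq_iff[OF gh'(1) gh(1) gh'(2) gh(2)] 1 cq by blast
    qed
    have "{germ (k \<circ>\<^sub>m l) \<psi> | k \<omega>' l \<psi>. (k, \<omega>') \<in> germ g (act h \<omega>) \<and> (l, \<psi>) \<in> germ h \<omega> \<and> \<omega>' = act l \<psi>} =
        {germ (g \<circ>\<^sub>m h) \<omega>}" (is "?A = _")
    proof (intro equalityI subsetI)
      fix \<gamma> assume "\<gamma> \<in> ?A"
      then obtain k \<omega>' l \<psi> where kl: "\<gamma> = germ (k \<circ>\<^sub>m l) \<psi>" "(k, \<omega>') \<in> germ g (act h \<omega>)" "(l, \<psi>) \<in> germ h \<omega>"
        by blast
      then have "\<omega>' = act h \<omega>" "\<psi> = \<omega>" using germ_Om(2)[OF g a] germ_Om(2)[OF h \<omega>] by auto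
      then show "\<gamma> \<in> {germ (g \<circ>\<^sub>m h) \<omega>}" using * kl by simp
    next
      fix \<gamma> assume "\<gamma> \<in> {germ (g \<circ>\<^sub>m h) \<omega>}"
      then show "\<gamma> \<in> ?A" using germ_OmI[OF g a] germ_OmI[OF h \<omega>] by blast
    qed
    then show ?thesis unfolding G_P_fields paterson_def groupoid.select_convs by simp
  qed
  show "ginv G_P (germ g \<omega>) = germ (pinv g) (act g \<omega>)" if g: "g \<in> inv_hull" and \<omega>: "\<omega> \<in> Om g"
    unfolding G_P_fields paterson_def groupoid.select_convs
  proof (rule the_elem_image[OF germ_OmI[OF that]])
    fix y assume "y \<in> germ g \<omega>"
    then obtain h where y: "y = (h, \<omega>)" "(h, \<omega>) \<in> germ g \<omega>" using germ_Om(2)[OF g \<omega>] by (cases y) auto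
    note M = germ_Om[OF g \<omega> y(2)]
    obtain p where p: "p \<in> idems" "\<omega> p = 1" "g \<circ>\<^sub>m p = h \<circ>\<^sub>m p" using M(6) by blast
    have pg: "pinv g \<in> inv_hull" "pinv h \<in> inv_hull" using g M(1) inv_hull.intros by auto
    \<comment> \<open>Agreement of g and h on p becomes agreement of their inverses on gpg^{-1},
      which has value 1 at the moved character.\<close>
    let ?c = "pinv (pinv g) \<circ>\<^sub>m p \<circ>\<^sub>m pinv g"
    have c: "?c \<in> idems" by (rule idem_conj[OF pg(1) p(1)])
    have W: "\<omega> \<in> Omega" using \<omega> Om_Omega by blast
    have "evn \<omega> (\<lambda>s. s \<in> dom g \<and> s \<in> dom p)"
      by (rule evn_conj[OF _ evn_dom[of p \<omega>, OF p(1,2)]]) (use \<omega> Om_iff[OF g] in blast)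
    then have "evn \<omega> (\<lambda>s. \<exists>t. g s = Some t \<and> t \<in> dom ?c)"
    proof (rule evn_mono)
      fix s assume s: "s \<in> dom g \<and> s \<in> dom p"
      then obtain t where "g s = Some t" by blast
      then show "\<exists>t. g s = Some t \<and> t \<in> dom ?c"
        unfolding dom_conj[OF pg(1) p(1)] using s by (auto simp: pinv_iff[OF g])
    qed
    then have 1: "act g \<omega> ?c = 1" using act_value[OF g W c] by blast
    have eq: "pinv h \<circ>\<^sub>m ?c = pinv g \<circ>\<^sub>m ?c"
    proof (rule comp_idem_cong[OF c])
      fix y assume "y \<in> dom ?c"
      then obtain x where x: "pinv g y = Some x" "x \<in> dom p" unfolding dom_conj[OF pg(1) p(1)] by blast
      then have "g x = Some y" by (simp add: pinv_iff[OF g])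
      then have "h x = Some y" using agree_on[OF p(1,3) x(2)] by simp
      then have "pinv h y = Some x" by (simp add: pinv_iff[OF M(1)])
      then show "pinv h y = pinv g y" using x by simp
    qed
    have "act g \<omega> \<in> Om (pinv h)" using Om_pinv(1)[OF M(1,3)] M(5) by simp
    then have "germ (pinv h) (act g \<omega>) = germ (pinv g) (act g \<omega>)"
      using germ_Om_eq_iff[OF pg(2,1) _ Om_pinv(1)[OF g \<omega>], of "act g \<omega>"] 1 c eq by blast
    then show "(case y of (g, \<omega>) \<Rightarrow> germ (pinv g) (act g \<omega>)) = germ (pinv g) (act g \<omega>)"
      using y M(5) by simp
  qed
  show "\<omega> = \<psi>" if "\<omega> \<in> Omega" "\<psi> \<in> Omega" "germ Some \<omega> = germ Some \<psi>"
    using germ_Om_eq_iff[OF Some_hull Some_hull] that by simp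
  show "germ g \<omega> = germ h \<omega>" if "g \<in> inv_hull" "h \<in> inv_hull" "\<omega> \<in> Om g" "\<omega> \<in> Om h" "p \<in> idems"
    "\<omega> p = 1" "g \<circ>\<^sub>m p = h \<circ>\<^sub>m p"
    using germ_Om_eq_iff[OF that(1-4)] that by blast
  show "evn \<omega> (\<lambda>s. g s = h s)" if "g \<in> inv_hull" "h \<in> inv_hull" "\<omega> \<in> Om g" "\<omega> \<in> Om h" "germ g \<omega> = germ h \<omega>"
    using germ_Om_eq_iff[OF that(1-4)] that agree_evn by blast
  show "openin Otop {\<omega> \<in> Om g \<inter> Om h. germ g \<omega> = germ h \<omega>}" if g: "g \<in> inv_hull" and h: "h \<in> inv_hull"
  proof -
    \<comment> \<open>Each idempotent on which g and h agree contributes the open set where its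
      value is 1.\<close>
    have "{\<omega> \<in> Om g \<inter> Om h. germ g \<omega> = germ h \<omega>} =
      Om g \<inter> Om h \<inter> \<Union>((\<lambda>p. {\<omega> \<in> Omega. \<omega> p = 1}) ` {p \<in> idems. g \<circ>\<^sub>m p = h \<circ>\<^sub>m p})"
      using germ_Om_eq_iff[OF g h] Om_Omega by auto
    moreover have "openin Otop \<dots>"
      by (intro openin_Int openin_Om g h openin_Union) (auto simp: openin_idem simp del: One_nat_def)
    ultimately show ?thesis by simp
  qed
qed

section \<open>The quotient groupoid\<close>

definition qgerm :: "('s \<rightharpoonup> 's) \<Rightarrow> 's chr \<Rightarrow> 's germ set" where
  "qgerm g \<omega> = germ_rel `` {germ g \<omega>}"

text \<open>\<open>bar_evn\<close> turns the relation into agreement near \<omega>. Other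
  representatives of the two germs agree with the given ones near \<omega>, so the choice does not
  matter.\<close>

lemma germ_rel_iff:
  assumes "g \<in> inv_hull" "h \<in> inv_hull" "\<omega> \<in> Om g" "\<psi> \<in> Om h"
  shows "(germ g \<omega>, germ h \<psi>) \<in> germ_rel \<longleftrightarrow> \<omega> = \<psi> \<and> evn \<omega> (\<lambda>s. g s = h s)"
proof
  assume "(germ g \<omega>, germ h \<psi>) \<in> germ_rel"
  then obtain g' h' \<theta> where *: "(g', \<theta>) \<in> germ g \<omega>" "(h', \<theta>) \<in> germ h \<psi>"
    "\<exists>X\<in>constructible_bar. char_ext \<theta> X \<and> g' |` X = h' |` X" by (auto simp: germ_rel_def)
  note M = germ_Om[OF assms(1,3) *(1)] germ_Om[OF assms(2,4) *(2)]
  have eq: "\<theta> = \<omega>" "\<omega> = \<psi>" using M(2) M(8) by auto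
  have "evn \<omega> (\<lambda>s. g' s = h' s)" using *(3) bar_evn[OF Om_Omega[OF assms(3)]] eq by blast
  from evn_conj[OF M(4) evn_conj[OF this M(10)[folded eq(2)]]]
  show "\<omega> = \<psi> \<and> evn \<omega> (\<lambda>s. g s = h s)" using eq(2) by (auto elim!: evn_mono)
next
  assume *: "\<omega> = \<psi> \<and> evn \<omega> (\<lambda>s. g s = h s)"
  then have "\<exists>X\<in>constructible_bar. char_ext \<omega> X \<and> g |` X = h |` X"
    using bar_evn[OF Om_Omega[OF assms(3)]] by blast
  moreover have "(g, \<omega>) \<in> germ g \<omega>" "(h, \<omega>) \<in> germ h \<psi>" using germ_OmI assms * by auto
  moreover have "germ g \<omega> \<in> arrows G_P" "germ h \<psi> \<in> arrows G_P" using assms P.arrowI by auto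
  ultimately show "(germ g \<omega>, germ h \<psi>) \<in> germ_rel" unfolding germ_rel_def by blast
qed

lemma equiv_germ_rel: "equiv (arrows G_P) (germ_rel :: ('s germ \<times> 's germ) set)"
proof (rule equivI)
  let ?r = "germ_rel :: ('s germ \<times> 's germ) set"
  have sub: "?r \<subseteq> arrows G_P \<times> arrows G_P" by (auto simp: germ_rel_def)
  show "?r \<subseteq> arrows G_P \<times> arrows G_P" by (rule sub)
  show "refl_on (arrows G_P) ?r"
  proof (rule refl_onI)
    fix \<gamma> :: "'s germ" assume "\<gamma> \<in> arrows G_P"
    then obtain g \<omega> where "g \<in> inv_hull" "\<omega> \<in> Om g" "\<gamma> = germ g \<omega>" by (rule P.arrowE)
    then show "(\<gamma>, \<gamma>) \<in> germ_rel" by (simp add: germ_rel_iff evn_True)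
  qed
  show "sym ?r"
  proof (rule symI)
    fix \<gamma> \<delta> :: "'s germ" assume *: "(\<gamma>, \<delta>) \<in> germ_rel"
    then obtain g \<omega> h \<psi> where "g \<in> inv_hull" "\<omega> \<in> Om g" "\<gamma> = germ g \<omega>" "h \<in> inv_hull" "\<psi> \<in> Om h" "\<delta> = germ h \<psi>"
      using sub by (blast elim: P.arrowE)
    then show "(\<delta>, \<gamma>) \<in> germ_rel" using * by (auto simp: germ_rel_iff elim: evn_mono)
  qed
  show "trans ?r"
  proof (rule transI)
    fix \<gamma> \<delta> \<epsilon> :: "'s germ" assume *: "(\<gamma>, \<delta>) \<in> germ_rel" "(\<delta>, \<epsilon>) \<in> germ_rel"
    then have ar: "\<gamma> \<in> arrows G_P" "\<delta> \<in> arrows G_P" "\<epsilon> \<in> arrows G_P" using sub by auto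
    obtain g \<omega> where g: "g \<in> inv_hull" "\<omega> \<in> Om g" "\<gamma> = germ g \<omega>" using ar(1) by (rule P.arrowE)
    obtain h \<psi> where h: "h \<in> inv_hull" "\<psi> \<in> Om h" "\<delta> = germ h \<psi>" using ar(2) by (rule P.arrowE)
    obtain k \<theta> where k: "k \<in> inv_hull" "\<theta> \<in> Om k" "\<epsilon> = germ k \<theta>" using ar(3) by (rule P.arrowE)
    have "\<omega> = \<psi>" "\<psi> = \<theta>" "evn \<omega> (\<lambda>s. g s = h s)" "evn \<omega> (\<lambda>s. h s = k s)"
      using * germ_rel_iff[OF g(1) h(1) g(2) h(2)] germ_rel_iff[OF h(1) k(1) h(2) k(2)] g h k by auto
    then show "(\<gamma>, \<epsilon>) \<in> germ_rel"
      unfolding g(3) k(3) germ_rel_iff[OF g(1) k(1) g(2) k(2)]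
      using evn_mono[OF evn_conj, of \<omega> "\<lambda>s. g s = h s" "\<lambda>s. h s = k s" "\<lambda>s. g s = k s"] by auto
  qed
qed

lemma qgerm_eq_iff:
  assumes "g \<in> inv_hull" "h \<in> inv_hull" "\<omega> \<in> Om g" "\<psi> \<in> Om h"
  shows "qgerm g \<omega> = qgerm h \<psi> \<longleftrightarrow> \<omega> = \<psi> \<and> evn \<omega> (\<lambda>s. g s = h s)"
  unfolding qgerm_def
  using eq_equiv_class_iff[OF equiv_germ_rel] P.arrowI assms germ_rel_iff[OF assms] by auto

lemma qgerm_memE:
  assumes "\<gamma> \<in> qgerm g \<omega>" "g \<in> inv_hull" "\<omega> \<in> Om g"
  obtains h where "h \<in> inv_hull" "\<omega> \<in> Om h" "\<gamma> = germ h \<omega>" "evn \<omega> (\<lambda>s. g s = h s)"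
proof -
  have r: "(germ g \<omega>, \<gamma>) \<in> germ_rel" using assms by (simp add: qgerm_def)
  then have "\<gamma> \<in> arrows G_P" by (auto simp: germ_rel_def)
  then obtain h \<psi> where h: "h \<in> inv_hull" "\<psi> \<in> Om h" "\<gamma> = germ h \<psi>" by (rule P.arrowE)
  then show thesis using that germ_rel_iff[OF assms(2) h(1) assms(3) h(2)] r by blast
qed

lemma qgerm_self: "g \<in> inv_hull \<Longrightarrow> \<omega> \<in> Om g \<Longrightarrow> germ g \<omega> \<in> qgerm g \<omega>"
  by (simp add: qgerm_def germ_rel_iff evn_True)

lemma G_S_fields:
  "gtop G_S = quotient_top (gtop G_P) (germ_rel :: ('s germ \<times> 's germ) set)"
  "gsrc G_S = (\<lambda>C. the_elem ((\<lambda>g. germ_rel `` {gsrc G_P g}) ` C))"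
  "grng G_S = (\<lambda>C. the_elem ((\<lambda>g. germ_rel `` {grng G_P g}) ` C))"
  "gmul G_S = (\<lambda>C D. the_elem {germ_rel `` {gmul G_P g h} | g h. g \<in> C \<and> h \<in> D \<and> gsrc G_P g = grng G_P h})"
  "ginv G_S = (\<lambda>C. the_elem ((\<lambda>g. germ_rel `` {ginv G_P g}) ` C))"
  by (simp_all add: G_S_def groupoid_quotient_def)

lemma arrows_G_S: "arrows (G_S :: 's germ set groupoid) = {qgerm g \<omega> | g \<omega>. g \<in> inv_hull \<and> \<omega> \<in> Om g}"
proof -
  have "{x \<in> arrows G_P. germ_rel `` {x} \<in> arrows G_P // (germ_rel :: ('s germ \<times> 's germ) set)} = arrows G_P"
    by (auto intro: quotientI)
  then have "openin (gtop G_S) (arrows G_P // (germ_rel :: ('s germ \<times> 's germ) set))"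
    unfolding G_S_fields openin_quotient_top arrows_def by simp
  moreover have "U \<subseteq> arrows G_P // germ_rel" if "openin (gtop G_S) U" for U :: "'s germ set set"
    using that unfolding G_S_fields openin_quotient_top arrows_def by simp
  ultimately have "arrows (G_S :: 's germ set groupoid) = arrows G_P // germ_rel"
    unfolding arrows_def[of G_S] using openin_subset openin_topspace by blast
  also have "\<dots> = {qgerm g \<omega> | g \<omega>. g \<in> inv_hull \<and> \<omega> \<in> Om g}"
    unfolding quotient_def arrows_G_P qgerm_def by auto
  finally show ?thesis .
qed

sublocale Q: germ_groupoid S_type "G_S :: 's germ set groupoid" qgerm
proof
  fix g h :: "'s \<rightharpoonup> 's" and \<omega> \<psi> :: "'s chr" and p :: "'s \<rightharpoonup> 's" and W :: "'s germ set set"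
  show "arrows (G_S :: 's germ set groupoid) = {qgerm g \<omega> | g \<omega>. g \<in> inv_hull \<and> \<omega> \<in> Om g}" by (rule arrows_G_S)
  show "openin (gtop G_S) W \<longleftrightarrow> W \<subseteq> arrows G_S \<and> (\<forall>g\<in>inv_hull. openin Otop {\<omega> \<in> Om g. qgerm g \<omega> \<in> W})"
  proof -
    have "topspace (gtop G_P) // germ_rel = arrows (G_S :: 's germ set groupoid)"
      unfolding arrows_G_S quotient_def arrows_def[symmetric] arrows_G_P qgerm_def by auto
    \<comment> \<open>Pulling a set back through the quotient map and then along
      \<open>germ g\<close> is pulling it back along \<open>qgerm g\<close>.\<close>
    moreover have "{\<omega> \<in> Om g. germ g \<omega> \<in> {x \<in> topspace (gtop G_P). germ_rel `` {x} \<in> W}} = {\<omega> \<in> Om g. qgerm g \<omega> \<in> W}"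
      if "g \<in> inv_hull" for g
      using P.arrowI[OF that] by (auto simp: qgerm_def arrows_def)
    ultimately show ?thesis
      unfolding G_S_fields(1) openin_quotient_top P.openin_iff by (auto simp: arrows_def)
  qed
  show "gsrc G_S (qgerm g \<omega>) = qgerm Some \<omega>" if "g \<in> inv_hull" "\<omega> \<in> Om g"
    unfolding G_S_fields
  proof (rule the_elem_image[OF qgerm_self[OF that]])
    fix \<gamma> assume "\<gamma> \<in> qgerm g \<omega>"
    then show "germ_rel `` {gsrc G_P \<gamma>} = qgerm Some \<omega>"
      by (rule qgerm_memE[OF _ that]) (simp add: P.src qgerm_def)
  qed
  show "grng G_S (qgerm g \<omega>) = qgerm Some (act g \<omega>)" if "g \<in> inv_hull" "\<omega> \<in> Om g"
    unfolding G_S_fields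
  proof (rule the_elem_image[OF qgerm_self[OF that]])
    fix \<gamma> assume "\<gamma> \<in> qgerm g \<omega>"
    then show "germ_rel `` {grng G_P \<gamma>} = qgerm Some (act g \<omega>)"
      by (rule qgerm_memE[OF _ that]) (use act_cong(2)[OF that(1) _ that(2)] in \<open>simp add: P.rng qgerm_def\<close>)
  qed
  show "gmul G_S (qgerm g (act h \<omega>)) (qgerm h \<omega>) = qgerm (g \<circ>\<^sub>m h) \<omega>"
    if g: "g \<in> inv_hull" and h: "h \<in> inv_hull" and \<omega>: "\<omega> \<in> Om h" and a: "act h \<omega> \<in> Om g"
  proof -
    have gh: "g \<circ>\<^sub>m h \<in> inv_hull" "\<omega> \<in> Om (g \<circ>\<^sub>m h)"
      using g h inv_hull.intros Om_comp[OF g h \<omega>] a by auto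
    have *: "germ_rel `` {gmul G_P \<gamma> \<delta>} = qgerm (g \<circ>\<^sub>m h) \<omega>"
      if \<gamma>: "\<gamma> \<in> qgerm g (act h \<omega>)" and \<delta>: "\<delta> \<in> qgerm h \<omega>" for \<gamma> \<delta>
    proof -
      obtain g' where g': "g' \<in> inv_hull" "act h \<omega> \<in> Om g'" "\<gamma> = germ g' (act h \<omega>)" "evn (act h \<omega>) (\<lambda>s. g s = g' s)"
        using \<gamma> by (rule qgerm_memE[OF _ g a])
      obtain h' where h': "h' \<in> inv_hull" "\<omega> \<in> Om h'" "\<delta> = germ h' \<omega>" "evn \<omega> (\<lambda>s. h s = h' s)"
        using \<delta> by (rule qgerm_memE[OF _ h \<omega>])
      have ac: "act h \<omega> = act h' \<omega>" by (rule act_cong(2)[OF h h'(1) \<omega> h'(4)])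
      have gh': "g' \<circ>\<^sub>m h' \<in> inv_hull" "\<omega> \<in> Om (g' \<circ>\<^sub>m h')"
        using g'(1) h'(1) inv_hull.intros Om_comp[OF g'(1) h'(1,2)] g'(2) ac by auto
      have m: "gmul G_P \<gamma> \<delta> = germ (g' \<circ>\<^sub>m h') \<omega>"
        unfolding g'(3) h'(3) ac by (rule P.mul[OF g'(1) h'(1,2)]) (use g'(2) ac in simp)
      \<comment> \<open>g and g' agree near the moved character; \<open>evn_act\<close> brings this
        back to \<omega>, where it combines with the agreement of h and h'.\<close>
      from evn_conj[OF evn_act[OF h g'(4)] h'(4)]
      have "evn \<omega> (\<lambda>s. (g' \<circ>\<^sub>m h') s = (g \<circ>\<^sub>m h) s)"
      proof (rule evn_mono)
        fix s assume s: "(\<forall>t. h s = Some t \<longrightarrow> g t = g' t) \<and> h s = h' s"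
        show "(g' \<circ>\<^sub>m h') s = (g \<circ>\<^sub>m h) s"
        proof (cases "h s")
          case None
          then have "h' s = None" using s by simp
          then show ?thesis using None by (simp add: map_comp_def)
        next
          case (Some t)
          then have "h' s = Some t" "g t = g' t" using s by simp_all
          then show ?thesis using Some by (simp add: map_comp_def)
        qed
      qed
      then have "qgerm (g' \<circ>\<^sub>m h') \<omega> = qgerm (g \<circ>\<^sub>m h) \<omega>" using qgerm_eq_iff[OF gh'(1) gh(1) gh'(2) gh(2)] by simp
      then show ?thesis unfolding m qgerm_def .
    qed
    have "gsrc G_P (germ g (act h \<omega>)) = grng G_P (germ h \<omega>)" using P.src[OF g a] P.rng[OF h \<omega>] by simp
    then have "{germ_rel `` {gmul G_P \<gamma> \<delta>} | \<gamma> \<delta>. \<gamma> \<in> qgerm g (act h \<omega>) \<and> \<delta> \<in> qgerm h \<omega> \<and> gsrc G_P \<gamma> = grng G_P \<delta>} =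
        {qgerm (g \<circ>\<^sub>m h) \<omega>}"
      using * qgerm_self[OF g a] qgerm_self[OF h \<omega>] by blast
    then show ?thesis unfolding G_S_fields by simp
  qed
  show "ginv G_S (qgerm g \<omega>) = qgerm (pinv g) (act g \<omega>)" if g: "g \<in> inv_hull" and \<omega>: "\<omega> \<in> Om g"
    unfolding G_S_fields
  proof (rule the_elem_image[OF qgerm_self[OF that]])
    fix \<gamma> assume "\<gamma> \<in> qgerm g \<omega>"
    then obtain h where h: "h \<in> inv_hull" "\<omega> \<in> Om h" "\<gamma> = germ h \<omega>" "evn \<omega> (\<lambda>s. g s = h s)"
      by (rule qgerm_memE[OF _ g \<omega>])
    have ac: "act g \<omega> = act h \<omega>" by (rule act_cong(2)[OF g h(1) \<omega> h(4)])
    have pg: "pinv g \<in> inv_hull" "pinv h \<in> inv_hull" using g h(1) inv_hull.intros by auto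
    have o: "act g \<omega> \<in> Om (pinv g)" "act g \<omega> \<in> Om (pinv h)"
      using Om_pinv(1)[OF g \<omega>] Om_pinv(1)[OF h(1,2)] ac by auto
    \<comment> \<open>\<omega> is rewritten as the image under g^{-1} of the moved character, so
      that \<open>evn_act\<close> for g^{-1} carries the agreement to the range side.\<close>
    have "evn (act (pinv g) (act g \<omega>)) (\<lambda>s. g s = h s)" using h(4) Om_pinv(2)[OF g \<omega>] by simp
    from evn_act[OF pg(1) this]
    have "evn (act g \<omega>) (\<lambda>s. \<forall>t. pinv g s = Some t \<longrightarrow> g t = h t)" .
    moreover have "evn (act g \<omega>) (\<lambda>s. s \<in> dom (pinv g))" using o(1) Om_iff[OF pg(1)] by blast
    ultimately have "evn (act g \<omega>) (\<lambda>s. pinv h s = pinv g s)"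
    proof (rule evn_mono[OF evn_conj])
      fix s assume s: "(\<forall>t. pinv g s = Some t \<longrightarrow> g t = h t) \<and> s \<in> dom (pinv g)"
      then obtain t where t: "pinv g s = Some t" by blast
      then have "h t = Some s" using s by (simp add: pinv_iff[OF g])
      then show "pinv h s = pinv g s" using t pinv_iff[OF h(1), of s t] by simp
    qed
    then have "qgerm (pinv h) (act g \<omega>) = qgerm (pinv g) (act g \<omega>)"
      using qgerm_eq_iff[OF pg(2,1) o(2,1)] by simp
    then show "germ_rel `` {ginv G_P \<gamma>} = qgerm (pinv g) (act g \<omega>)"
      unfolding h(3) P.inv[OF h(1,2)] ac qgerm_def .
  qed
  show "\<omega> = \<psi>" if "\<omega> \<in> Omega" "\<psi> \<in> Omega" "qgerm Some \<omega> = qgerm Some \<psi>"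
    using qgerm_eq_iff[OF Some_hull Some_hull] that by simp
  show "qgerm g \<omega> = qgerm h \<omega>" if "g \<in> inv_hull" "h \<in> inv_hull" "\<omega> \<in> Om g" "\<omega> \<in> Om h" "p \<in> idems"
    "\<omega> p = 1" "g \<circ>\<^sub>m p = h \<circ>\<^sub>m p"
    using P.eqI[OF that] by (simp add: qgerm_def)
  show "evn \<omega> (\<lambda>s. g s = h s)" if "g \<in> inv_hull" "h \<in> inv_hull" "\<omega> \<in> Om g" "\<omega> \<in> Om h" "qgerm g \<omega> = qgerm h \<omega>"
    using qgerm_eq_iff[OF that(1-4)] that by blast
  show "openin Otop {\<omega> \<in> Om g \<inter> Om h. qgerm g \<omega> = qgerm h \<omega>}" if g: "g \<in> inv_hull" and h: "h \<in> inv_hull"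
  proof -
    \<comment> \<open>Equality in the quotient is agreement near \<omega>, which is an open
      condition by \<open>openin_evn\<close>.\<close>
    have "{\<omega> \<in> Om g \<inter> Om h. qgerm g \<omega> = qgerm h \<omega>} =
      Om g \<inter> Om h \<inter> {\<omega> \<in> Omega. evn \<omega> (\<lambda>s. g s = h s)}"
      using qgerm_eq_iff[OF g h] Om_Omega by auto
    then show ?thesis by (simp add: openin_Int openin_Om g h openin_evn)
  qed
qed

end

theorem proposition2p16:
  assumes countable: "countable (UNIV :: 's::monoid_mult set)"
    and left_cancel: "\<And>a b c :: 's. a * b = a * c \<Longrightarrow> b = c"
    and units_act: "\<And>(U :: 's set) X. finite U \<Longrightarrow> U \<subseteq> monoid_units - {1} \<Longrightarrow>
          X \<in> constructible_bar \<Longrightarrow> 1 \<in> X \<Longrightarrow>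
          \<exists>Z\<in>constructible_bar. Z \<noteq> {} \<and> Z \<subseteq> X \<and> (\<forall>s\<in>Z. \<forall>u\<in>U. u * s \<noteq> s)"
  shows "defines_ess_iso G_P unit_P (fibre_P :: 's \<Rightarrow> 's germ) \<and>
         defines_ess_iso G_S unit_S (fibre_S :: 's \<Rightarrow> 's germ set)"
proof -
  \<comment> \<open>The two sublocales apply the common argument to both groupoids; it remains to
    match the units and the bijections from S with their definitions.\<close>
  interpret left_cancellative "TYPE('s)" by unfold_locales (rule left_cancel)
  have "P.fib = fibre_P" "Q.fib = fibre_S"
    by (simp_all add: fun_eq_iff P.fib_def Q.fib_def fibre_P_def fibre_S_def qgerm_def)
  moreover have "germ Some (point_char 1) = (unit_P :: 's germ)" "qgerm Some (point_char 1) = (unit_S :: 's germ set)"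
    by (simp_all add: unit_P_def unit_S_def qgerm_def)
  ultimately show ?thesis
    using P.ess_iso[OF countable units_act] Q.ess_iso[OF countable units_act] by simp
qed

end
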